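(* Let $p_1,p_2,q_1,q_2,p,q\in(0,\infty]$, $\tau\in[0,1]$. Suppose $m\in\mathscr{P}(\mathbb{R}^{2d})$ is submultiplicative and $\omega_i,\mu_i\in\mathscr{P}(\mathbb{R}^d)$, $i=1,2$. Write $m_\alpha(z_1)=m(z_1,0)$, $m_\beta(z_2)=m(0,z_2)$ for $z_1,z_2\in\mathbb{R}^d$, and $\mathcal{I}g(x)=g(-x)$. Consider the boundedness $$(\ast)\qquad W_\tau:\mathcal{M}^{p_1,q_1}_{\omega_1\otimes\mu_1}(\mathbb{R}^d)\times\mathcal{M}^{p_2,q_2}_{\omega_2\otimes\mu_2}(\mathbb{R}^d)\longrightarrow M^{p,q}_{1\otimes m}(\mathbb{R}^{2d}).$$ (1) If $p<\infty$, then $(\ast)$ holds if and only if $$l^{p_1/p}_{\omega_1^p}(\mathbb{Z}^d)\ast l^{p_2/p}_{\mathcal{I}\omega_2^p}(\mathbb{Z}^d)\subset l^{q/p}_{\mathcal{I}m_\beta^p}(\mathbb{Z}^d)\quad\text{and}\quad l^{q_1/p}_{\mu_1^p}(\mathbb{Z}^d)\ast l^{q_2/p}_{\mathcal{I}\mu_2^p}(\mathbb{Z}^d)\subset l^{q/p}_{m_\alpha^p}(\mathbb{Z}^d).$$ (2) If $p\ge q$, then $(\ast)$ holds if and only if $$l^{p_1}_{\omega_1}(\mathbb{Z}^d),\ l^{p_2}_{\mathcal{I}\omega_2}(\mathbb{Z}^d)\subset l^q_{\mathcal{I}m_\beta}(\mathbb{Z}^d)\quad\text{and}\quad l^{q_1}_{\mu_1}(\mathbb{Z}^d),\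 l^{q_2}_{\mathcal{I}\mu_2}(\mathbb{Z}^d)\subset l^q_{m_\alpha}(\mathbb{Z}^d).$$
   Context: $\tau$-Wigner distribution: for $f_1,f_2\in L^2(\mathbb{R}^d)$, $W_\tau(f_1,f_2)(x,\xi)=\int_{\mathbb{R}^d}f_1(x+\tau t)\overline{f_2(x-(1-\tau)t)}e^{-2\pi i\xi\cdot t}\,dt$. Weights: $m$ is $v$-moderate if $m(z+w)\le Cv(z)m(w)$ for all $z,w$. $\mathscr{P}(\mathbb{R}^{n})$ is the set of non-negative (measurable) functions on $\mathbb{R}^n$ that are $v$-moderate for some $v$ of polynomial growth with $v(z+w)\le v(z)v(w)$. In the theorem, "$m$ submultiplicative" means $m(z+w)\le C\,m(z)m(w)$ for all $z,w\in\mathbb{R}^{2d}$, for some constant $C$. $(\omega\otimes\mu)(z_1,z_2)=\omega(z_1)\mu(z_2)$. Modulation spaces: for $f\in\mathcal{S}'(\mathbb{R}^n)$ and a fixed nonzero $\phi\in\mathcal{S}(\mathbb{R}^n)$, $V_\phi f(x,\xi)=\langle f,M_\xi T_x\phi\rangle$ with $T_xg(t)=g(t-x)$, $M_\xi g(t)=e^{2\pi it\cdot\xi}g(t)$. For $0<p,q\le\infty$ and $m\in\mathscr{P}(\mathbb{R}^{2n})$, $M^{p,q}_m(\mathbb{R}^n)$ is the set of $f\in\mathcal{S}'(\mathbb{R}^n)$ with $\|f\|_{M^{p,q}_m}=\big(\int(\int|V_\phi f(x,\xi)|^pm(x,\xi)^pdx)^{q/p}d\xi\big)^{1/q}<\infty$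 (usual modification if $p$ or $q$ is $\infty$; different $\phi$ give equivalent quasi-norms). $\mathcal{M}^{p,q}_m(\mathbb{R}^n)$ is the closure of $\mathcal{S}(\mathbb{R}^n)$ in $M^{p,q}_m(\mathbb{R}^n)$. For $m$ on $\mathbb{R}^{2d}$, $(1\otimes m)(z,\zeta)=m(\zeta)$ for $z,\zeta\in\mathbb{R}^{2d}$. Boundedness notation: $W_\tau:\mathcal{M}^{p_1,q_1}_{m_1}\times\mathcal{M}^{p_2,q_2}_{m_2}\to X$ means there is $C>0$ with $\|W_\tau(f_1,f_2)\|_X\le C\|f_1\|_{M^{p_1,q_1}_{m_1}}\|f_2\|_{M^{p_2,q_2}_{m_2}}$ for all $f_1,f_2\in\mathcal{S}(\mathbb{R}^d)$. Discrete spaces: $\|\vec b\|_{l^p_\omega(\mathbb{Z}^d)}=(\sum_k|b_k|^p\omega(k)^p)^{1/p}$ (usual modification for $p=\infty$). $X\subset Z$ means $\|\vec a\|_Z\le C\|\vec a\|_X$ for all $\vec a\in X$; $X\ast Y\subset Z$ means $\|\vec a\ast\vec b\|_Z\le C\|\vec a\|_X\|\vec b\|_Y$ for all $\vec a\in X,\vec b\in Y$, with $(\vec a\ast\vec b)_n=\sum_ka_kb_{n-k}$ (the series converging absolutely). "$X,Y\subset Z$" means $X\subset Z$ and $Y\subset Z$. *)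

theory Defs
  imports "HOL-Analysis.Analysis" "HOL-Probability.Essential_Supremum"
begin

section \<open>Schwartz functions\<close>

definition partial_deriv :: "'a::euclidean_space \<Rightarrow> ('a \<Rightarrow> complex) \<Rightarrow> 'a \<Rightarrow> complex" where
  "partial_deriv b f = (\<lambda>x. frechet_derivative f (at x) b)"

text \<open>A list of basis vectors plays the role of a multi-index. Smoothness is expressed by
  (total) differentiability of every iterated partial derivative.\<close>

definition schwartz :: "('a::euclidean_space \<Rightarrow> complex) \<Rightarrow> bool" where
  "schwartz f \<longleftrightarrow> (\<forall>bs \<in> lists Basis.
     (\<forall>x. foldr partial_deriv bs f differentiable (at x)) \<and>
     (\<forall>N::nat. \<exists>C::real. \<forall>x. (1 + norm x) ^ N * cmod (foldr partial_deriv bs f x) \<le> C))"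


section \<open>Weights\<close>

definition moderate :: "('a::euclidean_space \<Rightarrow> real) \<Rightarrow> ('a \<Rightarrow> real) \<Rightarrow> bool" where
  "moderate v m \<longleftrightarrow> (\<exists>C::real. \<forall>z w. m (z + w) \<le> C * v z * m w)"

definition polynomial_growth :: "('a::euclidean_space \<Rightarrow> real) \<Rightarrow> bool" where
  "polynomial_growth v \<longleftrightarrow> (\<exists>(C::real) (N::nat). \<forall>z. v z \<le> C * (1 + norm z) ^ N)"

text \<open>The last conjunct excludes the zero function, for which the modulation ``norm''
  is identically zero. A moderate weight with a single zero vanishes identically, so it amounts to
  strict positivity.\<close>

definition poly_weight :: "('a::euclidean_space \<Rightarrow> real) \<Rightarrow> bool" where
  "poly_weight m \<longleftrightarrow>
     m \<in> borel_measurable lebesgue \<and> (\<forall>z. 0 \<le> m z) \<and>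
     (\<exists>v. (\<forall>z. 0 \<le> v z) \<and> polynomial_growth v \<and> (\<forall>z w. v (z + w) \<le> v z * v w) \<and> moderate v m) \<and>
     (\<exists>z. m z \<noteq> 0)"

definition submultiplicative :: "('a::euclidean_space \<Rightarrow> real) \<Rightarrow> bool" where
  "submultiplicative m \<longleftrightarrow> (\<exists>C::real. \<forall>z w. m (z + w) \<le> C * m z * m w)"

definition tensor :: "('a \<Rightarrow> real) \<Rightarrow> ('b \<Rightarrow> real) \<Rightarrow> 'a \<times> 'b \<Rightarrow> real" (infixr "\<otimes>\<^sub>w" 70) where
  "w \<otimes>\<^sub>w u = (\<lambda>(x, y). w x * u y)"

definition reflect :: "('a::uminus \<Rightarrow> real) \<Rightarrow> 'a \<Rightarrow> real" where
  "reflect g = (\<lambda>x. g (- x))"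

definition weight_power :: "('a \<Rightarrow> real) \<Rightarrow> ennreal \<Rightarrow> 'a \<Rightarrow> real" where
  "weight_power w p = (\<lambda>x. w x powr enn2real p)"


section \<open>Lebesgue quasi-norms with exponents in (0,\<infinity>]\<close>

text \<open>Only used for positive exponents \<open>a\<close>.\<close>

definition ennreal_powr :: "ennreal \<Rightarrow> real \<Rightarrow> ennreal" where
  "ennreal_powr x a = (if x = \<infinity> then \<infinity> else ennreal (enn2real x powr a))"

definition Lp_norm :: "'a measure \<Rightarrow> ennreal \<Rightarrow> ('a \<Rightarrow> ennreal) \<Rightarrow> ennreal" where
  "Lp_norm M p f =
     (if p = \<infinity> then esssup M f
      else ennreal_powr (\<integral>\<^sup>+x. ennreal_powr (f x) (enn2real p) \<partial>M) (1 / enn2real p))"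


section \<open>Modulation spaces\<close>

definition translate :: "'a::euclidean_space \<Rightarrow> ('a \<Rightarrow> complex) \<Rightarrow> 'a \<Rightarrow> complex" where
  "translate x g = (\<lambda>t. g (t - x))"

definition modulate :: "'a::euclidean_space \<Rightarrow> ('a \<Rightarrow> complex) \<Rightarrow> 'a \<Rightarrow> complex" where
  "modulate \<xi> g = (\<lambda>t. cis (2 * pi * (t \<bullet> \<xi>)) * g t)"

text \<open>A distribution is a linear functional \<open>u\<close> on test functions; the pairing
  \<open>\<langle>u, \<psi>\<rangle>\<close>, which is conjugate-linear in \<open>\<psi>\<close>, is \<open>u\<close> applied to the complex conjugate of \<open>\<psi>\<close>.
  An ordinary function \<open>f\<close> is identified with the functional \<open>regular_distr f\<close>.\<close>

definition regular_distr :: "('a::euclidean_space \<Rightarrow> complex) \<Rightarrow> ('a \<Rightarrow> complex) \<Rightarrow> complex" where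
  "regular_distr f = (\<lambda>\<psi>. \<integral>t. f t * \<psi> t \<partial>lebesgue)"

definition stft ::
  "('a::euclidean_space \<Rightarrow> complex) \<Rightarrow> (('a \<Rightarrow> complex) \<Rightarrow> complex) \<Rightarrow> 'a \<Rightarrow> 'a \<Rightarrow> complex" where
  "stft \<phi> u x \<xi> = u (\<lambda>t. cnj (modulate \<xi> (translate x \<phi>) t))"

definition modulation_norm ::
  "('a::euclidean_space \<Rightarrow> complex) \<Rightarrow> ennreal \<Rightarrow> ennreal \<Rightarrow> ('a \<times> 'a \<Rightarrow> real) \<Rightarrow>
   (('a \<Rightarrow> complex) \<Rightarrow> complex) \<Rightarrow> ennreal" where
  "modulation_norm \<phi> p q m u =
     Lp_norm lebesgue q (\<lambda>\<xi>. Lp_norm lebesgue p (\<lambda>x. ennreal (cmod (stft \<phi> u x \<xi>) * m (x, \<xi>))))"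


section \<open>The Wigner distribution and its boundedness\<close>

definition wigner ::
  "real \<Rightarrow> ('a::euclidean_space \<Rightarrow> complex) \<Rightarrow> ('a \<Rightarrow> complex) \<Rightarrow> 'a \<times> 'a \<Rightarrow> complex" where
  "wigner \<tau> f\<^sub>1 f\<^sub>2 = (\<lambda>(x, \<xi>).
     \<integral>t. f\<^sub>1 (x + \<tau> *\<^sub>R t) * cnj (f\<^sub>2 (x - (1 - \<tau>) *\<^sub>R t)) * cis (- 2 * pi * (\<xi> \<bullet> t)) \<partial>lebesgue)"

text \<open>By convention, boundedness on the closures of the Schwartz class means the norm estimate on
  pairs of Schwartz functions. Here \<open>\<phi>\<close> is the window on the domain side, \<open>\<Phi>\<close> the window on the
  target side, and \<open>M\<^sub>1\<close>, \<open>M\<^sub>2\<close>, \<open>M\<close> are the weights.\<close>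

definition wigner_bounded ::
  "('a::euclidean_space \<Rightarrow> complex) \<Rightarrow> ('a \<times> 'a \<Rightarrow> complex) \<Rightarrow> real \<Rightarrow>
   ennreal \<Rightarrow> ennreal \<Rightarrow> ('a \<times> 'a \<Rightarrow> real) \<Rightarrow>
   ennreal \<Rightarrow> ennreal \<Rightarrow> ('a \<times> 'a \<Rightarrow> real) \<Rightarrow>
   ennreal \<Rightarrow> ennreal \<Rightarrow> (('a \<times> 'a) \<times> ('a \<times> 'a) \<Rightarrow> real) \<Rightarrow> bool" where
  "wigner_bounded \<phi> \<Phi> \<tau> p\<^sub>1 q\<^sub>1 M\<^sub>1 p\<^sub>2 q\<^sub>2 M\<^sub>2 p q M \<longleftrightarrow>
     (\<exists>C::real. C > 0 \<and> (\<forall>f\<^sub>1 f\<^sub>2. schwartz f\<^sub>1 \<longrightarrow> schwartz f\<^sub>2 \<longrightarrow>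
        modulation_norm \<Phi> p q M (regular_distr (wigner \<tau> f\<^sub>1 f\<^sub>2))
          \<le> ennreal C * modulation_norm \<phi> p\<^sub>1 q\<^sub>1 M\<^sub>1 (regular_distr f\<^sub>1)
                      * modulation_norm \<phi> p\<^sub>2 q\<^sub>2 M\<^sub>2 (regular_distr f\<^sub>2)))"


section \<open>Weighted sequence spaces\<close>

definition lattice_point :: "int ^ 'd \<Rightarrow> real ^ 'd" where
  "lattice_point k = (\<chi> i. real_of_int (k $ i))"

text \<open>For counting measure the essential supremum is the supremum.\<close>

definition lp_norm :: "ennreal \<Rightarrow> (real ^ 'd::finite \<Rightarrow> real) \<Rightarrow> (int ^ 'd \<Rightarrow> complex) \<Rightarrow> ennreal" where
  "lp_norm p w b = Lp_norm (count_space UNIV) p (\<lambda>k. ennreal (cmod (b k) * w (lattice_point k)))"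

definition lp_space :: "ennreal \<Rightarrow> (real ^ 'd::finite \<Rightarrow> real) \<Rightarrow> (int ^ 'd \<Rightarrow> complex) set" where
  "lp_space p w = {b. lp_norm p w b < \<infinity>}"

definition lp_embeds ::
  "ennreal \<Rightarrow> (real ^ 'd::finite \<Rightarrow> real) \<Rightarrow> ennreal \<Rightarrow> (real ^ 'd \<Rightarrow> real) \<Rightarrow> bool" where
  "lp_embeds p w q u \<longleftrightarrow>
     (\<exists>C::real. C > 0 \<and> (\<forall>a \<in> lp_space p w. lp_norm q u a \<le> ennreal C * lp_norm p w a))"

definition conv :: "(int ^ 'd::finite \<Rightarrow> complex) \<Rightarrow> (int ^ 'd \<Rightarrow> complex) \<Rightarrow> int ^ 'd \<Rightarrow> complex" where
  "conv a b = (\<lambda>n. \<Sum>\<^sub>\<infinity>k. a k * b (n - k))"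

definition lp_conv_embeds ::
  "ennreal \<Rightarrow> (real ^ 'd::finite \<Rightarrow> real) \<Rightarrow> ennreal \<Rightarrow> (real ^ 'd \<Rightarrow> real) \<Rightarrow>
   ennreal \<Rightarrow> (real ^ 'd \<Rightarrow> real) \<Rightarrow> bool" where
  "lp_conv_embeds p\<^sub>1 w\<^sub>1 p\<^sub>2 w\<^sub>2 q u \<longleftrightarrow>
     (\<exists>C::real. C > 0 \<and> (\<forall>a \<in> lp_space p\<^sub>1 w\<^sub>1. \<forall>b \<in> lp_space p\<^sub>2 w\<^sub>2.
        (\<forall>n. (\<lambda>k. cmod (a k * b (n - k))) summable_on UNIV) \<and>
        lp_norm q u (conv a b) \<le> ennreal C * lp_norm p\<^sub>1 w\<^sub>1 a * lp_norm p\<^sub>2 w\<^sub>2 b))"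

end

theory Submission
  imports Defs "HOL-Probability.Characteristic_Functions"
begin

text \<open>The short-time Fourier transform of \<open>W\<^sub>\<tau>(f\<^sub>1, f\<^sub>2)\<close> with window \<open>W\<^sub>\<tau>(g, g)\<close> is, up to a unimodular
  factor and a translation in \<open>z\<close> depending on \<open>\<zeta>\<close> only, the product of \<open>V\<^sub>g f\<^sub>1(z)\<close> and the conjugate of
  \<open>V\<^sub>g f\<^sub>2(z + (\<zeta>\<^sub>2, -\<zeta>\<^sub>1))\<close>. Hence the target norm is a weighted mixed norm of a correlation of \<open>|V\<^sub>g f\<^sub>1|\<close> and
  \<open>|V\<^sub>g f\<^sub>2|\<close>. Since the Peetre maximal function of a short-time Fourier transform has the same weighted norm
  up to constants, for all exponents in \<open>(0, \<infinity>]\<close>, all norms may be replaced by norms over the integer lattice.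

  Testing on sums of time shifts, or of frequency shifts, of a Gaussian, whose transforms are non-negative
  on the time axis and the frequency axis respectively, shows that boundedness implies one
  correlation inequality per variable; these are the convolution embeddings, and Dirac sequences
  reduce them to the four embeddings. Conversely, for \<open>p \<le> q\<close> the two correlation inequalities are combined by
  Minkowski's inequality. For \<open>q \<le> p\<close> the inner \<open>l\<^sup>p\<close> norm is dominated by the \<open>l\<^sup>q\<close> norm,
  and submultiplicativity of \<open>m\<close> distributes the weight over the two factors of a double sum over \<open>z\<close> and
  \<open>z + (\<zeta>\<^sub>2, -\<zeta>\<^sub>1)\<close>.\<close>

section \<open>Lebesgue quasi-norms\<close>

text \<open>Exponents below 1 shape the proof: the quasi-norms then have no duality and Young's
  inequality fails for functions, so the reproducing formula cannot be estimated directly. It is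
  estimated in r-th powers, with r at most 1 and at most every exponent, and on unit cubes, where
  sequence norms are nested and Minkowski's inequality applies to ratios of exponents. The order N
  of the maximal function stays free, since the order that suffices depends on the exponents and
  weights of each norm. The weight \<open>1 \<otimes> m\<close> does not see z, so the translation
  in z, the only trace of \<tau>, drops out. The rotation of \<zeta> pairs the time weights with
  \<open>m\<^sub>\<beta>\<close> and the frequency weights with \<open>m\<^sub>\<alpha>\<close>; the
  sign in it is why only \<open>m\<^sub>\<beta>\<close> is reflected. A correlation inequality makes
  sense for every p. For finite p its p-th power is a convolution inequality, whence the exponents
  divided by p and the reflected second weights. In (1) with q < p the two inequalities are not
  combined by Minkowski but through the four embeddings that they imply.\<close>

lemma ennreal_powr_ennreal: "0 \<le> x \<Longrightarrow> ennreal_powr (ennreal x) a = ennreal (x powr a)"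
  by (simp add: ennreal_powr_def)

text \<open>As \<open>0 powr a = 0\<close> for every a, including a = 0, and the value at
  \<infinity> is fixed to be \<infinity>, these rules hold for every real exponent. The convention
  \<open>ennreal_powr 0 0 = 0\<close> causes a case distinction in the Peetre argument.\<close>

lemma ennreal_powr_simps [simp]:
  "ennreal_powr 0 a = 0" "ennreal_powr \<infinity> a = \<infinity>" "ennreal_powr top a = top" "ennreal_powr 1 a = 1"
  by (auto simp: ennreal_powr_def)

lemma ennreal_powr_one [simp]: "ennreal_powr x 1 = x"
  by (cases x) (auto simp: ennreal_powr_def)

lemma ennreal_powr_mult:
  assumes "0 < a" shows "ennreal_powr (x * y) a = ennreal_powr x a * ennreal_powr y a"
proof (cases x)
  case (real u)
  show ?thesis
  proof (cases y)
    case (real v)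
    with \<open>x = ennreal u\<close> \<open>0 \<le> u\<close> show ?thesis
      by (simp add: ennreal_powr_ennreal powr_mult flip: ennreal_mult)
  next
    case top
    with real \<open>x = ennreal u\<close> assms show ?thesis
      by (cases "u = 0") (auto simp: ennreal_powr_ennreal ennreal_mult_top)
  qed
next
  case top
  then show ?thesis using assms
    by (cases y) (auto simp: ennreal_powr_ennreal ennreal_top_mult)
qed

lemma ennreal_powr_powr: "ennreal_powr (ennreal_powr x a) b = ennreal_powr x (a * b)"
  by (cases x) (auto simp: ennreal_powr_ennreal powr_powr)

lemma ennreal_powr_inverse [simp]:
  assumes "0 < a"
  shows "ennreal_powr (ennreal_powr x a) (1 / a) = x" "ennreal_powr (ennreal_powr x (1 / a)) a = x"
  using assms by (simp_all add: ennreal_powr_powr)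

lemma ennreal_powr_mono:
  assumes "0 < a" "x \<le> y" shows "ennreal_powr x a \<le> ennreal_powr y a"
proof (cases y)
  case (real v)
  then obtain u where "x = ennreal u" "0 \<le> u" "u \<le> v"
    using assms(2) by (cases x) (auto simp: top_unique)
  with real assms(1) show ?thesis by (simp add: ennreal_powr_ennreal powr_mono2 ennreal_leI)
qed auto

lemma ennreal_powr_le_iff:
  assumes "0 < a" shows "ennreal_powr x a \<le> ennreal_powr y a \<longleftrightarrow> x \<le> y"
  using ennreal_powr_mono[OF assms, of x y]
    ennreal_powr_mono[of "1 / a" "ennreal_powr x a" "ennreal_powr y a"] assms by auto

lemma ennreal_powr_le_swap:
  assumes "0 < a" shows "ennreal_powr x (1 / a) \<le> y \<longleftrightarrow> x \<le> ennreal_powr y a"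
  using ennreal_powr_le_iff[OF assms, of "ennreal_powr x (1 / a)" y] assms by simp

lemma ennreal_le_powr_swap:
  assumes "0 < a" shows "x \<le> ennreal_powr y (1 / a) \<longleftrightarrow> ennreal_powr x a \<le> y"
  using ennreal_powr_le_iff[OF assms, of x "ennreal_powr y (1 / a)"] assms by simp

lemma ennreal_powr_SUP:
  assumes "0 < a" "I \<noteq> {}"
  shows "ennreal_powr (SUP i\<in>I. f i) a = (SUP i\<in>I. ennreal_powr (f i) a)"
proof (rule antisym)
  have "(SUP i\<in>I. f i) \<le> ennreal_powr (SUP i\<in>I. ennreal_powr (f i) a) (1 / a)"
  proof (rule SUP_least)
    fix i assume "i \<in> I"
    then have "ennreal_powr (f i) a \<le> (SUP i\<in>I. ennreal_powr (f i) a)" by (rule SUP_upper)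
    from ennreal_powr_mono[OF _ this, of "1 / a"] assms
    show "f i \<le> ennreal_powr (SUP i\<in>I. ennreal_powr (f i) a) (1 / a)" by simp
  qed
  from ennreal_powr_mono[OF assms(1) this] assms(1)
  show "ennreal_powr (SUP i\<in>I. f i) a \<le> (SUP i\<in>I. ennreal_powr (f i) a)" by simp
  show "(SUP i\<in>I. ennreal_powr (f i) a) \<le> ennreal_powr (SUP i\<in>I. f i) a"
    by (intro SUP_least ennreal_powr_mono SUP_upper assms)
qed

lemma ennreal_powr_eq_0_iff [simp]: "ennreal_powr x a = 0 \<longleftrightarrow> x = 0"
  by (cases x) (auto simp: ennreal_powr_ennreal)

lemma ennreal_powr_eq_top_iff [simp]: "ennreal_powr x a = top \<longleftrightarrow> x = top"
  by (cases x) (auto simp: ennreal_powr_ennreal)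

lemma measurable_ennreal_powr [measurable (raw)]:
  assumes "f \<in> borel_measurable M" shows "(\<lambda>x. ennreal_powr (f x) a) \<in> borel_measurable M"
  using assms unfolding ennreal_powr_def by measurable

lemma enn2real_pos: "0 < p \<Longrightarrow> p \<noteq> \<infinity> \<Longrightarrow> 0 < enn2real p"
  by (cases p) auto

section \<open>Monotonicity, homogeneity and powers of the quasi-norms\<close>

lemma esssup_count_space: "esssup (count_space A) f = (SUP x\<in>A. (f x::ennreal))"
  by (auto simp: esssup_eq_AE AE_count_space intro!: antisym Inf_lower Inf_greatest SUP_upper SUP_least)

lemma Lp_norm_inf [simp]: "Lp_norm M \<infinity> f = esssup M f" "Lp_norm M top f = esssup M f"
  by (simp_all add: Lp_norm_def)

lemma Lp_norm_finite:
  "p \<noteq> \<infinity> \<Longrightarrow> Lp_norm M p f =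
    ennreal_powr (\<integral>\<^sup>+x. ennreal_powr (f x) (enn2real p) \<partial>M) (1 / enn2real p)"
  by (simp add: Lp_norm_def)

text \<open>\<open>esssup\<close> takes the value \<infinity> on non-measurable functions, so at p =
  \<infinity> measurability is asked of the smaller function. For finite p the integral is a
  supremum over simple minorants, hence monotone for all functions.\<close>

lemma Lp_norm_AE_mono:
  assumes "0 < p" "AE x in M. f x \<le> g x" "p = \<infinity> \<Longrightarrow> f \<in> borel_measurable M"
  shows "Lp_norm M p f \<le> Lp_norm M p g"
proof (cases "p = \<infinity>")
  case True
  then show ?thesis using assms by (simp add: esssup_AE_mono)
next
  case False
  then have "0 < enn2real p" using assms(1) by (simp add: enn2real_pos)
  then show ?thesis using False assms(2)
    by (auto simp: Lp_norm_finite intro!: ennreal_powr_mono nn_integral_mono_AE)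
qed

lemma Lp_norm_mono:
  assumes "0 < p" "\<And>x. x \<in> space M \<Longrightarrow> f x \<le> g x" "p = \<infinity> \<Longrightarrow> f \<in> borel_measurable M"
  shows "Lp_norm M p f \<le> Lp_norm M p g"
  by (rule Lp_norm_AE_mono) (use assms in auto)

lemma Lp_norm_cong:
  assumes "0 < p" "\<And>x. x \<in> space M \<Longrightarrow> f x = g x"
  shows "Lp_norm M p f = Lp_norm M p g"
proof -
  have "f \<in> borel_measurable M \<longleftrightarrow> g \<in> borel_measurable M"
    by (rule measurable_cong) (use assms in auto)
  then show ?thesis
    by (cases "p = \<infinity> \<and> f \<notin> borel_measurable M")
      (auto simp: assms esssup_non_measurable intro!: antisym Lp_norm_mono)
qed

lemma Lp_norm_count_mono:
  assumes "0 < p" "\<And>x. x \<in> A \<Longrightarrow> f x \<le> g x"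
  shows "Lp_norm (count_space A) p f \<le> Lp_norm (count_space A) p g"
  by (rule Lp_norm_mono) (use assms in auto)

lemma Lp_norm_cmult:
  assumes "0 < p" "c < \<infinity>"
  shows "Lp_norm M p (\<lambda>x. c * f x) \<le> c * Lp_norm M p f"
\<comment> \<open>Zero is special because it makes a non-measurable function measurable: at p =
  \<infinity> the left side is then 0, whereas for c > 0 both sides are \<infinity>.\<close>
proof (cases "c = 0")
  case True
  show ?thesis
  proof (cases "p = \<infinity>")
    case True
    have "esssup M (\<lambda>x. 0) \<le> (0::ennreal)" by (rule esssup_I) auto
    then show ?thesis using True \<open>c = 0\<close> by auto
  next
    case False
    then show ?thesis using True by (simp add: Lp_norm_finite)
  qed
next
  case False
  have fin: "c \<noteq> \<infinity>" using assms by auto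
  show ?thesis
  proof (cases "p = \<infinity>")
    case True
    show ?thesis
    proof (cases "f \<in> borel_measurable M")
      case True
      have "AE x in M. c * f x \<le> c * esssup M f"
        using esssup_AE[of f M] by eventually_elim (simp add: mult_left_mono)
      then show ?thesis using \<open>p = \<infinity>\<close> True by (auto intro!: esssup_I)
    next
      case nm: False
      then show ?thesis using \<open>p = \<infinity>\<close> False by (simp add: esssup_non_measurable ennreal_mult_top)
    qed
  next
    case pf: False
    then have p: "0 < enn2real p" using assms(1) by (simp add: enn2real_pos)
    let ?c = "ennreal_powr c (enn2real p)"
    have "?c \<noteq> top" using fin by simp
    then have c: "?c \<noteq> 0" "?c < \<infinity>" using False by (auto simp only: less_top ennreal_powr_eq_0_iff infinity_ennreal_def)
    have "(\<integral>\<^sup>+x. ?c * ennreal_powr (f x) (enn2real p) \<partial>M) \<le> ?c * (\<integral>\<^sup>+x. ennreal_powr (f x) (enn2real p) \<partial>M)"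
    proof -
      have "(\<integral>\<^sup>+x. ?c * ennreal_powr (f x) (enn2real p) \<partial>M)
          = (SUP g \<in> {g. simple_function M g \<and> g \<le> (\<lambda>x. ?c * ennreal_powr (f x) (enn2real p))}. integral\<^sup>S M g)"
        by (simp add: nn_integral_def)
      also have "\<dots> \<le> ?c * (\<integral>\<^sup>+x. ennreal_powr (f x) (enn2real p) \<partial>M)"
      proof (rule SUP_least)
        \<comment> \<open>\<open>f\<close> is arbitrary, so homogeneity of the integral is applied
          to a simple minorant \<open>g\<close> instead: \<open>g / ?c\<close> is measurable and
          lies below the p-th power of \<open>f\<close>.\<close>
        fix g assume g: "g \<in> {g. simple_function M g \<and> g \<le> (\<lambda>x. ?c * ennreal_powr (f x) (enn2real p))}"
        then have sg: "simple_function M g" and le: "\<And>x. g x \<le> ?c * ennreal_powr (f x) (enn2real p)"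
          by (auto simp: le_fun_def)
        have [measurable]: "g \<in> borel_measurable M" using sg by (rule borel_measurable_simple_function)
        have eq: "g x = ?c * (g x / ?c)" for x
          using c by (metis ennreal_times_divide mult.commute ennreal_mult_divide_eq less_top infinity_ennreal_def)
        have "integral\<^sup>S M g = (\<integral>\<^sup>+x. g x \<partial>M)" using sg by (simp add: nn_integral_eq_simple_integral)
        also have "\<dots> = (\<integral>\<^sup>+x. ?c * (g x / ?c) \<partial>M)" using eq by simp
        also have "\<dots> = ?c * (\<integral>\<^sup>+x. g x / ?c \<partial>M)" by (rule nn_integral_cmult) measurable
        also have "\<dots> \<le> ?c * (\<integral>\<^sup>+x. ennreal_powr (f x) (enn2real p) \<partial>M)"
        proof (intro mult_left_mono nn_integral_mono)
          fix x
          show "g x / ?c \<le> ennreal_powr (f x) (enn2real p)"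
            using divide_right_mono_ennreal[OF le[of x], of ?c] ennreal_mult_divide_eq[of ?c] c assms(2)
            by (subst (asm) mult.commute) auto
        qed auto
        finally show "integral\<^sup>S M g \<le> \<dots>" .
      qed
      finally show ?thesis .
    qed
    from ennreal_powr_mono[OF _ this, of "1 / enn2real p"] show ?thesis
      using pf p by (simp add: Lp_norm_finite ennreal_powr_mult)
  qed
qed

lemma Lp_norm_cmult_eq:
  assumes "0 < p" "c < \<infinity>" "0 < c"
  shows "Lp_norm M p (\<lambda>x. c * f x) = c * Lp_norm M p f"
proof (rule antisym)
  have c: "inverse c < \<infinity>" using assms by (cases c) (auto simp: inverse_ennreal)
  have cc: "c * inverse c = 1"
    using assms by (simp add: ennreal_divide_self flip: divide_ennreal_def)
  have "f = (\<lambda>x. inverse c * (c * f x))"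
    using cc by (simp add: mult.assoc[symmetric] mult.commute)
  then have "Lp_norm M p f \<le> inverse c * Lp_norm M p (\<lambda>x. c * f x)"
    using Lp_norm_cmult[OF assms(1) c, of M "\<lambda>x. c * f x"] by simp
  then have "c * Lp_norm M p f \<le> c * (inverse c * Lp_norm M p (\<lambda>x. c * f x))"
    by (rule mult_left_mono) simp
  then show "c * Lp_norm M p f \<le> Lp_norm M p (\<lambda>x. c * f x)"
    using cc by (simp add: mult.assoc[symmetric])
qed (rule Lp_norm_cmult[OF assms(1,2)])

text \<open>The change of exponent from p to p / r. With the inner exponent in the role of r it
  turns a correlation inequality into a convolution inequality.\<close>

lemma Lp_norm_powr:
  assumes "0 < p" "0 < r"
  shows "Lp_norm M p f = ennreal_powr (Lp_norm M (p / ennreal r) (\<lambda>x. ennreal_powr (f x) r)) (1 / r)"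
proof (cases "p = \<infinity>")
  case True
  have inf: "p / ennreal r = \<infinity>" using True by (simp add: ennreal_top_divide)
  show ?thesis
  proof (cases "f \<in> borel_measurable M")
    case [measurable]: True
    have "esssup M f \<le> ennreal_powr (esssup M (\<lambda>x. ennreal_powr (f x) r)) (1 / r)"
      by (rule esssup_I) (use assms esssup_AE[of "\<lambda>x. ennreal_powr (f x) r" M] in
        \<open>auto simp: ennreal_le_powr_swap\<close>)
    moreover have "esssup M (\<lambda>x. ennreal_powr (f x) r) \<le> ennreal_powr (esssup M f) r"
      by (rule esssup_I) (use assms esssup_AE[of f M] in
        \<open>auto elim!: eventually_mono intro: ennreal_powr_mono\<close>)
    ultimately show ?thesis using inf True \<open>p = \<infinity>\<close> assms
      by (auto intro!: antisym simp: ennreal_powr_le_swap)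
  next
    case False
    have "(\<lambda>x. ennreal_powr (f x) r) \<notin> borel_measurable M"
    proof
      assume "(\<lambda>x. ennreal_powr (f x) r) \<in> borel_measurable M"
      then have "(\<lambda>x. ennreal_powr (ennreal_powr (f x) r) (1 / r)) \<in> borel_measurable M" by measurable
      then show False using False assms by simp
    qed
    then show ?thesis using inf False \<open>p = \<infinity>\<close> by (simp add: esssup_non_measurable)
  qed
next
  case False
  then obtain s where s: "p = ennreal s" "0 < s" using assms by (cases p) auto
  then have "p / ennreal r = ennreal (s / r)" using assms by (simp add: divide_ennreal)
  then show ?thesis using s assms by (simp add: Lp_norm_finite ennreal_powr_powr)
qed

section \<open>Minkowski's inequality for exponents in (0, \<infinity>]\<close>

lemma borel_measurable_nn_integral_count_space:
  assumes "countable B" "\<And>l. l \<in> B \<Longrightarrow> (\<lambda>x. f x l) \<in> borel_measurable M"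
  shows "(\<lambda>x. \<integral>\<^sup>+l. f x l \<partial>count_space B) \<in> borel_measurable M"
proof -
  interpret sigma_finite_measure "count_space B"
    using assms(1) by (rule sigma_finite_measure_count_space_countable)
  have "(\<lambda>a. f (fst a) (snd a)) \<in> borel_measurable (M \<Otimes>\<^sub>M count_space B)"
    by (rule measurable_compose_countable'[where f="\<lambda>b a. f (fst a) b" and I=B])
      (use assms in \<open>auto intro: measurable_compose[OF measurable_fst]\<close>)
  then show ?thesis
    by (intro borel_measurable_nn_integral) (simp add: case_prod_beta')
qed

text \<open>The graph of t ^ s lies above its tangent at c: s c ^ (s - 1) t \<le> t ^ s + (s - 1) c
  ^ s. This is Young's inequality for the conjugate exponents s and s / (s - 1), taken at t = u / N
  and multiplied by N.\<close>

lemma young_ennreal: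
  assumes "1 < s" "0 \<le> c" "0 < N" "N < \<infinity>"
  shows "ennreal (s * c powr (s - 1)) * u
    \<le> N * ennreal_powr (u / N) s + ennreal ((s - 1) * c powr s) * N"
proof -
  obtain n where n: "N = ennreal n" "0 < n" using assms by (cases N) auto
  show ?thesis
  proof (cases u)
    case (real v)
    define t where "t = v / n"
    have t: "0 \<le> t" "v = t * n" using real n by (auto simp: t_def)
    have y: "t * c powr (s - 1) \<le> t powr s / s + (c powr (s - 1)) powr (s / (s - 1)) / (s / (s - 1))"
      by (rule Youngs_inequality) (use assms t in \<open>auto simp: field_simps\<close>)
    have "(c powr (s - 1)) powr (s / (s - 1)) = c powr s" using assms by (simp add: powr_powr)
    with y have "s * (t * c powr (s - 1)) \<le> s * (t powr s / s + c powr s / (s / (s - 1)))"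
      using assms by (intro mult_left_mono) auto
    moreover have "s * (A / s + X / (s / (s - 1))) = A + (s - 1) * X" for A X
      using assms by (simp add: field_simps)
    ultimately have "s * (t * c powr (s - 1)) \<le> t powr s + (s - 1) * c powr s" by simp
    from mult_right_mono[OF this, of n] have "s * c powr (s - 1) * v \<le> n * t powr s + (s - 1) * c powr s * n"
      using n t by (simp add: algebra_simps)
    then show ?thesis
      using n real assms t by (simp add: divide_ennreal ennreal_powr_ennreal flip: ennreal_mult ennreal_plus)
  next
    case top
    then show ?thesis using n by (simp add: ennreal_top_divide ennreal_mult_top)
  qed
qed

text \<open>With \<open>N\<close> the pointwise norm, this is Jensen's inequality for
  the probability density \<open>N / \<integral>N\<close>, in its tangent line form.\<close>

lemma minkowski_nn_integral:
  fixes U :: "'x \<Rightarrow> 'l \<Rightarrow> ennreal"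
  assumes "1 \<le> s" "countable B" and U: "\<And>l. l \<in> B \<Longrightarrow> (\<lambda>x. U x l) \<in> borel_measurable M"
  shows "(\<integral>\<^sup>+l. ennreal_powr (\<integral>\<^sup>+x. U x l \<partial>M) s \<partial>count_space B)
    \<le> ennreal_powr (\<integral>\<^sup>+x. ennreal_powr (\<integral>\<^sup>+l. ennreal_powr (U x l) s \<partial>count_space B) (1 / s) \<partial>M) s"
proof (cases "s = 1")
  case True
  then show ?thesis
    using nn_integral_count_space_nn_integral[of B "\<lambda>l x. U x l" M] assms by simp
next
  case False
  with assms have s: "1 < s" by simp
  define N where "N x = ennreal_powr (\<integral>\<^sup>+l. ennreal_powr (U x l) s \<partial>count_space B) (1 / s)" for x
  have Nm[measurable]: "N \<in> borel_measurable M" unfolding N_def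
    by (intro measurable_ennreal_powr borel_measurable_nn_integral_count_space assms U)
  define \<Lambda> where "\<Lambda> = (\<integral>\<^sup>+x. N x \<partial>M)"
  have UN: "U x l \<le> N x" if "l \<in> B" for x l
  proof -
    have "ennreal_powr (U x l) s \<le> (\<integral>\<^sup>+l. ennreal_powr (U x l) s \<partial>count_space B)"
      using that by (rule nn_integral_ge_point)
    then show ?thesis unfolding N_def
      using ennreal_powr_mono[of "1 / s" "ennreal_powr (U x l) s"] s by simp
  qed
  show ?thesis
  proof (cases "\<Lambda> = \<infinity> \<or> \<Lambda> = 0")
    case True
    then show ?thesis
    proof
      assume "\<Lambda> = \<infinity>" then show ?thesis by (simp add: \<Lambda>_def N_def)
    next
      assume 0: "\<Lambda> = 0"
      have "(\<integral>\<^sup>+x. U x l \<partial>M) = 0" if "l \<in> B" for l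
        using nn_integral_mono[of M "\<lambda>x. U x l" N] UN[OF that] 0 by (simp add: \<Lambda>_def)
      then have "(\<integral>\<^sup>+l. ennreal_powr (\<integral>\<^sup>+x. U x l \<partial>M) s \<partial>count_space B) = (\<integral>\<^sup>+l. 0 \<partial>count_space B)"
        by (intro nn_integral_cong) simp
      then show ?thesis by simp
    qed
  next
    case False
    then obtain L where L: "\<Lambda> = ennreal L" "0 < L" by (cases \<Lambda>) auto
    \<comment> \<open>The integrand of Jensen's inequality with respect to the density
      \<open>N\<close>. Its sum over \<open>l\<close> is at most \<open>N x\<close> because
      \<open>N x\<close> is the l^s norm of \<open>U x\<close>.\<close>
    define V where "V x l = N x * ennreal_powr (U x l / N x) s" for x l
    have Vm[measurable]: "(\<lambda>x. V x l) \<in> borel_measurable M" if "l \<in> B" for l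
      using U[OF that] unfolding V_def by measurable
    have sumV: "(\<integral>\<^sup>+l. V x l \<partial>count_space B) \<le> N x" for x
    proof (cases "N x = 0 \<or> N x = \<infinity>")
      case True
      then have "V x l = 0" for l by (auto simp: V_def)
      then show ?thesis by simp
    next
      case False
      have "(\<integral>\<^sup>+l. V x l \<partial>count_space B)
        = (\<integral>\<^sup>+l. (N x * ennreal_powr (inverse (N x)) s) * ennreal_powr (U x l) s \<partial>count_space B)"
        using s by (intro nn_integral_cong) (simp add: V_def divide_ennreal_def ennreal_powr_mult ac_simps)
      also have "\<dots> = (N x * ennreal_powr (inverse (N x)) s) * (\<integral>\<^sup>+l. ennreal_powr (U x l) s \<partial>count_space B)"
        by (rule nn_integral_cmult) simp
      also have "(\<integral>\<^sup>+l. ennreal_powr (U x l) s \<partial>count_space B) = ennreal_powr (N x) s"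
        using s by (simp add: N_def)
      also have "(N x * ennreal_powr (inverse (N x)) s) * ennreal_powr (N x) s = N x * ennreal_powr (N x / N x) s"
        using s by (simp add: divide_ennreal_def ennreal_powr_mult ac_simps)
      also have "\<dots> = N x" using False by (simp add: ennreal_divide_self less_top)
      finally show ?thesis by simp
    qed
    have "ennreal_powr (\<integral>\<^sup>+x. U x l \<partial>M) s \<le> ennreal (L powr s / L) * (\<integral>\<^sup>+x. V x l \<partial>M)" if l: "l \<in> B" for l
    proof -
      note [measurable] = U[OF l] Vm[OF l]
      have "(\<integral>\<^sup>+x. U x l \<partial>M) \<le> \<Lambda>" unfolding \<Lambda>_def by (intro nn_integral_mono UN l)
      then obtain a where a: "(\<integral>\<^sup>+x. U x l \<partial>M) = ennreal a" "0 \<le> a" "a \<le> L"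
        using L by (cases "\<integral>\<^sup>+x. U x l \<partial>M") (auto simp: top_unique)
      \<comment> \<open>The point of tangency is the mean of \<open>U x l / N x\<close> for the
        probability density \<open>N / L\<close>. With this choice c ^ (s - 1) a = c ^ s L, so the
        term with s - 1 cancels after integration and c ^ s L remains.\<close>
      define c where "c = a / L"
      have c: "0 \<le> c" using a L by (simp add: c_def)
      have "AE x in M. N x \<noteq> \<infinity>"
        by (rule nn_integral_PInf_AE) (use L in \<open>auto simp: \<Lambda>_def[symmetric]\<close>)
      then have "AE x in M. ennreal (s * c powr (s - 1)) * U x l \<le> V x l + ennreal ((s - 1) * c powr s) * N x"
      proof eventually_elim
        case (elim x)
        show ?case
        proof (cases "N x = 0")
          case True then show ?thesis using UN[OF l, of x] by simp
        next
          case False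
          then show ?thesis unfolding V_def
            using elim by (intro young_ennreal s c) (auto simp: less_top zero_less_iff_neq_zero)
        qed
      qed
      from nn_integral_mono_AE[OF this]
      have "ennreal (s * c powr (s - 1)) * ennreal a \<le> (\<integral>\<^sup>+x. V x l \<partial>M) + ennreal ((s - 1) * c powr s) * ennreal L"
        by (simp add: nn_integral_add nn_integral_cmult a \<Lambda>_def[symmetric] L)
      then have *: "ennreal (s * (c powr (s - 1) * a)) \<le> (\<integral>\<^sup>+x. V x l \<partial>M) + ennreal ((s - 1) * c powr s * L)"
        using s a L c by (simp add: mult.assoc flip: ennreal_mult)
      have "c powr (s - 1) * a = c powr s * L"
        using a L by (cases "a = 0") (auto simp: c_def powr_diff)
      with * have **: "ennreal (s * (c powr s * L)) \<le> (\<integral>\<^sup>+x. V x l \<partial>M) + ennreal ((s - 1) * c powr s * L)" by simp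
      have "ennreal (c powr s * L) \<le> (\<integral>\<^sup>+x. V x l \<partial>M)"
      proof (cases "\<integral>\<^sup>+x. V x l \<partial>M")
        case (real v)
        with ** s L have "s * (c powr s * L) \<le> v + (s - 1) * c powr s * L"
          by (simp flip: ennreal_plus)
        then show ?thesis using real by (simp add: algebra_simps ennreal_leI)
      qed simp
      then have "ennreal (L powr s / L) * ennreal (c powr s * L) \<le> ennreal (L powr s / L) * (\<integral>\<^sup>+x. V x l \<partial>M)"
        by (rule mult_left_mono) simp
      moreover have "L powr s / L * (c powr s * L) = a powr s"
        using a L by (simp add: c_def powr_divide)
      ultimately show ?thesis using a L by (simp add: ennreal_powr_ennreal flip: ennreal_mult)
    qed
    then have "(\<integral>\<^sup>+l. ennreal_powr (\<integral>\<^sup>+x. U x l \<partial>M) s \<partial>count_space B)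
      \<le> (\<integral>\<^sup>+l. ennreal (L powr s / L) * (\<integral>\<^sup>+x. V x l \<partial>M) \<partial>count_space B)"
      by (intro nn_integral_mono) simp
    also have "\<dots> = ennreal (L powr s / L) * (\<integral>\<^sup>+l. (\<integral>\<^sup>+x. V x l \<partial>M) \<partial>count_space B)"
      by (rule nn_integral_cmult) simp
    also have "(\<integral>\<^sup>+l. (\<integral>\<^sup>+x. V x l \<partial>M) \<partial>count_space B) = (\<integral>\<^sup>+x. (\<integral>\<^sup>+l. V x l \<partial>count_space B) \<partial>M)"
      using assms by (intro nn_integral_count_space_nn_integral[symmetric]) auto
    also have "ennreal (L powr s / L) * \<dots> \<le> ennreal (L powr s / L) * \<Lambda>"
      unfolding \<Lambda>_def by (intro mult_left_mono nn_integral_mono sumV) simp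
    also have "\<dots> = ennreal_powr \<Lambda> s"
      using L by (simp add: ennreal_powr_ennreal flip: ennreal_mult)
    finally show ?thesis unfolding \<Lambda>_def N_def .
  qed
qed

text \<open>Minkowski's inequality for the ratio q / p \<ge> 1, applied to the p-th powers; this is
  what admits p < 1. At q = \<infinity> it is monotonicity.\<close>

lemma Lp_norm_swap:
  assumes "0 < p" "p \<le> q" "p \<noteq> \<infinity>" "countable B"
    and u: "\<And>l. l \<in> B \<Longrightarrow> (\<lambda>x. u x l) \<in> borel_measurable M"
  shows "Lp_norm (count_space B) q (\<lambda>l. Lp_norm M p (\<lambda>x. u x l))
    \<le> Lp_norm M p (\<lambda>x. Lp_norm (count_space B) q (\<lambda>l. u x l))"
proof (cases "q = \<infinity>")
  case True
  have "Lp_norm M p (\<lambda>x. u x l) \<le> Lp_norm M p (\<lambda>x. SUP l\<in>B. u x l)" if "l \<in> B" for l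
    by (rule Lp_norm_mono) (use assms that in \<open>auto intro: SUP_upper\<close>)
  then show ?thesis using True by (auto simp: esssup_count_space intro: SUP_least)
next
  case False
  let ?p = "enn2real p" and ?q = "enn2real q"
  have p: "0 < ?p" using assms by (intro enn2real_pos)
  have q: "0 < ?q" using assms False by (intro enn2real_pos) auto
  have pq: "?p \<le> ?q" using assms False by (intro enn2real_mono) (auto simp: less_top)
  define s where "s = ?q / ?p"
  have s: "1 \<le> s" "?q = ?p * s" using p pq by (auto simp: s_def)
  have "(\<integral>\<^sup>+l. ennreal_powr (\<integral>\<^sup>+x. ennreal_powr (u x l) ?p \<partial>M) s \<partial>count_space B)
    \<le> ennreal_powr (\<integral>\<^sup>+x. ennreal_powr (\<integral>\<^sup>+l. ennreal_powr (ennreal_powr (u x l) ?p) s \<partial>count_space B) (1 / s) \<partial>M) s"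
    by (rule minkowski_nn_integral) (use s assms in auto)
  from ennreal_powr_mono[OF _ this, of "1 / ?q"] show ?thesis
    using p q s False assms(3) by (simp add: Lp_norm_finite ennreal_powr_powr)
qed

lemma le_Lp_norm_count:
  assumes "0 < p" "k \<in> A" shows "f k \<le> Lp_norm (count_space A) p f"
proof (cases "p = \<infinity>")
  case True then show ?thesis using assms by (simp add: esssup_count_space SUP_upper)
next
  case False
  have "ennreal_powr (f k) (enn2real p) \<le> (\<integral>\<^sup>+x. ennreal_powr (f x) (enn2real p) \<partial>count_space A)"
    by (rule nn_integral_ge_point) (use assms in auto)
  then show ?thesis
    using ennreal_powr_mono[of "1 / enn2real p" "ennreal_powr (f k) (enn2real p)"] False assms
    by (simp add: Lp_norm_finite enn2real_pos)
qed

lemma ennreal_powr_add: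
  assumes "0 < a" "0 < b" shows "ennreal_powr x (a + b) = ennreal_powr x a * ennreal_powr x b"
  using assms by (cases x) (auto simp: ennreal_powr_ennreal powr_add ennreal_mult)

text \<open>Every entry is at most the l^p norm K, so f ^ q \<le> K ^ (q - p) f ^ p, and summation
  gives K ^ q.\<close>

lemma Lp_norm_count_antimono:
  assumes "0 < p" "p \<le> q"
  shows "Lp_norm (count_space A) q f \<le> Lp_norm (count_space A) p f"
proof (cases "p = q \<or> q = \<infinity>")
  case True
  then show ?thesis using assms
    by (auto simp: esssup_count_space intro!: SUP_least le_Lp_norm_count)
next
  case False
  then have pf: "p \<noteq> \<infinity>" and qf: "q \<noteq> \<infinity>" using assms by (auto simp: top_unique)
  let ?p = "enn2real p" and ?q = "enn2real q"
  have p: "0 < ?p" using assms pf by (auto intro: enn2real_pos)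
  have "?p \<le> ?q" using assms qf by (auto intro: enn2real_mono simp: less_top)
  moreover have "?p \<noteq> ?q"
    using False pf qf by (cases p; cases q) auto
  ultimately have pq: "?p < ?q" by simp
  define K where "K = Lp_norm (count_space A) p f"
  have "(\<integral>\<^sup>+x. ennreal_powr (f x) ?q \<partial>count_space A)
    \<le> (\<integral>\<^sup>+x. ennreal_powr K (?q - ?p) * ennreal_powr (f x) ?p \<partial>count_space A)"
  proof (rule nn_integral_mono)
    fix x assume "x \<in> space (count_space A)"
    then have "f x \<le> K" unfolding K_def using assms by (intro le_Lp_norm_count) auto
    then have "ennreal_powr (f x) (?q - ?p) \<le> ennreal_powr K (?q - ?p)"
      using pq by (intro ennreal_powr_mono) auto
    then show "ennreal_powr (f x) ?q \<le> ennreal_powr K (?q - ?p) * ennreal_powr (f x) ?p"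
      using ennreal_powr_add[of "?q - ?p" ?p "f x"] pq p by (simp add: mult_right_mono)
  qed
  also have "\<dots> = ennreal_powr K (?q - ?p) * (\<integral>\<^sup>+x. ennreal_powr (f x) ?p \<partial>count_space A)"
    by (rule nn_integral_cmult) simp
  also have "(\<integral>\<^sup>+x. ennreal_powr (f x) ?p \<partial>count_space A) = ennreal_powr K ?p"
    using p pf by (simp add: K_def Lp_norm_finite)
  also have "ennreal_powr K (?q - ?p) * ennreal_powr K ?p = ennreal_powr K ?q"
    using ennreal_powr_add[of "?q - ?p" ?p K] pq p by simp
  finally have "ennreal_powr (\<integral>\<^sup>+x. ennreal_powr (f x) ?q \<partial>count_space A) (1 / ?q) \<le> K"
    using p pq by (simp add: ennreal_powr_le_swap)
  then show ?thesis using qf by (simp add: Lp_norm_finite K_def)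
qed

section \<open>Schwartz functions\<close>

text \<open>In this form the bracket is submultiplicative with constant 1, so triangle estimates and
  their N-th powers produce no constants.\<close>

definition jbracket :: "'a::real_normed_vector \<Rightarrow> real" where
  "jbracket x = 1 + norm x"

lemma jbracket_ge_1 [simp]: "1 \<le> jbracket x" and jbracket_pos [simp]: "0 < jbracket x"
  and jbracket_nonneg [simp]: "0 \<le> jbracket x" and jbracket_nz [simp]: "jbracket x \<noteq> 0"
  by (auto simp: jbracket_def add_pos_nonneg intro: add_nonneg_nonneg)
    (metis add_pos_nonneg norm_ge_zero order_less_irrefl zero_less_one)

lemma jbracket_minus [simp]: "jbracket (- x) = jbracket x"
  by (simp add: jbracket_def)

lemma jbracket_minus_commute: "jbracket (x - y) = jbracket (y - x)"
  by (simp add: jbracket_def norm_minus_commute)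

lemma jbracket_add: "jbracket (x + y) \<le> jbracket x * jbracket y"
proof -
  have "norm (x + y) \<le> norm x + norm y" by (rule norm_triangle_ineq)
  also have "\<dots> \<le> norm x + norm y + norm x * norm y" by simp
  finally show ?thesis by (simp add: jbracket_def algebra_simps)
qed

lemma jbracket_triangle: "jbracket (x - z) \<le> jbracket (x - y) * jbracket (y - z)"
  using jbracket_add[of "x - y" "y - z"] by simp

lemma jbracket_power_pos [simp]: "0 < jbracket x ^ N" by simp

lemma continuous_jbracket [continuous_intros]:
  "continuous_on S f \<Longrightarrow> continuous_on S (\<lambda>x. jbracket (f x))"
  unfolding jbracket_def by (intro continuous_intros)

lemma jbracket_Pair: "jbracket x \<le> jbracket (x, y)" "jbracket y \<le> jbracket (x, y)"
  "jbracket (x, y) \<le> jbracket x * jbracket y"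
proof -
  show "jbracket x \<le> jbracket (x, y)" "jbracket y \<le> jbracket (x, y)"
    by (auto simp: jbracket_def norm_fst_le[of "(x, y)", simplified] norm_snd_le[of "(x, y)", simplified]
      norm_Pair real_le_rsqrt)
  have "norm (x, y) \<le> norm x + norm y" by (rule norm_Pair_le)
  also have "\<dots> \<le> norm x + norm y + norm x * norm y" by simp
  finally show "jbracket (x, y) \<le> jbracket x * jbracket y"
    by (simp add: jbracket_def algebra_simps)
qed

text \<open>Iterated derivatives never leave \<open>X\<close>. Below, \<open>X\<close> is chosen as
  a family of expressions closed under one differentiation, which avoids Leibniz formulas for higher
  derivatives.\<close>

lemma schwartz_coinduct [consumes 1, case_names diff decay deriv]:
  assumes "X f" and diff: "\<And>f x. X f \<Longrightarrow> f differentiable (at x)"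
    and decay: "\<And>f N. X f \<Longrightarrow> \<exists>C. \<forall>x. jbracket x ^ N * cmod (f x) \<le> C"
    and deriv: "\<And>f b. X f \<Longrightarrow> b \<in> Basis \<Longrightarrow> X (partial_deriv b f)"
  shows "schwartz f"
proof -
  have "X (foldr partial_deriv bs f)" if "bs \<in> lists Basis" for bs
    using that by (induction bs) (auto simp: assms(1) intro: deriv)
  then show ?thesis unfolding schwartz_def using diff decay by (auto simp: jbracket_def)
qed

section \<open>Closure properties of the Schwartz class\<close>

lemma schwartz_differentiable: "schwartz f \<Longrightarrow> f differentiable (at x)"
  unfolding schwartz_def by (drule bspec[of _ _ "[]"]) auto

lemma schwartz_decay_ex: "schwartz f \<Longrightarrow> \<exists>C. \<forall>x. jbracket x ^ N * cmod (f x) \<le> C"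
  unfolding schwartz_def jbracket_def by (drule bspec[of _ _ "[]"]) auto

lemma schwartz_decay:
  fixes f :: "'a::euclidean_space \<Rightarrow> complex"
  assumes "schwartz f"
  obtains C where "0 \<le> C" "\<And>x. jbracket x ^ N * cmod (f x) \<le> C"
proof -
  from schwartz_decay_ex[OF assms, of N] obtain C where C: "\<And>x. jbracket x ^ N * cmod (f x) \<le> C" by blast
  have "0 \<le> jbracket (0::'a) ^ N * cmod (f 0)" by simp
  also have "\<dots> \<le> C" by (rule C)
  finally show thesis using C that by blast
qed

lemma schwartz_partial_deriv:
  assumes "schwartz f" "b \<in> Basis" shows "schwartz (partial_deriv b f)"
proof -
  have "foldr partial_deriv bs (partial_deriv b f) = foldr partial_deriv (bs @ [b]) f" for bs
    by simp
  then show ?thesis using assms unfolding schwartz_def by (metis append_in_lists_conv lists.simps)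
qed

lemma partial_deriv_eq: "(f has_derivative f') (at x) \<Longrightarrow> partial_deriv b f x = f' b"
  unfolding partial_deriv_def by (metis frechet_derivative_at)

lemma has_derivative_partial_deriv:
  assumes "f differentiable (at x)"
  shows "(f has_derivative (\<lambda>h. \<Sum>b\<in>Basis. (h \<bullet> b) *\<^sub>R partial_deriv b f x)) (at x)"
proof -
  have d: "(f has_derivative frechet_derivative f (at x)) (at x)"
    using assms by (simp add: frechet_derivative_works)
  then interpret bounded_linear "frechet_derivative f (at x)" by (rule has_derivative_bounded_linear)
  have "frechet_derivative f (at x) h = (\<Sum>b\<in>Basis. (h \<bullet> b) *\<^sub>R partial_deriv b f x)" for h
  proof -
    have "frechet_derivative f (at x) h = frechet_derivative f (at x) (\<Sum>b\<in>Basis. (h \<bullet> b) *\<^sub>R b)"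
      by (simp add: euclidean_representation)
    also have "\<dots> = (\<Sum>b\<in>Basis. (h \<bullet> b) *\<^sub>R partial_deriv b f x)"
      by (simp add: sum scaleR partial_deriv_def)
    finally show ?thesis .
  qed
  then have "frechet_derivative f (at x) = (\<lambda>h. \<Sum>b\<in>Basis. (h \<bullet> b) *\<^sub>R partial_deriv b f x)" by blast
  with d show ?thesis by simp
qed

lemmas schwartz_has_derivative = has_derivative_partial_deriv[OF schwartz_differentiable]

lemma schwartz_continuous: "schwartz f \<Longrightarrow> continuous_on S f"
  by (simp add: continuous_at_imp_continuous_on differentiable_imp_continuous_within schwartz_differentiable)

lemma schwartz_measurable [measurable_dest]: "schwartz f \<Longrightarrow> f \<in> borel_measurable borel"
  by (simp add: borel_measurable_continuous_onI schwartz_continuous)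

lemma schwartz_lincomb:
  fixes f g :: "'a::euclidean_space \<Rightarrow> complex"
  assumes "schwartz f" "schwartz g" shows "schwartz (\<lambda>x. a * f x + b * g x)"
proof -
  define X where "X h \<longleftrightarrow> (\<exists>f g. schwartz f \<and> schwartz g \<and> h = (\<lambda>x. a * f x + b * g x))" for h :: "'a \<Rightarrow> complex"
  have "X (\<lambda>x. a * f x + b * g x)" using assms unfolding X_def by blast
  then show ?thesis
  proof (induct rule: schwartz_coinduct[of X])
    case (diff h x)
    then show ?case unfolding X_def by (auto intro!: differentiable_add differentiable_mult intro: schwartz_differentiable)
  next
    case (decay h N)
    then obtain f g where *: "schwartz f" "schwartz g" "h = (\<lambda>x. a * f x + b * g x)" unfolding X_def by blast
    obtain C where C: "\<And>x. jbracket x ^ N * cmod (f x) \<le> C" using schwartz_decay[OF *(1)] by blast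
    obtain D where D: "\<And>x. jbracket x ^ N * cmod (g x) \<le> D" using schwartz_decay[OF *(2)] by blast
    have "jbracket x ^ N * cmod (h x) \<le> cmod a * C + cmod b * D" for x
    proof -
      have "jbracket x ^ N * cmod (h x) \<le> jbracket x ^ N * (cmod (a * f x) + cmod (b * g x))"
        unfolding * by (intro mult_left_mono norm_triangle_ineq) simp
      also have "\<dots> = cmod a * (jbracket x ^ N * cmod (f x)) + cmod b * (jbracket x ^ N * cmod (g x))"
        by (simp add: norm_mult algebra_simps)
      also have "\<dots> \<le> cmod a * C + cmod b * D" by (intro add_mono mult_left_mono C D) auto
      finally show ?thesis .
    qed
    then show ?case by blast
  next
    case (deriv h c)
    then obtain f g where *: "schwartz f" "schwartz g" "h = (\<lambda>x. a * f x + b * g x)" unfolding X_def by blast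
    have "partial_deriv c h x = a * partial_deriv c f x + b * partial_deriv c g x" for x
      unfolding *(3)
      by (rule partial_deriv_eq[THEN trans],
          (rule derivative_intros schwartz_has_derivative *)+)
        (use deriv in \<open>simp add: inner_Basis if_distrib if_distribR cong: if_cong\<close>)
    then show ?case unfolding X_def using * deriv by (blast intro: schwartz_partial_deriv)
  qed
qed

lemma schwartz_0: "schwartz (\<lambda>x::'a::euclidean_space. 0)"
proof -
  have "foldr partial_deriv bs (\<lambda>x::'a. 0::complex) = (\<lambda>x. 0)" for bs
    by (induction bs) (auto simp: partial_deriv_def)
  then show ?thesis by (auto simp: schwartz_def intro: exI[of _ "0::real"])
qed

lemma schwartz_add: "schwartz f \<Longrightarrow> schwartz g \<Longrightarrow> schwartz (\<lambda>x. f x + g x)"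
  using schwartz_lincomb[of f g 1 1] by simp

lemma schwartz_cmult: "schwartz f \<Longrightarrow> schwartz (\<lambda>x. a * f x)"
  using schwartz_lincomb[of f "\<lambda>x. 0" a 1] by (simp add: schwartz_0)

lemma schwartz_sum: "(\<And>i. i \<in> I \<Longrightarrow> schwartz (f i)) \<Longrightarrow> schwartz (\<lambda>x. \<Sum>i\<in>I. f i x)"
  by (induction I rule: infinite_finite_induct) (auto simp: schwartz_0 intro: schwartz_add)

lemma schwartz_directional:
  "schwartz f \<Longrightarrow> schwartz (\<lambda>x. \<Sum>b\<in>Basis. (v \<bullet> b) *\<^sub>R partial_deriv b f x)"
  unfolding scaleR_conv_of_real by (intro schwartz_sum schwartz_cmult schwartz_partial_deriv)

text \<open>The invariant for \<open>schwartz_mult_linear\<close>: by the product and chain rules a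
  derivative of f(A z) g(B z) is a sum of two such products, with directional derivatives of f and g
  as new factors.\<close>

inductive bilinear_span for A :: "'c::euclidean_space \<Rightarrow> 'a::euclidean_space"
  and B :: "'c \<Rightarrow> 'b::euclidean_space" where
  zero: "bilinear_span A B (\<lambda>z. 0)"
| mult: "schwartz f \<Longrightarrow> schwartz g \<Longrightarrow> bilinear_span A B h \<Longrightarrow>
    bilinear_span A B (\<lambda>z. f (A z) * g (B z) + h z)"

text \<open>The bound with \<open>K\<close> says that A and B together determine z, so the decay of
  the two factors in A z and B z adds up to decay in z. Tensor products, the integrand of the
  short-time Fourier transform and the Wigner kernel are all of this shape.\<close>

lemma schwartz_mult_linear:
  fixes A :: "'c::euclidean_space \<Rightarrow> 'a::euclidean_space" and B :: "'c \<Rightarrow> 'b::euclidean_space"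
  assumes A: "linear A" and B: "linear B"
    and K: "\<And>z. norm z \<le> K * (norm (A z) + norm (B z))"
    and fg: "schwartz f" "schwartz g"
  shows "schwartz (\<lambda>z. f (A z) * g (B z))"
proof -
  have dA: "(A has_derivative A) (at z)" and dB: "(B has_derivative B) (at z)" for z
    using A B by (auto intro: linear_imp_has_derivative)
  have dprod: "((\<lambda>z. f (A z) * g (B z)) has_derivative
     (\<lambda>h. f (A z) * (\<Sum>b\<in>Basis. (B h \<bullet> b) *\<^sub>R partial_deriv b g (B z))
        + (\<Sum>b\<in>Basis. (A h \<bullet> b) *\<^sub>R partial_deriv b f (A z)) * g (B z))) (at z)"
    if "schwartz f" "schwartz g" for f g z
    by (intro has_derivative_mult has_derivative_compose[OF dA] has_derivative_compose[OF dB]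
        schwartz_has_derivative that)
  \<comment> \<open>A constant of at least 1 also covers the summand 1 of the bracket.\<close>
  define K' where "K' = max 1 K"
  have K': "jbracket z \<le> K' * (jbracket (A z) * jbracket (B z))" for z
  proof -
    have "norm z \<le> K' * (norm (A z) + norm (B z))"
      by (rule order_trans[OF K mult_right_mono]) (auto simp: K'_def)
    moreover have "1 \<le> K'" "0 \<le> K' * (norm (A z) * norm (B z))" by (auto simp: K'_def)
    moreover have "K' * ((1 + norm (A z)) * (1 + norm (B z)))
        = K' + K' * (norm (A z) + norm (B z)) + K' * (norm (A z) * norm (B z))"
      by (simp add: algebra_simps)
    ultimately show ?thesis unfolding jbracket_def by linarith
  qed
  have "bilinear_span A B (\<lambda>z. f (A z) * g (B z) + 0)"
    by (intro bilinear_span.intros fg)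
  then have "schwartz (\<lambda>z. f (A z) * g (B z) + 0)"
  proof (induct rule: schwartz_coinduct[of "bilinear_span A B"])
    case (diff h x)
    then show ?case
      by induction (auto intro!: differentiable_add intro: differentiableI[OF dprod])
  next
    case (decay h N)
    then show ?case
    proof induction
      case (mult f g h)
      obtain C where C: "\<And>x. jbracket x ^ N * cmod (f x) \<le> C" "0 \<le> C"
        using schwartz_decay[OF mult(1)] by blast
      obtain D where D: "\<And>x. jbracket x ^ N * cmod (g x) \<le> D" "0 \<le> D"
        using schwartz_decay[OF mult(2)] by blast
      obtain E where E: "\<And>x. jbracket x ^ N * cmod (h x) \<le> E" using mult by blast
      have "jbracket z ^ N * cmod (f (A z) * g (B z) + h z) \<le> K' ^ N * (C * D) + E" for z
      proof -
        have "jbracket z ^ N * cmod (f (A z) * g (B z))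
          \<le> (K' * (jbracket (A z) * jbracket (B z))) ^ N * cmod (f (A z) * g (B z))"
          by (intro mult_right_mono power_mono K') auto
        also have "\<dots> = K' ^ N * ((jbracket (A z) ^ N * cmod (f (A z))) * (jbracket (B z) ^ N * cmod (g (B z))))"
          by (simp add: norm_mult power_mult_distrib)
        also have "\<dots> \<le> K' ^ N * (C * D)"
          by (intro mult_left_mono mult_mono C D) (auto simp: K'_def)
        finally have "jbracket z ^ N * (cmod (f (A z) * g (B z)) + cmod (h z)) \<le> K' ^ N * (C * D) + E"
          using E[of z] by (simp add: algebra_simps)
        then show ?thesis
          by (meson order_trans mult_left_mono norm_triangle_ineq less_imp_le jbracket_power_pos)
      qed
      then show ?case by blast
    qed (auto intro: exI[of _ 0])
  next
    case (deriv h b)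
    have dh: "(h has_derivative frechet_derivative h (at z)) (at z) \<and> True" if "bilinear_span A B h" for h z
      using that by induction (auto simp: frechet_derivative_works[symmetric] intro!: differentiable_add intro: differentiableI[OF dprod])
    from deriv show ?case
    proof induction
      case zero
      have "partial_deriv b (\<lambda>z::'c. 0::complex) = (\<lambda>z. 0)" by (auto simp: partial_deriv_def)
      then show ?case by (simp add: bilinear_span.zero)
    next
      case (mult f g h)
      have "partial_deriv b (\<lambda>z. f (A z) * g (B z) + h z) = (\<lambda>z.
         f (A z) * (\<Sum>c\<in>Basis. (B b \<bullet> c) *\<^sub>R partial_deriv c g (B z))
        + ((\<Sum>c\<in>Basis. (A b \<bullet> c) *\<^sub>R partial_deriv c f (A z)) * g (B z) + partial_deriv b h z))"
      proof
        fix z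
        have "(h has_derivative frechet_derivative h (at z)) (at z)" using dh mult by blast
        from has_derivative_add[OF dprod[OF mult(1,2)] this]
        show "partial_deriv b (\<lambda>z. f (A z) * g (B z) + h z) z =
         f (A z) * (\<Sum>c\<in>Basis. (B b \<bullet> c) *\<^sub>R partial_deriv c g (B z))
        + ((\<Sum>c\<in>Basis. (A b \<bullet> c) *\<^sub>R partial_deriv c f (A z)) * g (B z) + partial_deriv b h z)"
          by (subst partial_deriv_eq) (auto simp: partial_deriv_def algebra_simps)
      qed
      then show ?case
        using bilinear_span.mult[OF mult(1) schwartz_directional[OF mult(2), of "B b"]
          bilinear_span.mult[OF schwartz_directional[OF mult(1), of "A b"] mult(2) mult(4)]] mult(5)
        by (simp add: mult)
    qed
  qed
  then show ?thesis by simp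
qed

lemma schwartz_mult: "schwartz f \<Longrightarrow> schwartz g \<Longrightarrow> schwartz (\<lambda>x. f x * g x)"
  by (rule schwartz_mult_linear[of "\<lambda>x. x" "\<lambda>x. x" 1]) (auto simp: linear_id[unfolded id_def])

lemma schwartz_translate:
  fixes f :: "'a::euclidean_space \<Rightarrow> complex"
  assumes "schwartz f" shows "schwartz (translate y f)"
proof -
  define X where "X h \<longleftrightarrow> (\<exists>f. schwartz f \<and> h = translate y f)" for h :: "'a \<Rightarrow> complex"
  have d: "(translate y f has_derivative (\<lambda>h. \<Sum>b\<in>Basis. (h \<bullet> b) *\<^sub>R partial_deriv b f (x - y))) (at x)"
    if "schwartz f" for f x
    unfolding translate_def
    by (rule has_derivative_compose[of "\<lambda>t. t - y", OF _ schwartz_has_derivative[OF that]])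
      (auto intro!: derivative_eq_intros)
  have "X (translate y f)" using assms unfolding X_def by blast
  then show ?thesis
  proof (induct rule: schwartz_coinduct[of X])
    case (diff h x)
    then show ?case unfolding X_def by (auto intro: differentiableI d)
  next
    case (decay h N)
    then obtain f where *: "schwartz f" "h = translate y f" unfolding X_def by blast
    obtain C where C: "\<And>x. jbracket x ^ N * cmod (f x) \<le> C" using schwartz_decay[OF *(1)] by blast
    have "jbracket x ^ N * cmod (h x) \<le> jbracket y ^ N * C" for x
    proof -
      have "jbracket x ^ N * cmod (h x) \<le> (jbracket y * jbracket (x - y)) ^ N * cmod (h x)"
        using jbracket_add[of y "x - y"] by (intro mult_right_mono power_mono) auto
      also have "\<dots> = jbracket y ^ N * (jbracket (x - y) ^ N * cmod (f (x - y)))"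
        by (simp add: * translate_def power_mult_distrib)
      also have "\<dots> \<le> jbracket y ^ N * C" by (intro mult_left_mono C) auto
      finally show ?thesis .
    qed
    then show ?case by blast
  next
    case (deriv h c)
    then obtain f where *: "schwartz f" "h = translate y f" unfolding X_def by blast
    have "partial_deriv c h = translate y (partial_deriv c f)"
      unfolding *(2) by (rule ext, subst partial_deriv_eq[OF d[OF *(1)]])
        (use deriv in \<open>simp add: translate_def inner_Basis if_distrib if_distribR cong: if_cong\<close>)
    then show ?case unfolding X_def using * deriv by (blast intro: schwartz_partial_deriv)
  qed
qed

lemma schwartz_cnj:
  fixes f :: "'a::euclidean_space \<Rightarrow> complex"
  assumes "schwartz f" shows "schwartz (\<lambda>x. cnj (f x))"
proof -
  define X where "X h \<longleftrightarrow> (\<exists>f. schwartz f \<and> h = (\<lambda>x. cnj (f x)))" for h :: "'a \<Rightarrow> complex"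
  have d: "((\<lambda>x. cnj (f x)) has_derivative (\<lambda>h. cnj (\<Sum>b\<in>Basis. (h \<bullet> b) *\<^sub>R partial_deriv b f x))) (at x)"
    if "schwartz f" for f and x :: 'a
    by (intro bounded_linear.has_derivative[OF bounded_linear_cnj] schwartz_has_derivative that)
  have "X (\<lambda>x. cnj (f x))" using assms unfolding X_def by blast
  then show ?thesis
  proof (induct rule: schwartz_coinduct[of X])
    case (diff h x)
    then show ?case unfolding X_def by (auto intro: differentiableI d)
  next
    case (decay h N)
    then show ?case unfolding X_def by (auto simp: schwartz_decay_ex)
  next
    case (deriv h c)
    then obtain f where *: "schwartz f" "h = (\<lambda>x. cnj (f x))" unfolding X_def by blast
    have "partial_deriv c h = (\<lambda>x. cnj (partial_deriv c f x))"
      unfolding *(2) by (rule ext, subst partial_deriv_eq[OF d[OF *(1)]])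
        (use deriv in \<open>simp add: inner_Basis if_distrib if_distribR cong: if_cong\<close>)
    then show ?case unfolding X_def using * deriv by (blast intro: schwartz_partial_deriv)
  qed
qed

lemma has_derivative_cis_inner:
  "((\<lambda>t. cis (c * (t \<bullet> \<xi>))) has_derivative (\<lambda>h. (\<i> * (c * (h \<bullet> \<xi>))) * cis (c * (t \<bullet> \<xi>)))) (at t)"
proof -
  have "((\<lambda>t. of_real (c * (t \<bullet> \<xi>))) has_derivative (\<lambda>h. complex_of_real (c * (h \<bullet> \<xi>)))) (at t)"
    by (auto intro!: derivative_eq_intros)
  from has_derivative_compose[OF has_derivative_mult_right[OF this, of \<i>]
      DERIV_exp[unfolded has_field_derivative_def]]
  show ?thesis unfolding cis_conv_exp by (simp add: mult.commute)
qed

lemma schwartz_modulate: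
  fixes f :: "'a::euclidean_space \<Rightarrow> complex"
  assumes "schwartz f" shows "schwartz (modulate \<xi> f)"
proof -
  define X where "X h \<longleftrightarrow> (\<exists>f. schwartz f \<and> h = modulate \<xi> f)" for h :: "'a \<Rightarrow> complex"
  have d: "(modulate \<xi> f has_derivative (\<lambda>h. cis (2 * pi * (x \<bullet> \<xi>)) * (\<Sum>b\<in>Basis. (h \<bullet> b) *\<^sub>R partial_deriv b f x)
     + \<i> * (2 * pi * (h \<bullet> \<xi>)) * cis (2 * pi * (x \<bullet> \<xi>)) * f x)) (at x)"
    if "schwartz f" for f x
    unfolding modulate_def
    using has_derivative_mult[OF has_derivative_cis_inner[of "2 * pi" \<xi> x] schwartz_has_derivative[OF that, of x]]
    by simp
  have "X (modulate \<xi> f)" using assms unfolding X_def by blast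
  then show ?thesis
  proof (induct rule: schwartz_coinduct[of X])
    case (diff h x)
    then show ?case unfolding X_def by (auto intro: differentiableI d)
  next
    case (decay h N)
    then show ?case unfolding X_def by (auto simp: modulate_def norm_mult schwartz_decay_ex)
  next
    case (deriv h c)
    then obtain f where *: "schwartz f" "h = modulate \<xi> f" unfolding X_def by blast
    have "partial_deriv c h = modulate \<xi> (\<lambda>x. 1 * partial_deriv c f x + \<i> * (2 * pi * (c \<bullet> \<xi>)) * f x)"
      unfolding *(2) by (rule ext, subst partial_deriv_eq[OF d[OF *(1)]])
        (use deriv in \<open>simp add: modulate_def algebra_simps inner_Basis if_distrib if_distribR cong: if_cong\<close>)
    then show ?case unfolding X_def using * deriv
      by (blast intro: schwartz_partial_deriv schwartz_lincomb)
  qed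
qed

lemma schwartz_mult_coord:
  fixes f :: "'a::euclidean_space \<Rightarrow> complex"
  assumes "schwartz f" "b \<in> Basis" shows "schwartz (\<lambda>x. of_real (x \<bullet> b) * f x)"
proof -
  \<comment> \<open>The summand \<open>g\<close> takes up the term in which the coordinate itself is
    differentiated.\<close>
  define X where "X h \<longleftrightarrow> (\<exists>f g. schwartz f \<and> schwartz g \<and> h = (\<lambda>x. of_real (x \<bullet> b) * f x + g x))" for h :: "'a \<Rightarrow> complex"
  have d: "((\<lambda>x. of_real (x \<bullet> b) * f x + g x) has_derivative (\<lambda>h.
     of_real (x \<bullet> b) * (\<Sum>b\<in>Basis. (h \<bullet> b) *\<^sub>R partial_deriv b f x) + of_real (h \<bullet> b) * f x
     + (\<Sum>b\<in>Basis. (h \<bullet> b) *\<^sub>R partial_deriv b g x))) (at x)"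
    if "schwartz f" "schwartz g" for f g x
    by (auto intro!: derivative_eq_intros schwartz_has_derivative that)
  have "X (\<lambda>x. of_real (x \<bullet> b) * f x + 0)" using assms unfolding X_def by (blast intro: schwartz_0)
  then have "schwartz (\<lambda>x. of_real (x \<bullet> b) * f x + 0)"
  proof (induct rule: schwartz_coinduct[of X])
    case (diff h x)
    then show ?case unfolding X_def by (auto intro: differentiableI d)
  next
    case (decay h N)
    then obtain f g where *: "schwartz f" "schwartz g" "h = (\<lambda>x. of_real (x \<bullet> b) * f x + g x)" unfolding X_def by blast
    obtain C where C: "\<And>x. jbracket x ^ (N+1) * cmod (f x) \<le> C" using schwartz_decay[OF *(1)] by blast
    obtain D where D: "\<And>x. jbracket x ^ N * cmod (g x) \<le> D" using schwartz_decay[OF *(2)] by blast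
    have "jbracket x ^ N * cmod (h x) \<le> C + D" for x
    proof -
      have "\<bar>x \<bullet> b\<bar> \<le> jbracket x" using Basis_le_norm[OF assms(2), of x] by (simp add: jbracket_def)
      then have "cmod (h x) \<le> jbracket x * cmod (f x) + cmod (g x)"
        unfolding * by (intro norm_triangle_le add_right_mono) (simp add: norm_mult mult_right_mono)
      then have "jbracket x ^ N * cmod (h x) \<le> jbracket x ^ N * (jbracket x * cmod (f x) + cmod (g x))"
        by (intro mult_left_mono) auto
      then show ?thesis using C[of x] D[of x] by (simp add: algebra_simps)
    qed
    then show ?case by blast
  next
    case (deriv h c)
    then obtain f g where *: "schwartz f" "schwartz g" "h = (\<lambda>x. of_real (x \<bullet> b) * f x + g x)" unfolding X_def by blast
    have "partial_deriv c h = (\<lambda>x. of_real (x \<bullet> b) * partial_deriv c f x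
       + (of_real (c \<bullet> b) * f x + 1 * partial_deriv c g x))"
      unfolding *(3) by (rule ext, subst partial_deriv_eq[OF d[OF *(1,2)]])
        (use deriv in \<open>simp add: inner_Basis if_distrib if_distribR cong: if_cong\<close>)
    then show ?case unfolding X_def using * deriv
      by (blast intro: schwartz_partial_deriv schwartz_lincomb)
  qed
  then show ?thesis by simp
qed

section \<open>The Gaussian\<close>

definition gauss :: "'a::euclidean_space \<Rightarrow> complex" where
  "gauss x = of_real (exp (- pi * (x \<bullet> x)))"

text \<open>Polynomials times the Gaussian. The family is closed under differentiation because a
  derivative of \<open>gauss\<close> is a multiple of a coordinate times
  \<open>gauss\<close>.\<close>

inductive gauss_span :: "('a::euclidean_space \<Rightarrow> complex) \<Rightarrow> bool" where
  gauss: "gauss_span gauss"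
| lincomb: "gauss_span f \<Longrightarrow> gauss_span g \<Longrightarrow> gauss_span (\<lambda>x. a * f x + b * g x)"
| coord: "gauss_span f \<Longrightarrow> b \<in> Basis \<Longrightarrow> gauss_span (\<lambda>x. of_real (x \<bullet> b) * f x)"

lemma differentiable_coord: "(\<lambda>x. complex_of_real (x \<bullet> b)) differentiable (at x)"
  unfolding differentiable_def by (rule exI) (auto intro!: derivative_eq_intros)

lemma has_derivative_gauss: "(gauss has_derivative (\<lambda>h. of_real (- 2 * pi * (x \<bullet> h)) * gauss x)) (at x)"
  unfolding gauss_def
  by (auto intro!: derivative_eq_intros simp: fun_eq_iff inner_commute algebra_simps)

lemma schwartz_gauss: "schwartz (gauss :: 'a::euclidean_space \<Rightarrow> complex)"
proof -
  have "gauss_span (gauss :: 'a \<Rightarrow> complex)" by (rule gauss_span.gauss)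
  then show ?thesis
proof (induct rule: schwartz_coinduct[of gauss_span])
  case (diff h x)
  then show ?case
    by induction (auto intro!: differentiable_add differentiable_mult differentiable_coord
        intro: differentiableI[OF has_derivative_gauss])
next
  case (decay h N)
  then show ?case
  proof (induction arbitrary: N)
    case gauss
    \<comment> \<open>From (1 + t) ^ N \<le> exp (N t) and N t \<le> N ^ 2 + t ^ 2 / 4 \<le> N ^ 2 +
      \<pi> t ^ 2 with t = norm x.\<close>
    have "jbracket x ^ N * cmod (gauss x) \<le> exp (real N ^ 2)" for x :: 'a
    proof -
      have "jbracket x ^ N \<le> exp (norm x) ^ N" by (intro power_mono) (auto simp: jbracket_def add.commute)
      also have "\<dots> = exp (real N * norm x)" by (simp add: exp_of_nat_mult)
      finally have "jbracket x ^ N * cmod (gauss x) \<le> exp (real N * norm x) * cmod (gauss x)"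
        by (intro mult_right_mono) auto
      also have "\<dots> = exp (real N * norm x - pi * (x \<bullet> x))" by (simp add: gauss_def mult_exp_exp)
      also have "\<dots> \<le> exp (real N ^ 2)"
      proof -
        have "0 \<le> (real N - norm x / 2)^2" by simp
        then have "real N * norm x \<le> real N ^ 2 + (norm x)^2 / 4"
          by (simp add: power2_eq_square algebra_simps)
        moreover have "1 * (norm x)^2 \<le> pi * (norm x)^2" using pi_gt3 by (intro mult_right_mono) auto
        moreover have "0 \<le> (norm x)^2" by simp
        ultimately have "real N * norm x - pi * (norm x)^2 \<le> real N ^ 2" by linarith
        then show ?thesis by (simp add: power2_norm_eq_inner)
      qed
      finally show ?thesis .
    qed
    then show ?case by blast
  next
    case (lincomb f g a b)
    obtain C where C: "\<And>x. jbracket x ^ N * cmod (f x) \<le> C" using lincomb by blast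
    obtain D where D: "\<And>x. jbracket x ^ N * cmod (g x) \<le> D" using lincomb by blast
    have "jbracket x ^ N * cmod (a * f x + b * g x) \<le> cmod a * C + cmod b * D" for x
    proof -
      have "jbracket x ^ N * cmod (a * f x + b * g x) \<le> jbracket x ^ N * (cmod (a * f x) + cmod (b * g x))"
        by (intro mult_left_mono norm_triangle_ineq) simp
      also have "\<dots> = cmod a * (jbracket x ^ N * cmod (f x)) + cmod b * (jbracket x ^ N * cmod (g x))"
        by (simp add: norm_mult algebra_simps)
      also have "\<dots> \<le> cmod a * C + cmod b * D" by (intro add_mono mult_left_mono C D) auto
      finally show ?thesis .
    qed
    then show ?case by blast
  next
    case (coord f b)
    obtain C where C: "\<And>x. jbracket x ^ (N+1) * cmod (f x) \<le> C" using coord by blast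
    have "jbracket x ^ N * cmod (of_real (x \<bullet> b) * f x) \<le> C" for x
    proof -
      have "\<bar>x \<bullet> b\<bar> \<le> jbracket x" using Basis_le_norm[OF coord(2), of x] by (simp add: jbracket_def)
      then have "jbracket x ^ N * (\<bar>x \<bullet> b\<bar> * cmod (f x)) \<le> jbracket x ^ N * (jbracket x * cmod (f x))"
        by (intro mult_left_mono mult_right_mono) auto
      then show ?thesis using C[of x] by (simp add: norm_mult algebra_simps)
    qed
    then show ?case by blast
  qed
next
  case (deriv h b)
  have dh: "f differentiable (at x)" if "gauss_span f" for f and x :: 'a
    using that by induction (auto intro!: differentiable_add differentiable_mult differentiable_coord
        intro: differentiableI[OF has_derivative_gauss])
  from deriv show ?case
  proof induction
    case gauss
    have "partial_deriv b gauss = (\<lambda>x::'a. (- 2 * pi) * (of_real (x \<bullet> b) * gauss x) + 0 * gauss x)"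
      by (rule ext, subst partial_deriv_eq[OF has_derivative_gauss]) simp
    then show ?case using gauss by (simp only:) (intro gauss_span.intros)
  next
    case (lincomb f g a c)
    have "partial_deriv b (\<lambda>x. a * f x + c * g x) = (\<lambda>x. a * partial_deriv b f x + c * partial_deriv b g x)"
      by (rule ext, subst partial_deriv_eq,
          (rule derivative_intros has_derivative_partial_deriv dh lincomb)+)
        (use lincomb in \<open>simp add: inner_Basis if_distrib if_distribR cong: if_cong\<close>)
    then show ?case using lincomb by (auto intro!: gauss_span.lincomb)
  next
    case (coord f c)
    have d: "((\<lambda>x. of_real (x \<bullet> c) * f x) has_derivative (\<lambda>h.
      of_real (x \<bullet> c) * (\<Sum>b\<in>Basis. (h \<bullet> b) *\<^sub>R partial_deriv b f x) + of_real (h \<bullet> c) * f x)) (at x)" for x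
      by (auto intro!: derivative_eq_intros has_derivative_partial_deriv dh coord)
    have "partial_deriv b (\<lambda>x. of_real (x \<bullet> c) * f x)
      = (\<lambda>x. 1 * (of_real (x \<bullet> c) * partial_deriv b f x) + of_real (b \<bullet> c) * f x)"
      by (rule ext, subst partial_deriv_eq[OF d])
        (use coord in \<open>simp add: inner_Basis if_distrib if_distribR cong: if_cong\<close>)
    then show ?case by (simp only:) (intro gauss_span.lincomb gauss_span.coord coord)
  qed
qed
qed

section \<open>Translations, and integrals that depend on a parameter\<close>

lemma lborel_integral_translate:
  fixes f :: "'a::euclidean_space \<Rightarrow> 'b::{banach, second_countable_topology}"
  assumes [measurable]: "f \<in> borel_measurable borel"
  shows "(\<integral>t. f (t + c) \<partial>lborel) = (\<integral>t. f t \<partial>lborel)"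
proof -
  have "(\<integral>t. f t \<partial>lborel) = (\<integral>t. f t \<partial>distr lborel borel ((+) c))" by (simp add: lborel_distr_plus)
  also have "\<dots> = (\<integral>t. f (c + t) \<partial>lborel)" by (rule integral_distr) auto
  finally show ?thesis by (simp add: add.commute)
qed

lemma lborel_integrable_translate:
  fixes f :: "'a::euclidean_space \<Rightarrow> 'b::{banach, second_countable_topology}"
  assumes "integrable lborel f" shows "integrable lborel (\<lambda>t. f (t + c))"
proof -
  have [measurable]: "f \<in> borel_measurable borel" using borel_measurable_integrable[OF assms] by simp
  have "integrable (distr lborel borel ((+) c)) f" using assms by (simp add: lborel_distr_plus)
  then show ?thesis by (subst (asm) integrable_distr_eq) (auto simp: add.commute)
qed

lemma lborel_nn_integral_translate:
  fixes f :: "'a::euclidean_space \<Rightarrow> ennreal"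
  assumes [measurable]: "f \<in> borel_measurable borel"
  shows "(\<integral>\<^sup>+t. f (t + c) \<partial>lborel) = (\<integral>\<^sup>+t. f t \<partial>lborel)"
proof -
  have "(\<integral>\<^sup>+t. f t \<partial>lborel) = (\<integral>\<^sup>+t. f t \<partial>distr lborel borel ((+) c))" by (simp add: lborel_distr_plus)
  also have "\<dots> = (\<integral>\<^sup>+t. f (c + t) \<partial>lborel)" by (rule nn_integral_distr) auto
  finally show ?thesis by (simp add: add.commute)
qed

lemma jbracket_measurable [measurable]: "jbracket \<in> borel_measurable borel"
  unfolding jbracket_def by measurable

lemma ennreal_le_suminf: "f n \<le> (\<Sum>n. f n :: ennreal)"
  using sum_le_suminf[of f "{n}"] by simp

text \<open>The shells \<open>n \<le> norm x < n + 1\<close> contribute at most a constant times \<open>1 / (n + 1)\<^sup>2\<close>.\<close>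

lemma integrable_jbracket:
  "integrable lborel (\<lambda>x::'a::euclidean_space. 1 / jbracket x ^ (DIM('a) + 2))"
proof (rule integrableI_bounded)
  have pw: "1 / c ^ (d + 2) * (V * c ^ d) = V * inverse (c ^ 2)" if "0 < c" for c V :: real and d
    using that by (simp add: power_add divide_inverse power2_eq_square)
  let ?d = "DIM('a)"
  let ?V = "unit_ball_vol (real ?d)"
  let ?g = "\<lambda>n (x::'a). ennreal (1 / (1 + real n) ^ (?d + 2)) * indicator (cball 0 (real (Suc n))) x"
  have "(\<integral>\<^sup>+x. ennreal (norm (1 / jbracket (x::'a) ^ (?d + 2))) \<partial>lborel) \<le> (\<integral>\<^sup>+x. (\<Sum>n. ?g n x) \<partial>lborel)"
  proof (rule nn_integral_mono)
    fix x :: 'a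
    define n where "n = nat \<lfloor>norm x\<rfloor>"
    have n: "real n \<le> norm x" "norm x \<le> real (Suc n)" unfolding n_def using norm_ge_zero[of x] by linarith+
    have "1 / jbracket x ^ (?d + 2) \<le> 1 / (1 + real n) ^ (?d + 2)"
      using n by (intro divide_left_mono power_mono) (auto simp: jbracket_def intro!: mult_pos_pos add_pos_nonneg)
    then have "ennreal (norm (1 / jbracket x ^ (?d + 2))) \<le> ?g n x"
      using n by (auto intro!: ennreal_leI)
    also have "?g n x \<le> (\<Sum>n. ?g n x)" by (rule ennreal_le_suminf)
    finally show "ennreal (norm (1 / jbracket x ^ (?d + 2))) \<le> (\<Sum>n. ?g n x)" .
  qed
  also have "\<dots> = (\<Sum>n. \<integral>\<^sup>+x. ?g n x \<partial>lborel)" by (rule nn_integral_suminf) (intro borel_measurable_times_ennreal borel_measurable_const borel_measurable_indicator, simp)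
  also have "\<dots> = (\<Sum>n. ennreal (?V * inverse (real (Suc n) ^ 2)))"
  proof (rule suminf_cong)
    fix n
    have "(\<integral>\<^sup>+x. ?g n x \<partial>lborel) = ennreal (1 / (1 + real n) ^ (?d + 2)) * emeasure lborel (cball (0::'a) (real (Suc n)))"
      by (rule nn_integral_cmult_indicator) simp
    also have "\<dots> = ennreal (1 / (1 + real n) ^ (?d + 2) * (?V * real (Suc n) ^ ?d))"
      by (subst emeasure_cball, simp) (rule ennreal_mult[symmetric], auto)
    also have "1 / (1 + real n) ^ (?d + 2) * (?V * real (Suc n) ^ ?d) = ?V * inverse (real (Suc n) ^ 2)"
      using pw[of "1 + real n" ?d ?V] by (simp add: add.commute)
    finally show "(\<integral>\<^sup>+x. ?g n x \<partial>lborel) = ennreal (?V * inverse (real (Suc n) ^ 2))" .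
  qed
  also have "\<dots> < \<infinity>"
  proof -
    have "summable (\<lambda>n. inverse (real (Suc n) ^ 2))"
      using inverse_power_summable[of 2, where 'a = real] by (subst summable_Suc_iff) auto
    then have "summable (\<lambda>n. ?V * inverse (real (Suc n) ^ 2))" by (rule summable_mult)
    then show ?thesis by (subst suminf_ennreal2) auto
  qed
  finally show "(\<integral>\<^sup>+x. ennreal (norm (1 / jbracket (x::'a) ^ (?d + 2))) \<partial>lborel) < \<infinity>" .
qed measurable

lemma integrable_jbracket_bound:
  fixes f :: "'a::euclidean_space \<Rightarrow> 'b::{banach, second_countable_topology}"
  assumes [measurable]: "f \<in> borel_measurable borel"
    and "\<And>x. norm (f x) \<le> C / jbracket x ^ (DIM('a) + 2)"
  shows "integrable lborel f"
proof (rule Bochner_Integration.integrable_bound)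
  show "integrable lborel (\<lambda>x::'a. C * (1 / jbracket x ^ (DIM('a) + 2)))"
    by (intro integrable_mult_right integrable_jbracket)
  show "AE x in lborel. norm (f x) \<le> norm (C * (1 / jbracket x ^ (DIM('a) + 2)))"
    by (rule AE_I2, rule order_trans[OF assms(2)]) (simp add: divide_right_mono)
qed simp

lemma schwartz_bound:
  fixes f :: "'a::euclidean_space \<Rightarrow> complex"
  assumes "schwartz f"
  obtains C where "0 \<le> C" "\<And>x. cmod (f x) \<le> C / jbracket x ^ N"
proof -
  obtain C where "0 \<le> C" "\<And>x. jbracket x ^ N * cmod (f x) \<le> C" using schwartz_decay[OF assms] by blast
  then show thesis by (intro that[of C]) (auto simp: pos_le_divide_eq mult.commute)
qed

lemma schwartz_integrable:
  fixes f :: "'a::euclidean_space \<Rightarrow> complex"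
  assumes "schwartz f" shows "integrable lborel f"
proof -
  obtain C where "\<And>x. cmod (f x) \<le> C / jbracket x ^ (DIM('a) + 2)" using schwartz_bound[OF assms] by blast
  then show ?thesis using assms by (intro integrable_jbracket_bound) auto
qed

text \<open>Dominated convergence along an arbitrary null sequence of increments. The mean value
  inequality bounds the difference K (z + h) t - K z t by \<open>w t * norm h\<close>, and the
  derivative satisfies the same bound, so \<open>2 * w\<close> dominates the remainder
  quotients.\<close>

lemma has_derivative_lborel_integral:
  fixes K :: "'z::euclidean_space \<Rightarrow> 'b::euclidean_space \<Rightarrow> complex"
  assumes d: "\<And>z t. ((\<lambda>z. K z t) has_derivative K' z t) (at z)"
    and bound: "\<And>z t h. norm (K' z t h) \<le> w t * norm h"
    and w: "integrable lborel w"
    and int: "\<And>z. integrable lborel (K z)"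
    and meas: "\<And>z h. (\<lambda>t. K' z t h) \<in> borel_measurable borel"
  shows "((\<lambda>z. \<integral>t. K z t \<partial>lborel) has_derivative (\<lambda>h. \<integral>t. K' z t h \<partial>lborel)) (at z)"
  unfolding has_derivative_at
proof
  have w0: "0 \<le> w t" for t
  proof -
    have "norm (K' 0 t (SOME b. b \<in> Basis)) \<le> w t * norm (SOME b::'z. b \<in> Basis)" by (rule bound)
    then show ?thesis by (metis norm_ge_zero norm_Basis SOME_Basis mult.right_neutral order_trans)
  qed
  have lin: "bounded_linear (K' z t)" for z t using d by (rule has_derivative_bounded_linear)
  have intK': "integrable lborel (\<lambda>t. K' z t h)" for h
    by (rule Bochner_Integration.integrable_bound[OF integrable_mult_left[OF w, of "norm h"]])
      (use meas bound w0 in auto)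
  show "bounded_linear (\<lambda>h. \<integral>t. K' z t h \<partial>lborel)"
  proof (rule bounded_linear_intro[where K = "\<integral>t. w t \<partial>lborel"])
    fix h k r
    show "(\<integral>t. K' z t (h + k) \<partial>lborel) = (\<integral>t. K' z t h \<partial>lborel) + (\<integral>t. K' z t k \<partial>lborel)"
      using intK' by (subst Bochner_Integration.integral_add[symmetric])
        (auto simp: linear_add bounded_linear.linear[OF lin])
    show "(\<integral>t. K' z t (r *\<^sub>R h) \<partial>lborel) = r *\<^sub>R (\<integral>t. K' z t h \<partial>lborel)"
      by (subst integral_scaleR_right[symmetric]) (auto simp: linear_scale bounded_linear.linear[OF lin] intK')
    have "norm (\<integral>t. K' z t h \<partial>lborel) \<le> (\<integral>t. w t * norm h \<partial>lborel)"
      using integral_norm_bound[of lborel "\<lambda>t. K' z t h"]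
      by (rule order_trans) (intro integral_mono integrable_norm integrable_mult_left intK' w bound)
    then show "norm (\<integral>t. K' z t h \<partial>lborel) \<le> norm h * (\<integral>t. w t \<partial>lborel)" by (simp add: mult.commute)
  qed
  have mvt: "norm (K (z + h) t - K z t) \<le> w t * norm h" for h t
    using differentiable_bound[of UNIV "\<lambda>z. K z t" "\<lambda>z. K' z t" "w t" "z + h" z] d
      onorm_le[of "K' _ t" "w t"] bound by simp
  let ?r = "\<lambda>h t. (K (z + h) t - K z t - K' z t h) /\<^sub>R norm h"
  show "(\<lambda>h. norm ((\<integral>t. K (z + h) t \<partial>lborel) - (\<integral>t. K z t \<partial>lborel) - (\<integral>t. K' z t h \<partial>lborel)) / norm h) \<midarrow>0\<rightarrow> 0"
    unfolding LIMSEQ_SEQ_conv[symmetric]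
  proof (intro allI impI, elim conjE)
    fix S :: "nat \<Rightarrow> 'z" assume S: "\<forall>n. S n \<noteq> 0" "S \<longlonglongrightarrow> 0"
    have "(\<lambda>n. \<integral>t. ?r (S n) t \<partial>lborel) \<longlonglongrightarrow> (\<integral>t. 0 \<partial>(lborel :: 'b measure))"
    proof (rule integral_dominated_convergence[where w = "\<lambda>t. 2 * w t" and f = "\<lambda>_. 0"
          and s = "\<lambda>n t. ?r (S n) t"])
      show "AE t in lborel. (\<lambda>n. ?r (S n) t) \<longlonglongrightarrow> 0"
      proof (rule AE_I2)
        fix t
        have "(\<lambda>h. norm (K (z + h) t - K z t - K' z t h) / norm h) \<midarrow>0\<rightarrow> 0"
          using d[where z=z and t=t] unfolding has_derivative_at by blast
        then have "(\<lambda>n. norm (K (z + S n) t - K z t - K' z t (S n)) / norm (S n)) \<longlonglongrightarrow> 0"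
          using S unfolding LIMSEQ_SEQ_conv[symmetric] by blast
        then have "(\<lambda>n. norm (?r (S n) t)) \<longlonglongrightarrow> 0" by (simp add: divide_inverse mult.commute)
        then show "(\<lambda>n. ?r (S n) t) \<longlonglongrightarrow> 0" by (rule tendsto_norm_zero_cancel)
      qed
      show "AE t in lborel. norm (?r (S n) t) \<le> 2 * w t" for n
      proof (rule AE_I2)
        fix t
        have "norm (K (z + S n) t - K z t - K' z t (S n)) \<le> w t * norm (S n) + w t * norm (S n)"
          by (rule order_trans[OF norm_triangle_ineq4 add_mono[OF mvt bound]])
        also have "\<dots> = 2 * w t * norm (S n)" by simp
        finally have "norm (K (z + S n) t - K z t - K' z t (S n)) / norm (S n) \<le> 2 * w t"
          using S(1)[rule_format, of n] by (subst pos_divide_le_eq) auto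
        then show "norm (?r (S n) t) \<le> 2 * w t" by (simp add: divide_inverse mult.commute)
      qed
      show "(\<lambda>t. ?r (S n) t) \<in> borel_measurable lborel" for n
        using int[THEN borel_measurable_integrable] meas by simp
    qed (use w in auto)
    from tendsto_norm[OF this]
    show "(\<lambda>n. norm ((\<integral>t. K (z + S n) t \<partial>lborel) - (\<integral>t. K z t \<partial>lborel) - (\<integral>t. K' z t (S n) \<partial>lborel)) / norm (S n)) \<longlonglongrightarrow> 0"
      using int intK' by (simp add: divide_inverse mult.commute)
  qed
qed

text \<open>By translation invariance the difference quotients of h along v have integral 0, and
  they converge dominatedly to the derivative. This is integration by parts without boundary
  terms.\<close>

lemma integral_directional_derivative:
  fixes h :: "'b::euclidean_space \<Rightarrow> complex"
  assumes d: "\<And>t. (h has_derivative h' t) (at t)" and v: "norm v = 1"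
    and bh: "\<And>t. cmod (h t) \<le> C / jbracket t ^ (DIM('b) + 2)"
    and bh': "\<And>t. cmod (h' t v) \<le> C / jbracket t ^ (DIM('b) + 2)"
    and meas [measurable]: "(\<lambda>t. h' t v) \<in> borel_measurable borel"
  shows "(\<integral>t. h' t v \<partial>lborel) = 0"
proof -
  let ?N = "DIM('b) + 2"
  have C: "0 \<le> C" using order_trans[OF norm_ge_zero bh[of 0]] by (simp add: jbracket_def)
  have hm [measurable]: "h \<in> borel_measurable borel"
    using d by (intro borel_measurable_continuous_onI continuous_at_imp_continuous_on)
      (auto intro: has_derivative_continuous)
  have hi: "integrable lborel h" by (rule integrable_jbracket_bound[OF hm bh])
  define s where "s n = 1 / real (Suc n)" for n
  have s: "0 < s n" "s n \<le> 1" for n by (auto simp: s_def)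
  have s0: "s \<longlonglongrightarrow> 0" unfolding s_def using LIMSEQ_inverse_real_of_nat by (simp add: divide_inverse)
  have bnd: "cmod (h (t + s n *\<^sub>R v) - h t) \<le> C * 2 ^ ?N / jbracket t ^ ?N * s n" for n t
  proof -
    have der: "((\<lambda>r. h (t + r *\<^sub>R v)) has_derivative (\<lambda>r. r *\<^sub>R h' (t + x *\<^sub>R v) v)) (at x within {0..1})" for x
    proof -
      interpret bounded_linear "h' (t + x *\<^sub>R v)" using d by (rule has_derivative_bounded_linear)
      have "((\<lambda>r. t + r *\<^sub>R v) has_derivative (\<lambda>r. r *\<^sub>R v)) (at x within {0..1})"
        by (auto intro!: derivative_eq_intros)
      from has_derivative_compose[OF this d] show ?thesis by (simp add: scaleR)
    qed
    \<comment> \<open>Along the segment the point moves by at most 1, which changes the bracket by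
      at most a factor 2; hence the 2 ^ ?N.\<close>
    have on: "onorm (\<lambda>r. r *\<^sub>R h' (t + x *\<^sub>R v) v) \<le> C * 2 ^ ?N / jbracket t ^ ?N" if "x \<in> {0..1}" for x
    proof (rule onorm_le)
      fix r :: real
      have "jbracket t \<le> jbracket (t + x *\<^sub>R v) * jbracket (- (x *\<^sub>R v))"
        using jbracket_add[of "t + x *\<^sub>R v" "- (x *\<^sub>R v)"] by simp
      also have "\<dots> \<le> jbracket (t + x *\<^sub>R v) * 2"
        using that v by (intro mult_left_mono) (auto simp: jbracket_def)
      finally have "jbracket t ^ ?N \<le> (jbracket (t + x *\<^sub>R v) * 2) ^ ?N" by (intro power_mono) auto
      then have "1 / jbracket (t + x *\<^sub>R v) ^ ?N \<le> 2 ^ ?N / jbracket t ^ ?N"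
        by (simp add: field_simps power_mult_distrib)
      from mult_left_mono[OF this C] bh'[of "t + x *\<^sub>R v"]
      have "cmod (h' (t + x *\<^sub>R v) v) \<le> C * 2 ^ ?N / jbracket t ^ ?N" by simp
      from mult_right_mono[OF this abs_ge_zero[of r]]
      show "norm (r *\<^sub>R h' (t + x *\<^sub>R v) v) \<le> C * 2 ^ ?N / jbracket t ^ ?N * norm r" by (simp add: mult.commute)
    qed
    have "norm (h (t + s n *\<^sub>R v) - h (t + 0 *\<^sub>R v)) \<le> C * 2 ^ ?N / jbracket t ^ ?N * norm (s n - 0)"
      by (rule differentiable_bound[OF _ der on]) (use s[of n] in auto)
    then show ?thesis using s[of n] by simp
  qed
  have "(\<lambda>n. \<integral>t. (h (t + s n *\<^sub>R v) - h t) /\<^sub>R s n \<partial>lborel) \<longlonglongrightarrow> (\<integral>t. h' t v \<partial>lborel)"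
  proof (rule integral_dominated_convergence[where w = "\<lambda>t. C * 2 ^ ?N * (1 / jbracket t ^ ?N)"])
    show "integrable lborel (\<lambda>t::'b. C * 2 ^ ?N * (1 / jbracket t ^ ?N))"
      by (intro integrable_mult_right integrable_jbracket)
    show "AE t in lborel. norm ((h (t + s n *\<^sub>R v) - h t) /\<^sub>R s n) \<le> C * 2 ^ ?N * (1 / jbracket t ^ ?N)" for n
    proof (rule AE_I2)
      fix t
      have "norm ((h (t + s n *\<^sub>R v) - h t) /\<^sub>R s n) = cmod (h (t + s n *\<^sub>R v) - h t) / s n"
        using s(1)[of n] by (simp add: divide_inverse mult.commute)
      also have "\<dots> \<le> C * 2 ^ ?N / jbracket t ^ ?N"
        using bnd[of t n] s(1)[of n] by (simp only: pos_divide_le_eq)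
      finally show "norm ((h (t + s n *\<^sub>R v) - h t) /\<^sub>R s n) \<le> C * 2 ^ ?N * (1 / jbracket t ^ ?N)" by simp
    qed
    show "AE t in lborel. (\<lambda>n. (h (t + s n *\<^sub>R v) - h t) /\<^sub>R s n) \<longlonglongrightarrow> h' t v"
    proof (rule AE_I2)
      fix t
      interpret bounded_linear "h' t" using d by (rule has_derivative_bounded_linear)
      have "(\<lambda>k. norm (h (t + k) - h t - h' t k) / norm k) \<midarrow>0\<rightarrow> 0"
        using d[of t] unfolding has_derivative_at by blast
      moreover have "\<forall>n. s n *\<^sub>R v \<noteq> 0"
        using s(1) v by (metis norm_zero scaleR_eq_0_iff zero_neq_one less_irrefl)
      moreover have "(\<lambda>n. s n *\<^sub>R v) \<longlonglongrightarrow> 0" using tendsto_scaleR[OF s0 tendsto_const[of v]] by simp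
      ultimately have "(\<lambda>n. norm (h (t + s n *\<^sub>R v) - h t - h' t (s n *\<^sub>R v)) / norm (s n *\<^sub>R v)) \<longlonglongrightarrow> 0"
        unfolding LIMSEQ_SEQ_conv[symmetric] by (auto dest: spec[of _ "\<lambda>n. s n *\<^sub>R v"])
      moreover have "norm (h (t + s n *\<^sub>R v) - h t - h' t (s n *\<^sub>R v)) / norm (s n *\<^sub>R v)
        = norm ((h (t + s n *\<^sub>R v) - h t) /\<^sub>R s n - h' t v)" for n
      proof -
        have "(h (t + s n *\<^sub>R v) - h t) /\<^sub>R s n - h' t v = (h (t + s n *\<^sub>R v) - h t - h' t (s n *\<^sub>R v)) /\<^sub>R s n"
          using s(1)[of n] by (simp add: scaleR scaleR_diff_right)
        then show ?thesis using s(1)[of n] v by (simp add: divide_inverse mult.commute)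
      qed
      ultimately have "(\<lambda>n. (h (t + s n *\<^sub>R v) - h t) /\<^sub>R s n - h' t v) \<longlonglongrightarrow> 0"
        by (simp add: tendsto_norm_zero_iff)
      then show "(\<lambda>n. (h (t + s n *\<^sub>R v) - h t) /\<^sub>R s n) \<longlonglongrightarrow> h' t v" by (rule LIM_zero_cancel)
    qed
  qed measurable
  moreover have "(\<integral>t. (h (t + s n *\<^sub>R v) - h t) /\<^sub>R s n \<partial>lborel) = 0" for n
  proof -
    have "integrable lborel (\<lambda>t. h (s n *\<^sub>R v + t))"
      using lborel_integrable_translate[OF hi, of "s n *\<^sub>R v"] by (simp add: add.commute)
    then have "integrable lborel (\<lambda>t. h (t + s n *\<^sub>R v))" by (simp add: add.commute)
    then show ?thesis using hi lborel_integral_translate[OF hm, of "s n *\<^sub>R v"] by simp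
  qed
  ultimately have "(\<lambda>n. 0) \<longlonglongrightarrow> (\<integral>t. h' t v \<partial>lborel)" by (simp only:)
  then show ?thesis by (simp add: LIMSEQ_const_iff)
qed

section \<open>Fourier transform\<close>

text \<open>Only the second variable is transformed. The short-time Fourier transform and the Wigner
  distribution are both of this form, so one proof of Schwartz regularity serves both.\<close>

definition partial_fourier :: "('a::euclidean_space \<times> 'b::euclidean_space \<Rightarrow> complex) \<Rightarrow> 'a \<times> 'b \<Rightarrow> complex" where
  "partial_fourier H = (\<lambda>(x, \<xi>). \<integral>t. H (x, t) * cis (- 2 * pi * (\<xi> \<bullet> t)) \<partial>lborel)"

lemma cmod_directional_le:
  fixes f :: "'a::euclidean_space \<Rightarrow> complex"
  assumes "\<And>b. b \<in> Basis \<Longrightarrow> cmod (partial_deriv b f x) \<le> C"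
  shows "cmod (\<Sum>b\<in>Basis. (h \<bullet> b) *\<^sub>R partial_deriv b f x) \<le> real DIM('a) * C * norm h"
proof -
  have "cmod (\<Sum>b\<in>Basis. (h \<bullet> b) *\<^sub>R partial_deriv b f x) \<le> (\<Sum>b\<in>(Basis::'a set). norm h * C)"
  proof (rule sum_norm_le)
    fix b :: 'a assume b: "b \<in> Basis"
    have "\<bar>h \<bullet> b\<bar> * cmod (partial_deriv b f x) \<le> norm h * C"
      by (intro mult_mono Basis_le_norm assms b) auto
    then show "cmod ((h \<bullet> b) *\<^sub>R partial_deriv b f x) \<le> norm h * C" by simp
  qed
  then show ?thesis by (simp add: algebra_simps)
qed

lemma schwartz_deriv_bound:
  fixes f :: "'a::euclidean_space \<Rightarrow> complex"
  assumes "schwartz f"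
  obtains C where "0 \<le> C" "\<And>x. cmod (f x) \<le> C / jbracket x ^ N"
    "\<And>x b. b \<in> Basis \<Longrightarrow> cmod (partial_deriv b f x) \<le> C / jbracket x ^ N"
proof -
  obtain C0 where C0: "0 \<le> C0" "\<And>x. cmod (f x) \<le> C0 / jbracket x ^ N"
    using schwartz_bound[OF assms] by blast
  have "\<exists>C. \<forall>b\<in>(Basis::'a set). 0 \<le> C b \<and> (\<forall>x. cmod (partial_deriv b f x) \<le> C b / jbracket x ^ N)"
    by (rule bchoice) (metis schwartz_bound[OF schwartz_partial_deriv[OF assms]])
  then obtain C where C: "\<And>b. b \<in> Basis \<Longrightarrow> 0 \<le> C b"
    "\<And>b x. b \<in> (Basis::'a set) \<Longrightarrow> cmod (partial_deriv b f x) \<le> C b / jbracket x ^ N" by blast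
  define D where "D = C0 + (\<Sum>b\<in>Basis. C b)"
  have "C0 \<le> D" "\<And>b. b \<in> Basis \<Longrightarrow> C b \<le> D"
    using C0 C(1) by (auto simp: D_def sum_nonneg intro!: add_increasing member_le_sum)
  then have "C0 / jbracket x ^ N \<le> D / jbracket x ^ N" "b \<in> Basis \<Longrightarrow> C b / jbracket x ^ N \<le> D / jbracket x ^ N"
    for x :: 'a and b by (auto intro!: divide_right_mono)
  then show thesis using C0 C(2) \<open>C0 \<le> D\<close>
    by (intro that[of D]) (blast intro: order_trans)+
qed

lemma jbracket_pair_divide:
  assumes "0 \<le> C" shows "C / jbracket (x, t) ^ (M + N) \<le> C / jbracket x ^ M / jbracket t ^ N"
proof -
  have "jbracket x ^ M * jbracket t ^ N \<le> jbracket (x, t) ^ M * jbracket (x, t) ^ N"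
    by (intro mult_mono power_mono jbracket_Pair) auto
  then have "C / jbracket (x, t) ^ (M + N) \<le> C / (jbracket x ^ M * jbracket t ^ N)"
    by (intro divide_left_mono assms) (auto simp: power_add)
  then show ?thesis by simp
qed

lemma divide_jbracket_antimono:
  assumes "0 \<le> C" "N \<le> M" shows "C / jbracket x ^ M \<le> C / jbracket x ^ N"
  by (intro divide_left_mono power_increasing assms) auto

lemma divide_jbracket_le: "0 \<le> C \<Longrightarrow> C / jbracket x ^ M \<le> C"
  using divide_jbracket_antimono[of C 0 M x] by simp

lemma schwartz_partial_fourier_diff_bound:
  fixes H :: "'a::euclidean_space \<times> 'b::euclidean_space \<Rightarrow> complex"
  assumes H: "schwartz H"
  shows "(partial_fourier H has_derivative (\<lambda>(u, v). \<integral>t. ((\<Sum>b\<in>Basis. ((u, 0) \<bullet> b) *\<^sub>R partial_deriv b H (fst z, t))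
      + \<i> * (- 2 * pi * (v \<bullet> t)) * H (fst z, t)) * cis (- 2 * pi * (snd z \<bullet> t)) \<partial>lborel)) (at z)"
proof -
  let ?N = "DIM('b) + 2"
  \<comment> \<open>One power more than integrability in t requires: it pays for the factor t that
    differentiating the exponential produces.\<close>
  obtain C where C: "0 \<le> C" "\<And>z. cmod (H z) \<le> C / jbracket z ^ (?N + 1)"
    "\<And>z b. b \<in> Basis \<Longrightarrow> cmod (partial_deriv b H z) \<le> C / jbracket z ^ (?N + 1)"
    using schwartz_deriv_bound[OF H] by blast
  have Hc: "continuous_on S H" for S by (rule schwartz_continuous[OF H])
  have pc: "continuous_on S (partial_deriv b H)" if "b \<in> Basis" for S b
    by (rule schwartz_continuous[OF schwartz_partial_deriv[OF H that]])
  define K where "K z t = H (fst z, t) * cis (- 2 * pi * (snd z \<bullet> t))" for z t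
  define K' where "K' z t h = ((\<Sum>b\<in>Basis. ((fst h, 0) \<bullet> b) *\<^sub>R partial_deriv b H (fst z, t))
      + \<i> * (- 2 * pi * (snd h \<bullet> t)) * H (fst z, t)) * cis (- 2 * pi * (snd z \<bullet> t))"
    for z h :: "'a \<times> 'b" and t :: 'b
  define w where "w t = (real DIM('a \<times> 'b) * C + 2 * pi * C) * (1 / jbracket t ^ ?N)" for t :: 'b
  have b1: "C / jbracket (x, t) ^ (?N + 1) \<le> C / jbracket t ^ ?N" for x :: 'a and t :: 'b
    using jbracket_pair_divide[OF C(1), of x t 1 ?N] divide_jbracket_le[of C x 1] C(1)
    by (intro order_trans[OF _ divide_right_mono[of "C / jbracket x ^ 1" C]]) (auto simp: add.commute)
  have b2: "norm t * (C / jbracket (x, t) ^ (?N + 1)) \<le> C / jbracket t ^ ?N" for x :: 'a and t :: 'b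
  proof -
    have "norm t * (C / jbracket (x, t) ^ (?N + 1)) \<le> jbracket t * (C / jbracket t ^ (?N + 1))"
      using jbracket_pair_divide[OF C(1), of x t 0 "?N + 1"] C(1)
      by (intro mult_mono) (auto simp: jbracket_def)
    also have "\<dots> = C / jbracket t ^ ?N" by simp
    finally show ?thesis .
  qed
  have "((\<lambda>z. \<integral>t. K z t \<partial>lborel) has_derivative (\<lambda>h. \<integral>t. K' z t h \<partial>lborel)) (at z)"
  proof (rule has_derivative_lborel_integral[where w = w])
    fix z :: "'a \<times> 'b" and t :: 'b
    have "((\<lambda>z. (fst z, t)) has_derivative (\<lambda>h. (fst h, 0))) (at z)"
      by (auto intro!: derivative_eq_intros)
    from has_derivative_compose[OF this schwartz_has_derivative[OF H, of "(fst z, t)"]]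
    have 1: "((\<lambda>z. H (fst z, t)) has_derivative
      (\<lambda>h. \<Sum>b\<in>Basis. ((fst h, 0) \<bullet> b) *\<^sub>R partial_deriv b H (fst z, t))) (at z)" .
    have "(snd has_derivative snd) (at z)"
      by (auto intro!: derivative_eq_intros)
    from has_derivative_compose[OF this has_derivative_cis_inner[of "- 2 * pi" t "snd z"]]
    have 2: "((\<lambda>z. cis (- 2 * pi * (snd z \<bullet> t))) has_derivative
      (\<lambda>h. \<i> * (- 2 * pi * (snd h \<bullet> t)) * cis (- 2 * pi * (snd z \<bullet> t)))) (at z)" by simp
    show "((\<lambda>z. K z t) has_derivative K' z t) (at z)"
      unfolding K_def K'_def
      by (rule has_derivative_eq_rhs[OF has_derivative_mult[OF 1 2]]) (simp add: fun_eq_iff algebra_simps)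
  next
    fix z h :: "'a \<times> 'b" and t :: 'b
    have "cmod (\<Sum>b\<in>Basis. ((fst h, 0) \<bullet> b) *\<^sub>R partial_deriv b H (fst z, t))
      \<le> real DIM('a \<times> 'b) * (C / jbracket t ^ ?N) * norm (fst h, 0::'b)"
      by (rule cmod_directional_le) (use C(3) b1 in \<open>blast intro: order_trans\<close>)
    also have "\<dots> \<le> real DIM('a \<times> 'b) * (C / jbracket t ^ ?N) * norm h"
      using C(1) norm_fst_le[of "fst h" "snd h"] by (intro mult_left_mono) (auto simp: norm_Pair)
    finally have 1: "cmod (\<Sum>b\<in>Basis. ((fst h, 0) \<bullet> b) *\<^sub>R partial_deriv b H (fst z, t))
      \<le> real DIM('a \<times> 'b) * C * (1 / jbracket t ^ ?N) * norm h" by simp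
    have ip: "\<bar>snd h \<bullet> t\<bar> \<le> norm h * norm t"
      by (rule order_trans[OF Cauchy_Schwarz_ineq2 mult_right_mono])
        (use norm_snd_le[of "snd h" "fst h"] in auto)
    have "cmod (\<i> * (- 2 * pi * (snd h \<bullet> t)) * H (fst z, t)) = 2 * pi * (\<bar>snd h \<bullet> t\<bar> * cmod (H (fst z, t)))"
      by (simp add: norm_mult)
    also have "\<dots> \<le> 2 * pi * ((norm h * norm t) * (C / jbracket (fst z, t) ^ (?N + 1)))"
      by (intro mult_left_mono mult_mono ip C(2)) auto
    also have "\<dots> = 2 * pi * norm h * (norm t * (C / jbracket (fst z, t) ^ (?N + 1)))" by simp
    also have "\<dots> \<le> 2 * pi * norm h * (C / jbracket t ^ ?N)"
      by (intro mult_left_mono b2) auto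
    also have "\<dots> = 2 * pi * C * (1 / jbracket t ^ ?N) * norm h" by (simp add: field_simps)
    finally have 2: "cmod (\<i> * (- 2 * pi * (snd h \<bullet> t)) * H (fst z, t)) \<le> 2 * pi * C * (1 / jbracket t ^ ?N) * norm h" .
    have "cmod (K' z t h) \<le> real DIM('a \<times> 'b) * C * (1 / jbracket t ^ ?N) * norm h + 2 * pi * C * (1 / jbracket t ^ ?N) * norm h"
      unfolding K'_def norm_mult norm_cis mult_1_right by (rule norm_triangle_mono[OF 1 2])
    also have "\<dots> = w t * norm h" unfolding w_def distrib_right ..
    finally show "norm (K' z t h) \<le> w t * norm h" .
  next
    show "integrable lborel w" unfolding w_def by (intro integrable_mult_right integrable_jbracket)
    fix z :: "'a \<times> 'b"
    show "integrable lborel (K z)"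
    proof (rule integrable_jbracket_bound)
      show "K z \<in> borel_measurable borel" unfolding K_def cis_conv_exp
        by (intro borel_measurable_continuous_onI continuous_intros continuous_on_compose2[OF Hc]) auto
      show "norm (K z t) \<le> C / jbracket t ^ ?N" for t
        using C(2)[of "(fst z, t)"] b1 by (auto simp: K_def norm_mult intro: order_trans)
    qed
    show "(\<lambda>t. K' z t h) \<in> borel_measurable borel" for h unfolding K'_def cis_conv_exp
      by (intro borel_measurable_continuous_onI continuous_intros continuous_on_compose2[OF Hc]
          continuous_on_compose2[OF pc]) auto
  qed
  then show ?thesis unfolding K_def K'_def partial_fourier_def by (simp add: case_prod_beta')
qed

lemma schwartz_section_integrable:
  fixes H :: "'a::euclidean_space \<times> 'b::euclidean_space \<Rightarrow> complex"
  assumes H: "schwartz H" shows "integrable lborel (\<lambda>t. H (x, t) * cis (c * (\<xi> \<bullet> t)))"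
proof -
  obtain C where C: "0 \<le> C" "\<And>z. cmod (H z) \<le> C / jbracket z ^ (0 + (DIM('b) + 2))"
    using schwartz_bound[OF H] by blast
  show ?thesis
  proof (rule integrable_jbracket_bound)
    show "(\<lambda>t. H (x, t) * cis (c * (\<xi> \<bullet> t))) \<in> borel_measurable borel" unfolding cis_conv_exp
      by (intro borel_measurable_continuous_onI continuous_intros
          continuous_on_compose2[OF schwartz_continuous[OF H]]) auto
    show "norm (H (x, t) * cis (c * (\<xi> \<bullet> t))) \<le> C / jbracket t ^ (DIM('b) + 2)" for t
      using C(2)[of "(x,t)"] jbracket_pair_divide[OF C(1), of x t 0 "DIM('b) + 2"]
      by (simp add: norm_mult)
  qed
qed

text \<open>Integration by parts: the derivative of H(x, t) times the exponential in direction b has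
  integral 0.\<close>

lemma partial_fourier_partial_deriv_snd:
  fixes H :: "'a::euclidean_space \<times> 'b::euclidean_space \<Rightarrow> complex"
  assumes H: "schwartz H" and b: "b \<in> Basis"
  shows "partial_fourier (partial_deriv (0, b) H) (x, \<xi>) = 2 * pi * \<i> * (\<xi> \<bullet> b) * partial_fourier H (x, \<xi>)"
proof -
  let ?N = "DIM('b) + 2"
  obtain C where C: "0 \<le> C" "\<And>z. cmod (H z) \<le> C / jbracket z ^ (0 + ?N)"
    "\<And>z b. b \<in> Basis \<Longrightarrow> cmod (partial_deriv b H z) \<le> C / jbracket z ^ (0 + ?N)"
    using schwartz_deriv_bound[OF H] by blast
  have b': "(0, b) \<in> (Basis :: ('a \<times> 'b) set)" using b by (auto simp: Basis_prod_def)
  have pH: "schwartz (partial_deriv (0, b) H)" by (rule schwartz_partial_deriv[OF H b'])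
  define h' where "h' t v = (\<Sum>c\<in>Basis. ((0, v) \<bullet> c) *\<^sub>R partial_deriv c H (x, t)) * cis (- 2 * pi * (t \<bullet> \<xi>))
     + H (x, t) * (\<i> * (- 2 * pi * (v \<bullet> \<xi>)) * cis (- 2 * pi * (t \<bullet> \<xi>)))" for t v
  have h'b: "h' t b = partial_deriv (0, b) H (x, t) * cis (- 2 * pi * (\<xi> \<bullet> t))
    + (- 2 * pi * \<i> * (\<xi> \<bullet> b)) * (H (x, t) * cis (- 2 * pi * (\<xi> \<bullet> t)))" for t
  proof -
    have "(\<Sum>c\<in>Basis. ((0, b) \<bullet> c) *\<^sub>R partial_deriv c H (x, t)) = partial_deriv (0, b) H (x, t)"
      using b' by (simp add: inner_Basis if_distrib if_distribR cong: if_cong)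
    then show ?thesis unfolding h'_def by (simp add: inner_commute algebra_simps)
  qed
  have i1: "integrable lborel (\<lambda>t. partial_deriv (0, b) H (x, t) * cis (- 2 * pi * (\<xi> \<bullet> t)))"
    and i2: "integrable lborel (\<lambda>t. H (x, t) * cis (- 2 * pi * (\<xi> \<bullet> t)))"
    using schwartz_section_integrable[OF pH] schwartz_section_integrable[OF H] by blast+
  define D where "D = C + 2 * pi * \<bar>\<xi> \<bullet> b\<bar> * C"
  have CD: "C \<le> D" using C(1) by (simp add: D_def)
  have bd: "C / jbracket (x, t) ^ (0 + ?N) \<le> C / jbracket t ^ ?N" for t
    using jbracket_pair_divide[OF C(1), of x t 0 ?N] by simp
  have "0 = (\<integral>t. h' t b \<partial>lborel)"
  proof (rule sym)
    show "(\<integral>t. h' t b \<partial>lborel) = 0"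
  proof (rule integral_directional_derivative)
    fix t :: 'b
    have "((\<lambda>t. (x, t)) has_derivative (\<lambda>v. (0, v))) (at t)" by (auto intro!: derivative_eq_intros)
    from has_derivative_mult[OF has_derivative_compose[OF this schwartz_has_derivative[OF H, of "(x, t)"]]
        has_derivative_cis_inner[of "- 2 * pi" \<xi> t]]
    show "((\<lambda>t. H (x, t) * cis (- 2 * pi * (t \<bullet> \<xi>))) has_derivative h' t) (at t)"
      unfolding h'_def by (rule has_derivative_eq_rhs) (simp add: fun_eq_iff algebra_simps)
    show "cmod (H (x, t) * cis (- 2 * pi * (t \<bullet> \<xi>))) \<le> D / jbracket t ^ ?N"
      using order_trans[OF C(2) bd, of t] divide_right_mono[OF CD, of "jbracket t ^ ?N"]
      by (simp add: norm_mult)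
    have "cmod (h' t b) \<le> C / jbracket t ^ ?N + 2 * pi * \<bar>\<xi> \<bullet> b\<bar> * (C / jbracket t ^ ?N)"
      unfolding h'b
    proof (rule norm_triangle_mono)
      show "cmod (partial_deriv (0, b) H (x, t) * cis (- 2 * pi * (\<xi> \<bullet> t))) \<le> C / jbracket t ^ ?N"
        using order_trans[OF C(3)[OF b'] bd, of t] by (simp add: norm_mult)
      have "cmod ((- 2 * pi * \<i> * (\<xi> \<bullet> b)) * (H (x, t) * cis (- 2 * pi * (\<xi> \<bullet> t))))
        = 2 * pi * \<bar>\<xi> \<bullet> b\<bar> * cmod (H (x, t))" by (simp add: norm_mult)
      also have "\<dots> \<le> 2 * pi * \<bar>\<xi> \<bullet> b\<bar> * (C / jbracket t ^ ?N)"
        by (intro mult_left_mono order_trans[OF C(2) bd]) auto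
      finally show "cmod ((- 2 * pi * \<i> * (\<xi> \<bullet> b)) * (H (x, t) * cis (- 2 * pi * (\<xi> \<bullet> t)))) \<le> \<dots>" .
    qed
    also have "\<dots> = D / jbracket t ^ ?N" by (simp add: D_def add_divide_distrib)
    finally show "cmod (h' t b) \<le> D / jbracket t ^ ?N" .
  next
    show "(\<lambda>t. h' t b) \<in> borel_measurable borel"
      using borel_measurable_integrable[OF i1] borel_measurable_integrable[OF i2] unfolding h'b by simp
  qed (use b in simp)
  qed
  also have "(\<integral>t. h' t b \<partial>lborel) = partial_fourier (partial_deriv (0, b) H) (x, \<xi>) + (- 2 * pi * \<i> * (\<xi> \<bullet> b)) * partial_fourier H (x, \<xi>)"
    unfolding h'b partial_fourier_def prod.case
    by (subst Bochner_Integration.integral_add[OF i1 integrable_mult_right[OF i2]])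
      (simp only: integral_mult_right_zero)
  finally show ?thesis by simp
qed

text \<open>Each further power of the bracket of \<xi> is traded for one derivative of H in t, since
  the norm of \<xi> is at most the sum of the absolute values of its coordinates and each coordinate
  times the transform is, up to 2 \<pi>, the transform of a derivative.\<close>

lemma schwartz_partial_fourier_decay:
  fixes H :: "'a::euclidean_space \<times> 'b::euclidean_space \<Rightarrow> complex"
  assumes "schwartz H"
  shows "\<exists>C. \<forall>x \<xi>. jbracket x ^ M * jbracket \<xi> ^ N * cmod (partial_fourier H (x, \<xi>)) \<le> C"
  using assms
proof (induction N arbitrary: H)
  case 0
  let ?N = "DIM('b) + 2"
  obtain C where C: "0 \<le> C" "\<And>z. cmod (H z) \<le> C / jbracket z ^ (M + ?N)"
    using schwartz_bound[OF 0] by blast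
  have "jbracket x ^ M * jbracket \<xi> ^ 0 * cmod (partial_fourier H (x, \<xi>)) \<le> (\<integral>t. C * (1 / jbracket t ^ ?N) \<partial>(lborel :: 'b measure))" for x \<xi>
  proof -
    have "cmod (partial_fourier H (x, \<xi>)) \<le> (\<integral>t. norm (H (x, t) * cis (- 2 * pi * (\<xi> \<bullet> t))) \<partial>lborel)"
      unfolding partial_fourier_def by simp
    also have "\<dots> \<le> (\<integral>t. C / jbracket x ^ M * (1 / jbracket t ^ ?N) \<partial>(lborel :: 'b measure))"
    proof (rule integral_mono)
      show "integrable lborel (\<lambda>t. norm (H (x, t) * cis (- 2 * pi * (\<xi> \<bullet> t))))"
        by (intro integrable_norm schwartz_section_integrable 0)
      show "integrable lborel (\<lambda>t::'b. C / jbracket x ^ M * (1 / jbracket t ^ ?N))"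
        by (intro integrable_mult_right integrable_jbracket)
      show "norm (H (x, t) * cis (- 2 * pi * (\<xi> \<bullet> t))) \<le> C / jbracket x ^ M * (1 / jbracket t ^ ?N)" for t
        using order_trans[OF C(2) jbracket_pair_divide[OF C(1)], of x t] by (simp add: norm_mult)
    qed
    also have "\<dots> = (\<integral>t. C * (1 / jbracket t ^ ?N) \<partial>(lborel :: 'b measure)) / jbracket x ^ M"
      by (simp only: integral_mult_right_zero) simp
    finally show ?thesis by (simp add: field_simps)
  qed
  then show ?case by blast
next
  case (Suc N)
  have b': "(0, b) \<in> (Basis :: ('a \<times> 'b) set)" if "b \<in> Basis" for b using that by (auto simp: Basis_prod_def)
  obtain C where C: "\<And>x \<xi>. jbracket x ^ M * jbracket \<xi> ^ N * cmod (partial_fourier H (x, \<xi>)) \<le> C"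
    using Suc by blast
  have "\<exists>D. \<forall>b\<in>(Basis::'b set). \<forall>x \<xi>. jbracket x ^ M * jbracket \<xi> ^ N * cmod (partial_fourier (partial_deriv (0, b) H) (x, \<xi>)) \<le> D b"
    by (intro bchoice ballI Suc.IH schwartz_partial_deriv b' Suc.prems)
  then obtain D where D: "\<And>b x \<xi>. b \<in> Basis \<Longrightarrow> jbracket x ^ M * jbracket \<xi> ^ N * cmod (partial_fourier (partial_deriv (0, b) H) (x, \<xi>)) \<le> D b"
    by blast
  have "jbracket x ^ M * jbracket \<xi> ^ Suc N * cmod (partial_fourier H (x, \<xi>)) \<le> C + (\<Sum>b\<in>Basis. D b)" for x \<xi>
  proof -
    let ?J = "jbracket x ^ M * jbracket \<xi> ^ N" and ?F = "cmod (partial_fourier H (x, \<xi>))"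
    have J: "0 \<le> ?J" by simp
    have "jbracket \<xi> * ?F \<le> ?F + (\<Sum>b\<in>Basis. \<bar>\<xi> \<bullet> b\<bar>) * ?F"
      using mult_right_mono[OF norm_le_l1[of \<xi>], of ?F] by (simp add: jbracket_def algebra_simps)
    also have "\<dots> \<le> ?F + (\<Sum>b\<in>Basis. cmod (partial_fourier (partial_deriv (0, b) H) (x, \<xi>)))"
      unfolding sum_distrib_right
    proof (intro add_left_mono sum_mono)
      fix b :: 'b assume b: "b \<in> Basis"
      have "1 * (\<bar>\<xi> \<bullet> b\<bar> * ?F) \<le> 2 * pi * (\<bar>\<xi> \<bullet> b\<bar> * ?F)"
        using pi_gt3 by (intro mult_right_mono) auto
      also have "\<dots> = cmod (partial_fourier (partial_deriv (0, b) H) (x, \<xi>))"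
        unfolding partial_fourier_partial_deriv_snd[OF Suc.prems b] by (simp add: norm_mult)
      finally show "\<bar>\<xi> \<bullet> b\<bar> * ?F \<le> cmod (partial_fourier (partial_deriv (0, b) H) (x, \<xi>))" by simp
    qed
    finally have "?J * (jbracket \<xi> * ?F) \<le> ?J * (?F + (\<Sum>b\<in>Basis. cmod (partial_fourier (partial_deriv (0, b) H) (x, \<xi>))))"
      using J by (rule mult_left_mono)
    also have "\<dots> = ?J * ?F + (\<Sum>b\<in>Basis. ?J * cmod (partial_fourier (partial_deriv (0, b) H) (x, \<xi>)))"
      by (simp add: algebra_simps sum_distrib_left)
    also have "\<dots> \<le> C + (\<Sum>b\<in>Basis. D b)" by (intro add_mono C sum_mono D)
    finally show ?thesis by (simp add: algebra_simps)
  qed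
  then show ?case by blast
qed

text \<open>The partial Fourier transforms of Schwartz functions form a family closed under
  differentiation: derivatives in the first variable pass to H, those in the second multiply H by a
  coordinate.\<close>

lemma schwartz_partial_fourier:
  fixes H :: "'a::euclidean_space \<times> 'b::euclidean_space \<Rightarrow> complex"
  assumes "schwartz H" shows "schwartz (partial_fourier H)"
proof -
  define X where "X F \<longleftrightarrow> (\<exists>H. schwartz H \<and> F = partial_fourier H)" for F :: "'a \<times> 'b \<Rightarrow> complex"
  have "X (partial_fourier H)" using assms unfolding X_def by blast
  then show ?thesis
  proof (induct rule: schwartz_coinduct[of X])
    case (diff F z)
    then show ?case unfolding X_def by (auto intro: differentiableI schwartz_partial_fourier_diff_bound)
  next
    case (decay F N)
    then obtain H where *: "schwartz H" "F = partial_fourier H" unfolding X_def by blast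
    obtain C where C: "\<And>x \<xi>. jbracket x ^ N * jbracket \<xi> ^ N * cmod (partial_fourier H (x, \<xi>)) \<le> C"
      using schwartz_partial_fourier_decay[OF *(1)] by blast
    have "jbracket z ^ N * cmod (F z) \<le> C" for z
    proof (cases z)
      case (Pair x \<xi>)
      have "jbracket z ^ N * cmod (F z) \<le> (jbracket x * jbracket \<xi>) ^ N * cmod (F z)"
        unfolding Pair by (intro mult_right_mono power_mono jbracket_Pair) auto
      then show ?thesis using C[of x \<xi>] unfolding Pair * by (simp add: power_mult_distrib)
    qed
    then show ?case by blast
  next
    case (deriv F c)
    then obtain H where *: "schwartz H" "F = partial_fourier H" unfolding X_def by blast
    from deriv(2) consider b where "c = (b, 0)" "b \<in> Basis" | b where "c = (0, b)" "b \<in> Basis"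
      by (auto simp: Basis_prod_def)
    then show ?case
    proof cases
      case 1
      have "partial_deriv c F = partial_fourier (partial_deriv c H)"
      proof
        fix z :: "'a \<times> 'b"
        have "(\<Sum>b'\<in>Basis. ((b, 0) \<bullet> b') *\<^sub>R partial_deriv b' H (fst z, t)) = partial_deriv c H (fst z, t)" for t
          using deriv(2) unfolding 1 by (simp add: inner_Basis if_distrib if_distribR cong: if_cong)
        then show "partial_deriv c F z = partial_fourier (partial_deriv c H) z"
          unfolding *(2) using partial_deriv_eq[OF schwartz_partial_fourier_diff_bound[OF *(1)], of c z]
          by (simp add: 1 partial_fourier_def case_prod_beta')
      qed
      then show ?thesis unfolding X_def using * deriv by (blast intro: schwartz_partial_deriv)
    next
      case 2
      have "partial_deriv c F = partial_fourier (\<lambda>z. (- 2 * pi * \<i>) * ((z \<bullet> (0, b)) * H z))"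
      proof
        fix z :: "'a \<times> 'b"
        show "partial_deriv c F z = partial_fourier (\<lambda>z. (- 2 * pi * \<i>) * ((z \<bullet> (0, b)) * H z)) z"
          unfolding *(2) using partial_deriv_eq[OF schwartz_partial_fourier_diff_bound[OF *(1)], of c z]
          by (simp add: 2 partial_fourier_def case_prod_beta' zero_prod_def[symmetric] inner_commute algebra_simps)
      qed
      moreover have "schwartz (\<lambda>z. (- 2 * pi * \<i>) * ((z \<bullet> (0, b)) * H z))"
        using deriv(2) unfolding 2 by (intro schwartz_cmult schwartz_mult_coord *)
      ultimately show ?thesis unfolding X_def by blast
    qed
  qed
qed

section \<open>Fubini, the transform of the Gaussian, and inversion\<close>

lemma lborel_Fubini:
  fixes F :: "'a::euclidean_space \<Rightarrow> 'b::euclidean_space \<Rightarrow> complex"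
  assumes c: "continuous_on UNIV (\<lambda>(x, y). F x y)"
    and b: "\<And>x y. cmod (F x y) \<le> f x * g y"
    and f: "integrable lborel f" and g: "integrable lborel g"
  shows "(\<integral>y. (\<integral>x. F x y \<partial>lborel) \<partial>lborel) = (\<integral>x. (\<integral>y. F x y \<partial>lborel) \<partial>lborel)"
proof (rule lborel_pair.Fubini_integral)
  have Fm [measurable]: "(\<lambda>(x, y). F x y) \<in> borel_measurable (borel \<Otimes>\<^sub>M borel)"
    unfolding borel_prod by (rule borel_measurable_continuous_onI[OF c])
  have i: "integrable lborel (\<lambda>y. F x y)" for x
  proof (rule Bochner_Integration.integrable_bound)
    show "integrable lborel (\<lambda>y. f x * g y)" using g by simp
    show "AE y in lborel. cmod (F x y) \<le> norm (f x * g y)"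
      by (rule AE_I2, rule order_trans[OF b]) simp
  qed measurable
  show "integrable (lborel \<Otimes>\<^sub>M lborel) (\<lambda>(x, y). F x y)"
  proof (rule lborel_pair.Fubini_integrable)
    show "integrable lborel (\<lambda>x. \<integral>y. norm (case (x, y) of (x, y) \<Rightarrow> F x y) \<partial>lborel)"
    proof (rule Bochner_Integration.integrable_bound)
      show "integrable lborel (\<lambda>x. f x * (\<integral>y. g y \<partial>lborel))" using f by simp
      show "AE x in lborel. norm (\<integral>y. norm (case (x, y) of (x, y) \<Rightarrow> F x y) \<partial>lborel) \<le> norm (f x * (\<integral>y. g y \<partial>lborel))"
      proof (rule AE_I2)
        fix x
        have "(\<integral>y. cmod (F x y) \<partial>lborel) \<le> (\<integral>y. f x * g y \<partial>lborel)"
          by (intro integral_mono integrable_norm i b integrable_mult_right g)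
        then show "norm (\<integral>y. norm (case (x, y) of (x, y) \<Rightarrow> F x y) \<partial>lborel) \<le> norm (f x * (\<integral>y. g y \<partial>lborel))"
          by (simp add: abs_of_nonneg[OF Bochner_Integration.integral_nonneg])
      qed
    qed measurable
  qed (use i in auto)
qed

lemma lborel_integral_affine:
  fixes f :: "'a::euclidean_space \<Rightarrow> 'b::{banach, second_countable_topology}"
  assumes [measurable]: "f \<in> borel_measurable borel" and "c \<noteq> 0"
  shows "(\<integral>x. f x \<partial>lborel) = \<bar>c\<bar> ^ DIM('a) *\<^sub>R (\<integral>x. f (t + c *\<^sub>R x) \<partial>lborel)"
proof -
  have "(\<integral>x. f x \<partial>lborel) = (\<integral>x. f x \<partial>density (distr lborel borel (\<lambda>x. t + c *\<^sub>R x)) (\<lambda>_. ennreal (\<bar>c\<bar> ^ DIM('a))))"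
    using lborel_affine[OF assms(2), of t] by simp
  also have "\<dots> = (\<integral>x. \<bar>c\<bar> ^ DIM('a) *\<^sub>R f x \<partial>distr lborel borel (\<lambda>x. t + c *\<^sub>R x))"
    by (rule integral_density) auto
  also have "\<dots> = (\<integral>x. \<bar>c\<bar> ^ DIM('a) *\<^sub>R f (t + c *\<^sub>R x) \<partial>lborel)"
    by (rule integral_distr) auto
  finally show ?thesis by simp
qed

lemma lborel_integral_reflect:
  fixes f :: "'a::euclidean_space \<Rightarrow> 'b::{banach, second_countable_topology}"
  assumes "f \<in> borel_measurable borel"
  shows "(\<integral>x. f (t - x) \<partial>lborel) = (\<integral>x. f x \<partial>lborel)"
  using lborel_integral_affine[OF assms, of "-1" t] by simp

lemma integral_lborel_prod:
  fixes f :: "'a::euclidean_space \<Rightarrow> real \<Rightarrow> complex"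
  assumes int: "\<And>b. b \<in> Basis \<Longrightarrow> integrable lborel (f b)"
  shows "(\<integral>x. (\<Prod>b\<in>Basis. f b (x \<bullet> b)) \<partial>(lborel :: 'a measure)) = (\<Prod>b\<in>Basis. \<integral>x. f b x \<partial>lborel)"
proof -
  interpret product_sigma_finite "\<lambda>_::'a. lborel :: real measure" by standard
  have [measurable]: "f b \<in> borel_measurable borel" if "b \<in> Basis" for b
    using borel_measurable_integrable[OF int[OF that]] by simp
  have "(\<integral>x. (\<Prod>b\<in>Basis. f b (x \<bullet> b)) \<partial>(lborel :: 'a measure))
    = (\<integral>x. (\<Prod>b\<in>Basis. f b ((\<Sum>b\<in>Basis. x b *\<^sub>R b) \<bullet> b)) \<partial>(\<Pi>\<^sub>M b\<in>(Basis::'a set). lborel))"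
    by (subst lborel_eq, rule integral_distr) measurable
  also have "\<dots> = (\<integral>x. (\<Prod>b\<in>Basis. f b (x b)) \<partial>(\<Pi>\<^sub>M b\<in>(Basis::'a set). lborel))"
    by (intro Bochner_Integration.integral_cong prod.cong refl)
      (simp add: inner_sum_left inner_Basis if_distrib cong: if_cong)
  also have "\<dots> = (\<Prod>b\<in>Basis. \<integral>x. f b x \<partial>lborel)"
    by (rule product_integral_prod) (use int in auto)
  finally show ?thesis .
qed

text \<open>The characteristic function of the standard normal distribution at
  -\<open>sqrt (2 * pi)\<close> y, after the substitution that rescales the variable by
  \<open>sqrt (2 * pi)\<close>.\<close>

lemma fourier_gauss_real:
  "integrable lborel (\<lambda>x::real. of_real (exp (- pi * x\<^sup>2)) * cis (- 2 * pi * (x * y)))" (is ?I)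
  "(\<integral>x. of_real (exp (- pi * x\<^sup>2)) * cis (- 2 * pi * (x * y)) \<partial>lborel) = of_real (exp (- pi * y\<^sup>2))" (is ?E)
proof -
  define c where "c = sqrt (2 * pi)"
  have c: "0 < c" "c * c = 2 * pi" by (auto simp: c_def)
  define t where "t = - c * y"
  let ?f = "\<lambda>x. std_normal_density x *\<^sub>R iexp (t * x)"
  have fi: "integrable lborel ?f"
    by (rule Bochner_Integration.integrable_bound[OF integrable_std_normal_moment[of 0]]) auto
  have *: "?f (0 + c * x) = (1 / c) * (of_real (exp (- pi * x\<^sup>2)) * cis (- 2 * pi * (x * y)))" for x
  proof -
    have "(c * x)\<^sup>2 / 2 = pi * x\<^sup>2" "t * (c * x) = - 2 * pi * (x * y)"
      using c(2) by (simp_all add: power2_eq_square t_def algebra_simps)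
    then show ?thesis
      by (simp add: std_normal_density_def c_def cis_conv_exp scaleR_conv_of_real)
  qed
  have "integrable lborel (\<lambda>x. ?f (0 + c * x))"
    by (rule lborel_integrable_real_affine[OF fi]) (use c in simp)
  then have "integrable lborel (\<lambda>x. of_real c * ?f (0 + c * x))" by (rule integrable_mult_right)
  moreover have "of_real c * ?f (0 + c * x) = of_real (exp (- pi * x\<^sup>2)) * cis (- 2 * pi * (x * y))" for x
    by (subst *) (use c in simp)
  ultimately show ?I by (simp only:)
  have "char std_normal_distribution t = (\<integral>x. ?f x \<partial>lborel)"
    unfolding char_def by (rule integral_density) auto
  also have "\<dots> = \<bar>c\<bar> *\<^sub>R (\<integral>x. ?f (0 + c * x) \<partial>lborel)"
    by (rule lborel_integral_real_affine) (use c in simp)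
  also have "\<dots> = c *\<^sub>R (\<integral>x. (1 / c) * (of_real (exp (- pi * x\<^sup>2)) * cis (- 2 * pi * (x * y))) \<partial>lborel)"
    unfolding * using c by simp
  also have "\<dots> = (\<integral>x. of_real (exp (- pi * x\<^sup>2)) * cis (- 2 * pi * (x * y)) \<partial>lborel)"
    unfolding integral_mult_right_zero using c by (simp add: scaleR_conv_of_real)
  finally have "complex_of_real (exp (- t\<^sup>2 / 2)) = (\<integral>x. of_real (exp (- pi * x\<^sup>2)) * cis (- 2 * pi * (x * y)) \<partial>lborel)"
    by (simp add: char_std_normal_distribution)
  moreover have "- t\<^sup>2 / 2 = - pi * y\<^sup>2"
    using c(2) by (simp add: t_def power_mult_distrib power2_eq_square[of c])
  ultimately show ?E by (simp only:)
qed

definition fourier :: "('a::euclidean_space \<Rightarrow> complex) \<Rightarrow> 'a \<Rightarrow> complex" where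
  "fourier h \<xi> = (\<integral>t. h t * cis (- 2 * pi * (\<xi> \<bullet> t)) \<partial>lborel)"

text \<open>The factor \<pi> in the exponent of \<open>gauss\<close> is chosen for this
  self-duality, which also gives total integral 1. Both the kernel and the exponential factor over
  the coordinates.\<close>

lemma fourier_gauss: "fourier gauss \<xi> = gauss (\<xi> :: 'a::euclidean_space)"
proof -
  have e: "gauss t * cis (- 2 * pi * (\<xi> \<bullet> t))
    = (\<Prod>b\<in>Basis. of_real (exp (- pi * (t \<bullet> b)\<^sup>2)) * cis (- 2 * pi * ((t \<bullet> b) * (\<xi> \<bullet> b))))" for t
  proof -
    have "gauss t = (\<Prod>b\<in>Basis. of_real (exp (- pi * (t \<bullet> b)\<^sup>2)))"
      by (simp add: gauss_def euclidean_inner[of t t] power2_eq_square sum_distrib_left exp_sum flip: of_real_prod)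
    moreover have "cis (- 2 * pi * (\<xi> \<bullet> t)) = (\<Prod>b\<in>Basis. cis (- 2 * pi * ((t \<bullet> b) * (\<xi> \<bullet> b))))"
      by (simp add: euclidean_inner[of \<xi> t] cis_conv_exp exp_sum[symmetric] sum_distrib_left sum_negf mult.commute)
    ultimately show ?thesis by (simp add: prod.distrib)
  qed
  have "fourier gauss \<xi> = (\<Prod>b\<in>Basis. of_real (exp (- pi * (\<xi> \<bullet> b)\<^sup>2)))"
    unfolding fourier_def e
    using integral_lborel_prod[of "\<lambda>b x. of_real (exp (- pi * x\<^sup>2)) * cis (- 2 * pi * (x * (\<xi> \<bullet> b)))"]
      fourier_gauss_real by simp
  also have "\<dots> = gauss \<xi>"
    by (simp add: gauss_def euclidean_inner[of \<xi> \<xi>] power2_eq_square sum_distrib_left exp_sum flip: of_real_prod)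
  finally show ?thesis .
qed

lemma integral_gauss: "(\<integral>x. gauss (x :: 'a::euclidean_space) \<partial>lborel) = 1"
  using fourier_gauss[of "0::'a"] by (simp add: fourier_def gauss_def)

lemma fourier_gauss_scaled:
  fixes u :: "'a::euclidean_space"
  assumes "0 < e"
  shows "(\<integral>\<xi>. gauss (e *\<^sub>R \<xi>) * cis (- 2 * pi * (u \<bullet> \<xi>)) \<partial>lborel)
    = gauss (u /\<^sub>R e) / of_real (e ^ DIM('a))"
proof -
  have m: "(\<lambda>t. gauss t * cis (- 2 * pi * ((u /\<^sub>R e) \<bullet> t))) \<in> borel_measurable borel"
    unfolding cis_conv_exp
    by (intro borel_measurable_continuous_onI continuous_intros schwartz_continuous schwartz_gauss)
  have "gauss (u /\<^sub>R e) = (\<integral>t. gauss t * cis (- 2 * pi * ((u /\<^sub>R e) \<bullet> t)) \<partial>lborel)"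
    using fourier_gauss[of "u /\<^sub>R e"] by (simp add: fourier_def)
  also have "\<dots> = \<bar>e\<bar> ^ DIM('a) *\<^sub>R (\<integral>t. gauss (0 + e *\<^sub>R t) * cis (- 2 * pi * ((u /\<^sub>R e) \<bullet> (0 + e *\<^sub>R t))) \<partial>lborel)"
    by (rule lborel_integral_affine[OF m]) (use assms in simp)
  finally have "gauss (u /\<^sub>R e) = \<bar>e\<bar> ^ DIM('a) *\<^sub>R (\<integral>t. gauss (0 + e *\<^sub>R t) * cis (- 2 * pi * ((u /\<^sub>R e) \<bullet> (0 + e *\<^sub>R t))) \<partial>lborel)" .
  moreover have "(u /\<^sub>R e) \<bullet> (0 + e *\<^sub>R t) = u \<bullet> t" for t
    using assms by (simp add: mult.assoc[symmetric])
  ultimately show ?thesis using assms by (simp only: add_0) (simp add: scaleR_conv_of_real)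
qed

text \<open>A factor \<open>gauss (e n *\<^sub>R \<xi>)\<close> is inserted, which makes Fubini
  applicable. The transform of that factor is a Gaussian approximate identity, so the integral
  becomes the mean of h(x + e v) against \<open>gauss v\<close>. As e tends to 0 both sides converge
  dominatedly, on the left by integrability of the transform, on the right by boundedness and
  continuity of h.\<close>

lemma fourier_inversion:
  fixes h :: "'a::euclidean_space \<Rightarrow> complex"
  assumes h: "integrable lborel h" "continuous_on UNIV h" "\<And>x. cmod (h x) \<le> B"
    and hh: "integrable lborel (fourier h)"
  shows "(\<integral>\<xi>. fourier h \<xi> * cis (2 * pi * (\<xi> \<bullet> x)) \<partial>lborel) = h x"
proof -
  define e where "e n = 1 / real (Suc n)" for n
  have e: "0 < e n" for n by (simp add: e_def)
  have e0: "e \<longlonglongrightarrow> 0" unfolding e_def using LIMSEQ_inverse_real_of_nat by (simp add: divide_inverse)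
  have gc: "continuous_on S (gauss :: 'a \<Rightarrow> complex)" for S by (intro schwartz_continuous schwartz_gauss)
  have gi: "integrable lborel (gauss :: 'a \<Rightarrow> complex)" by (intro schwartz_integrable schwartz_gauss)
  have g1: "cmod (gauss y) \<le> 1" for y :: 'a by (simp add: gauss_def)
  have [measurable]: "h \<in> borel_measurable borel" "gauss \<in> borel_measurable (borel :: 'a measure)"
    "fourier h \<in> borel_measurable borel"
    using h(2) gc hh[THEN borel_measurable_integrable] by (auto intro: borel_measurable_continuous_onI)
  have eq: "(\<integral>\<xi>. fourier h \<xi> * cis (2 * pi * (\<xi> \<bullet> x)) * gauss (e n *\<^sub>R \<xi>) \<partial>lborel)
     = (\<integral>v. h (x + e n *\<^sub>R v) * gauss v \<partial>lborel)" for n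
  proof -
    have gie: "integrable lborel (\<lambda>\<xi>::'a. gauss (e n *\<^sub>R \<xi>))"
    proof -
      have "integrable (distr lborel borel (\<lambda>x. 0 + e n *\<^sub>R x)) (gauss :: 'a \<Rightarrow> complex)"
      proof -
        have "integrable (density (distr lborel borel (\<lambda>x. 0 + e n *\<^sub>R x)) (\<lambda>_. ennreal (\<bar>e n\<bar>^DIM('a)))) (gauss :: 'a \<Rightarrow> complex)"
          using gi lborel_affine[of "e n" "0::'a"] e[of n] by simp
        then have "integrable (distr lborel borel (\<lambda>x. 0 + e n *\<^sub>R x)) (\<lambda>x. (\<bar>e n\<bar>^DIM('a)) *\<^sub>R (gauss (x::'a)))"
          by (subst (asm) integrable_density) auto
        from integrable_scaleR_right[OF this, of "1 / \<bar>e n\<bar>^DIM('a)"]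
        show ?thesis using e[of n] by simp
      qed
      then show ?thesis by (subst (asm) integrable_distr_eq) auto
    qed
    have "(\<integral>\<xi>. fourier h \<xi> * cis (2 * pi * (\<xi> \<bullet> x)) * gauss (e n *\<^sub>R \<xi>) \<partial>lborel)
      = (\<integral>\<xi>. (\<integral>s. h s * cis (- 2 * pi * ((s - x) \<bullet> \<xi>)) * gauss (e n *\<^sub>R \<xi>) \<partial>lborel) \<partial>lborel)"
    proof (intro Bochner_Integration.integral_cong refl)
      fix \<xi>
      have "fourier h \<xi> * cis (2 * pi * (\<xi> \<bullet> x)) * gauss (e n *\<^sub>R \<xi>)
        = (\<integral>s. h s * cis (- 2 * pi * (\<xi> \<bullet> s)) * (cis (2 * pi * (\<xi> \<bullet> x)) * gauss (e n *\<^sub>R \<xi>)) \<partial>lborel)"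
        unfolding fourier_def by (simp only: integral_mult_left_zero) (rule mult.assoc)
      also have "\<dots> = (\<integral>s. h s * cis (- 2 * pi * ((s - x) \<bullet> \<xi>)) * gauss (e n *\<^sub>R \<xi>) \<partial>lborel)"
        by (intro Bochner_Integration.integral_cong refl)
          (simp add: cis_mult[symmetric] inner_diff_left algebra_simps inner_commute[of \<xi>] cis_mult)
      finally show "fourier h \<xi> * cis (2 * pi * (\<xi> \<bullet> x)) * gauss (e n *\<^sub>R \<xi>) = \<dots>" .
    qed
    also have "\<dots> = (\<integral>s. (\<integral>\<xi>. h s * cis (- 2 * pi * ((s - x) \<bullet> \<xi>)) * gauss (e n *\<^sub>R \<xi>) \<partial>lborel) \<partial>lborel)"
    proof (rule lborel_Fubini[where f = "\<lambda>s. cmod (h s)" and g = "\<lambda>\<xi>. cmod (gauss (e n *\<^sub>R \<xi>))"])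
      show "continuous_on UNIV (\<lambda>(s, \<xi>). h s * cis (- 2 * pi * ((s - x) \<bullet> \<xi>)) * gauss (e n *\<^sub>R \<xi>))"
        unfolding case_prod_beta' cis_conv_exp
        by (intro continuous_intros continuous_on_compose2[OF gc] continuous_on_compose2[OF h(2)]) auto
    qed (use h gie in \<open>auto simp: norm_mult\<close>)
    also have "\<dots> = (\<integral>s. h s * (gauss ((s - x) /\<^sub>R e n) / of_real (e n ^ DIM('a))) \<partial>lborel)"
    proof (intro Bochner_Integration.integral_cong refl)
      fix s
      have "(\<integral>\<xi>. h s * cis (- 2 * pi * ((s - x) \<bullet> \<xi>)) * gauss (e n *\<^sub>R \<xi>) \<partial>lborel)
        = (\<integral>\<xi>. h s * (gauss (e n *\<^sub>R \<xi>) * cis (- 2 * pi * ((s - x) \<bullet> \<xi>))) \<partial>lborel)" by (simp only: mult_ac)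
      then show "(\<integral>\<xi>. h s * cis (- 2 * pi * ((s - x) \<bullet> \<xi>)) * gauss (e n *\<^sub>R \<xi>) \<partial>lborel)
        = h s * (gauss ((s - x) /\<^sub>R e n) / of_real (e n ^ DIM('a)))"
        by (simp only: integral_mult_right_zero fourier_gauss_scaled[OF e])
    qed
    also have "\<dots> = \<bar>e n\<bar> ^ DIM('a) *\<^sub>R (\<integral>v. h (x + e n *\<^sub>R v) * (gauss ((x + e n *\<^sub>R v - x) /\<^sub>R e n) / of_real (e n ^ DIM('a))) \<partial>lborel)"
      by (rule lborel_integral_affine) (use e[of n] in auto)
    also have "\<dots> = (\<integral>v. \<bar>e n\<bar> ^ DIM('a) *\<^sub>R (h (x + e n *\<^sub>R v) * (gauss ((x + e n *\<^sub>R v - x) /\<^sub>R e n) / of_real (e n ^ DIM('a)))) \<partial>lborel)"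
      by simp
    also have "\<dots> = (\<integral>v. h (x + e n *\<^sub>R v) * gauss v \<partial>lborel)"
      using e[of n] by (intro Bochner_Integration.integral_cong refl) (simp add: scaleR_conv_of_real)
    finally show ?thesis .
  qed
  have lim1: "(\<lambda>n. \<integral>v. h (x + e n *\<^sub>R v) * gauss v \<partial>lborel) \<longlonglongrightarrow> (\<integral>v. h x * gauss v \<partial>(lborel :: 'a measure))"
  proof (rule integral_dominated_convergence[where w = "\<lambda>v. B * cmod (gauss v)"])
    show "AE v in lborel. (\<lambda>n. h (x + e n *\<^sub>R v) * gauss v) \<longlonglongrightarrow> h x * gauss v"
    proof (intro AE_I2 tendsto_mult tendsto_const)
      fix v
      have "(\<lambda>n. x + e n *\<^sub>R v) \<longlonglongrightarrow> x + 0 *\<^sub>R v" by (intro tendsto_intros e0)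
      then show "(\<lambda>n. h (x + e n *\<^sub>R v)) \<longlonglongrightarrow> h x"
        using continuous_on_tendsto_compose[OF h(2), of "\<lambda>n. x + e n *\<^sub>R v" x sequentially] by simp
    qed
  qed (use gi h(3) in \<open>auto simp: norm_mult intro!: mult_right_mono\<close>)
  have lim2: "(\<lambda>n. \<integral>\<xi>. fourier h \<xi> * cis (2 * pi * (\<xi> \<bullet> x)) * gauss (e n *\<^sub>R \<xi>) \<partial>lborel)
    \<longlonglongrightarrow> (\<integral>\<xi>. fourier h \<xi> * cis (2 * pi * (\<xi> \<bullet> x)) * 1 \<partial>lborel)"
  proof (rule integral_dominated_convergence[where w = "\<lambda>\<xi>. cmod (fourier h \<xi>)"])
    have cm: "(\<lambda>\<xi>. cis (2 * pi * (\<xi> \<bullet> x))) \<in> borel_measurable borel"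
      unfolding cis_conv_exp by (intro borel_measurable_continuous_onI continuous_intros)
    show "(\<lambda>\<xi>. fourier h \<xi> * cis (2 * pi * (\<xi> \<bullet> x)) * 1) \<in> borel_measurable lborel"
      "(\<lambda>\<xi>. fourier h \<xi> * cis (2 * pi * (\<xi> \<bullet> x)) * gauss (e n *\<^sub>R \<xi>)) \<in> borel_measurable lborel" for n
      using cm by simp_all
    show "AE \<xi> in lborel. (\<lambda>n. fourier h \<xi> * cis (2 * pi * (\<xi> \<bullet> x)) * gauss (e n *\<^sub>R \<xi>))
       \<longlonglongrightarrow> fourier h \<xi> * cis (2 * pi * (\<xi> \<bullet> x)) * 1"
    proof (intro AE_I2 tendsto_mult tendsto_const)
      fix \<xi> :: 'a
      have "(\<lambda>n. e n *\<^sub>R \<xi>) \<longlonglongrightarrow> 0 *\<^sub>R \<xi>" by (intro tendsto_intros e0)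
      then show "(\<lambda>n. gauss (e n *\<^sub>R \<xi>)) \<longlonglongrightarrow> 1"
        using continuous_on_tendsto_compose[OF gc[of UNIV], of "\<lambda>n. e n *\<^sub>R \<xi>" 0 sequentially] by (simp add: gauss_def)
    qed
    show "AE \<xi> in lborel. norm (fourier h \<xi> * cis (2 * pi * (\<xi> \<bullet> x)) * gauss (e n *\<^sub>R \<xi>)) \<le> cmod (fourier h \<xi>)" for n
      using mult_left_mono[OF g1 norm_ge_zero] by (auto simp: norm_mult)
  qed (use hh in auto)
  have "(\<integral>v. h x * gauss v \<partial>(lborel :: 'a measure)) = h x" by (simp add: integral_gauss)
  with LIMSEQ_unique[OF lim2] lim1 show ?thesis unfolding eq by simp
qed

lemma schwartz_tensor:
  fixes f :: "'a::euclidean_space \<Rightarrow> complex" and g :: "'b::euclidean_space \<Rightarrow> complex"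
  assumes "schwartz f" "schwartz g" shows "schwartz (\<lambda>z. f (fst z) * g (snd z))"
  by (rule schwartz_mult_linear[of fst snd 1])
    (use assms norm_Pair_le in \<open>auto simp: linear_fst linear_snd\<close>)

text \<open>An auxiliary variable with a Gaussian factor, evaluated at 0 where the factor is 1,
  makes the full transform a section of a partial one, so the regularity results carry over.\<close>

lemma fourier_eq_partial_fourier: "fourier h \<xi> = partial_fourier (\<lambda>z. gauss (fst z) * h (snd z)) (0 :: 'b::euclidean_space, \<xi>)"
  by (simp add: fourier_def partial_fourier_def gauss_def)

lemma fourier_schwartz:
  fixes h :: "'a::euclidean_space \<Rightarrow> complex"
  assumes "schwartz h"
  shows "continuous_on S (fourier h)" "integrable lborel (fourier h)"
proof -
  have s: "schwartz (partial_fourier (\<lambda>z::real \<times> 'a. gauss (fst z) * h (snd z)))"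
    by (intro schwartz_partial_fourier schwartz_tensor schwartz_gauss assms)
  show c: "continuous_on S (fourier h)" for S unfolding fourier_eq_partial_fourier[where 'b = real, abs_def]
    by (intro continuous_on_compose2[OF schwartz_continuous[OF s]] continuous_intros) auto
  obtain C where C: "0 \<le> C" "\<And>z. cmod (partial_fourier (\<lambda>z::real \<times> 'a. gauss (fst z) * h (snd z)) z) \<le> C / jbracket z ^ (0 + (DIM('a) + 2))"
    using schwartz_bound[OF s] by blast
  show "integrable lborel (fourier h)"
    by (rule integrable_jbracket_bound[OF borel_measurable_continuous_onI[OF c], of C], unfold fourier_eq_partial_fourier[where 'b = real])
      (rule order_trans[OF C(2)], use jbracket_pair_divide[OF C(1), of "0::real" _ 0 "DIM('a) + 2"] in simp)
qed

text \<open>The conjugate of the second transform is written as an integral, Fubini exchanges the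
  order, and inversion evaluates the inner integral.\<close>

lemma plancherel:
  fixes h k :: "'a::euclidean_space \<Rightarrow> complex"
  assumes h: "schwartz h" and k: "schwartz k"
  shows "(\<integral>\<xi>. fourier h \<xi> * cnj (fourier k \<xi>) \<partial>lborel) = (\<integral>t. h t * cnj (k t) \<partial>lborel)"
proof -
  have kc: "continuous_on S k" for S by (rule schwartz_continuous[OF k])
  obtain B where B: "\<And>x. cmod (h x) \<le> B" using schwartz_bound[OF h, of 0] by auto
  have "(\<integral>\<xi>. fourier h \<xi> * cnj (fourier k \<xi>) \<partial>lborel)
    = (\<integral>\<xi>. (\<integral>t. cnj (k t) * (fourier h \<xi> * cis (2 * pi * (\<xi> \<bullet> t))) \<partial>lborel) \<partial>lborel)"
  proof (intro Bochner_Integration.integral_cong refl)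
    fix \<xi>
    have "cnj (fourier k \<xi>) = (\<integral>t. cnj (k t) * cis (2 * pi * (\<xi> \<bullet> t)) \<partial>lborel)"
      unfolding fourier_def by (simp add: cis_cnj flip: Bochner_Integration.integral_cnj)
    then have "fourier h \<xi> * cnj (fourier k \<xi>) = (\<integral>t. fourier h \<xi> * (cnj (k t) * cis (2 * pi * (\<xi> \<bullet> t))) \<partial>lborel)"
      by (simp only: integral_mult_right_zero)
    then show "fourier h \<xi> * cnj (fourier k \<xi>) = (\<integral>t. cnj (k t) * (fourier h \<xi> * cis (2 * pi * (\<xi> \<bullet> t))) \<partial>lborel)"
      by (simp only: mult_ac)
  qed
  also have "\<dots> = (\<integral>t. (\<integral>\<xi>. cnj (k t) * (fourier h \<xi> * cis (2 * pi * (\<xi> \<bullet> t))) \<partial>lborel) \<partial>lborel)"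
  proof (rule lborel_Fubini[where f = "\<lambda>t. cmod (k t)" and g = "\<lambda>\<xi>. cmod (fourier h \<xi>)"])
    show "continuous_on UNIV (\<lambda>(t, \<xi>). cnj (k t) * (fourier h \<xi> * cis (2 * pi * (\<xi> \<bullet> t))))"
      unfolding case_prod_beta' cis_conv_exp
      by (intro continuous_intros continuous_on_compose2[OF kc] continuous_on_compose2[OF fourier_schwartz(1)[OF h]]) auto
  qed (use schwartz_integrable[OF k] fourier_schwartz(2)[OF h] in \<open>auto simp: norm_mult\<close>)
  also have "\<dots> = (\<integral>t. cnj (k t) * h t \<partial>lborel)"
    by (simp only: integral_mult_right_zero
        fourier_inversion[OF schwartz_integrable[OF h] schwartz_continuous[OF h] B fourier_schwartz(2)[OF h]])
  finally show ?thesis by (simp only: mult.commute)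
qed

section \<open>Short-time Fourier transform\<close>

text \<open>For Schwartz functions \<open>stft\<close> is this function of the pair (x, \<xi>). As a
  partial Fourier transform it is itself Schwartz in both variables jointly.\<close>

definition stft_fun :: "('a::euclidean_space \<Rightarrow> complex) \<Rightarrow> ('a \<Rightarrow> complex) \<Rightarrow> 'a \<times> 'a \<Rightarrow> complex" where
  "stft_fun \<phi> f = partial_fourier (\<lambda>z. f (snd z) * cnj (\<phi> (snd z - fst z)))"

lemma stft_fun_eq_fourier: "stft_fun \<phi> f (x, \<xi>) = fourier (\<lambda>t. f t * cnj (\<phi> (t - x))) \<xi>"
  by (simp add: stft_fun_def partial_fourier_def fourier_def)

lemma schwartz_stft_fun:
  fixes \<phi> f :: "'a::euclidean_space \<Rightarrow> complex"
  assumes "schwartz \<phi>" "schwartz f" shows "schwartz (stft_fun \<phi> f)"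
  unfolding stft_fun_def
proof (rule schwartz_partial_fourier, rule schwartz_mult_linear[where A = snd and B = "\<lambda>z. snd z - fst z" and K = 2])
  show "linear (\<lambda>z::'a \<times> 'a. snd z - fst z)" by (intro linear_compose_sub linear_fst linear_snd)
  fix z :: "'a \<times> 'a"
  have "norm (fst z) \<le> norm (snd z) + norm (snd z - fst z)"
    by (metis add.commute norm_minus_commute norm_triangle_sub)
  then have "norm (fst z) + norm (snd z) \<le> 2 * (norm (snd z) + norm (snd z - fst z))"
    using norm_ge_zero[of "snd z - fst z"] by argo
  then show "norm z \<le> 2 * (norm (snd z) + norm (snd z - fst z))"
    using norm_Pair_le[of "fst z" "snd z"] by simp
qed (use assms linear_snd schwartz_cnj in auto)

lemma window_product_schwartz:
  "schwartz \<phi> \<Longrightarrow> schwartz f \<Longrightarrow> schwartz (\<lambda>t. f t * cnj (\<phi> (t - x)))"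
  using schwartz_mult[OF _ schwartz_cnj[OF schwartz_translate[of \<phi> x]]] by (simp add: translate_def)

lemma stft_regular:
  fixes \<phi> f :: "'a::euclidean_space \<Rightarrow> complex"
  assumes "schwartz \<phi>" "schwartz f"
  shows "stft \<phi> (regular_distr f) x \<xi> = stft_fun \<phi> f (x, \<xi>)"
proof -
  have "stft \<phi> (regular_distr f) x \<xi> = (\<integral>t. f t * cnj (\<phi> (t - x)) * cis (- 2 * pi * (\<xi> \<bullet> t)) \<partial>lebesgue)"
    unfolding stft_def regular_distr_def modulate_def translate_def
    by (simp add: cis_cnj inner_commute mult_ac)
  also have "\<dots> = (\<integral>t. f t * cnj (\<phi> (t - x)) * cis (- 2 * pi * (\<xi> \<bullet> t)) \<partial>lborel)"
    unfolding cis_conv_exp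
    by (rule integral_completion, subst measurable_lborel2)
      (intro borel_measurable_continuous_onI continuous_intros
        schwartz_continuous[OF window_product_schwartz[OF assms]])
  finally show ?thesis by (simp add: stft_fun_eq_fourier fourier_def)
qed

lemma stft_fun_bound:
  fixes \<phi> f :: "'a::euclidean_space \<Rightarrow> complex"
  assumes "schwartz \<phi>" "schwartz f"
  obtains C where "0 < C" "\<And>x \<xi>. cmod (stft_fun \<phi> f (x, \<xi>)) \<le> C / (jbracket x ^ N * jbracket \<xi> ^ N)"
proof -
  obtain C where C: "0 \<le> C" "\<And>z. cmod (stft_fun \<phi> f z) \<le> C / jbracket z ^ (N + N)"
    using schwartz_bound[OF schwartz_stft_fun[OF assms]] by blast
  have "cmod (stft_fun \<phi> f (x, \<xi>)) \<le> (C + 1) / (jbracket x ^ N * jbracket \<xi> ^ N)" for x \<xi>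
  proof -
    have "cmod (stft_fun \<phi> f (x, \<xi>)) \<le> C / jbracket x ^ N / jbracket \<xi> ^ N"
      by (rule order_trans[OF C(2) jbracket_pair_divide[OF C(1)]])
    also have "\<dots> = C / (jbracket x ^ N * jbracket \<xi> ^ N)" by simp
    also have "\<dots> \<le> (C + 1) / (jbracket x ^ N * jbracket \<xi> ^ N)" by (intro divide_right_mono) auto
    finally show ?thesis .
  qed
  with C(1) show thesis by (intro that[of "C + 1"]) auto
qed

text \<open>The orthogonality relations with one common window: Plancherel in \<xi> for fixed x,
  Fubini in (t, x), and the substitution of t - x, which splits off the norm of the window.\<close>

lemma moyal:
  fixes \<phi> f g :: "'a::euclidean_space \<Rightarrow> complex"
  assumes \<phi>: "schwartz \<phi>" and f: "schwartz f" and g: "schwartz g"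
  shows "(\<integral>x. (\<integral>\<xi>. stft_fun \<phi> f (x, \<xi>) * cnj (stft_fun \<phi> g (x, \<xi>)) \<partial>lborel) \<partial>lborel)
    = (\<integral>t. f t * cnj (g t) \<partial>lborel) * (\<integral>t. \<phi> t * cnj (\<phi> t) \<partial>lborel)"
proof -
  let ?N = "DIM('a) + 2"
  have c: "continuous_on S \<phi>" "continuous_on S f" "continuous_on S g" for S
    using assms by (auto intro: schwartz_continuous)
  \<comment> \<open>Twice the integrable order: one half gives integrability in t, the other pays
    for replacing the bracket of t - x by that of x.\<close>
  obtain A where A: "0 \<le> A" "\<And>x. cmod (f x) \<le> A / jbracket x ^ (?N + ?N)"
    using schwartz_bound[OF f] by blast
  obtain B where B: "0 \<le> B" "\<And>x. cmod (g x) \<le> B / jbracket x ^ 0"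
    using schwartz_bound[OF g] by blast
  obtain D where D: "0 \<le> D" "\<And>x. cmod (\<phi> x * cnj (\<phi> x)) \<le> D / jbracket x ^ ?N"
    using schwartz_bound[OF schwartz_mult[OF \<phi> schwartz_cnj[OF \<phi>]]] by blast
  have "(\<integral>x. (\<integral>\<xi>. stft_fun \<phi> f (x, \<xi>) * cnj (stft_fun \<phi> g (x, \<xi>)) \<partial>lborel) \<partial>lborel)
    = (\<integral>x. (\<integral>t. f t * cnj (g t) * (\<phi> (t - x) * cnj (\<phi> (t - x))) \<partial>lborel) \<partial>lborel)"
    unfolding stft_fun_eq_fourier plancherel[OF window_product_schwartz[OF \<phi> f] window_product_schwartz[OF \<phi> g]]
    by (simp add: mult_ac)
  also have "\<dots> = (\<integral>t. (\<integral>x. f t * cnj (g t) * (\<phi> (t - x) * cnj (\<phi> (t - x))) \<partial>lborel) \<partial>lborel)"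
  proof (rule lborel_Fubini[where f = "\<lambda>t. A * B * D * (1 / jbracket t ^ ?N)" and g = "\<lambda>x. 1 / jbracket x ^ ?N"])
    show "continuous_on UNIV (\<lambda>(t, x). f t * cnj (g t) * (\<phi> (t - x) * cnj (\<phi> (t - x))))"
      unfolding case_prod_beta'
      by (intro continuous_intros continuous_on_compose2[OF c(1)] continuous_on_compose2[OF c(2)] continuous_on_compose2[OF c(3)]) auto
    fix t x :: 'a
    have "jbracket x ^ ?N \<le> (jbracket t * jbracket (t - x)) ^ ?N"
      using jbracket_add[of t "x - t"] by (intro power_mono) (auto simp: jbracket_minus_commute)
    then have j: "1 / jbracket (t - x) ^ ?N \<le> jbracket t ^ ?N / jbracket x ^ ?N"
      by (simp add: field_simps power_mult_distrib)
    have "cmod (f t * cnj (g t) * (\<phi> (t - x) * cnj (\<phi> (t - x))))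
      \<le> A / jbracket t ^ (?N + ?N) * B * (D * (jbracket t ^ ?N / jbracket x ^ ?N))"
      unfolding norm_mult[of "f t * cnj (g t)"]
    proof (rule mult_mono)
      show "cmod (f t * cnj (g t)) \<le> A / jbracket t ^ (?N + ?N) * B"
        unfolding norm_mult complex_mod_cnj using A(1) B(2)[of t] by (intro mult_mono A(2)) auto
      show "cmod (\<phi> (t - x) * cnj (\<phi> (t - x))) \<le> D * (jbracket t ^ ?N / jbracket x ^ ?N)"
        using order_trans[OF D(2)[of "t - x"], of "D * (jbracket t ^ ?N / jbracket x ^ ?N)"] mult_left_mono[OF j D(1)] by simp
    qed (use A(1) B(1) in auto)
    also have "\<dots> = A * B * D * (1 / jbracket t ^ ?N) * (1 / jbracket x ^ ?N)" by (simp add: power_add)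
    finally show "cmod (f t * cnj (g t) * (\<phi> (t - x) * cnj (\<phi> (t - x))))
      \<le> A * B * D * (1 / jbracket t ^ ?N) * (1 / jbracket x ^ ?N)" .
  next
    show "integrable lborel (\<lambda>t::'a. A * B * D * (1 / jbracket t ^ ?N))" by (intro integrable_mult_right integrable_jbracket)
  qed (rule integrable_jbracket)
  also have "\<dots> = (\<integral>t. f t * cnj (g t) * (\<integral>t. \<phi> t * cnj (\<phi> t) \<partial>lborel) \<partial>lborel)"
    unfolding integral_mult_right_zero
    by (subst lborel_integral_reflect[of "\<lambda>t. \<phi> t * cnj (\<phi> t)"])
      (auto intro!: borel_measurable_continuous_onI continuous_intros c)
  finally show ?thesis by (simp only: integral_mult_left_zero)
qed

lemma stft_fun_inner: "stft_fun \<psi> f (y, \<eta>) = (\<integral>t. f t * cnj (modulate \<eta> (translate y \<psi>) t) \<partial>lborel)"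
  by (simp add: stft_fun_eq_fourier fourier_def modulate_def translate_def cis_cnj inner_commute mult_ac)

lemma stft_fun_covariance:
  fixes \<phi> \<psi> :: "'a::euclidean_space \<Rightarrow> complex"
  assumes "schwartz \<phi>" "schwartz \<psi>"
  shows "stft_fun \<phi> (modulate \<eta> (translate y \<psi>)) (x, \<xi>) = cis (2 * pi * ((\<eta> - \<xi>) \<bullet> y)) * stft_fun \<phi> \<psi> (x - y, \<xi> - \<eta>)"
proof -
  have c: "continuous_on S \<phi>" "continuous_on S \<psi>" for S using assms by (auto intro: schwartz_continuous)
  define F where "F t = cis (2 * pi * (t \<bullet> \<eta>)) * \<psi> (t - y) * cnj (\<phi> (t - x)) * cis (- 2 * pi * (\<xi> \<bullet> t))" for t
  have "F \<in> borel_measurable borel" unfolding F_def cis_conv_exp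
    by (intro borel_measurable_continuous_onI continuous_intros continuous_on_compose2[OF c(1)] continuous_on_compose2[OF c(2)]) auto
  then have "(\<integral>t. F t \<partial>lborel) = (\<integral>t. F (t + y) \<partial>lborel)" by (simp add: lborel_integral_translate)
  also have "\<dots> = (\<integral>t. cis (2 * pi * ((\<eta> - \<xi>) \<bullet> y)) * (\<psi> t * cnj (\<phi> (t - (x - y))) * cis (- 2 * pi * ((\<xi> - \<eta>) \<bullet> t))) \<partial>lborel)"
  proof (intro Bochner_Integration.integral_cong refl)
    fix t
    have e: "cis (2 * pi * ((t + y) \<bullet> \<eta>)) * cis (- 2 * pi * (\<xi> \<bullet> (t + y))) = cis (2 * pi * ((\<eta> - \<xi>) \<bullet> y)) * cis (- 2 * pi * ((\<xi> - \<eta>) \<bullet> t))"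
      by (simp add: cis_mult inner_diff_left inner_add_left inner_add_right inner_commute[of _ \<eta>] algebra_simps)
    have d: "t + y - y = t" "t + y - x = t - (x - y)" by simp_all
    have "F (t + y) = (cis (2 * pi * ((t + y) \<bullet> \<eta>)) * cis (- 2 * pi * (\<xi> \<bullet> (t + y)))) * (\<psi> t * cnj (\<phi> (t - (x - y))))"
      unfolding F_def d by (simp only: mult_ac)
    also have "\<dots> = cis (2 * pi * ((\<eta> - \<xi>) \<bullet> y)) * (\<psi> t * cnj (\<phi> (t - (x - y))) * cis (- 2 * pi * ((\<xi> - \<eta>) \<bullet> t)))"
      unfolding e by (simp only: mult_ac)
    finally show "F (t + y) = \<dots>" .
  qed
  also have "\<dots> = cis (2 * pi * ((\<eta> - \<xi>) \<bullet> y)) * stft_fun \<phi> \<psi> (x - y, \<xi> - \<eta>)"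
    by (simp only: integral_mult_right_zero stft_fun_eq_fourier fourier_def)
  finally show ?thesis
    by (simp add: F_def stft_fun_eq_fourier fourier_def modulate_def translate_def)
qed

lemma norm_integral_le_nn_integral:
  fixes f :: "'a \<Rightarrow> 'b::{banach, second_countable_topology}"
  shows "ennreal (norm (integral\<^sup>L M f)) \<le> (\<integral>\<^sup>+x. ennreal (norm (f x)) \<partial>M)"
  by (cases "integrable M f") (auto simp: not_integrable_integral_eq integral_norm_bound_ennreal)

text \<open>A continuous function that does not vanish at a point is nonzero on a nonempty open set,
  and such a set is not negligible.\<close>

lemma window_norm_pos:
  fixes \<phi> :: "'a::euclidean_space \<Rightarrow> complex"
  assumes \<phi>: "schwartz \<phi>" and nz: "\<phi> t0 \<noteq> 0"
  obtains r where "0 < r" "(\<integral>t. \<phi> t * cnj (\<phi> t) \<partial>lborel) = of_real r"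
proof -
  have i: "integrable lborel (\<lambda>t. (cmod (\<phi> t))\<^sup>2)"
    using integrable_Re[OF schwartz_integrable[OF schwartz_mult[OF \<phi> schwartz_cnj[OF \<phi>]]]]
    unfolding complex_norm_square[symmetric] Re_complex_of_real .
  have eq: "(\<integral>t. \<phi> t * cnj (\<phi> t) \<partial>lborel) = of_real (\<integral>t. (cmod (\<phi> t))\<^sup>2 \<partial>lborel)"
    unfolding complex_norm_square[symmetric] by (rule integral_complex_of_real)
  have "(\<integral>t. (cmod (\<phi> t))\<^sup>2 \<partial>lborel) \<noteq> 0"
  proof
    assume "(\<integral>t. (cmod (\<phi> t))\<^sup>2 \<partial>lborel) = 0"
    then have "AE t in lborel. (cmod (\<phi> t))\<^sup>2 = 0"
      by (subst (asm) integral_nonneg_eq_0_iff_AE[OF i]) auto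
    then have "AE t in lborel. \<phi> t = 0" by simp
    then have "{t. \<phi> t \<noteq> 0} \<in> null_sets lborel"
      using \<phi> by (subst (asm) AE_iff_null) (auto simp: schwartz_measurable)
    then have "negligible {t. \<phi> t \<noteq> 0}" by (simp add: negligible_iff_null_sets null_sets_completionI)
    moreover have "open {t. \<phi> t \<noteq> 0}"
      by (intro open_Collect_neq schwartz_continuous[OF \<phi>] continuous_intros)
    ultimately show False using nz open_not_negligible by blast
  qed
  moreover have "0 \<le> (\<integral>t. (cmod (\<phi> t))\<^sup>2 \<partial>lborel)" by (intro Bochner_Integration.integral_nonneg) auto
  ultimately show thesis using eq by (intro that[of "\<integral>t. (cmod (\<phi> t))\<^sup>2 \<partial>lborel"]) (auto simp: less_le simp del: Bochner_Integration.integral_nonneg)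
qed

text \<open>The orthogonality relations applied to f and the shifted window
  \<open>modulate \<eta> (translate y \<psi>)\<close>, whose transform is, by covariance, a shift of
  that of \<psi> and decays to every order. The constant is the decay constant divided by the
  squared norm of \<phi>. The case \<psi> = \<phi> feeds the Peetre argument, the general case the
  change of window.\<close>

lemma stft_fun_reproducing:
  fixes \<phi> \<psi> :: "'a::euclidean_space \<Rightarrow> complex"
  assumes \<phi>: "schwartz \<phi>" and nz: "\<phi> t0 \<noteq> 0" and \<psi>: "schwartz \<psi>"
  obtains C where "0 < C" "\<And>f y \<eta>. schwartz f \<Longrightarrow> ennreal (cmod (stft_fun \<psi> f (y, \<eta>)))
    \<le> ennreal C * (\<integral>\<^sup>+x. \<integral>\<^sup>+\<xi>. ennreal (cmod (stft_fun \<phi> f (x, \<xi>)) / (jbracket (x - y) ^ N * jbracket (\<xi> - \<eta>) ^ N)) \<partial>lborel \<partial>lborel)"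
proof -
  obtain r where r: "0 < r" "(\<integral>t. \<phi> t * cnj (\<phi> t) \<partial>lborel) = of_real r" using window_norm_pos[OF \<phi> nz] by blast
  obtain A where A: "0 < A" "\<And>x \<xi>. cmod (stft_fun \<phi> \<psi> (x, \<xi>)) \<le> A / (jbracket x ^ N * jbracket \<xi> ^ N)"
    using stft_fun_bound[OF \<phi> \<psi>] by blast
  have "ennreal (cmod (stft_fun \<psi> f (y, \<eta>)))
    \<le> ennreal (A / r) * (\<integral>\<^sup>+x. \<integral>\<^sup>+\<xi>. ennreal (cmod (stft_fun \<phi> f (x, \<xi>)) / (jbracket (x - y) ^ N * jbracket (\<xi> - \<eta>) ^ N)) \<partial>lborel \<partial>lborel)"
    if f: "schwartz f" for f y \<eta>
  proof -
    define g where "g = modulate \<eta> (translate y \<psi>)"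
    have g: "schwartz g" unfolding g_def by (intro schwartz_modulate schwartz_translate \<psi>)
    define K where "K x \<xi> = cmod (stft_fun \<phi> f (x, \<xi>)) / (jbracket (x - y) ^ N * jbracket (\<xi> - \<eta>) ^ N)" for x \<xi>
    have fc: "continuous_on S (stft_fun \<phi> f)" for S by (intro schwartz_continuous schwartz_stft_fun \<phi> f)
    have Kc: "continuous_on UNIV (\<lambda>(x, \<xi>). K x \<xi>)" unfolding K_def case_prod_beta'
      by (intro continuous_intros continuous_on_compose2[OF fc]) auto
    then have [measurable]: "(\<lambda>(x, \<xi>). K x \<xi>) \<in> borel_measurable (borel \<Otimes>\<^sub>M borel)"
      unfolding borel_prod by (rule borel_measurable_continuous_onI)
    have "(\<integral>x. (\<integral>\<xi>. stft_fun \<phi> f (x, \<xi>) * cnj (stft_fun \<phi> g (x, \<xi>)) \<partial>lborel) \<partial>lborel) = of_real r * stft_fun \<psi> f (y, \<eta>)"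
      unfolding moyal[OF \<phi> f g] r(2) stft_fun_inner[of \<psi> f y \<eta>] g_def[symmetric] by (rule mult.commute)
    then have "ennreal (r * cmod (stft_fun \<psi> f (y, \<eta>))) = ennreal (cmod (\<integral>x. (\<integral>\<xi>. stft_fun \<phi> f (x, \<xi>) * cnj (stft_fun \<phi> g (x, \<xi>)) \<partial>lborel) \<partial>lborel))"
      using r by (simp add: norm_mult)
    also have "\<dots> \<le> (\<integral>\<^sup>+x. ennreal (cmod (\<integral>\<xi>. stft_fun \<phi> f (x, \<xi>) * cnj (stft_fun \<phi> g (x, \<xi>)) \<partial>lborel)) \<partial>lborel)"
      by (rule norm_integral_le_nn_integral)
    also have "\<dots> \<le> (\<integral>\<^sup>+x. \<integral>\<^sup>+\<xi>. ennreal (cmod (stft_fun \<phi> f (x, \<xi>) * cnj (stft_fun \<phi> g (x, \<xi>)))) \<partial>lborel \<partial>lborel)"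
      by (intro nn_integral_mono norm_integral_le_nn_integral)
    also have "\<dots> \<le> (\<integral>\<^sup>+x. \<integral>\<^sup>+\<xi>. ennreal A * ennreal (K x \<xi>) \<partial>lborel \<partial>lborel)"
    proof (intro nn_integral_mono)
      fix x \<xi>
      have "cmod (stft_fun \<phi> f (x, \<xi>) * cnj (stft_fun \<phi> g (x, \<xi>))) \<le> cmod (stft_fun \<phi> f (x, \<xi>)) * (A / (jbracket (x - y) ^ N * jbracket (\<xi> - \<eta>) ^ N))"
        unfolding norm_mult g_def stft_fun_covariance[OF \<phi> \<psi>] complex_mod_cnj norm_cis mult_1_left
        by (intro mult_left_mono A(2) norm_ge_zero)
      also have "\<dots> = A * K x \<xi>" by (simp add: K_def)
      finally show "ennreal (cmod (stft_fun \<phi> f (x, \<xi>) * cnj (stft_fun \<phi> g (x, \<xi>)))) \<le> ennreal A * ennreal (K x \<xi>)"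
        using A(1) by (simp add: ennreal_leI K_def flip: ennreal_mult)
    qed
    also have "\<dots> = ennreal A * (\<integral>\<^sup>+x. \<integral>\<^sup>+\<xi>. ennreal (K x \<xi>) \<partial>lborel \<partial>lborel)"
      by (simp add: nn_integral_cmult)
    finally have "ennreal (1 / r) * ennreal (r * cmod (stft_fun \<psi> f (y, \<eta>))) \<le> ennreal (1 / r) * (ennreal A * (\<integral>\<^sup>+x. \<integral>\<^sup>+\<xi>. ennreal (K x \<xi>) \<partial>lborel \<partial>lborel))"
      by (rule mult_left_mono) simp
    then show ?thesis using r(1) A(1) unfolding K_def by (simp add: mult.assoc[symmetric] flip: ennreal_mult)
  qed
  with A(1) r(1) show thesis by (intro that[of "A / r"]) auto
qed

section \<open>Lattice sums and the Peetre maximal function\<close>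

text \<open>The integer points in coordinates of an arbitrary Euclidean space, so that the same
  lemmas serve for x and for pairs (x, \<xi>). In \<open>real ^ 'd\<close> it is the range of
  \<open>lattice_point\<close>.\<close>

definition lattice :: "'a::euclidean_space set" where
  "lattice = {x. \<forall>b\<in>Basis. x \<bullet> b \<in> \<int>}"

abbreviation lnorm :: "ennreal \<Rightarrow> ('a::euclidean_space \<Rightarrow> ennreal) \<Rightarrow> ennreal" where
  "lnorm \<equiv> Lp_norm (count_space lattice)"

definition lfloor :: "'a::euclidean_space \<Rightarrow> 'a" where
  "lfloor x = (\<Sum>b\<in>Basis. of_int \<lfloor>x \<bullet> b\<rfloor> *\<^sub>R b)"

lemma lfloor_inner [simp]: "b \<in> Basis \<Longrightarrow> lfloor x \<bullet> b = of_int \<lfloor>x \<bullet> b\<rfloor>"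
  by (simp add: lfloor_def inner_sum_left inner_Basis if_distrib cong: if_cong)

lemma lfloor_in_lattice [simp]: "lfloor x \<in> lattice"
  by (simp add: lattice_def)

lemma lattice_add [simp]: "j \<in> lattice \<Longrightarrow> k \<in> lattice \<Longrightarrow> j + k \<in> lattice"
  and lattice_diff [simp]: "j \<in> lattice \<Longrightarrow> k \<in> lattice \<Longrightarrow> j - k \<in> lattice"
  and lattice_minus [simp]: "k \<in> lattice \<Longrightarrow> - k \<in> lattice"
  and lattice_0 [simp]: "0 \<in> lattice"
  by (auto simp: lattice_def inner_simps)

lemma norm_lfloor_le: "norm (x - lfloor (x :: 'a::euclidean_space)) \<le> real DIM('a)"
proof -
  have "norm (x - lfloor x) \<le> (\<Sum>b\<in>Basis. \<bar>(x - lfloor x) \<bullet> b\<bar>)" by (rule norm_le_l1)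
  also have "\<dots> \<le> (\<Sum>b\<in>(Basis::'a set). 1)"
    by (intro sum_mono) (auto simp: inner_diff_left abs_le_iff, linarith+)
  finally show ?thesis by simp
qed

lemma jbracket_lfloor: "jbracket (x - lfloor (x :: 'a::euclidean_space)) \<le> 1 + real DIM('a)"
  using norm_lfloor_le[of x] by (simp add: jbracket_def)

lemma lfloor_measurable [measurable]: "lfloor \<in> borel_measurable borel"
  unfolding lfloor_def by measurable

lemma countable_lattice: "countable (lattice :: 'a::euclidean_space set)"
proof -
  have "lattice \<subseteq> (\<lambda>f. \<Sum>b\<in>Basis. f b *\<^sub>R b) ` (Pi\<^sub>E (Basis :: 'a set) (\<lambda>_. \<int>))"
  proof
    fix x :: 'a assume "x \<in> lattice"
    then have "(\<lambda>b\<in>Basis. x \<bullet> b) \<in> Pi\<^sub>E Basis (\<lambda>_. \<int>)" by (auto simp: lattice_def)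
    moreover have "x = (\<Sum>b\<in>Basis. (\<lambda>b\<in>Basis. x \<bullet> b) b *\<^sub>R b)"
      by (simp add: euclidean_representation)
    ultimately show "x \<in> (\<lambda>f. \<Sum>b\<in>Basis. f b *\<^sub>R b) ` (Pi\<^sub>E (Basis :: 'a set) (\<lambda>_. \<int>))" by blast
  qed
  moreover have "countable (Pi\<^sub>E (Basis :: 'a set) (\<lambda>_. \<int> :: real set))"
    by (intro countable_PiE) (auto simp: Ints_def)
  ultimately show ?thesis by (meson countable_image countable_subset)
qed

lemma lattice_Pair [simp]: "(x, y) \<in> lattice \<longleftrightarrow> x \<in> lattice \<and> y \<in> lattice"
  by (simp add: lattice_def Basis_prod_def ball_Un)

lemma lattice_times: "lattice = lattice \<times> lattice"
  by auto

text \<open>For lattice points k this is the half-open unit cube with lower corner k. These cubes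
  partition the space and have measure 1.\<close>

definition cube :: "'a::euclidean_space \<Rightarrow> 'a set" where
  "cube k = {x. lfloor x = k}"

lemma cube_measurable [measurable]: "cube k \<in> sets borel"
proof -
  have "lfloor -` {k} \<inter> space borel \<in> sets borel" by (rule measurable_sets[OF lfloor_measurable]) simp
  then show ?thesis by (simp add: cube_def vimage_def)
qed

text \<open>The half-open cube lies between the open and the closed box with corners k and k + One,
  both of volume 1.\<close>

lemma emeasure_cube:
  fixes k :: "'a::euclidean_space"
  assumes "k \<in> lattice" shows "emeasure lborel (cube k) = 1"
proof (rule antisym)
  have k: "of_int \<lfloor>k \<bullet> b\<rfloor> = k \<bullet> b" if "b \<in> Basis" for b
    using assms that by (auto simp: lattice_def)
  have cube: "x \<in> cube k \<longleftrightarrow> (\<forall>b\<in>Basis. k \<bullet> b \<le> x \<bullet> b \<and> x \<bullet> b < k \<bullet> b + 1)" for x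
  proof -
    have "x \<in> cube k \<longleftrightarrow> (\<forall>b\<in>Basis. of_int \<lfloor>x \<bullet> b\<rfloor> = k \<bullet> b)"
      unfolding cube_def mem_Collect_eq euclidean_eq_iff[of "lfloor x" k] by simp
    also have "\<dots> \<longleftrightarrow> (\<forall>b\<in>Basis. k \<bullet> b \<le> x \<bullet> b \<and> x \<bullet> b < k \<bullet> b + 1)"
    proof (intro ball_cong refl)
      fix b :: 'a assume "b \<in> Basis"
      then obtain i :: int where "k \<bullet> b = of_int i" using assms by (auto simp: lattice_def elim: Ints_cases)
      then show "of_int \<lfloor>x \<bullet> b\<rfloor> = k \<bullet> b \<longleftrightarrow> k \<bullet> b \<le> x \<bullet> b \<and> x \<bullet> b < k \<bullet> b + 1"
        by (auto simp: floor_eq_iff)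
    qed
    finally show ?thesis .
  qed
  have "emeasure lborel (cube k) \<le> emeasure lborel (cbox k (k + One))"
    by (rule emeasure_mono) (auto simp: cube cbox_def inner_add_left less_imp_le)
  also have "\<dots> = 1" by (simp add: emeasure_lborel_cbox_eq inner_add_left)
  finally show "emeasure lborel (cube k) \<le> 1" .
  have "1 = emeasure lborel (box k (k + One))" by (simp add: emeasure_lborel_box_eq inner_add_left)
  also have "\<dots> \<le> emeasure lborel (cube k)"
    by (rule emeasure_mono) (auto simp: cube box_def inner_add_left less_imp_le)
  finally show "1 \<le> emeasure lborel (cube k)" .
qed

lemma nn_integral_cubes:
  fixes h :: "'a::euclidean_space \<Rightarrow> ennreal"
  assumes [measurable]: "h \<in> borel_measurable borel"
  shows "(\<integral>\<^sup>+x. h x \<partial>lborel) = (\<integral>\<^sup>+k. \<integral>\<^sup>+x. h x * indicator (cube k) x \<partial>lborel \<partial>count_space lattice)"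
proof -
  have "(\<integral>\<^sup>+k. h x * indicator (cube k) x \<partial>count_space lattice) = h x" for x
  proof -
    have "(\<integral>\<^sup>+k. h x * indicator (cube k) x \<partial>count_space lattice) = (\<integral>\<^sup>+k. h x * indicator {lfloor x} k \<partial>count_space lattice)"
      by (intro nn_integral_cong) (auto simp: cube_def split: split_indicator)
    also have "\<dots> = h x * emeasure (count_space lattice) {lfloor x}"
      by (rule nn_integral_cmult_indicator) simp
    finally show ?thesis by simp
  qed
  then have "(\<integral>\<^sup>+x. h x \<partial>lborel) = (\<integral>\<^sup>+x. (\<integral>\<^sup>+k. h x * indicator (cube k) x \<partial>count_space lattice) \<partial>lborel)" by simp
  also have "\<dots> = (\<integral>\<^sup>+k. \<integral>\<^sup>+x. h x * indicator (cube k) x \<partial>lborel \<partial>count_space lattice)"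
    by (rule nn_integral_count_space_nn_integral[OF countable_lattice]) measurable
  finally show ?thesis .
qed

lemma nn_integral_step:
  fixes c :: "'a::euclidean_space \<Rightarrow> ennreal"
  assumes [measurable]: "(\<lambda>x. c (lfloor x)) \<in> borel_measurable borel"
  shows "(\<integral>\<^sup>+x. c (lfloor x) \<partial>lborel) = (\<integral>\<^sup>+k. c k \<partial>count_space lattice)"
proof -
  have "(\<integral>\<^sup>+x. c (lfloor x) * indicator (cube k) x \<partial>lborel) = c k" if "k \<in> lattice" for k
  proof -
    have "(\<integral>\<^sup>+x. c (lfloor x) * indicator (cube k) x \<partial>lborel) = (\<integral>\<^sup>+x. c k * indicator (cube k) x \<partial>lborel)"
      by (intro nn_integral_cong) (auto simp: cube_def split: split_indicator)
    also have "\<dots> = c k" using emeasure_cube[OF that] by (subst nn_integral_cmult_indicator) auto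
    finally show ?thesis .
  qed
  then show ?thesis unfolding nn_integral_cubes[OF assms] by (intro nn_integral_cong) simp
qed

text \<open>\<open>lfloor\<close> is measurable into a countable discrete space, so composing it
  with any function c stays measurable.\<close>

lemma step_measurable [measurable]:
  fixes c :: "'a::euclidean_space \<Rightarrow> 'b::topological_space"
  shows "(\<lambda>x. c (lfloor x)) \<in> borel_measurable borel"
proof -
  have "lfloor -` {k} \<inter> space borel \<in> sets borel" for k :: 'a
    by (rule measurable_sets[OF lfloor_measurable]) simp
  then have "(lfloor :: 'a \<Rightarrow> 'a) \<in> borel \<rightarrow>\<^sub>M count_space lattice"
    by (subst measurable_count_space_eq_countable[OF countable_lattice]) auto
  then show ?thesis by (rule measurable_compose) simp
qed

section \<open>Comparison of integrals with lattice sums\<close>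

lemma Lp_norm_lebesgue_eq:
  assumes "p = \<infinity> \<Longrightarrow> f \<in> borel_measurable borel"
  shows "Lp_norm lebesgue p f = Lp_norm lborel p f"
proof (cases "p = \<infinity>")
  case True
  then have "f \<in> borel_measurable lborel" using assms by simp
  then show ?thesis using True
    by (auto simp: esssup_eq_AE measurable_completion AE_completion_iff)
next
  case False
  then show ?thesis by (simp add: Lp_norm_finite nn_integral_completion)
qed

lemma Lp_norm_le_step:
  fixes h :: "'a::euclidean_space \<Rightarrow> ennreal"
  assumes "0 < p" "\<And>x. h x \<le> c (lfloor x)" "p = \<infinity> \<Longrightarrow> h \<in> borel_measurable lebesgue"
  shows "Lp_norm lebesgue p h \<le> lnorm p c"
proof (cases "p = \<infinity>")
  case True
  have "h x \<le> (SUP k\<in>lattice. c k)" for x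
    by (rule order_trans[OF assms(2)], rule SUP_upper) simp
  then show ?thesis using True assms(3) by (auto simp: esssup_count_space intro: esssup_I)
next
  case False
  have "Lp_norm lebesgue p h \<le> Lp_norm lborel p (\<lambda>x. c (lfloor x))"
    using assms False by (subst Lp_norm_lebesgue_eq) (auto intro: Lp_norm_mono)
  also have "\<dots> = lnorm p c"
    using False nn_integral_step[OF step_measurable, of "\<lambda>k. ennreal_powr (c k) (enn2real p)"]
    by (simp add: Lp_norm_finite)
  finally show ?thesis .
qed

text \<open>The tangent line inequality at the mean c is integrated, and the term with s - 1 is
  cancelled. If the mean is \<infinity>, then v \<le> 1 + v ^ s forces the right side to be
  \<infinity> too.\<close>

lemma jensen_nn_integral:
  assumes "emeasure M (space M) = 1" "1 \<le> s" and [measurable]: "v \<in> borel_measurable M"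
  shows "ennreal_powr (\<integral>\<^sup>+x. v x \<partial>M) s \<le> (\<integral>\<^sup>+x. ennreal_powr (v x) s \<partial>M)"
proof (cases "s = 1")
  case False
  then have s: "1 < s" using assms by simp
  show ?thesis
  proof (cases "\<integral>\<^sup>+x. v x \<partial>M")
    case (real c)
    have "ennreal (s * c powr (s - 1)) * (\<integral>\<^sup>+x. v x \<partial>M) = (\<integral>\<^sup>+x. ennreal (s * c powr (s - 1)) * v x \<partial>M)"
      by (rule nn_integral_cmult[symmetric]) measurable
    also have "\<dots> \<le> (\<integral>\<^sup>+x. ennreal_powr (v x) s + ennreal ((s - 1) * c powr s) \<partial>M)"
      using young_ennreal[OF s real(1), of 1] by (intro nn_integral_mono) (simp add: divide_ennreal_def)
    also have "\<dots> = (\<integral>\<^sup>+x. ennreal_powr (v x) s \<partial>M) + ennreal ((s - 1) * c powr s)"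
      using assms by (subst nn_integral_add) auto
    finally have *: "ennreal (s * (c powr (s - 1) * c)) \<le> (\<integral>\<^sup>+x. ennreal_powr (v x) s \<partial>M) + ennreal ((s - 1) * c powr s)"
      using real s by (simp add: mult.assoc flip: ennreal_mult)
    have "c powr (s - 1) * c = c powr s" using real s by (cases "c = 0") (auto simp: powr_diff)
    with * have *: "ennreal (s * c powr s) \<le> (\<integral>\<^sup>+x. ennreal_powr (v x) s \<partial>M) + ennreal ((s - 1) * c powr s)" by simp
    show ?thesis
    proof (cases "\<integral>\<^sup>+x. ennreal_powr (v x) s \<partial>M")
      case r: (real d)
      with * s have "s * c powr s \<le> d + (s - 1) * c powr s" by (simp flip: ennreal_plus)
      then show ?thesis using real r by (simp add: ennreal_powr_ennreal algebra_simps ennreal_leI)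
    qed simp
  next
    case top
    have "v x \<le> 1 + ennreal_powr (v x) s" for x
    proof (cases "v x \<le> 1")
      case True then show ?thesis by (rule order_trans) simp
    next
      case False
      show ?thesis
      proof (cases "v x")
        case (real c)
        with False have "1 < c" by (simp add: ennreal_1[symmetric] del: ennreal_1)
        then have "c powr 1 \<le> c powr s" using s by (intro powr_mono) auto
        then show ?thesis using real \<open>1 < c\<close>
          by (simp add: ennreal_powr_ennreal add_increasing ennreal_leI)
      qed simp
    qed
    then have "(\<integral>\<^sup>+x. v x \<partial>M) \<le> (\<integral>\<^sup>+x. 1 + ennreal_powr (v x) s \<partial>M)" by (intro nn_integral_mono)
    also have "\<dots> = 1 + (\<integral>\<^sup>+x. ennreal_powr (v x) s \<partial>M)" using assms by (subst nn_integral_add) auto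
    finally show ?thesis using top by (auto simp: top_unique)
  qed
qed simp

lemma Lp_norm_cube_mono:
  fixes h :: "'a::euclidean_space \<Rightarrow> ennreal"
  assumes "0 < r" "r \<le> p" "p \<noteq> \<infinity>" "k \<in> lattice" and [measurable]: "h \<in> borel_measurable borel"
  shows "Lp_norm lborel r (\<lambda>x. h x * indicator (cube k) x) \<le> Lp_norm lborel p (\<lambda>x. h x * indicator (cube k) x)"
proof -
  let ?r = "enn2real r" and ?p = "enn2real p"
  have rf: "r \<noteq> \<infinity>" using assms by (auto simp: top_unique)
  have r: "0 < ?r" using assms rf by (intro enn2real_pos)
  have rp: "?r \<le> ?p" using assms by (intro enn2real_mono) (auto simp: less_top)
  let ?M = "density lborel (indicator (cube k))"
  have ind: "ennreal_powr (h x * indicator (cube k) x) a = indicator (cube k) x * ennreal_powr (h x) a" for x a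
    by (simp split: split_indicator)
  have "ennreal_powr (\<integral>\<^sup>+x. ennreal_powr (h x) ?r \<partial>?M) (?p / ?r) \<le> (\<integral>\<^sup>+x. ennreal_powr (ennreal_powr (h x) ?r) (?p / ?r) \<partial>?M)"
    by (rule jensen_nn_integral) (use r rp emeasure_cube[OF assms(4)] in \<open>auto simp: emeasure_density\<close>)
  then have "ennreal_powr (\<integral>\<^sup>+x. ennreal_powr (h x) ?r \<partial>?M) (?p / ?r) \<le> (\<integral>\<^sup>+x. ennreal_powr (h x) ?p \<partial>?M)"
    using r by (simp add: ennreal_powr_powr)
  from ennreal_powr_mono[OF _ this, of "1 / ?p"]
  have "ennreal_powr (\<integral>\<^sup>+x. ennreal_powr (h x) ?r \<partial>?M) (1 / ?r) \<le> ennreal_powr (\<integral>\<^sup>+x. ennreal_powr (h x) ?p \<partial>?M) (1 / ?p)"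
    using r rp by (simp add: ennreal_powr_powr)
  then show ?thesis
    using rf assms by (simp add: Lp_norm_finite ind nn_integral_density)
qed

lemma Lp_norm_cubes:
  fixes h :: "'a::euclidean_space \<Rightarrow> ennreal"
  assumes "0 < p" "p \<noteq> \<infinity>" and [measurable]: "h \<in> borel_measurable borel"
  shows "lnorm p (\<lambda>k. Lp_norm lborel p (\<lambda>x. h x * indicator (cube k) x)) = Lp_norm lborel p h"
proof -
  let ?p = "enn2real p"
  have p: "0 < ?p" using assms by (intro enn2real_pos)
  have ind: "ennreal_powr (h x * indicator (cube k) x) ?p = ennreal_powr (h x) ?p * indicator (cube k) x" for x k
    by (simp split: split_indicator)
  show ?thesis
    using p assms nn_integral_cubes[of "\<lambda>x. ennreal_powr (h x) ?p"] by (simp add: Lp_norm_finite ind)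
qed

text \<open>A unit cube is a probability space, so on each cube the L^r norm is at most the L^p norm
  by Jensen; the weight is constant there and passes through the norm. At p = \<infinity> the
  essential bound is used on each cube.\<close>

lemma Lp_norm_cubes_le:
  fixes h :: "'a::euclidean_space \<Rightarrow> ennreal"
  assumes "0 < r" "r \<le> p" "r \<noteq> \<infinity>" and [measurable]: "h \<in> borel_measurable borel"
    and w: "\<And>k. w k < \<infinity>"
  shows "lnorm p (\<lambda>k. w k * Lp_norm lborel r (\<lambda>x. h x * indicator (cube k) x))
    \<le> Lp_norm lborel p (\<lambda>x. w (lfloor x) * h x)"
proof -
  have p: "0 < p" using assms by auto
  have eq: "w (lfloor x) * h x * indicator (cube k) x = w k * (h x * indicator (cube k) x)" for x k
    by (auto simp: cube_def split: split_indicator)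
  show ?thesis
  proof (cases "p = \<infinity>")
    case False
    have "w k * Lp_norm lborel r (\<lambda>x. h x * indicator (cube k) x)
      \<le> Lp_norm lborel p (\<lambda>x. w (lfloor x) * h x * indicator (cube k) x)" if k: "k \<in> lattice" for k
    proof (cases "w k = 0")
      case False
      have "w k * Lp_norm lborel r (\<lambda>x. h x * indicator (cube k) x) \<le> w k * Lp_norm lborel p (\<lambda>x. h x * indicator (cube k) x)"
        by (intro mult_left_mono Lp_norm_cube_mono) (use assms k \<open>p \<noteq> \<infinity>\<close> in auto)
      also have "\<dots> = Lp_norm lborel p (\<lambda>x. w k * (h x * indicator (cube k) x))"
        by (rule Lp_norm_cmult_eq[symmetric]) (use p w False in \<open>auto simp: zero_less_iff_neq_zero\<close>)
      finally show ?thesis by (simp only: eq)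
    qed simp
    then have "lnorm p (\<lambda>k. w k * Lp_norm lborel r (\<lambda>x. h x * indicator (cube k) x))
      \<le> lnorm p (\<lambda>k. Lp_norm lborel p (\<lambda>x. w (lfloor x) * h x * indicator (cube k) x))"
      by (intro Lp_norm_count_mono p)
    also have "\<dots> = Lp_norm lborel p (\<lambda>x. w (lfloor x) * h x)"
      by (rule Lp_norm_cubes) (use p False in auto)
    finally show ?thesis .
  next
    case True
    let ?E = "esssup lborel (\<lambda>x. w (lfloor x) * h x)"
    have "w k * Lp_norm lborel r (\<lambda>x. h x * indicator (cube k) x) \<le> ?E" if k: "k \<in> lattice" for k
    proof (cases "w k = 0 \<or> ?E = \<infinity>")
      case False
      have "AE x in lborel. w (lfloor x) * h x \<le> ?E" by (rule esssup_AE)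
      then have ae: "AE x in lborel. w k * (h x * indicator (cube k) x) \<le> ?E * indicator (cube k) x"
        by eventually_elim (auto simp: cube_def split: split_indicator)
      have "w k * Lp_norm lborel r (\<lambda>x. h x * indicator (cube k) x) = Lp_norm lborel r (\<lambda>x. w k * (h x * indicator (cube k) x))"
        by (rule Lp_norm_cmult_eq[symmetric]) (use assms w False in \<open>auto simp: zero_less_iff_neq_zero\<close>)
      also have "\<dots> \<le> Lp_norm lborel r (\<lambda>x. ?E * indicator (cube k) x)"
        by (rule Lp_norm_AE_mono) (use assms ae in auto)
      also have "\<dots> \<le> ?E * Lp_norm lborel r (indicator (cube k))"
        by (rule Lp_norm_cmult) (use assms False in \<open>auto simp: less_top\<close>)
      also have "Lp_norm lborel r (indicator (cube k)) = 1"
      proof -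
        have "ennreal_powr (indicator (cube k) x) a = indicator (cube k) x" for x a by (simp split: split_indicator)
        then show ?thesis using assms emeasure_cube[OF k] by (simp add: Lp_norm_finite)
      qed
      finally show ?thesis by simp
    qed auto
    then show ?thesis using True by (auto simp: esssup_count_space intro: SUP_least)
  qed
qed

section \<open>The Peetre maximal function\<close>

definition peetre :: "nat \<Rightarrow> ('a::euclidean_space \<times> 'a \<Rightarrow> real) \<Rightarrow> 'a \<times> 'a \<Rightarrow> ennreal" where
  "peetre N F = (\<lambda>(y, \<eta>). SUP (x, \<xi>). ennreal (F (x, \<xi>) / (jbracket (x - y) ^ N * jbracket (\<xi> - \<eta>) ^ N)))"

lemma le_peetre: "ennreal (F (x, \<xi>) / (jbracket (x - y) ^ N * jbracket (\<xi> - \<eta>) ^ N)) \<le> peetre N F (y, \<eta>)"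
  unfolding peetre_def prod.case by (rule SUP_upper2[of "(x, \<xi>)"]) auto

lemma peetre_least:
  "(\<And>x \<xi>. ennreal (F (x, \<xi>) / (jbracket (x - y) ^ N * jbracket (\<xi> - \<eta>) ^ N)) \<le> c) \<Longrightarrow> peetre N F (y, \<eta>) \<le> c"
  unfolding peetre_def by (auto intro: SUP_least)

lemma peetre_finite:
  assumes "\<And>z. F z \<le> B" "\<And>z. 0 \<le> F z" shows "peetre N F z \<le> ennreal B"
proof (cases z)
  case (Pair y \<eta>)
  have "ennreal (F (x, \<xi>) / (jbracket (x - y) ^ N * jbracket (\<xi> - \<eta>) ^ N)) \<le> ennreal B" for x \<xi>
  proof (rule ennreal_leI)
    have "F (x, \<xi>) / (jbracket (x - y) ^ N * jbracket (\<xi> - \<eta>) ^ N) \<le> F (x, \<xi>) / 1"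
      using assms(2) by (intro divide_left_mono mult_ge1_I) auto
    then show "F (x, \<xi>) / (jbracket (x - y) ^ N * jbracket (\<xi> - \<eta>) ^ N) \<le> B" using assms(1)[of "(x, \<xi>)"] by simp
  qed
  then show ?thesis unfolding Pair by (rule peetre_least)
qed

text \<open>Recentring the kernel from (y, \<eta>) to another point costs the N-th powers of the
  brackets of the displacement, by the triangle inequality for brackets in each variable.\<close>

lemma jbracket_quotient_le:
  assumes "0 \<le> a"
  shows "a / (jbracket (x - y) ^ N * jbracket (\<xi> - \<eta>) ^ N)
    \<le> (jbracket (y - y') ^ N * jbracket (\<eta> - \<eta>') ^ N) * (a / (jbracket (x - y') ^ N * jbracket (\<xi> - \<eta>') ^ N))"
proof -
  have "jbracket (x - y') ^ N \<le> (jbracket (x - y) * jbracket (y - y')) ^ N"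
    "jbracket (\<xi> - \<eta>') ^ N \<le> (jbracket (\<xi> - \<eta>) * jbracket (\<eta> - \<eta>')) ^ N"
    by (intro power_mono jbracket_triangle; simp)+
  from mult_mono[OF this] have "jbracket (x - y') ^ N * jbracket (\<xi> - \<eta>') ^ N
    \<le> (jbracket (x - y) ^ N * jbracket (\<xi> - \<eta>) ^ N) * (jbracket (y - y') ^ N * jbracket (\<eta> - \<eta>') ^ N)"
    by (simp add: power_mult_distrib mult_ac)
  then have "1 / (jbracket (x - y) ^ N * jbracket (\<xi> - \<eta>) ^ N)
    \<le> (jbracket (y - y') ^ N * jbracket (\<eta> - \<eta>') ^ N) / (jbracket (x - y') ^ N * jbracket (\<xi> - \<eta>') ^ N)"
    by (simp add: divide_le_eq le_divide_eq mult.commute)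
  from mult_left_mono[OF this assms] show ?thesis by (simp add: mult_ac)
qed

text \<open>The maximal function varies slowly, in contrast to F itself. This is what permits
  replacing its values by those at lattice points, even though the lattice may miss the points where
  F is large.\<close>

lemma peetre_shift:
  assumes F: "\<And>z. 0 \<le> F z"
  shows "peetre N F (y, \<eta>) \<le> ennreal (jbracket (y - y') ^ N * jbracket (\<eta> - \<eta>') ^ N) * peetre N F (y', \<eta>')"
proof (rule peetre_least)
  fix x \<xi>
  have "ennreal (F (x, \<xi>) / (jbracket (x - y) ^ N * jbracket (\<xi> - \<eta>) ^ N))
    \<le> ennreal ((jbracket (y - y') ^ N * jbracket (\<eta> - \<eta>') ^ N) * (F (x, \<xi>) / (jbracket (x - y') ^ N * jbracket (\<xi> - \<eta>') ^ N)))"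
    by (intro ennreal_leI jbracket_quotient_le F)
  also have "\<dots> = ennreal (jbracket (y - y') ^ N * jbracket (\<eta> - \<eta>') ^ N) * ennreal (F (x, \<xi>) / (jbracket (x - y') ^ N * jbracket (\<xi> - \<eta>') ^ N))"
    by (rule ennreal_mult) (use F in auto)
  also have "\<dots> \<le> ennreal (jbracket (y - y') ^ N * jbracket (\<eta> - \<eta>') ^ N) * peetre N F (y', \<eta>')"
    by (intro mult_left_mono le_peetre) simp
  finally show "ennreal (F (x, \<xi>) / (jbracket (x - y) ^ N * jbracket (\<xi> - \<eta>) ^ N)) \<le> \<dots>" .
qed

text \<open>The Peetre trick: a reproducing inequality in \<open>L\<^sup>1\<close> implies one in \<open>L\<^sup>r\<close> for \<open>r < 1\<close>, because the
  surplus power \<open>1 - r\<close> is absorbed by the maximal function, which is known to be finite.\<close>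

lemma peetre_self_improvement:
  fixes F :: "'a::euclidean_space \<times> 'a \<Rightarrow> real"
  assumes F: "\<And>z. 0 \<le> F z" and B: "\<And>z. F z \<le> B" and c: "continuous_on UNIV F" and C: "0 < C"
    and rep: "\<And>y \<eta>. ennreal (F (y, \<eta>)) \<le> ennreal C * (\<integral>\<^sup>+x. \<integral>\<^sup>+\<xi>. ennreal (F (x, \<xi>) / (jbracket (x - y) ^ N * jbracket (\<xi> - \<eta>) ^ N)) \<partial>lborel \<partial>lborel)"
    and r: "0 < r" "r \<le> 1"
  shows "ennreal_powr (peetre N F (y, \<eta>)) r
    \<le> ennreal C * (\<integral>\<^sup>+\<xi>. \<integral>\<^sup>+x. ennreal_powr (ennreal (F (x, \<xi>) / (jbracket (x - y) ^ N * jbracket (\<xi> - \<eta>) ^ N))) r \<partial>lborel \<partial>lborel)"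
proof -
  define P where "P = peetre N F (y, \<eta>)"
  define G where "G x \<xi> = ennreal (F (x, \<xi>) / (jbracket (x - y) ^ N * jbracket (\<xi> - \<eta>) ^ N))" for x \<xi>
  have "continuous_on UNIV (\<lambda>(x, \<xi>). F (x, \<xi>) / (jbracket (x - y) ^ N * jbracket (\<xi> - \<eta>) ^ N))"
    unfolding case_prod_beta' by (intro continuous_intros continuous_on_compose2[OF c]) auto
  then have [measurable]: "(\<lambda>(x, \<xi>). F (x, \<xi>) / (jbracket (x - y) ^ N * jbracket (\<xi> - \<eta>) ^ N)) \<in> borel_measurable (borel \<Otimes>\<^sub>M borel)"
    unfolding borel_prod by (rule borel_measurable_continuous_onI)
  have Gm [measurable]: "(\<lambda>(x, \<xi>). G x \<xi>) \<in> borel_measurable (borel \<Otimes>\<^sub>M borel)"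
    unfolding G_def by measurable
  have fin: "P < \<infinity>" unfolding P_def using peetre_finite[of F B N "(y, \<eta>)", OF B F] by (rule order.strict_trans1) simp
  let ?I = "\<integral>\<^sup>+x. \<integral>\<^sup>+\<xi>. ennreal_powr (G x \<xi>) r \<partial>lborel \<partial>lborel"
  have GP: "G x \<xi> \<le> P" for x \<xi> unfolding G_def P_def by (rule le_peetre)
  have split: "ennreal_powr t r * ennreal_powr t (1 - r) = t" for t
    using r by (cases "r = 1"; cases t) (auto simp: ennreal_powr_ennreal simp flip: ennreal_mult powr_add)
  have GG: "G x \<xi> \<le> ennreal_powr P (1 - r) * ennreal_powr (G x \<xi>) r" for x \<xi>
  proof (cases "r = 1 \<or> P = 0")
    case True
    then show ?thesis
    proof
      assume "r = 1"
      show ?thesis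
      proof (cases "P = 0")
        case True then show ?thesis using GP[of x \<xi>] by simp
      next
        case False
        then have "ennreal_powr P 0 = 1" using fin by (cases P) (auto simp: ennreal_powr_ennreal)
        then show ?thesis using \<open>r = 1\<close> by simp
      qed
    qed (use GP[of x \<xi>] in simp)
  next
    case False
    then have "ennreal_powr (G x \<xi>) (1 - r) \<le> ennreal_powr P (1 - r)"
      using r by (intro ennreal_powr_mono GP) auto
    from mult_left_mono[OF this, of "ennreal_powr (G x \<xi>) r"] split[of "G x \<xi>"]
    show ?thesis by (simp add: mult.commute)
  qed
  have "P \<le> ennreal C * (ennreal_powr P (1 - r) * ?I)"
    unfolding P_def
  proof (rule peetre_least)
    fix x \<xi>
    let ?J = "jbracket (x - y) ^ N * jbracket (\<xi> - \<eta>) ^ N"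
    have "ennreal (F (x, \<xi>) / ?J) = ennreal (1 / ?J) * ennreal (F (x, \<xi>))"
      using F by (simp flip: ennreal_mult)
    also have "\<dots> \<le> ennreal (1 / ?J) * (ennreal C * (\<integral>\<^sup>+x'. \<integral>\<^sup>+\<xi>'. ennreal (F (x', \<xi>') / (jbracket (x' - x) ^ N * jbracket (\<xi>' - \<xi>) ^ N)) \<partial>lborel \<partial>lborel))"
      by (intro mult_left_mono rep) simp
    \<comment> \<open>The reproducing inequality holds at (x, \<xi>); recentring its kernel at (y,
      \<eta>) costs exactly \<open>?J\<close>, the denominator in the maximal function.\<close>
    also have "\<dots> \<le> ennreal (1 / ?J) * (ennreal C * (\<integral>\<^sup>+x'. \<integral>\<^sup>+\<xi>'. ennreal ?J * G x' \<xi>' \<partial>lborel \<partial>lborel))"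
    proof (intro mult_left_mono nn_integral_mono)
      fix x' \<xi>'
      show "ennreal (F (x', \<xi>') / (jbracket (x' - x) ^ N * jbracket (\<xi>' - \<xi>) ^ N)) \<le> ennreal ?J * G x' \<xi>'"
        unfolding G_def using jbracket_quotient_le[OF F, of "(x', \<xi>')" x' x N \<xi>' \<xi> y \<eta>] F
        by (simp add: ennreal_leI flip: ennreal_mult)
    qed auto
    also have "\<dots> = ennreal C * (\<integral>\<^sup>+x'. \<integral>\<^sup>+\<xi>'. G x' \<xi>' \<partial>lborel \<partial>lborel)"
    proof -
      have "(\<integral>\<^sup>+x'. \<integral>\<^sup>+\<xi>'. ennreal ?J * G x' \<xi>' \<partial>lborel \<partial>lborel) = ennreal ?J * (\<integral>\<^sup>+x'. \<integral>\<^sup>+\<xi>'. G x' \<xi>' \<partial>lborel \<partial>lborel)"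
        by (simp add: nn_integral_cmult)
      moreover have "ennreal (1 / ?J) * ennreal ?J = 1" by (simp flip: ennreal_mult)
      ultimately show ?thesis by (simp add: mult_ac)
    qed
    also have "\<dots> \<le> ennreal C * (\<integral>\<^sup>+x'. \<integral>\<^sup>+\<xi>'. ennreal_powr P (1 - r) * ennreal_powr (G x' \<xi>') r \<partial>lborel \<partial>lborel)"
      by (intro mult_left_mono nn_integral_mono GG) simp
    also have "\<dots> = ennreal C * (ennreal_powr P (1 - r) * ?I)" by (simp add: nn_integral_cmult)
    finally show "ennreal (F (x, \<xi>) / ?J) \<le> ennreal C * (ennreal_powr (peetre N F (y, \<eta>)) (1 - r) * ?I)"
      unfolding P_def .
  qed
  then have "ennreal_powr P r \<le> ennreal C * ?I"
  proof (cases "P = 0")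
    case False
    \<comment> \<open>The surplus power is divided out. It is finite because F is bounded and
      nonzero because P is.\<close>
    define Q where "Q = ennreal_powr P (1 - r)"
    have Q: "Q \<noteq> 0" "Q \<noteq> \<infinity>" unfolding Q_def using False fin by auto
    assume "P \<le> ennreal C * (ennreal_powr P (1 - r) * ?I)"
    then have "ennreal_powr P r * Q \<le> (ennreal C * ?I) * Q" unfolding Q_def split by (simp add: mult_ac)
    then show ?thesis using Q by (simp add: ennreal_mult_le_mult_iff mult.commute[of _ Q])
  qed simp
  also have "?I = (\<integral>\<^sup>+\<xi>. \<integral>\<^sup>+x. ennreal_powr (G x \<xi>) r \<partial>lborel \<partial>lborel)"
    by (rule lborel_pair.Fubini'[symmetric]) measurable
  finally show ?thesis unfolding P_def G_def .
qed

section \<open>Discretised modulation norms\<close>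

text \<open>The auxiliary weight v is replaced by its polynomial bound, and absolute values make the
  constants positive. If m vanished at one point, moderateness would make it vanish at every other
  point, contrary to the last conjunct of \<open>poly_weight\<close>.\<close>

lemma poly_weightE:
  fixes m :: "'a::euclidean_space \<Rightarrow> real"
  assumes "poly_weight m"
  obtains C a where "1 \<le> C" "\<And>x y. m x \<le> C * jbracket (x - y) ^ a * m y" "\<And>x. 0 < m x"
    "m \<in> borel_measurable lebesgue"
proof -
  from assms obtain v where v: "\<And>z. 0 \<le> v z" "polynomial_growth v" "moderate v m"
    and m: "m \<in> borel_measurable lebesgue" "\<And>z. 0 \<le> m z" "\<exists>z. m z \<noteq> 0"
    unfolding poly_weight_def by blast
  from v obtain C0 where C0: "\<And>z w. m (z + w) \<le> C0 * v z * m w" unfolding moderate_def by blast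
  from v obtain D a where D: "\<And>z. v z \<le> D * (1 + norm z) ^ a" unfolding polynomial_growth_def by blast
  define C where "C = \<bar>C0\<bar> * \<bar>D\<bar> + 1"
  have bound: "m x \<le> C * jbracket (x - y) ^ a * m y" for x y
  proof -
    have "m x \<le> C0 * v (x - y) * m y" using C0[of "x - y" y] by simp
    also have "\<dots> \<le> \<bar>C0\<bar> * (\<bar>D\<bar> * jbracket (x - y) ^ a) * m y"
    proof (intro mult_right_mono mult_mono m(2) v(1))
      show "v (x - y) \<le> \<bar>D\<bar> * jbracket (x - y) ^ a"
        by (rule order_trans[OF D]) (simp add: jbracket_def mult_right_mono)
    qed auto
    also have "\<dots> \<le> C * jbracket (x - y) ^ a * m y"
      unfolding mult.assoc[symmetric] C_def by (intro mult_right_mono m(2)) auto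
    finally show ?thesis .
  qed
  from m obtain z0 where z0: "0 < m z0" by (metis less_le)
  have "0 < m x" for x
  proof (rule ccontr)
    assume "\<not> 0 < m x"
    then have "m x = 0" using m(2)[of x] by simp
    then show False using bound[of z0 x] z0 by simp
  qed
  with bound m(1) show thesis by (intro that[of C a]) (auto simp: C_def)
qed

text \<open>The sublevel sets are closed. For finite p this is Fatou's lemma along a convergent
  sequence of parameters, for p = \<infinity> the limit of countably many almost everywhere bounds.
  Measurability in the outer variable is needed where the outer exponent is \<infinity>.\<close>

lemma Lp_norm_param_measurable:
  fixes F :: "'a::euclidean_space \<times> 'b::euclidean_space \<Rightarrow> real"
  assumes p: "0 < p" and c: "continuous_on UNIV F" and F: "\<And>z. 0 \<le> F z"
    and w: "w \<in> borel_measurable lebesgue" "\<And>x. 0 \<le> w x"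
  shows "(\<lambda>\<xi>. Lp_norm lebesgue p (\<lambda>x. ennreal (w x) * ennreal (F (x, \<xi>)))) \<in> borel_measurable borel"
proof (rule borel_measurableI_le)
  fix c0 :: ennreal
  have Fm: "(\<lambda>x. F (x, \<xi>)) \<in> borel_measurable lebesgue" for \<xi>
    by (rule measurable_completion, subst measurable_lborel2, rule borel_measurable_continuous_onI)
      (intro continuous_on_compose2[OF c] continuous_intros, auto)
  note [measurable] = w(1) Fm
  have "closed {\<xi>. Lp_norm lebesgue p (\<lambda>x. ennreal (w x) * ennreal (F (x, \<xi>))) \<le> c0}"
    unfolding closed_sequential_limits
  proof (intro allI impI, elim conjE)
    fix s :: "nat \<Rightarrow> 'b" and \<xi>
    assume s: "\<forall>n. s n \<in> {\<xi>. Lp_norm lebesgue p (\<lambda>x. ennreal (w x) * ennreal (F (x, \<xi>))) \<le> c0}" and lim: "s \<longlonglongrightarrow> \<xi>"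
    have Fl: "(\<lambda>n. F (x, s n)) \<longlonglongrightarrow> F (x, \<xi>)" for x
      using continuous_on_tendsto_compose[OF c tendsto_Pair[OF tendsto_const lim]] by simp
    show "\<xi> \<in> {\<xi>. Lp_norm lebesgue p (\<lambda>x. ennreal (w x) * ennreal (F (x, \<xi>))) \<le> c0}"
    proof (cases "p = \<infinity>")
      case True
      have "AE x in lebesgue. ennreal (w x) * ennreal (F (x, s n)) \<le> c0" for n
        using esssup_AE[of "\<lambda>x. ennreal (w x) * ennreal (F (x, s n))" lebesgue] s True
        by (auto elim: eventually_mono intro: order_trans)
      then have "AE x in lebesgue. \<forall>n. ennreal (w x) * ennreal (F (x, s n)) \<le> c0"
        by (subst AE_all_countable) simp
      then have "AE x in lebesgue. ennreal (w x) * ennreal (F (x, \<xi>)) \<le> c0"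
      proof eventually_elim
        case (elim x)
        have "(\<lambda>n. ennreal (w x * F (x, s n))) \<longlonglongrightarrow> ennreal (w x * F (x, \<xi>))"
          by (intro tendsto_intros Fl)
        moreover have "ennreal (w x) * ennreal (F (x, \<xi>)) = ennreal (w x * F (x, \<xi>))" for \<xi>
          using w(2) F by (simp add: ennreal_mult)
        ultimately show ?case using elim by (auto intro: LIMSEQ_le_const2)
      qed
      then show ?thesis using True by (auto intro!: esssup_I)
    next
      case False
      let ?p = "enn2real p"
      have pp: "0 < ?p" using p False by (intro enn2real_pos)
      define U where "U \<xi> x = ennreal ((w x * F (x, \<xi>)) powr ?p)" for \<xi> x
      have U: "ennreal_powr (ennreal (w x) * ennreal (F (x, \<xi>))) ?p = U \<xi> x" for x \<xi>
        using w(2) F by (simp add: U_def ennreal_powr_ennreal flip: ennreal_mult)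
      have Ul: "(\<lambda>n. U (s n) x) \<longlonglongrightarrow> U \<xi> x" for x
        unfolding U_def using pp w(2) F by (intro tendsto_ennrealI tendsto_powr' tendsto_mult tendsto_const Fl) auto
      have "(\<integral>\<^sup>+x. U \<xi> x \<partial>lebesgue) = (\<integral>\<^sup>+x. liminf (\<lambda>n. U (s n) x) \<partial>lebesgue)"
        by (intro nn_integral_cong) (simp add: lim_imp_Liminf[OF _ Ul])
      also have "\<dots> \<le> liminf (\<lambda>n. \<integral>\<^sup>+x. U (s n) x \<partial>lebesgue)"
        by (rule nn_integral_liminf) (simp add: U_def)
      also have "\<dots> \<le> liminf (\<lambda>n. ennreal_powr c0 ?p)"
        using s False pp by (intro Liminf_mono always_eventually) (simp add: Lp_norm_finite U ennreal_powr_le_swap)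
      also have "\<dots> = ennreal_powr c0 ?p" by (rule Liminf_const) simp
      finally show ?thesis using False pp by (simp add: Lp_norm_finite U ennreal_powr_le_swap)
    qed
  qed
  then have "{\<xi>. Lp_norm lebesgue p (\<lambda>x. ennreal (w x) * ennreal (F (x, \<xi>))) \<le> c0} \<in> sets borel"
    by (rule borel_closed)
  then show "{\<xi> \<in> space borel. Lp_norm lebesgue p (\<lambda>x. ennreal (w x) * ennreal (F (x, \<xi>))) \<le> c0} \<in> sets borel"
    by (simp only: space_borel UNIV_I simp_thms)
qed

section \<open>Summability and Young's inequality on the lattice\<close>

lemma Lp_norm_count_bij:
  assumes "bij_betw g A B" "0 < p"
  shows "Lp_norm (count_space A) p (\<lambda>k. f (g k)) = Lp_norm (count_space B) p f"
proof (cases "p = \<infinity>")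
  case True
  then show ?thesis using bij_betw_imp_surj_on[OF assms(1)] by (auto simp: esssup_count_space image_image)
next
  case False
  then show ?thesis using nn_integral_bij_count_space[OF assms(1), of "\<lambda>x. ennreal_powr (f x) (enn2real p)"] by (simp add: Lp_norm_finite)
qed

lemma bij_lattice_shift: "i \<in> lattice \<Longrightarrow> bij_betw (\<lambda>k. k + i) lattice lattice"
  by (rule bij_betwI[where g = "\<lambda>k. k - i"]) auto

lemma bij_lattice_uminus: "bij_betw uminus lattice lattice"
  by (rule bij_betwI[where g = uminus]) auto

text \<open>The sum is the integral of a step function, and on each cube the bracket at the corner
  is comparable to the bracket at the point.\<close>

lemma lattice_sum_finite:
  "(\<integral>\<^sup>+k. ennreal (1 / jbracket k ^ (DIM('a::euclidean_space) + 2)) \<partial>count_space (lattice :: 'a set)) < \<infinity>"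
proof -
  let ?d = "DIM('a) + 2" and ?J = "1 + real DIM('a)"
  have "(\<integral>\<^sup>+k. ennreal (1 / jbracket k ^ ?d) \<partial>count_space (lattice :: 'a set)) = (\<integral>\<^sup>+x. ennreal (1 / jbracket (lfloor x) ^ ?d) \<partial>(lborel :: 'a measure))"
    by (rule nn_integral_step[symmetric]) simp
  also have "\<dots> \<le> (\<integral>\<^sup>+x. ennreal (?J ^ ?d) * ennreal (1 / jbracket x ^ ?d) \<partial>(lborel :: 'a measure))"
  proof (rule nn_integral_mono)
    fix x :: 'a
    have "jbracket x \<le> jbracket (lfloor x) * ?J"
      using jbracket_add[of "lfloor x" "x - lfloor x"] jbracket_lfloor[of x]
      by (auto intro: order_trans mult_left_mono)
    then have "jbracket x ^ ?d \<le> (jbracket (lfloor x) * ?J) ^ ?d" by (intro power_mono) auto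
    then have "1 / jbracket (lfloor x) ^ ?d \<le> ?J ^ ?d * (1 / jbracket x ^ ?d)"
      unfolding power_mult_distrib by (subst divide_le_eq) (simp_all add: le_divide_eq mult.commute)
    then show "ennreal (1 / jbracket (lfloor x) ^ ?d) \<le> ennreal (?J ^ ?d) * ennreal (1 / jbracket x ^ ?d)"
      by (subst ennreal_mult[symmetric]) (auto intro: ennreal_leI)
  qed
  also have "\<dots> = ennreal (?J ^ ?d) * (\<integral>\<^sup>+x. ennreal (1 / jbracket x ^ ?d) \<partial>(lborel :: 'a measure))"
    by (rule nn_integral_cmult) simp
  also have "\<dots> < \<infinity>"
  proof -
    have "(\<integral>\<^sup>+x. ennreal (norm (1 / jbracket x ^ ?d)) \<partial>(lborel :: 'a measure)) < \<infinity>"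
      using integrable_jbracket[where 'a = 'a] unfolding integrable_iff_bounded by blast
    then show ?thesis by (simp add: ennreal_mult_less_top)
  qed
  finally show ?thesis .
qed

lemma lattice_Lp_finite:
  assumes "0 < r" "real (DIM('a::euclidean_space) + 2) \<le> r * real M"
  shows "Lp_norm (count_space (lattice :: 'a set)) (ennreal r) (\<lambda>k. ennreal (1 / jbracket k ^ M)) < \<infinity>"
proof -
  have "(\<integral>\<^sup>+k. ennreal_powr (ennreal (1 / jbracket k ^ M)) r \<partial>count_space (lattice :: 'a set))
    \<le> (\<integral>\<^sup>+k. ennreal (1 / jbracket k ^ (DIM('a) + 2)) \<partial>count_space (lattice :: 'a set))"
  proof (rule nn_integral_mono)
    fix k :: 'a
    have "jbracket k powr real (DIM('a) + 2) \<le> jbracket k powr (r * real M)"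
      using assms(2) by (intro powr_mono) auto
    then have "1 / jbracket k powr (r * real M) \<le> 1 / jbracket k powr real (DIM('a) + 2)"
      by (intro divide_left_mono mult_pos_pos) auto
    moreover have "(1 / jbracket k ^ M) powr r = 1 / jbracket k powr (r * real M)"
      by (simp add: powr_divide powr_powr mult.commute flip: powr_realpow)
    moreover have "jbracket k powr real (DIM('a) + 2) = jbracket k ^ (DIM('a) + 2)"
      by (rule powr_realpow) simp
    ultimately show "ennreal_powr (ennreal (1 / jbracket k ^ M)) r \<le> ennreal (1 / jbracket k ^ (DIM('a) + 2))"
      by (simp only: ennreal_powr_ennreal zero_le_divide_1_iff zero_le_power jbracket_nonneg) (rule ennreal_leI)
  qed
  also have "\<dots> < \<infinity>" by (rule lattice_sum_finite)
  finally have "(\<integral>\<^sup>+k. ennreal_powr (ennreal (1 / jbracket k ^ M)) r \<partial>count_space (lattice :: 'a set)) \<noteq> top" by simp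
  then have "Lp_norm (count_space (lattice :: 'a set)) (ennreal r) (\<lambda>k. ennreal (1 / jbracket k ^ M)) \<noteq> top"
    using assms by (simp add: Lp_norm_finite)
  then show ?thesis by (simp add: less_top)
qed

text \<open>Since r \<le> p, Minkowski moves the l^p norm inside the l^r norm, where it is
  translation invariant. The condition that g is not zero keeps the right side \<infinity> when V
  has infinite norm, because 0 * \<infinity> = 0.\<close>

lemma lattice_young:
  assumes r: "0 < r" "r \<le> p" "r \<noteq> \<infinity>" and g: "\<And>j. g j < \<infinity>" "lnorm r g \<noteq> 0"
  shows "lnorm p (\<lambda>k. lnorm r (\<lambda>j. g j * V (k + j)))
    \<le> lnorm r g * lnorm p (V :: 'a::euclidean_space \<Rightarrow> ennreal)"
proof -
  have p: "0 < p" using r by auto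
  let ?V = "lnorm p V"
  show ?thesis
  proof (cases "?V = \<infinity>")
    case True
    then show ?thesis using g(2) by (simp add: ennreal_mult_top)
  next
    case False
    have "lnorm p (\<lambda>k. lnorm r (\<lambda>j. g j * V (k + j)))
      \<le> lnorm r (\<lambda>j. lnorm p (\<lambda>k. g j * V (k + j)))"
      by (rule Lp_norm_swap) (use r countable_lattice in auto)
    also have "\<dots> \<le> lnorm r (\<lambda>j. ?V * g j)"
    proof (rule Lp_norm_count_mono[OF r(1)])
      fix j :: 'a assume j: "j \<in> lattice"
      have "lnorm p (\<lambda>k. g j * V (k + j)) \<le> g j * lnorm p (\<lambda>k. V (k + j))"
        by (rule Lp_norm_cmult) (use p g in auto)
      also have "lnorm p (\<lambda>k. V (k + j)) = ?V"
        by (rule Lp_norm_count_bij[OF bij_lattice_shift[OF j] p])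
      finally show "lnorm p (\<lambda>k. g j * V (k + j)) \<le> ?V * g j" by (simp add: mult.commute)
    qed
    also have "\<dots> \<le> ?V * lnorm r g"
      by (rule Lp_norm_cmult) (use r False in \<open>auto simp: less_top\<close>)
    finally show ?thesis by (simp add: mult.commute)
  qed
qed

text \<open>The one-variable inequality used twice: for fixed n and i in the variable k, and then in
  n for the sequence of inner norms.\<close>

lemma lattice_young2:
  fixes V :: "'a::euclidean_space \<times> 'b::euclidean_space \<Rightarrow> ennreal"
  assumes r: "0 < r" "r \<le> p" "r \<le> q" "r \<noteq> \<infinity>"
    and g: "\<And>j. g j < \<infinity>" "lnorm r g \<noteq> 0" "lnorm r g < \<infinity>"
    and h: "\<And>j. h j < \<infinity>" "lnorm r h \<noteq> 0"
  shows "lnorm q (\<lambda>n. lnorm p (\<lambda>k.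
      lnorm r (\<lambda>i. lnorm r (\<lambda>j. g j * h i * V (k + j, n + i)))))
    \<le> lnorm r g * lnorm r h
      * lnorm q (\<lambda>n. lnorm p (\<lambda>k. V (k, n)))"
proof -
  have p: "0 < p" and q: "0 < q" using r by auto
  let ?G = "lnorm r g"
  define V2 where "V2 n = lnorm p (\<lambda>k. V (k, n))" for n
  have "lnorm p (\<lambda>k. lnorm r (\<lambda>i. lnorm r (\<lambda>j. g j * h i * V (k + j, n + i))))
     \<le> lnorm r (\<lambda>i. h i * (?G * V2 (n + i)))" for n
  proof -
    have "lnorm p (\<lambda>k. lnorm r (\<lambda>i. lnorm r (\<lambda>j. g j * h i * V (k + j, n + i))))
      \<le> lnorm r (\<lambda>i. lnorm p (\<lambda>k. lnorm r (\<lambda>j. g j * h i * V (k + j, n + i))))"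
      by (rule Lp_norm_swap) (use r p countable_lattice in auto)
    also have "\<dots> \<le> lnorm r (\<lambda>i. h i * (?G * V2 (n + i)))"
    proof (rule Lp_norm_count_mono[OF r(1)])
      fix i
      have "lnorm p (\<lambda>k. lnorm r (\<lambda>j. g j * h i * V (k + j, n + i)))
        \<le> lnorm p (\<lambda>k. h i * lnorm r (\<lambda>j. g j * V (k + j, n + i)))"
        by (rule Lp_norm_count_mono[OF p], rule order_trans[OF _ Lp_norm_cmult[OF r(1) h(1)]])
          (simp_all add: mult_ac)
      also have "\<dots> \<le> h i * lnorm p (\<lambda>k. lnorm r (\<lambda>j. g j * V (k + j, n + i)))"
        by (rule Lp_norm_cmult) (use p h in auto)
      also have "\<dots> \<le> h i * (?G * V2 (n + i))"
        unfolding V2_def using r g by (intro mult_left_mono lattice_young[where V = "\<lambda>k. V (k, n + i)"]) auto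
      finally show "lnorm p (\<lambda>k. lnorm r (\<lambda>j. g j * h i * V (k + j, n + i)))
        \<le> h i * (?G * V2 (n + i))" .
    qed
    finally show ?thesis .
  qed
  then have "lnorm q (\<lambda>n. lnorm p (\<lambda>k.
      lnorm r (\<lambda>i. lnorm r (\<lambda>j. g j * h i * V (k + j, n + i)))))
    \<le> lnorm q (\<lambda>n. lnorm r (\<lambda>i. h i * (?G * V2 (n + i))))"
    by (intro Lp_norm_count_mono q)
  also have "\<dots> \<le> lnorm r h * lnorm q (\<lambda>n. ?G * V2 n)"
    by (rule lattice_young) (use r h in auto)
  also have "\<dots> \<le> lnorm r h * (?G * lnorm q V2)"
    by (intro mult_left_mono Lp_norm_cmult q g) auto
  finally show ?thesis unfolding V2_def[abs_def] by (simp only: mult_ac)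
qed

text \<open>The discrete counterpart of \<open>modulation_norm\<close> for the weight
  \<open>w \<otimes>\<^sub>w u\<close>, with the time sum inside. It is applied to maximal
  functions, whose lattice values control the whole function.\<close>

definition lattice_norm :: "ennreal \<Rightarrow> ennreal \<Rightarrow> ('a::euclidean_space \<Rightarrow> real) \<Rightarrow> ('a \<Rightarrow> real) \<Rightarrow> ('a \<times> 'a \<Rightarrow> ennreal) \<Rightarrow> ennreal" where
  "lattice_norm p q w u P = lnorm q (\<lambda>n. lnorm p (\<lambda>k. ennreal (w k * u n) * P (k, n)))"

lemma lattice_norm_mono:
  assumes "0 < p" "0 < q" "\<And>k n. k \<in> lattice \<Longrightarrow> n \<in> lattice \<Longrightarrow> P (k, n) \<le> Q (k, n)"
  shows "lattice_norm p q w u P \<le> lattice_norm p q w u Q"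
  unfolding lattice_norm_def by (intro Lp_norm_count_mono assms mult_left_mono) auto

lemma lattice_norm_cmult:
  assumes "0 < p" "0 < q" "c < \<infinity>"
  shows "lattice_norm p q w u (\<lambda>z. c * P z) \<le> c * lattice_norm p q w u P"
proof -
  have "lattice_norm p q w u (\<lambda>z. c * P z) \<le> lnorm q (\<lambda>n. c * lnorm p (\<lambda>k. ennreal (w k * u n) * P (k, n)))"
    unfolding lattice_norm_def
    by (rule Lp_norm_count_mono[OF assms(2)], rule order_trans[OF _ Lp_norm_cmult[OF assms(1,3)]]) (simp add: mult_ac)
  also have "\<dots> \<le> c * lattice_norm p q w u P"
    unfolding lattice_norm_def by (rule Lp_norm_cmult[OF assms(2,3)])
  finally show ?thesis .
qed

section \<open>Modulation norms against lattice norms\<close>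

lemma modulation_norm_regular:
  fixes \<phi> f :: "'a::euclidean_space \<Rightarrow> complex"
  assumes "schwartz \<phi>" "schwartz f" and p: "0 < p" and w: "\<And>x. 0 < w x" and u: "\<And>x. 0 < u x"
  shows "modulation_norm \<phi> p q (w \<otimes>\<^sub>w u) (regular_distr f)
    = Lp_norm lebesgue q (\<lambda>\<xi>. ennreal (u \<xi>) * Lp_norm lebesgue p (\<lambda>x. ennreal (w x) * ennreal (cmod (stft_fun \<phi> f (x, \<xi>)))))"
proof -
  have "Lp_norm lebesgue p (\<lambda>x. ennreal (cmod (stft \<phi> (regular_distr f) x \<xi>) * (w \<otimes>\<^sub>w u) (x, \<xi>)))
    = ennreal (u \<xi>) * Lp_norm lebesgue p (\<lambda>x. ennreal (w x) * ennreal (cmod (stft_fun \<phi> f (x, \<xi>))))" for \<xi>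
  proof -
    have "ennreal (cmod (stft \<phi> (regular_distr f) x \<xi>) * (w \<otimes>\<^sub>w u) (x, \<xi>)) = ennreal (u \<xi>) * (ennreal (w x) * ennreal (cmod (stft_fun \<phi> f (x, \<xi>))))" for x
      using w[of x] u[of \<xi>] by (simp add: stft_regular[OF assms(1,2)] tensor_def mult_ac flip: ennreal_mult)
    then show ?thesis using Lp_norm_cmult_eq[OF p, of "ennreal (u \<xi>)" lebesgue] u[of \<xi>] by simp
  qed
  then show ?thesis unfolding modulation_norm_def by simp
qed

text \<open>Every point is moved to the corner of its cube. Weights are moderate and the maximal
  function varies slowly, so this costs only a constant, for every order N.\<close>

lemma modulation_norm_le_lattice_norm:
  fixes \<phi> :: "'a::euclidean_space \<Rightarrow> complex"
  assumes \<phi>: "schwartz \<phi>" and p: "0 < p" and q: "0 < q" and w: "poly_weight w" and u: "poly_weight u"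
  obtains C where "0 < C" "\<And>f. schwartz f \<Longrightarrow> modulation_norm \<phi> p q (w \<otimes>\<^sub>w u) (regular_distr f)
    \<le> ennreal C * lattice_norm p q w u (peetre N (\<lambda>z. cmod (stft_fun \<phi> f z)))"
proof -
  obtain Cw a where w: "1 \<le> Cw" "\<And>x y. w x \<le> Cw * jbracket (x - y) ^ a * w y" "\<And>x. 0 < w x" "w \<in> borel_measurable lebesgue"
    using poly_weightE[OF w] by blast
  obtain Cu b where u: "1 \<le> Cu" "\<And>x y. u x \<le> Cu * jbracket (x - y) ^ b * u y" "\<And>x. 0 < u x" "u \<in> borel_measurable lebesgue"
    using poly_weightE[OF u] by blast
  define J where "J = 1 + real DIM('a)"
  have J: "jbracket (x - lfloor x) \<le> J" "0 < J" for x :: 'a using jbracket_lfloor[of x] by (auto simp: J_def)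
  \<comment> \<open>The first two factors come from moving the weights over a distance with bracket
    at most J, the last from moving the maximal function in both variables.\<close>
  define C where "C = (Cw * J ^ a) * (Cu * J ^ b) * (J ^ N * J ^ N)"
  have C: "0 < C" unfolding C_def using J(2) w(1) u(1) by (intro mult_pos_pos zero_less_power) auto
  have "modulation_norm \<phi> p q (w \<otimes>\<^sub>w u) (regular_distr f)
    \<le> ennreal C * lattice_norm p q w u (peetre N (\<lambda>z. cmod (stft_fun \<phi> f z)))" if f: "schwartz f" for f
  proof -
    define F where "F z = cmod (stft_fun \<phi> f z)" for z
    have Fc: "continuous_on UNIV F" unfolding F_def
      by (intro continuous_intros schwartz_continuous schwartz_stft_fun \<phi> f)
    have F0: "0 \<le> F z" for z by (simp add: F_def)
    define c where "c k n = ennreal C * (ennreal (w k * u n) * peetre N F (k, n))" for k n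
    have le: "ennreal (u \<xi>) * (ennreal (w x) * ennreal (F (x, \<xi>))) \<le> c (lfloor x) (lfloor \<xi>)" for x \<xi>
    proof -
      let ?k = "lfloor x" and ?n = "lfloor \<xi>"
      have "ennreal (F (x, \<xi>)) \<le> peetre N F (x, \<xi>)" using le_peetre[of F x \<xi> x N \<xi>] by (simp add: jbracket_def)
      also have "\<dots> \<le> ennreal (jbracket (x - ?k) ^ N * jbracket (\<xi> - ?n) ^ N) * peetre N F (?k, ?n)"
        by (rule peetre_shift[OF F0])
      also have "\<dots> \<le> ennreal (J ^ N * J ^ N) * peetre N F (?k, ?n)"
        using J by (intro mult_right_mono ennreal_leI mult_mono power_mono) (auto intro: less_imp_le)
      finally have 1: "ennreal (F (x, \<xi>)) \<le> ennreal (J ^ N * J ^ N) * peetre N F (?k, ?n)" .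
      have "w x \<le> Cw * J ^ a * w ?k"
        using w(1) w(3)[of ?k] J by (intro order_trans[OF w(2)[of x ?k]] mult_right_mono mult_left_mono power_mono) auto
      moreover have "u \<xi> \<le> Cu * J ^ b * u ?n"
        using u(1) u(3)[of ?n] J by (intro order_trans[OF u(2)[of \<xi> ?n]] mult_right_mono mult_left_mono power_mono) auto
      ultimately have "u \<xi> * w x \<le> (Cu * J ^ b * u ?n) * (Cw * J ^ a * w ?k)"
        using w(3)[of x] u(3)[of \<xi>] w(1) u(1) w(3)[of ?k] u(3)[of ?n] J(2)
        by (intro mult_mono mult_nonneg_nonneg) (auto intro: less_imp_le)
      then have 2: "ennreal (u \<xi>) * ennreal (w x) \<le> ennreal ((Cw * J ^ a) * (Cu * J ^ b) * (w ?k * u ?n))"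
        using w(3)[of x] u(3)[of \<xi>] by (simp add: mult_ac ennreal_leI flip: ennreal_mult)
      have "ennreal (u \<xi>) * (ennreal (w x) * ennreal (F (x, \<xi>)))
        \<le> ennreal ((Cw * J ^ a) * (Cu * J ^ b) * (w ?k * u ?n)) * (ennreal (J ^ N * J ^ N) * peetre N F (?k, ?n))"
        unfolding mult.assoc[symmetric, of "ennreal (u \<xi>)"] by (rule mult_mono[OF 2 1]) auto
      also have "ennreal ((Cw * J ^ a) * (Cu * J ^ b) * (w ?k * u ?n)) = ennreal ((Cw * J ^ a) * (Cu * J ^ b)) * ennreal (w ?k * u ?n)"
        using w(1) u(1) w(3)[of ?k] u(3)[of ?n] J(2) by (intro ennreal_mult mult_nonneg_nonneg) (auto intro: less_imp_le)
      also have "ennreal ((Cw * J ^ a) * (Cu * J ^ b)) * ennreal (w ?k * u ?n) * (ennreal (J ^ N * J ^ N) * peetre N F (?k, ?n))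
        = (ennreal ((Cw * J ^ a) * (Cu * J ^ b)) * ennreal (J ^ N * J ^ N)) * (ennreal (w ?k * u ?n) * peetre N F (?k, ?n))"
        by (simp only: mult_ac)
      also have "ennreal ((Cw * J ^ a) * (Cu * J ^ b)) * ennreal (J ^ N * J ^ N) = ennreal C"
        unfolding C_def using w(1) u(1) J(2) by (intro ennreal_mult[symmetric] mult_nonneg_nonneg) auto
      finally show ?thesis unfolding c_def .
    qed
    have Fm: "(\<lambda>x. F (x, \<xi>)) \<in> borel_measurable lebesgue" for \<xi>
      by (rule measurable_completion, subst measurable_lborel2, rule borel_measurable_continuous_onI)
        (intro continuous_on_compose2[OF Fc] continuous_intros, auto)
    define g where "g \<xi> = Lp_norm lebesgue p (\<lambda>x. ennreal (w x) * ennreal (F (x, \<xi>)))" for \<xi>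
    have gm: "g \<in> borel_measurable lebesgue" unfolding g_def
      by (rule measurable_completion, subst measurable_lborel2, rule Lp_norm_param_measurable[OF p Fc F0 w(4)])
        (simp add: less_imp_le w)
    have "ennreal (u \<xi>) * g \<xi> \<le> lnorm p (\<lambda>k. c k (lfloor \<xi>))" for \<xi>
    proof -
      have "ennreal (u \<xi>) * g \<xi> = Lp_norm lebesgue p (\<lambda>x. ennreal (u \<xi>) * (ennreal (w x) * ennreal (F (x, \<xi>))))"
        unfolding g_def by (rule Lp_norm_cmult_eq[symmetric]) (use p u in auto)
      also have "\<dots> \<le> lnorm p (\<lambda>k. c k (lfloor \<xi>))"
        by (rule Lp_norm_le_step) (use p le w(4) Fm in auto)
      finally show ?thesis .
    qed
    then have "Lp_norm lebesgue q (\<lambda>\<xi>. ennreal (u \<xi>) * g \<xi>) \<le> lnorm q (\<lambda>n. lnorm p (\<lambda>k. c k n))"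
      by (rule Lp_norm_le_step[OF q]) (use u(4) gm in auto)
    also have "\<dots> = lattice_norm p q w u (\<lambda>z. ennreal C * peetre N F z)"
      unfolding lattice_norm_def c_def by (simp only: mult_ac)
    also have "\<dots> \<le> ennreal C * lattice_norm p q w u (peetre N F)" by (rule lattice_norm_cmult) (use p q in auto)
    finally show ?thesis unfolding modulation_norm_regular[OF \<phi> f p w(3) u(3)] g_def F_def .
  qed
  with C show thesis by (rule that)
qed

text \<open>In the reproducing inequality the kernel is given the order N + DIM + 2: the part of
  order N turns F into its maximal function, and the rest is integrable. The pointwise bound so
  obtained passes to the supremum by slow variation.\<close>

lemma peetre_window_change:
  fixes \<phi> \<psi> :: "'a::euclidean_space \<Rightarrow> complex"
  assumes \<phi>: "schwartz \<phi>" and nz: "\<phi> t0 \<noteq> 0" and \<psi>: "schwartz \<psi>"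
  obtains C where "0 < C" "\<And>f z. schwartz f \<Longrightarrow> peetre N (\<lambda>z. cmod (stft_fun \<psi> f z)) z \<le> ennreal C * peetre N (\<lambda>z. cmod (stft_fun \<phi> f z)) z"
proof -
  let ?d = "DIM('a) + 2"
  obtain C0 where C0: "0 < C0" "\<And>f y \<eta>. schwartz f \<Longrightarrow> ennreal (cmod (stft_fun \<psi> f (y, \<eta>)))
    \<le> ennreal C0 * (\<integral>\<^sup>+x. \<integral>\<^sup>+\<xi>. ennreal (cmod (stft_fun \<phi> f (x, \<xi>)) / (jbracket (x - y) ^ (N + ?d) * jbracket (\<xi> - \<eta>) ^ (N + ?d))) \<partial>lborel \<partial>lborel)"
    using stft_fun_reproducing[OF \<phi> nz \<psi>] by blast
  define I where "I = (\<integral>\<^sup>+x. ennreal (1 / jbracket x ^ ?d) \<partial>(lborel :: 'a measure))"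
  have "(\<integral>\<^sup>+x. ennreal (norm (1 / jbracket x ^ ?d)) \<partial>(lborel :: 'a measure)) < \<infinity>"
    using integrable_jbracket[where 'a = 'a] unfolding integrable_iff_bounded by blast
  then have "I < \<infinity>" by (simp add: I_def)
  then obtain I' where I': "I = ennreal I'" "0 \<le> I'" by (cases I) auto
  have Iy: "(\<integral>\<^sup>+x. ennreal (1 / jbracket (x - y) ^ ?d) \<partial>(lborel :: 'a measure)) = I" for y
    using lborel_nn_integral_translate[of "\<lambda>x. ennreal (1 / jbracket x ^ ?d)" "- y"] by (simp add: I_def)
  \<comment> \<open>The summand 1 makes the constant positive without a lower bound for I'.\<close>
  define C where "C = C0 * (I' * I') + 1"
  have C: "0 < C" using C0(1) I' by (auto simp: C_def intro!: add_nonneg_pos)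
  have "peetre N (\<lambda>z. cmod (stft_fun \<psi> f z)) (y, \<eta>) \<le> ennreal C * peetre N (\<lambda>z. cmod (stft_fun \<phi> f z)) (y, \<eta>)"
    if f: "schwartz f" for f y \<eta>
  proof -
    let ?F = "\<lambda>z. cmod (stft_fun \<phi> f z)"
    have pt: "ennreal (cmod (stft_fun \<psi> f (y, \<eta>))) \<le> ennreal C * peetre N ?F (y, \<eta>)" for y \<eta>
    proof -
      have "ennreal (cmod (stft_fun \<psi> f (y, \<eta>)))
        \<le> ennreal C0 * (\<integral>\<^sup>+x. \<integral>\<^sup>+\<xi>. ennreal (cmod (stft_fun \<phi> f (x, \<xi>)) / (jbracket (x - y) ^ (N + ?d) * jbracket (\<xi> - \<eta>) ^ (N + ?d))) \<partial>lborel \<partial>lborel)"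
        by (rule C0(2)[OF f])
      also have "\<dots> \<le> ennreal C0 * (\<integral>\<^sup>+x. \<integral>\<^sup>+\<xi>. peetre N ?F (y, \<eta>) * ennreal (1 / jbracket (x - y) ^ ?d) * ennreal (1 / jbracket (\<xi> - \<eta>) ^ ?d) \<partial>lborel \<partial>lborel)"
      proof (intro mult_left_mono nn_integral_mono)
        fix x \<xi>
        have "ennreal (?F (x, \<xi>) / (jbracket (x - y) ^ (N + ?d) * jbracket (\<xi> - \<eta>) ^ (N + ?d)))
          = ennreal (?F (x, \<xi>) / (jbracket (x - y) ^ N * jbracket (\<xi> - \<eta>) ^ N)) * ennreal (1 / jbracket (x - y) ^ ?d) * ennreal (1 / jbracket (\<xi> - \<eta>) ^ ?d)"
          by (simp add: power_add mult_ac flip: ennreal_mult)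
        also have "\<dots> \<le> peetre N ?F (y, \<eta>) * ennreal (1 / jbracket (x - y) ^ ?d) * ennreal (1 / jbracket (\<xi> - \<eta>) ^ ?d)"
          by (intro mult_right_mono le_peetre) auto
        finally show "ennreal (?F (x, \<xi>) / (jbracket (x - y) ^ (N + ?d) * jbracket (\<xi> - \<eta>) ^ (N + ?d))) \<le> \<dots>" .
      qed simp
      also have "\<dots> = ennreal C0 * (peetre N ?F (y, \<eta>) * I * I)"
      proof -
        have "(\<integral>\<^sup>+x. \<integral>\<^sup>+\<xi>. peetre N ?F (y, \<eta>) * ennreal (1 / jbracket (x - y) ^ ?d) * ennreal (1 / jbracket (\<xi> - \<eta>) ^ ?d) \<partial>lborel \<partial>lborel)
          = (\<integral>\<^sup>+x. (peetre N ?F (y, \<eta>) * I) * ennreal (1 / jbracket (x - y) ^ ?d) \<partial>lborel)"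
          by (subst nn_integral_cmult) (simp_all only: Iy mult_ac, measurable)
        also have "\<dots> = peetre N ?F (y, \<eta>) * I * I"
          by (subst nn_integral_cmult) (simp_all only: Iy, measurable)
        finally show ?thesis by simp
      qed
      also have "\<dots> = ennreal (C0 * (I' * I')) * peetre N ?F (y, \<eta>)"
        using I' C0(1) by (simp add: ennreal_mult mult_ac)
      also have "\<dots> \<le> ennreal C * peetre N ?F (y, \<eta>)" by (intro mult_right_mono ennreal_leI) (auto simp: C_def)
      finally show ?thesis .
    qed
    show ?thesis
    proof (rule peetre_least)
      fix x \<xi>
      let ?J = "jbracket (x - y) ^ N * jbracket (\<xi> - \<eta>) ^ N"
      have "ennreal (cmod (stft_fun \<psi> f (x, \<xi>)) / ?J) = ennreal (1 / ?J) * ennreal (cmod (stft_fun \<psi> f (x, \<xi>)))"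
        by (simp flip: ennreal_mult)
      also have "\<dots> \<le> ennreal (1 / ?J) * (ennreal C * (ennreal ?J * peetre N ?F (y, \<eta>)))"
        by (intro mult_left_mono order_trans[OF pt] peetre_shift) auto
      also have "\<dots> = (ennreal (1 / ?J) * ennreal ?J) * (ennreal C * peetre N ?F (y, \<eta>))" by (simp only: mult_ac)
      also have "ennreal (1 / ?J) * ennreal ?J = 1" by (simp flip: ennreal_mult)
      finally show "ennreal (cmod (stft_fun \<psi> f (x, \<xi>)) / ?J) \<le> ennreal C * peetre N ?F (y, \<eta>)" by simp
    qed
  qed
  with C show thesis by (intro that[of C]) auto
qed

text \<open>The L^r norm of F on the product of the unit cubes at k and n. Unlike a value of F at
  one point, it can be summed back to an integral norm of F.\<close>

definition local_mean :: "ennreal \<Rightarrow> ('a::euclidean_space \<times> 'a \<Rightarrow> real) \<Rightarrow> 'a \<times> 'a \<Rightarrow> ennreal" where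
  "local_mean r F = (\<lambda>(k, n). Lp_norm lborel r (\<lambda>\<xi>. Lp_norm lborel r (\<lambda>x. ennreal (F (x, \<xi>)) * indicator (cube k) x) * indicator (cube n) \<xi>))"

lemma local_mean_measurable:
  fixes F :: "'a::euclidean_space \<times> 'a \<Rightarrow> real"
  assumes "r \<noteq> \<infinity>" and c: "continuous_on UNIV F"
  shows "(\<lambda>\<xi>. Lp_norm lborel r (\<lambda>x. ennreal (F (x, \<xi>)) * indicator (cube k) x)) \<in> borel_measurable borel"
proof -
  have [measurable]: "F \<in> borel_measurable (borel \<Otimes>\<^sub>M borel)"
    unfolding borel_prod by (rule borel_measurable_continuous_onI[OF c])
  have "(\<lambda>\<xi>. \<integral>\<^sup>+x. ennreal_powr (ennreal (F (x, \<xi>)) * indicator (cube k) x) (enn2real r) \<partial>lborel) \<in> borel_measurable borel"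
    by (rule lborel.borel_measurable_nn_integral) measurable
  then show ?thesis using assms(1) by (simp add: Lp_norm_finite)
qed

lemma indicator_powr: "0 < a \<Longrightarrow> ennreal_powr (t * indicator A x) a = ennreal_powr t a * indicator A x"
  by (simp split: split_indicator)

text \<open>The self-improved inequality is split into cubes, on each of which the kernel equals its
  value at the corner up to the factor (1 + DIM) ^ N per variable. Taking the r-th root at the end
  produces \<open>C powr (1 / r)\<close>.\<close>

lemma peetre_le_local_means:
  fixes F :: "'a::euclidean_space \<times> 'a \<Rightarrow> real"
  assumes F: "\<And>z. 0 \<le> F z" and B: "\<And>z. F z \<le> B" and c: "continuous_on UNIV F" and C: "0 < C"
    and rep: "\<And>y \<eta>. ennreal (F (y, \<eta>)) \<le> ennreal C * (\<integral>\<^sup>+x. \<integral>\<^sup>+\<xi>. ennreal (F (x, \<xi>) / (jbracket (x - y) ^ N * jbracket (\<xi> - \<eta>) ^ N)) \<partial>lborel \<partial>lborel)"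
    and r: "0 < r" "r \<le> 1" and kn: "k \<in> lattice" "n \<in> lattice"
  shows "peetre N F (k, n) \<le> ennreal (C powr (1 / r) * ((1 + real DIM('a)) ^ N * (1 + real DIM('a)) ^ N))
    * lnorm (ennreal r) (\<lambda>i. lnorm (ennreal r) (\<lambda>j.
        ennreal (1 / jbracket j ^ N) * ennreal (1 / jbracket i ^ N) * local_mean (ennreal r) F (k + j, n + i)))"
proof -
  define J where "J = (1 + real DIM('a)) ^ N"
  have J: "0 < J" by (simp add: J_def)
  have r': "enn2real (ennreal r) = r" using r by simp
  \<comment> \<open>The r-th power of the kernel bound on a whole cube, as a function of the lattice
    displacement j.\<close>
  define \<gamma> where "\<gamma> j = ennreal_powr (ennreal (J * (1 / jbracket j ^ N))) r" for j :: 'a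
  define b where "b k' n' = (\<integral>\<^sup>+\<xi>. (\<integral>\<^sup>+x. ennreal_powr (ennreal (F (x, \<xi>))) r * indicator (cube k') x \<partial>lborel) * indicator (cube n') \<xi> \<partial>lborel)" for k' n'
  have [measurable]: "F \<in> borel_measurable (borel \<Otimes>\<^sub>M borel)"
    unfolding borel_prod by (rule borel_measurable_continuous_onI[OF c])
  define G where "G x \<xi> = ennreal_powr (ennreal (F (x, \<xi>) / (jbracket (x - k) ^ N * jbracket (\<xi> - n) ^ N))) r" for x \<xi>
  have [measurable]: "(\<lambda>(x, \<xi>). G x \<xi>) \<in> borel_measurable (borel \<Otimes>\<^sub>M borel)"
    unfolding G_def by measurable
  have brk: "1 / jbracket (x - k) ^ N \<le> J * (1 / jbracket (lfloor x - k) ^ N)" for x k :: 'a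
  proof -
    have "jbracket (lfloor x - k) \<le> jbracket (lfloor x - x) * jbracket (x - k)" by (rule jbracket_triangle)
    also have "\<dots> \<le> (1 + real DIM('a)) * jbracket (x - k)"
      using jbracket_lfloor[of x] by (intro mult_right_mono) (auto simp: jbracket_minus_commute)
    finally have "jbracket (lfloor x - k) ^ N \<le> ((1 + real DIM('a)) * jbracket (x - k)) ^ N" by (intro power_mono) auto
    then show ?thesis unfolding J_def power_mult_distrib by (simp add: divide_le_eq le_divide_eq mult.commute)
  qed
  have GG: "G x \<xi> \<le> \<gamma> (lfloor x - k) * \<gamma> (lfloor \<xi> - n) * ennreal_powr (ennreal (F (x, \<xi>))) r" for x \<xi>
  proof -
    have "F (x, \<xi>) / (jbracket (x - k) ^ N * jbracket (\<xi> - n) ^ N) = (1 / jbracket (x - k) ^ N) * (1 / jbracket (\<xi> - n) ^ N) * F (x, \<xi>)"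
      by simp
    also have "\<dots> \<le> (J * (1 / jbracket (lfloor x - k) ^ N)) * (J * (1 / jbracket (lfloor \<xi> - n) ^ N)) * F (x, \<xi>)"
      using J by (intro mult_right_mono mult_mono brk F) auto
    finally have "ennreal (F (x, \<xi>) / (jbracket (x - k) ^ N * jbracket (\<xi> - n) ^ N))
      \<le> ennreal (J * (1 / jbracket (lfloor x - k) ^ N)) * ennreal (J * (1 / jbracket (lfloor \<xi> - n) ^ N)) * ennreal (F (x, \<xi>))"
      using J F by (simp add: ennreal_leI flip: ennreal_mult)
    from ennreal_powr_mono[OF r(1) this] show ?thesis
      unfolding G_def \<gamma>_def by (simp only: ennreal_powr_mult[OF r(1)])
  qed
  have "(\<integral>\<^sup>+\<xi>. \<integral>\<^sup>+x. G x \<xi> \<partial>lborel \<partial>lborel)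
    = (\<integral>\<^sup>+n'. \<integral>\<^sup>+\<xi>. (\<integral>\<^sup>+k'. \<integral>\<^sup>+x. G x \<xi> * indicator (cube k') x \<partial>lborel \<partial>count_space lattice) * indicator (cube n') \<xi> \<partial>lborel \<partial>count_space lattice)"
    by (subst nn_integral_cubes, measurable, subst nn_integral_cubes, measurable)
  also have "\<dots> \<le> (\<integral>\<^sup>+n'. \<integral>\<^sup>+\<xi>. (\<integral>\<^sup>+k'. \<gamma> (k' - k) * \<gamma> (n' - n) * (\<integral>\<^sup>+x. ennreal_powr (ennreal (F (x, \<xi>))) r * indicator (cube k') x \<partial>lborel) \<partial>count_space lattice) * indicator (cube n') \<xi> \<partial>lborel \<partial>count_space lattice)"
  proof (intro nn_integral_mono)
    fix n' \<xi>
    show "(\<integral>\<^sup>+k'. \<integral>\<^sup>+x. G x \<xi> * indicator (cube k') x \<partial>lborel \<partial>count_space lattice) * indicator (cube n') \<xi>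
      \<le> (\<integral>\<^sup>+k'. \<gamma> (k' - k) * \<gamma> (n' - n) * (\<integral>\<^sup>+x. ennreal_powr (ennreal (F (x, \<xi>))) r * indicator (cube k') x \<partial>lborel) \<partial>count_space lattice) * indicator (cube n') \<xi>"
    proof (cases "\<xi> \<in> cube n'")
      case True
      have "(\<integral>\<^sup>+x. G x \<xi> * indicator (cube k') x \<partial>lborel) \<le> \<gamma> (k' - k) * \<gamma> (n' - n) * (\<integral>\<^sup>+x. ennreal_powr (ennreal (F (x, \<xi>))) r * indicator (cube k') x \<partial>lborel)" for k'
      proof -
        have "(\<integral>\<^sup>+x. G x \<xi> * indicator (cube k') x \<partial>lborel) \<le> (\<integral>\<^sup>+x. \<gamma> (k' - k) * \<gamma> (n' - n) * (ennreal_powr (ennreal (F (x, \<xi>))) r * indicator (cube k') x) \<partial>lborel)"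
          using GG[of _ \<xi>] True by (intro nn_integral_mono) (auto simp: cube_def mult.assoc split: split_indicator)
        also have "\<dots> = \<gamma> (k' - k) * \<gamma> (n' - n) * (\<integral>\<^sup>+x. ennreal_powr (ennreal (F (x, \<xi>))) r * indicator (cube k') x \<partial>lborel)"
          by (rule nn_integral_cmult) measurable
        finally show ?thesis .
      qed
      then show ?thesis by (intro mult_right_mono nn_integral_mono) auto
    qed simp
  qed
  also have "\<dots> = (\<integral>\<^sup>+n'. \<integral>\<^sup>+\<xi>. (\<integral>\<^sup>+k'. \<gamma> (k' - k) * \<gamma> (n' - n) * ((\<integral>\<^sup>+x. ennreal_powr (ennreal (F (x, \<xi>))) r * indicator (cube k') x \<partial>lborel) * indicator (cube n') \<xi>) \<partial>count_space lattice) \<partial>lborel \<partial>count_space lattice)"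
    by (simp add: nn_integral_multc[symmetric] mult.assoc)
  also have "\<dots> = (\<integral>\<^sup>+n'. \<integral>\<^sup>+k'. \<gamma> (k' - k) * \<gamma> (n' - n) * b k' n' \<partial>count_space lattice \<partial>count_space lattice)"
  proof (intro nn_integral_cong)
    fix n'
    have "(\<integral>\<^sup>+\<xi>. (\<integral>\<^sup>+k'. \<gamma> (k' - k) * \<gamma> (n' - n) * ((\<integral>\<^sup>+x. ennreal_powr (ennreal (F (x, \<xi>))) r * indicator (cube k') x \<partial>lborel) * indicator (cube n') \<xi>) \<partial>count_space lattice) \<partial>lborel)
      = (\<integral>\<^sup>+k'. \<integral>\<^sup>+\<xi>. \<gamma> (k' - k) * \<gamma> (n' - n) * ((\<integral>\<^sup>+x. ennreal_powr (ennreal (F (x, \<xi>))) r * indicator (cube k') x \<partial>lborel) * indicator (cube n') \<xi>) \<partial>lborel \<partial>count_space lattice)"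
      by (rule nn_integral_count_space_nn_integral[OF countable_lattice]) measurable
    also have "\<dots> = (\<integral>\<^sup>+k'. \<gamma> (k' - k) * \<gamma> (n' - n) * b k' n' \<partial>count_space lattice)"
      unfolding b_def by (intro nn_integral_cong nn_integral_cmult) measurable
    finally show "(\<integral>\<^sup>+\<xi>. (\<integral>\<^sup>+k'. \<gamma> (k' - k) * \<gamma> (n' - n) * ((\<integral>\<^sup>+x. ennreal_powr (ennreal (F (x, \<xi>))) r * indicator (cube k') x \<partial>lborel) * indicator (cube n') \<xi>) \<partial>count_space lattice) \<partial>lborel) = \<dots>" .
  qed
  also have "\<dots> = (\<integral>\<^sup>+i. \<integral>\<^sup>+j. \<gamma> j * \<gamma> i * b (k + j) (n + i) \<partial>count_space lattice \<partial>count_space lattice)"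
  proof -
    have sh: "(\<integral>\<^sup>+k'. h k' \<partial>count_space lattice) = (\<integral>\<^sup>+j. h (k + j) \<partial>count_space lattice)" if "k \<in> lattice" for h and k :: 'a
      using nn_integral_bij_count_space[OF bij_lattice_shift[OF that], of h] by (simp add: add.commute)
    show ?thesis by (subst sh[OF kn(2)], subst sh[OF kn(1)]) simp
  qed
  finally have sums: "(\<integral>\<^sup>+\<xi>. \<integral>\<^sup>+x. G x \<xi> \<partial>lborel \<partial>lborel) \<le> (\<integral>\<^sup>+i. \<integral>\<^sup>+j. \<gamma> j * \<gamma> i * b (k + j) (n + i) \<partial>count_space lattice \<partial>count_space lattice)" .
  have "ennreal_powr (peetre N F (k, n)) r \<le> ennreal C * (\<integral>\<^sup>+\<xi>. \<integral>\<^sup>+x. G x \<xi> \<partial>lborel \<partial>lborel)"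
    unfolding G_def by (rule peetre_self_improvement[OF F B c C rep r])
  also have "\<dots> \<le> ennreal C * (\<integral>\<^sup>+i. \<integral>\<^sup>+j. \<gamma> j * \<gamma> i * b (k + j) (n + i) \<partial>count_space lattice \<partial>count_space lattice)"
    by (rule mult_left_mono[OF sums]) simp
  finally have main: "ennreal_powr (peetre N F (k, n)) r \<le> ennreal C * (\<integral>\<^sup>+i. \<integral>\<^sup>+j. \<gamma> j * \<gamma> i * b (k + j) (n + i) \<partial>count_space lattice \<partial>count_space lattice)" .
  have bm: "b k' n' = ennreal_powr (local_mean (ennreal r) F (k', n')) r" for k' n'
    using r by (simp add: local_mean_def Lp_norm_finite b_def indicator_powr)
  have "ennreal C * (\<integral>\<^sup>+i. \<integral>\<^sup>+j. \<gamma> j * \<gamma> i * b (k + j) (n + i) \<partial>count_space lattice \<partial>count_space lattice)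
    = (\<integral>\<^sup>+i. \<integral>\<^sup>+j. ennreal C * (\<gamma> j * \<gamma> i * b (k + j) (n + i)) \<partial>count_space lattice \<partial>count_space lattice)"
    by (simp add: nn_integral_cmult)
  also have "\<dots> = (\<integral>\<^sup>+i. \<integral>\<^sup>+j. ennreal_powr (ennreal (C powr (1 / r) * (J * J))) r * ennreal_powr (ennreal (1 / jbracket j ^ N) * ennreal (1 / jbracket i ^ N) * local_mean (ennreal r) F (k + j, n + i)) r \<partial>count_space lattice \<partial>count_space lattice)"
  proof (intro nn_integral_cong)
    fix i j :: 'a
    have "ennreal C = ennreal_powr (ennreal (C powr (1 / r))) r"
      using r C by (simp add: ennreal_powr_ennreal powr_powr)
    then show "ennreal C * (\<gamma> j * \<gamma> i * b (k + j) (n + i)) = ennreal_powr (ennreal (C powr (1 / r) * (J * J))) r * ennreal_powr (ennreal (1 / jbracket j ^ N) * ennreal (1 / jbracket i ^ N) * local_mean (ennreal r) F (k + j, n + i)) r"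
      unfolding \<gamma>_def bm using J
      by (simp only: ennreal_powr_mult[OF r(1), symmetric] ennreal_mult less_imp_le powr_ge_zero mult_nonneg_nonneg
          zero_le_divide_1_iff zero_le_power jbracket_nonneg mult_ac)
  qed
  also have "\<dots> = ennreal_powr (ennreal (C powr (1 / r) * (J * J))) r * (\<integral>\<^sup>+i. \<integral>\<^sup>+j. ennreal_powr (ennreal (1 / jbracket j ^ N) * ennreal (1 / jbracket i ^ N) * local_mean (ennreal r) F (k + j, n + i)) r \<partial>count_space lattice \<partial>count_space lattice)"
    by (simp add: nn_integral_cmult)
  finally have "ennreal_powr (peetre N F (k, n)) r \<le> ennreal_powr (ennreal (C powr (1 / r) * (J * J))) r * (\<integral>\<^sup>+i. \<integral>\<^sup>+j. ennreal_powr (ennreal (1 / jbracket j ^ N) * ennreal (1 / jbracket i ^ N) * local_mean (ennreal r) F (k + j, n + i)) r \<partial>count_space lattice \<partial>count_space lattice)"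
    using main by simp
  from ennreal_powr_mono[OF _ this, of "1 / r"] show ?thesis
    unfolding J_def[symmetric] using r by (simp add: Lp_norm_finite ennreal_powr_mult)
qed

text \<open>As r \<le> p, Minkowski moves the l^p sum over k inside the L^r mean in \<xi>. The cubes
  in x then add up to an L^p norm g(\<xi>), and the cubes in \<xi> to an L^q norm because r \<le> q.
  The weights stay step functions.\<close>

lemma lattice_norm_local_mean_le:
  fixes F :: "'a::euclidean_space \<times> 'a \<Rightarrow> real"
  assumes r: "0 < r" "r \<le> p" "r \<le> q" "r \<noteq> \<infinity>" and c: "continuous_on UNIV F" and F: "\<And>z. 0 \<le> F z"
    and w: "\<And>x. 0 < w x" and u: "\<And>x. 0 < u x"
  shows "lattice_norm p q w u (local_mean r F)
    \<le> Lp_norm lborel q (\<lambda>\<xi>. ennreal (u (lfloor \<xi>)) * Lp_norm lborel p (\<lambda>x. ennreal (w (lfloor x)) * ennreal (F (x, \<xi>))))"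
proof -
  have p: "0 < p" and q: "0 < q" using r by auto
  define \<Phi> where "\<Phi> k \<xi> = Lp_norm lborel r (\<lambda>x. ennreal (F (x, \<xi>)) * indicator (cube k) x)" for k \<xi>
  have \<Phi>m: "\<Phi> k \<in> borel_measurable borel" for k
    unfolding \<Phi>_def[abs_def] by (rule local_mean_measurable[OF r(4) c])
  define g where "g \<xi> = Lp_norm lborel p (\<lambda>x. ennreal (w (lfloor x)) * ennreal (F (x, \<xi>)))" for \<xi>
  have Fx: "(\<lambda>x. F (x, \<xi>)) \<in> borel_measurable borel" for \<xi>
    by (rule borel_measurable_continuous_onI) (intro continuous_on_compose2[OF c] continuous_intros, auto)
  have geq: "g \<xi> = Lp_norm lebesgue p (\<lambda>x. ennreal (w (lfloor x)) * ennreal (F (x, \<xi>)))" for \<xi>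
    unfolding g_def using Fx by (subst Lp_norm_lebesgue_eq) auto
  have gm: "g \<in> borel_measurable borel"
    unfolding geq[abs_def]
    by (rule Lp_norm_param_measurable[OF p c F]) (auto intro!: measurable_completion simp: less_imp_le w)
  have inner: "lnorm p (\<lambda>k. ennreal (w k) * local_mean r F (k, n)) \<le> Lp_norm lborel r (\<lambda>\<xi>. g \<xi> * indicator (cube n) \<xi>)" for n
  proof -
    have "lnorm p (\<lambda>k. ennreal (w k) * local_mean r F (k, n))
      = lnorm p (\<lambda>k. Lp_norm lborel r (\<lambda>\<xi>. ennreal (w k) * (\<Phi> k \<xi> * indicator (cube n) \<xi>)))"
      using r w by (intro Lp_norm_cong p) (simp add: local_mean_def \<Phi>_def Lp_norm_cmult_eq)
    also have "\<dots> \<le> Lp_norm lborel r (\<lambda>\<xi>. lnorm p (\<lambda>k. ennreal (w k) * (\<Phi> k \<xi> * indicator (cube n) \<xi>)))"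
      by (rule Lp_norm_swap) (use r countable_lattice \<Phi>m in auto)
    also have "\<dots> \<le> Lp_norm lborel r (\<lambda>\<xi>. g \<xi> * indicator (cube n) \<xi>)"
    proof (rule Lp_norm_mono[OF r(1)])
      fix \<xi>
      have "lnorm p (\<lambda>k. ennreal (w k) * (\<Phi> k \<xi> * indicator (cube n) \<xi>))
        \<le> indicator (cube n) \<xi> * lnorm p (\<lambda>k. ennreal (w k) * \<Phi> k \<xi>)"
        by (rule order_trans[OF _ Lp_norm_cmult[OF p]]) (auto simp: mult_ac indicator_def)
      also have "\<dots> \<le> indicator (cube n) \<xi> * g \<xi>"
        unfolding \<Phi>_def g_def by (intro mult_left_mono Lp_norm_cubes_le) (use r Fx in auto)
      finally show "lnorm p (\<lambda>k. ennreal (w k) * (\<Phi> k \<xi> * indicator (cube n) \<xi>)) \<le> g \<xi> * indicator (cube n) \<xi>"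
        by (simp only: mult.commute)
    qed (use r in auto)
    finally show ?thesis .
  qed
  have "lattice_norm p q w u (local_mean r F) \<le> lnorm q (\<lambda>n. ennreal (u n) * Lp_norm lborel r (\<lambda>\<xi>. g \<xi> * indicator (cube n) \<xi>))"
    unfolding lattice_norm_def
  proof (rule Lp_norm_count_mono[OF q])
    fix n
    have "lnorm p (\<lambda>k. ennreal (w k * u n) * local_mean r F (k, n))
      = lnorm p (\<lambda>k. ennreal (u n) * (ennreal (w k) * local_mean r F (k, n)))"
      using w u by (intro Lp_norm_cong p) (simp add: less_imp_le ennreal_mult mult_ac)
    also have "\<dots> \<le> ennreal (u n) * lnorm p (\<lambda>k. ennreal (w k) * local_mean r F (k, n))"
      by (rule Lp_norm_cmult) (use p in auto)
    also have "\<dots> \<le> ennreal (u n) * Lp_norm lborel r (\<lambda>\<xi>. g \<xi> * indicator (cube n) \<xi>)"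
      by (intro mult_left_mono inner) simp
    finally show "lnorm p (\<lambda>k. ennreal (w k * u n) * local_mean r F (k, n)) \<le> \<dots>" .
  qed
  also have "\<dots> \<le> Lp_norm lborel q (\<lambda>\<xi>. ennreal (u (lfloor \<xi>)) * g \<xi>)"
    by (rule Lp_norm_cubes_le) (use r gm in auto)
  finally show ?thesis unfolding g_def .
qed

text \<open>Local means are spread over the lattice by polynomially decaying kernels, which are
  convolved away by Young's inequality in l^\<rho>. The lower bound on N makes these kernels lie in
  l^\<rho> after the growth of the weights has been subtracted.\<close>

lemma lattice_norm_le_modulation_norm:
  fixes \<phi> :: "'a::euclidean_space \<Rightarrow> complex"
  assumes \<phi>: "schwartz \<phi>" and nz: "\<phi> t0 \<noteq> 0" and p: "0 < p" and q: "0 < q" and w: "poly_weight w" and u: "poly_weight u"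
  shows "\<exists>N0. \<forall>N\<ge>N0. \<exists>C>0. \<forall>f. schwartz f \<longrightarrow>
    lattice_norm p q w u (peetre N (\<lambda>z. cmod (stft_fun \<phi> f z))) \<le> ennreal C * modulation_norm \<phi> p q (w \<otimes>\<^sub>w u) (regular_distr f)"
proof -
  obtain Cw a where w: "1 \<le> Cw" "\<And>x y. w x \<le> Cw * jbracket (x - y) ^ a * w y" "\<And>x. 0 < w x" "w \<in> borel_measurable lebesgue"
    using poly_weightE[OF w] by blast
  obtain Cu b where u: "1 \<le> Cu" "\<And>x y. u x \<le> Cu * jbracket (x - y) ^ b * u y" "\<And>x. 0 < u x" "u \<in> borel_measurable lebesgue"
    using poly_weightE[OF u] by blast
  \<comment> \<open>At most 1 for the Peetre argument, and at most p and q for Young's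
    inequality.\<close>
  obtain \<rho> where \<rho>: "ennreal \<rho> = min 1 (min p q)" "0 < \<rho>"
  proof (cases "min 1 (min p q)")
    case (real x)
    moreover have "0 < min 1 (min p q)" using p q by (simp add: min_def)
    ultimately show thesis by (intro that[of x]) auto
  qed (simp add: min_def split: if_splits)
  have \<rho>le: "ennreal \<rho> \<le> 1" "ennreal \<rho> \<le> p" "ennreal \<rho> \<le> q"
    unfolding \<rho>(1) by (auto intro: min.coboundedI2)
  then have \<rho>1: "\<rho> \<le> 1" by simp
  \<comment> \<open>An order from which on inverse powers of the bracket are in l^\<rho>: it ensures
    \<rho> M \<ge> DIM + 2.\<close>
  define M where "M = nat \<lceil>real (DIM('a) + 2) / \<rho>\<rceil>"
  have M: "real (DIM('a) + 2) \<le> \<rho> * real M'" if "M \<le> M'" for M'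
  proof -
    have "real (DIM('a) + 2) / \<rho> \<le> real M" unfolding M_def by (rule real_nat_ceiling_ge)
    also have "\<dots> \<le> real M'" using that by simp
    finally show ?thesis using \<rho> by (simp add: divide_le_eq mult.commute)
  qed
  define J where "J = 1 + real DIM('a)"
  have J: "jbracket (x - lfloor x) \<le> J" "0 < J" for x :: 'a using jbracket_lfloor[of x] by (auto simp: J_def)
  have "\<exists>C>0. \<forall>f. schwartz f \<longrightarrow>
    lattice_norm p q w u (peetre N (\<lambda>z. cmod (stft_fun \<phi> f z))) \<le> ennreal C * modulation_norm \<phi> p q (w \<otimes>\<^sub>w u) (regular_distr f)"
    if N: "M + a + b \<le> N" for N
  proof -
    obtain C0 where C0: "0 < C0" "\<And>f y \<eta>. schwartz f \<Longrightarrow> ennreal (cmod (stft_fun \<phi> f (y, \<eta>)))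
      \<le> ennreal C0 * (\<integral>\<^sup>+x. \<integral>\<^sup>+\<xi>. ennreal (cmod (stft_fun \<phi> f (x, \<xi>)) / (jbracket (x - y) ^ N * jbracket (\<xi> - \<eta>) ^ N)) \<partial>lborel \<partial>lborel)"
      using stft_fun_reproducing[OF \<phi> nz \<phi>] by blast
    define C1 where "C1 = C0 powr (1 / \<rho>) * (J ^ N * J ^ N)"
    have C1: "0 < C1" using C0 J by (simp add: C1_def)
    \<comment> \<open>Shifting the weight w by j costs the bracket of j to the power a, so order N -
      a remains of the kernel; likewise N - b for u.\<close>
    define g where "g j = ennreal (1 / jbracket j ^ (N - a))" for j :: 'a
    define h where "h j = ennreal (1 / jbracket j ^ (N - b))" for j :: 'a
    have ghf: "g j < \<infinity>" "h j < \<infinity>" for j by (auto simp: g_def h_def)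
    let ?R = "lnorm (ennreal \<rho>)"
    have gf: "?R g < \<infinity>" and hf: "?R h < \<infinity>" unfolding g_def h_def
      using N by (auto intro!: lattice_Lp_finite \<rho> M simp del: infinity_ennreal_def)
    have "1 \<le> ?R g" "1 \<le> ?R h"
      using le_Lp_norm_count[of "ennreal \<rho>" 0 lattice g] le_Lp_norm_count[of "ennreal \<rho>" 0 lattice h] \<rho> p q
      by (auto simp: g_def h_def jbracket_def)
    then have g0: "?R g \<noteq> 0" and h0: "?R h \<noteq> 0" by auto
    define K where "K = enn2real (?R g) * enn2real (?R h)"
    have K: "?R g * ?R h = ennreal K" "0 < K"
      using gf hf g0 h0 by (auto simp: K_def ennreal_mult enn2real_pos zero_less_iff_neq_zero less_top)
    define C2 where "C2 = C1 * (Cw * Cu) * K * ((Cu * J ^ b) * (Cw * J ^ a))"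
    have C2: "0 < C2" unfolding C2_def using C1 w(1) u(1) K J by (intro mult_pos_pos zero_less_power) auto
    have "lattice_norm p q w u (peetre N (\<lambda>z. cmod (stft_fun \<phi> f z))) \<le> ennreal C2 * modulation_norm \<phi> p q (w \<otimes>\<^sub>w u) (regular_distr f)"
      if f: "schwartz f" for f
    proof -
      define F where "F z = cmod (stft_fun \<phi> f z)" for z
      have Fc: "continuous_on UNIV F" unfolding F_def
        by (intro continuous_intros schwartz_continuous schwartz_stft_fun \<phi> f)
      have F0: "0 \<le> F z" for z by (simp add: F_def)
      obtain B where B': "\<And>z. cmod (stft_fun \<phi> f z) \<le> B / jbracket z ^ 0"
        using schwartz_bound[OF schwartz_stft_fun[OF \<phi> f]] by blast
      then have B: "F z \<le> B" for z unfolding F_def using B'[of z] by simp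
      define V where "V z = ennreal (w (fst z) * u (snd z)) * local_mean (ennreal \<rho>) F z" for z
      have step: "ennreal (w k * u n) * peetre N F (k, n) \<le> ennreal (C1 * (Cw * Cu)) * ?R (\<lambda>i. ?R (\<lambda>j. g j * h i * V (k + j, n + i)))"
        if kn: "k \<in> lattice" "n \<in> lattice" for k n
      proof -
        let ?W = "ennreal (w k * u n)"
        have Wpos: "0 < ?W" using w(3)[of k] u(3)[of n] by simp
        have \<rho>0: "0 < ennreal \<rho>" using \<rho>(2) by simp
        have "peetre N F (k, n) \<le> ennreal C1 * ?R (\<lambda>i. ?R (\<lambda>j.
          ennreal (1 / jbracket j ^ N) * ennreal (1 / jbracket i ^ N) * local_mean (ennreal \<rho>) F (k + j, n + i)))"
          unfolding C1_def J_def
          by (rule peetre_le_local_means[OF F0 B Fc C0(1) _ \<rho>(2) \<rho>1 kn]) (use C0(2)[OF f] in \<open>simp add: F_def\<close>)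
        then have "?W * peetre N F (k, n) \<le> ?W * (ennreal C1 * ?R (\<lambda>i. ?R (\<lambda>j.
          ennreal (1 / jbracket j ^ N) * ennreal (1 / jbracket i ^ N) * local_mean (ennreal \<rho>) F (k + j, n + i))))"
          by (rule mult_left_mono) simp
        also have "\<dots> = ennreal C1 * ?R (\<lambda>i. ?R (\<lambda>j.
          ?W * (ennreal (1 / jbracket j ^ N) * ennreal (1 / jbracket i ^ N) * local_mean (ennreal \<rho>) F (k + j, n + i))))"
          using Wpos \<rho>0 by (simp add: Lp_norm_cmult_eq mult_ac)
        also have "\<dots> \<le> ennreal C1 * ?R (\<lambda>i. ?R (\<lambda>j. ennreal (Cw * Cu) * (g j * h i * V (k + j, n + i))))"
        proof (intro mult_left_mono Lp_norm_count_mono \<rho>0)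
          fix i j :: 'a
          have "w k \<le> Cw * jbracket j ^ a * w (k + j)" using w(2)[of k "k + j"] by simp
          moreover have "u n \<le> Cu * jbracket i ^ b * u (n + i)" using u(2)[of n "n + i"] by simp
          ultimately have "w k * u n \<le> (Cw * jbracket j ^ a * w (k + j)) * (Cu * jbracket i ^ b * u (n + i))"
            using w(3)[of k] u(3)[of n] w(1) u(1) w(3)[of "k + j"] u(3)[of "n + i"]
            by (intro mult_mono mult_nonneg_nonneg) (auto intro: less_imp_le)
          then have "(w k * u n) * ((1 / jbracket j ^ N) * (1 / jbracket i ^ N))
            \<le> ((Cw * jbracket j ^ a * w (k + j)) * (Cu * jbracket i ^ b * u (n + i))) * ((1 / jbracket j ^ N) * (1 / jbracket i ^ N))"
            by (rule mult_right_mono) simp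
          also have "\<dots> = (Cw * Cu) * ((jbracket j ^ a / jbracket j ^ N) * (jbracket i ^ b / jbracket i ^ N) * (w (k + j) * u (n + i)))"
            by simp
          also have "jbracket j ^ a / jbracket j ^ N = 1 / jbracket j ^ (N - a)"
            using N by (simp add: power_diff field_simps)
          also have "jbracket i ^ b / jbracket i ^ N = 1 / jbracket i ^ (N - b)"
            using N by (simp add: power_diff field_simps)
          finally have "(w k * u n) * ((1 / jbracket j ^ N) * (1 / jbracket i ^ N))
            \<le> (Cw * Cu) * (1 / jbracket j ^ (N - a) * (1 / jbracket i ^ (N - b)) * (w (k + j) * u (n + i)))" .
          from ennreal_leI[OF this]
          have e: "ennreal (w k * u n) * (ennreal (1 / jbracket j ^ N) * ennreal (1 / jbracket i ^ N))
            \<le> ennreal (Cw * Cu) * (g j * h i * ennreal (w (k + j) * u (n + i)))"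
            unfolding g_def h_def using w(1) u(1) less_imp_le[OF w(3)] less_imp_le[OF u(3)]
            by (simp only: ennreal_mult[symmetric] mult_nonneg_nonneg zero_le_divide_1_iff zero_le_power jbracket_nonneg order_trans[OF zero_le_one])
          from mult_right_mono[OF e zero_le, of "local_mean (ennreal \<rho>) F (k + j, n + i)"]
          show "?W * (ennreal (1 / jbracket j ^ N) * ennreal (1 / jbracket i ^ N) * local_mean (ennreal \<rho>) F (k + j, n + i))
            \<le> ennreal (Cw * Cu) * (g j * h i * V (k + j, n + i))"
            unfolding V_def fst_conv snd_conv by (simp only: mult_ac)
        qed simp
        also have "\<dots> = ennreal C1 * (ennreal (Cw * Cu) * ?R (\<lambda>i. ?R (\<lambda>j. g j * h i * V (k + j, n + i))))"
          using \<rho>0 w(1) u(1) by (simp add: Lp_norm_cmult_eq)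
        finally show ?thesis using C1 w(1) u(1) by (simp add: ennreal_mult mult_ac)
      qed
      have pF: "0 < p" "0 < q" using p q .
      have "lattice_norm p q w u (peetre N F) \<le> lnorm q (\<lambda>n. lnorm p (\<lambda>k.
        ennreal (C1 * (Cw * Cu)) * ?R (\<lambda>i. ?R (\<lambda>j. g j * h i * V (k + j, n + i)))))"
        unfolding lattice_norm_def by (intro Lp_norm_count_mono p q step)
      also have "\<dots> = ennreal (C1 * (Cw * Cu)) * lnorm q (\<lambda>n. lnorm p (\<lambda>k.
        ?R (\<lambda>i. ?R (\<lambda>j. g j * h i * V (k + j, n + i)))))"
        using C1 w(1) u(1) p q by (simp add: Lp_norm_cmult_eq)
      also have "\<dots> \<le> ennreal (C1 * (Cw * Cu)) * (?R g * ?R h * lnorm q (\<lambda>n. lnorm p (\<lambda>k. V (k, n))))"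
        using \<rho>(2) \<rho>le g0 h0 gf ghf by (intro mult_left_mono lattice_young2) auto
      also have "lnorm q (\<lambda>n. lnorm p (\<lambda>k. V (k, n))) = lattice_norm p q w u (local_mean (ennreal \<rho>) F)"
        unfolding V_def lattice_norm_def by simp
      finally have D1: "lattice_norm p q w u (peetre N F) \<le> ennreal (C1 * (Cw * Cu)) * (?R g * ?R h * lattice_norm p q w u (local_mean (ennreal \<rho>) F))" .
      have "lattice_norm p q w u (local_mean (ennreal \<rho>) F) \<le> Lp_norm lborel q (\<lambda>\<xi>. ennreal (u (lfloor \<xi>)) * Lp_norm lborel p (\<lambda>x. ennreal (w (lfloor x)) * ennreal (F (x, \<xi>))))"
        by (rule lattice_norm_local_mean_le) (use \<rho>(2) \<rho>le Fc F0 w u in auto)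
      also have "\<dots> \<le> ennreal ((Cu * J ^ b) * (Cw * J ^ a)) * modulation_norm \<phi> p q (w \<otimes>\<^sub>w u) (regular_distr f)"
      proof -
        have Fx: "(\<lambda>x. F (x, \<xi>)) \<in> borel_measurable borel" for \<xi>
          by (rule borel_measurable_continuous_onI) (intro continuous_on_compose2[OF Fc] continuous_intros, auto)
        define G where "G \<xi> = Lp_norm lborel p (\<lambda>x. ennreal (w (lfloor x)) * ennreal (F (x, \<xi>)))" for \<xi>
        define G' where "G' \<xi> = Lp_norm lebesgue p (\<lambda>x. ennreal (w x) * ennreal (F (x, \<xi>)))" for \<xi>
        have Geq: "G \<xi> = Lp_norm lebesgue p (\<lambda>x. ennreal (w (lfloor x)) * ennreal (F (x, \<xi>)))" for \<xi>
          unfolding G_def using Fx by (subst Lp_norm_lebesgue_eq) auto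
        have Gm: "G \<in> borel_measurable borel"
          unfolding Geq[abs_def]
          by (rule Lp_norm_param_measurable[OF p Fc F0]) (auto intro!: measurable_completion simp: less_imp_le w)
        have wl: "w (lfloor x) \<le> (Cw * J ^ a) * w x" for x
          using w(1) w(3)[of x] J(1)[of x] J(2) by (intro order_trans[OF w(2)[of "lfloor x" x]] mult_right_mono mult_left_mono power_mono)
            (auto simp: jbracket_minus_commute)
        have ul: "u (lfloor x) \<le> (Cu * J ^ b) * u x" for x
          using u(1) u(3)[of x] J(1)[of x] J(2) by (intro order_trans[OF u(2)[of "lfloor x" x]] mult_right_mono mult_left_mono power_mono)
            (auto simp: jbracket_minus_commute)
        have GG': "G \<xi> \<le> ennreal (Cw * J ^ a) * G' \<xi>" for \<xi>
        proof -
          have "G \<xi> \<le> Lp_norm lebesgue p (\<lambda>x. ennreal (Cw * J ^ a) * (ennreal (w x) * ennreal (F (x, \<xi>))))"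
            unfolding Geq
          proof (rule Lp_norm_mono[OF p])
            fix x
            have "ennreal (w (lfloor x)) \<le> ennreal (Cw * J ^ a) * ennreal (w x)"
              using ennreal_leI[OF wl[of x]] w(1) less_imp_le[OF w(3)[of x]] J(2) by (simp add: ennreal_mult')
            from mult_right_mono[OF this]
            show "ennreal (w (lfloor x)) * ennreal (F (x, \<xi>)) \<le> ennreal (Cw * J ^ a) * (ennreal (w x) * ennreal (F (x, \<xi>)))"
              by (simp add: mult.assoc)
          next
            show "(\<lambda>x. ennreal (w (lfloor x)) * ennreal (F (x, \<xi>))) \<in> borel_measurable lebesgue"
              using Fx by (intro measurable_completion) auto
          qed
          also have "\<dots> \<le> ennreal (Cw * J ^ a) * G' \<xi>" unfolding G'_def by (rule Lp_norm_cmult) (use p in auto)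
          finally show ?thesis .
        qed
        have "Lp_norm lborel q (\<lambda>\<xi>. ennreal (u (lfloor \<xi>)) * G \<xi>) = Lp_norm lebesgue q (\<lambda>\<xi>. ennreal (u (lfloor \<xi>)) * G \<xi>)"
          using Gm by (subst Lp_norm_lebesgue_eq) auto
        also have "\<dots> \<le> Lp_norm lebesgue q (\<lambda>\<xi>. ennreal ((Cu * J ^ b) * (Cw * J ^ a)) * (ennreal (u \<xi>) * G' \<xi>))"
        proof (rule Lp_norm_mono[OF q])
          fix \<xi>
          have "ennreal (u (lfloor \<xi>)) \<le> ennreal (Cu * J ^ b) * ennreal (u \<xi>)"
            using ennreal_leI[OF ul[of \<xi>]] u(1) less_imp_le[OF u(3)[of \<xi>]] J(2) by (simp add: ennreal_mult')
          from mult_mono[OF this GG'[of \<xi>]]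
          have "ennreal (u (lfloor \<xi>)) * G \<xi> \<le> ennreal (Cu * J ^ b) * ennreal (u \<xi>) * (ennreal (Cw * J ^ a) * G' \<xi>)" by simp
          also have "\<dots> = (ennreal (Cu * J ^ b) * ennreal (Cw * J ^ a)) * (ennreal (u \<xi>) * G' \<xi>)" by (simp only: mult_ac)
          also have "ennreal (Cu * J ^ b) * ennreal (Cw * J ^ a) = ennreal ((Cu * J ^ b) * (Cw * J ^ a))"
            using u(1) w(1) J(2) by (intro ennreal_mult[symmetric] mult_nonneg_nonneg) auto
          finally show "ennreal (u (lfloor \<xi>)) * G \<xi> \<le> ennreal ((Cu * J ^ b) * (Cw * J ^ a)) * (ennreal (u \<xi>) * G' \<xi>)" .
        next
          show "(\<lambda>\<xi>. ennreal (u (lfloor \<xi>)) * G \<xi>) \<in> borel_measurable lebesgue"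
            using Gm by (intro measurable_completion) auto
        qed
        also have "\<dots> \<le> ennreal ((Cu * J ^ b) * (Cw * J ^ a)) * Lp_norm lebesgue q (\<lambda>\<xi>. ennreal (u \<xi>) * G' \<xi>)"
          by (rule Lp_norm_cmult) (use q in auto)
        finally show ?thesis
          unfolding modulation_norm_regular[OF \<phi> f p w(3) u(3)] G_def G'_def F_def .
      qed
      finally have D2: "lattice_norm p q w u (local_mean (ennreal \<rho>) F) \<le> ennreal ((Cu * J ^ b) * (Cw * J ^ a)) * modulation_norm \<phi> p q (w \<otimes>\<^sub>w u) (regular_distr f)" .
      have "lattice_norm p q w u (peetre N F) \<le> ennreal (C1 * (Cw * Cu)) * (?R g * ?R h * (ennreal ((Cu * J ^ b) * (Cw * J ^ a)) * modulation_norm \<phi> p q (w \<otimes>\<^sub>w u) (regular_distr f)))"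
        by (rule order_trans[OF D1]) (intro mult_left_mono D2; simp)
      also have "\<dots> = (ennreal (C1 * (Cw * Cu)) * ennreal K * ennreal ((Cu * J ^ b) * (Cw * J ^ a))) * modulation_norm \<phi> p q (w \<otimes>\<^sub>w u) (regular_distr f)"
        unfolding K(1) by (simp only: mult_ac)
      also have "ennreal (C1 * (Cw * Cu)) * ennreal K * ennreal ((Cu * J ^ b) * (Cw * J ^ a)) = ennreal C2"
      proof -
        have "0 \<le> C1 * (Cw * Cu)" "0 \<le> K" "0 \<le> (Cu * J ^ b) * (Cw * J ^ a)"
          using C1 w(1) u(1) K(2) J(2) by auto
        then show ?thesis unfolding C2_def by (simp only: ennreal_mult[symmetric] mult_nonneg_nonneg)
      qed
      finally show ?thesis unfolding F_def .
    qed
    with C2 show ?thesis by blast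
  qed
  then show ?thesis by blast
qed

section \<open>Short-time Fourier transform of Wigner distributions\<close>

lemma schwartz_section:
  fixes H :: "'a::euclidean_space \<times> 'b::euclidean_space \<Rightarrow> complex"
  assumes "schwartz H" shows "schwartz (\<lambda>t. H (x, t))"
proof -
  define X where "X h \<longleftrightarrow> (\<exists>H. schwartz H \<and> h = (\<lambda>t. H (x, t)))" for h :: "'b \<Rightarrow> complex"
  have d: "((\<lambda>t. H (x, t)) has_derivative (\<lambda>h. \<Sum>b\<in>Basis. ((0, h) \<bullet> b) *\<^sub>R partial_deriv b H (x, t))) (at t)"
    if "schwartz H" for H :: "'a \<times> 'b \<Rightarrow> complex" and t
  proof -
    have "((\<lambda>t. (x, t)) has_derivative (\<lambda>v. (0, v))) (at t)" by (auto intro!: derivative_eq_intros)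
    from has_derivative_compose[OF this schwartz_has_derivative[OF that, of "(x, t)"]] show ?thesis .
  qed
  have "X (\<lambda>t. H (x, t))" using assms unfolding X_def by blast
  then show ?thesis
  proof (induct rule: schwartz_coinduct[of X])
    case (diff h t)
    then show ?case unfolding X_def by (auto intro: differentiableI d)
  next
    case (decay h N)
    then obtain H where *: "schwartz H" "h = (\<lambda>t. H (x, t))" unfolding X_def by blast
    obtain C where C: "\<And>z. jbracket z ^ N * cmod (H z) \<le> C" using schwartz_decay[OF *(1)] by blast
    have "jbracket t ^ N * cmod (h t) \<le> C" for t
      unfolding *(2) by (rule order_trans[OF _ C[of "(x, t)"]]) (intro mult_right_mono power_mono jbracket_Pair, auto)
    then show ?case by blast
  next
    case (deriv h c)
    then obtain H where *: "schwartz H" "h = (\<lambda>t. H (x, t))" unfolding X_def by blast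
    have c: "(0, c) \<in> (Basis :: ('a \<times> 'b) set)" using deriv by (auto simp: Basis_prod_def)
    have "partial_deriv c h = (\<lambda>t. partial_deriv (0, c) H (x, t))"
      unfolding *(2) by (rule ext, subst partial_deriv_eq[OF d[OF *(1)]])
        (use c in \<open>simp add: inner_Basis if_distrib if_distribR cong: if_cong\<close>)
    then show ?case unfolding X_def using schwartz_partial_deriv[OF *(1) c] by blast
  qed
qed

text \<open>The second factor carries no conjugation, so the kernel is bilinear. It is used with
  conjugated functions for the Wigner distribution and again, after Plancherel, for the windowed
  functions.\<close>

definition wigner_kernel :: "real \<Rightarrow> ('a::euclidean_space \<Rightarrow> complex) \<Rightarrow> ('a \<Rightarrow> complex) \<Rightarrow> 'a \<times> 'a \<Rightarrow> complex" where
  "wigner_kernel \<tau> f g = (\<lambda>z. f (fst z + \<tau> *\<^sub>R snd z) * g (fst z - (1 - \<tau>) *\<^sub>R snd z))"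

lemma schwartz_wigner_kernel:
  fixes f g :: "'a::euclidean_space \<Rightarrow> complex"
  assumes \<tau>: "\<tau> \<in> {0..1}" and fg: "schwartz f" "schwartz g"
  shows "schwartz (wigner_kernel \<tau> f g)"
  unfolding wigner_kernel_def
proof (rule schwartz_mult_linear[where K = 3 and A = "\<lambda>z. fst z + \<tau> *\<^sub>R snd z" and B = "\<lambda>z. fst z - (1 - \<tau>) *\<^sub>R snd z"])
  show "linear (\<lambda>z::'a \<times> 'a. fst z + \<tau> *\<^sub>R snd z)" "linear (\<lambda>z::'a \<times> 'a. fst z - (1 - \<tau>) *\<^sub>R snd z)"
    by (intro linear_compose_sub linear_compose_add linear_fst linear_snd linear_compose_scale_right)+
  fix z :: "'a \<times> 'a"
  let ?A = "fst z + \<tau> *\<^sub>R snd z" and ?B = "fst z - (1 - \<tau>) *\<^sub>R snd z"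
  \<comment> \<open>The constant 3: the second component is the difference of the two arguments, and
    the first is \<open>?A\<close> minus a multiple of the second by a factor in [0, 1].\<close>
  have "snd z = ?A - ?B" by (simp add: algebra_simps)
  then have 1: "norm (snd z) \<le> norm ?A + norm ?B" by (metis norm_triangle_ineq4)
  have "fst z = ?A - \<tau> *\<^sub>R snd z" by simp
  then have "norm (fst z) \<le> norm ?A + norm (\<tau> *\<^sub>R snd z)" by (metis norm_triangle_ineq4)
  also have "norm (\<tau> *\<^sub>R snd z) \<le> 1 * norm (snd z)" unfolding norm_scaleR using \<tau> by (intro mult_right_mono) auto
  finally have 2: "norm (fst z) \<le> norm ?A + norm (snd z)" by simp
  have 3: "norm z \<le> norm (fst z) + norm (snd z)" using norm_Pair_le[of "fst z" "snd z"] by simp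
  have "0 \<le> norm ?B" by simp
  with 1 2 3 show "norm z \<le> 3 * (norm ?A + norm ?B)" by argo
qed (use fg in auto)

lemma wigner_eq_partial_fourier:
  fixes f g :: "'a::euclidean_space \<Rightarrow> complex"
  assumes "\<tau> \<in> {0..1}" "schwartz f" "schwartz g"
  shows "wigner \<tau> f g = partial_fourier (wigner_kernel \<tau> f (\<lambda>x. cnj (g x)))"
proof -
  have s: "schwartz (wigner_kernel \<tau> f (\<lambda>x. cnj (g x)))"
    by (intro schwartz_wigner_kernel schwartz_cnj assms)
  have "(\<integral>t. wigner_kernel \<tau> f (\<lambda>x. cnj (g x)) (x, t) * cis (- 2 * pi * (\<xi> \<bullet> t)) \<partial>lebesgue)
    = (\<integral>t. wigner_kernel \<tau> f (\<lambda>x. cnj (g x)) (x, t) * cis (- 2 * pi * (\<xi> \<bullet> t)) \<partial>lborel)" for x \<xi>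
    by (rule integral_completion) (rule borel_measurable_integrable[OF schwartz_section_integrable[OF s]])
  then show ?thesis by (simp add: wigner_def partial_fourier_def wigner_kernel_def)
qed

lemma schwartz_wigner:
  fixes f g :: "'a::euclidean_space \<Rightarrow> complex"
  assumes "\<tau> \<in> {0..1}" "schwartz f" "schwartz g"
  shows "schwartz (wigner \<tau> f g)"
  unfolding wigner_eq_partial_fourier[OF assms] by (intro schwartz_partial_fourier schwartz_wigner_kernel schwartz_cnj assms)

lemma schwartz_Fubini:
  fixes H :: "'a::euclidean_space \<times> 'b::euclidean_space \<Rightarrow> complex"
  assumes H: "schwartz H"
  shows "(\<integral>y. (\<integral>x. H (x, y) \<partial>lborel) \<partial>lborel) = (\<integral>x. (\<integral>y. H (x, y) \<partial>lborel) \<partial>lborel)"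
proof -
  let ?M = "DIM('a) + 2" and ?N = "DIM('b) + 2"
  obtain C where C: "0 \<le> C" "\<And>z. cmod (H z) \<le> C / jbracket z ^ (?M + ?N)"
    using schwartz_bound[OF H] by blast
  show ?thesis
  proof (rule lborel_Fubini[where f = "\<lambda>x. C * (1 / jbracket x ^ ?M)" and g = "\<lambda>y. 1 / jbracket y ^ ?N"])
    show "continuous_on UNIV (\<lambda>(x, y). H (x, y))" using schwartz_continuous[OF H] by (simp add: case_prod_beta')
    show "cmod (H (x, y)) \<le> C * (1 / jbracket x ^ ?M) * (1 / jbracket y ^ ?N)" for x y
      using order_trans[OF C(2) jbracket_pair_divide[OF C(1)], of x y] by simp
  qed (intro integrable_mult_right integrable_jbracket)+
qed

lemma schwartz_integral_pair:
  fixes H :: "'a::euclidean_space \<times> 'b::euclidean_space \<Rightarrow> complex"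
  assumes H: "schwartz H"
  shows "(\<integral>z. H z \<partial>lborel) = (\<integral>x. (\<integral>y. H (x, y) \<partial>lborel) \<partial>lborel)"
proof -
  have "integrable (lborel \<Otimes>\<^sub>M lborel) (case_prod (\<lambda>x y. H (x, y)))"
    using schwartz_integrable[OF H] unfolding lborel_prod by simp
  from lborel_pair.integral_fst[OF this] show ?thesis unfolding lborel_prod by simp
qed

text \<open>The substitution \<open>s\<^sub>1 = u + \<tau> t\<close>, \<open>s\<^sub>2 = u - (1 - \<tau>) t\<close> has determinant \<open>\<plusminus>1\<close>: it is a composition of
  two shears and a reflection.\<close>

lemma wigner_kernel_integral:
  fixes f g :: "'a::euclidean_space \<Rightarrow> complex"
  assumes \<tau>: "\<tau> \<in> {0..1}" and f: "schwartz f" and g: "schwartz g"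
  shows "(\<integral>u. (\<integral>t. wigner_kernel \<tau> f g (u, t) \<partial>lborel) \<partial>lborel) = (\<integral>s. f s \<partial>lborel) * (\<integral>s. g s \<partial>lborel)"
proof -
  have c: "continuous_on S f" "continuous_on S g" for S using f g by (auto intro: schwartz_continuous)
  have 0: "(0::real) \<in> {0..1}" by simp
  have "(\<integral>u. (\<integral>t. wigner_kernel \<tau> f g (u, t) \<partial>lborel) \<partial>lborel) = (\<integral>t. (\<integral>u. wigner_kernel \<tau> f g (u, t) \<partial>lborel) \<partial>lborel)"
    by (rule schwartz_Fubini[symmetric]) (rule schwartz_wigner_kernel[OF assms])
  also have "\<dots> = (\<integral>t. (\<integral>u. wigner_kernel 0 f g (u, t) \<partial>lborel) \<partial>lborel)"
  proof (rule Bochner_Integration.integral_cong[OF refl])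
    fix t
    have "(\<integral>u. wigner_kernel 0 f g (u + \<tau> *\<^sub>R t, t) \<partial>lborel) = (\<integral>u. wigner_kernel 0 f g (u, t) \<partial>lborel)"
      unfolding wigner_kernel_def
      by (rule lborel_integral_translate[of "\<lambda>u. f (fst (u, t) + 0 *\<^sub>R snd (u, t)) * g (fst (u, t) - (1 - 0) *\<^sub>R snd (u, t))"])
        (intro borel_measurable_continuous_onI continuous_intros continuous_on_compose2[OF c(1)] continuous_on_compose2[OF c(2)], auto)
    moreover have "wigner_kernel 0 f g (u + \<tau> *\<^sub>R t, t) = wigner_kernel \<tau> f g (u, t)" for u
      by (simp add: wigner_kernel_def algebra_simps)
    ultimately show "(\<integral>u. wigner_kernel \<tau> f g (u, t) \<partial>lborel) = (\<integral>u. wigner_kernel 0 f g (u, t) \<partial>lborel)" by simp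
  qed
  also have "\<dots> = (\<integral>u. (\<integral>t. wigner_kernel 0 f g (u, t) \<partial>lborel) \<partial>lborel)"
    by (rule schwartz_Fubini) (rule schwartz_wigner_kernel[OF 0 f g])
  also have "\<dots> = (\<integral>u. f u * (\<integral>t. g (u - t) \<partial>lborel) \<partial>lborel)"
    by (simp add: wigner_kernel_def)
  also have "\<dots> = (\<integral>u. f u * (\<integral>t. g t \<partial>lborel) \<partial>lborel)"
    using c by (subst lborel_integral_reflect) (auto intro: borel_measurable_continuous_onI)
  finally show ?thesis by (simp only: integral_mult_left_zero)
qed

text \<open>For fixed u, Plancherel in the frequency variable replaces the two Wigner distributions
  by their kernels in (u, t). The product of these kernels, with all phases, is again a Wigner
  kernel, of \<psi>1 and the conjugate of \<psi>2, so its integral splits. The leftover phase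
  depends on \<xi> and y only and disappears in the modulus.\<close>

lemma stft_fun_wigner:
  fixes f1 f2 \<phi>1 \<phi>2 :: "'a::euclidean_space \<Rightarrow> complex"
  assumes \<tau>: "\<tau> \<in> {0..1}" and f: "schwartz f1" "schwartz f2" and \<phi>: "schwartz \<phi>1" "schwartz \<phi>2"
  shows "cmod (stft_fun (wigner \<tau> \<phi>1 \<phi>2) (wigner \<tau> f1 f2) ((x, \<xi>), (\<eta>, y)))
    = cmod (stft_fun \<phi>1 f1 (x - \<tau> *\<^sub>R y, \<xi> + (1 - \<tau>) *\<^sub>R \<eta>)) * cmod (stft_fun \<phi>2 f2 (x + (1 - \<tau>) *\<^sub>R y, \<xi> - \<tau> *\<^sub>R \<eta>))"
proof -
  define W where "W = wigner \<tau> f1 f2"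
  define \<Phi> where "\<Phi> = wigner \<tau> \<phi>1 \<phi>2"
  have sW: "schwartz W" and s\<Phi>: "schwartz \<Phi>" unfolding W_def \<Phi>_def by (intro schwartz_wigner assms)+
  define hk where "hk u = (\<lambda>t. wigner_kernel \<tau> f1 (\<lambda>x. cnj (f2 x)) (u, t))" for u
  \<comment> \<open>The function of t whose transform is the shifted window together with the phase
    of y: modulation by \<xi> shifts in v, translation by -y produces the phase.\<close>
  define kk where "kk u = translate (- y) (modulate \<xi> (\<lambda>t. wigner_kernel \<tau> \<phi>1 (\<lambda>x. cnj (\<phi>2 x)) (u - x, t)))" for u
  have shk: "schwartz (hk u)" and skk: "schwartz (kk u)" for u unfolding hk_def kk_def
    by (intro schwartz_translate schwartz_modulate schwartz_section schwartz_wigner_kernel schwartz_cnj assms)+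
  have W: "W (u, v) = fourier (hk u) v" for u v
    unfolding W_def wigner_eq_partial_fourier[OF \<tau> f] by (simp add: partial_fourier_def fourier_def hk_def)
  have \<Phi>: "\<Phi> (u - x, v - \<xi>) * cis (2 * pi * (v \<bullet> y)) = fourier (kk u) v" for u v
  proof -
    define K where "K t = wigner_kernel \<tau> \<phi>1 (\<lambda>x. cnj (\<phi>2 x)) (u - x, t)" for t
    have sK: "schwartz K" unfolding K_def by (intro schwartz_section schwartz_wigner_kernel schwartz_cnj assms)
    have "fourier (kk u) v = (\<integral>t. cis (2 * pi * ((t + y) \<bullet> \<xi>)) * K (t + y) * cis (- 2 * pi * (v \<bullet> t)) \<partial>lborel)"
      by (simp add: fourier_def kk_def K_def translate_def modulate_def)
    also have "\<dots> = (\<integral>t. (\<lambda>t. cis (2 * pi * (t \<bullet> \<xi>)) * K t * cis (- 2 * pi * (v \<bullet> (t - y)))) (t + y) \<partial>lborel)" by simp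
    also have "\<dots> = (\<integral>t. cis (2 * pi * (t \<bullet> \<xi>)) * K t * cis (- 2 * pi * (v \<bullet> (t - y))) \<partial>lborel)"
      unfolding cis_conv_exp
      by (rule lborel_integral_translate) (intro borel_measurable_continuous_onI continuous_intros schwartz_continuous[OF sK])
    also have "\<dots> = (\<integral>t. K t * cis (- 2 * pi * ((v - \<xi>) \<bullet> t)) * cis (2 * pi * (v \<bullet> y)) \<partial>lborel)"
    proof (intro Bochner_Integration.integral_cong refl)
      fix t
      have "cis (2 * pi * (t \<bullet> \<xi>)) * cis (- 2 * pi * (v \<bullet> (t - y))) = cis (- 2 * pi * ((v - \<xi>) \<bullet> t)) * cis (2 * pi * (v \<bullet> y))"
        by (simp add: cis_mult inner_diff_left inner_diff_right inner_commute[of t] algebra_simps)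
      then show "cis (2 * pi * (t \<bullet> \<xi>)) * K t * cis (- 2 * pi * (v \<bullet> (t - y))) = K t * cis (- 2 * pi * ((v - \<xi>) \<bullet> t)) * cis (2 * pi * (v \<bullet> y))"
        by (simp only: mult_ac)
    qed
    also have "\<dots> = \<Phi> (u - x, v - \<xi>) * cis (2 * pi * (v \<bullet> y))"
      unfolding \<Phi>_def wigner_eq_partial_fourier[OF \<tau> \<phi>] integral_mult_left_zero by (simp add: partial_fourier_def K_def)
    finally show ?thesis by simp
  qed
  define H where "H z = W z * cnj (\<Phi> (z - (x, \<xi>))) * cis (- 2 * pi * ((\<eta>, y) \<bullet> z))" for z
  have sH: "schwartz H"
  proof -
    have "schwartz (modulate (- (\<eta>, y)) (\<lambda>z. W z * cnj (\<Phi> (z - (x, \<xi>)))))"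
      by (intro schwartz_modulate window_product_schwartz s\<Phi> sW)
    moreover have "modulate (- (\<eta>, y)) (\<lambda>z. W z * cnj (\<Phi> (z - (x, \<xi>)))) = H"
      by (rule ext) (simp only: H_def modulate_def inner_minus_right inner_commute[of _ "(\<eta>, y)"] mult_minus_right mult_minus_left mult.commute)
    ultimately show ?thesis by simp
  qed
  \<comment> \<open>Chosen so that the integral over s is the transform of f1 at the point claimed;
    likewise for \<psi>2.\<close>
  define \<psi>1 where "\<psi>1 = modulate (- (\<xi> + (1 - \<tau>) *\<^sub>R \<eta>)) (\<lambda>s. f1 s * cnj (\<phi>1 (s - (x - \<tau> *\<^sub>R y))))"
  define \<psi>2 where "\<psi>2 = modulate (- (\<xi> - \<tau> *\<^sub>R \<eta>)) (\<lambda>s. f2 s * cnj (\<phi>2 (s - (x + (1 - \<tau>) *\<^sub>R y))))"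
  have s\<psi>: "schwartz \<psi>1" "schwartz \<psi>2" unfolding \<psi>1_def \<psi>2_def
    by (intro schwartz_modulate window_product_schwartz assms)+
  have i1: "(\<integral>s. \<psi>1 s \<partial>lborel) = stft_fun \<phi>1 f1 (x - \<tau> *\<^sub>R y, \<xi> + (1 - \<tau>) *\<^sub>R \<eta>)"
    unfolding stft_fun_eq_fourier fourier_def \<psi>1_def modulate_def
    by (intro Bochner_Integration.integral_cong refl)
      (simp only: inner_minus_right inner_commute[of _ "\<xi> + (1 - \<tau>) *\<^sub>R \<eta>"] mult_minus_right mult_minus_left mult.commute)
  have i2: "(\<integral>s. \<psi>2 s \<partial>lborel) = stft_fun \<phi>2 f2 (x + (1 - \<tau>) *\<^sub>R y, \<xi> - \<tau> *\<^sub>R \<eta>)"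
    unfolding stft_fun_eq_fourier fourier_def \<psi>2_def modulate_def
    by (intro Bochner_Integration.integral_cong refl)
      (simp only: inner_minus_right inner_commute[of _ "\<xi> - \<tau> *\<^sub>R \<eta>"] mult_minus_right mult_minus_left mult.commute)
  have inner: "(\<integral>v. H (u, v) \<partial>lborel) = cis (- 2 * pi * (\<xi> \<bullet> y)) * (\<integral>t. wigner_kernel \<tau> \<psi>1 (\<lambda>s. cnj (\<psi>2 s)) (u, t) \<partial>lborel)" for u
  proof -
    have "H (u, v) = cis (- 2 * pi * (\<eta> \<bullet> u)) * (fourier (hk u) v * cnj (fourier (kk u) v))" for v
    proof -
      have "cis (- 2 * pi * ((\<eta>, y) \<bullet> (u, v))) = cis (- 2 * pi * (\<eta> \<bullet> u)) * cnj (cis (2 * pi * (v \<bullet> y)))"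
        by (simp add: cis_cnj cis_mult inner_commute[of y] algebra_simps)
      then show ?thesis unfolding H_def W[symmetric] \<Phi>[symmetric] complex_cnj_mult diff_Pair by (simp only: mult_ac)
    qed
    then have "(\<integral>v. H (u, v) \<partial>lborel) = cis (- 2 * pi * (\<eta> \<bullet> u)) * (\<integral>v. fourier (hk u) v * cnj (fourier (kk u) v) \<partial>lborel)" by simp
    also have "\<dots> = cis (- 2 * pi * (\<eta> \<bullet> u)) * (\<integral>t. hk u t * cnj (kk u t) \<partial>lborel)"
      by (simp only: plancherel[OF shk skk])
    also have "\<dots> = (\<integral>t. cis (- 2 * pi * (\<eta> \<bullet> u)) * (hk u t * cnj (kk u t)) \<partial>lborel)"
      by (simp only: integral_mult_right_zero)
    also have "\<dots> = (\<integral>t. cis (- 2 * pi * (\<xi> \<bullet> y)) * wigner_kernel \<tau> \<psi>1 (\<lambda>s. cnj (\<psi>2 s)) (u, t) \<partial>lborel)"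
    proof (intro Bochner_Integration.integral_cong refl)
      fix t
      let ?s1 = "u + \<tau> *\<^sub>R t" and ?s2 = "u - (1 - \<tau>) *\<^sub>R t"
      have a: "u - x + \<tau> *\<^sub>R (t + y) = ?s1 - (x - \<tau> *\<^sub>R y)" "u - x - (1 - \<tau>) *\<^sub>R (t + y) = ?s2 - (x + (1 - \<tau>) *\<^sub>R y)"
        by (simp_all add: algebra_simps)
      \<comment> \<open>The phases match because the bilinear identity \<open>e\<close> holds: in
        terms of ?s1 and ?s2 the variables u and t separate, and the remainder is the constant \<xi>
        \<bullet> y.\<close>
      have ph: "cis (- 2 * pi * (\<eta> \<bullet> u)) * cnj (cis (2 * pi * ((t + y) \<bullet> \<xi>)))
        = cis (- 2 * pi * (\<xi> \<bullet> y)) * (cis (2 * pi * (?s1 \<bullet> (- (\<xi> + (1 - \<tau>) *\<^sub>R \<eta>)))) * cnj (cis (2 * pi * (?s2 \<bullet> (- (\<xi> - \<tau> *\<^sub>R \<eta>))))))"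
      proof -
        have e: "\<eta> \<bullet> u + (t + y) \<bullet> \<xi> = \<xi> \<bullet> y + ?s1 \<bullet> (\<xi> + (1 - \<tau>) *\<^sub>R \<eta>) - ?s2 \<bullet> (\<xi> - \<tau> *\<^sub>R \<eta>)"
          by (simp add: inner_add_left inner_add_right inner_diff_left inner_diff_right inner_commute[of \<eta> u] inner_commute[of \<xi> y] algebra_simps)
        have "- 2 * pi * (\<eta> \<bullet> u) + - (2 * pi * ((t + y) \<bullet> \<xi>)) = - 2 * pi * (\<eta> \<bullet> u + (t + y) \<bullet> \<xi>)" by (simp add: algebra_simps)
        also have "\<dots> = - 2 * pi * (\<xi> \<bullet> y) + (2 * pi * (?s1 \<bullet> (- (\<xi> + (1 - \<tau>) *\<^sub>R \<eta>))) + - (2 * pi * (?s2 \<bullet> (- (\<xi> - \<tau> *\<^sub>R \<eta>)))))"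
          unfolding e inner_minus_right by (simp add: right_diff_distrib distrib_left)
        finally show ?thesis by (simp only: cis_cnj cis_mult)
      qed
      have "cis (- 2 * pi * (\<eta> \<bullet> u)) * (hk u t * cnj (kk u t))
        = (cis (- 2 * pi * (\<eta> \<bullet> u)) * cnj (cis (2 * pi * ((t + y) \<bullet> \<xi>)))) * ((f1 ?s1 * cnj (f2 ?s2)) * (cnj (\<phi>1 (?s1 - (x - \<tau> *\<^sub>R y))) * \<phi>2 (?s2 - (x + (1 - \<tau>) *\<^sub>R y))))"
        unfolding hk_def kk_def wigner_kernel_def translate_def modulate_def fst_conv snd_conv diff_minus_eq_add a complex_cnj_mult complex_cnj_cnj
        by (simp only: mult_ac)
      also have "\<dots> = cis (- 2 * pi * (\<xi> \<bullet> y)) * wigner_kernel \<tau> \<psi>1 (\<lambda>s. cnj (\<psi>2 s)) (u, t)"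
        unfolding ph wigner_kernel_def \<psi>1_def \<psi>2_def modulate_def fst_conv snd_conv complex_cnj_mult complex_cnj_cnj
        by (simp only: mult_ac)
      finally show "cis (- 2 * pi * (\<eta> \<bullet> u)) * (hk u t * cnj (kk u t)) = cis (- 2 * pi * (\<xi> \<bullet> y)) * wigner_kernel \<tau> \<psi>1 (\<lambda>s. cnj (\<psi>2 s)) (u, t)" .
    qed
    finally show ?thesis by (simp only: integral_mult_right_zero)
  qed
  have "stft_fun \<Phi> W ((x, \<xi>), (\<eta>, y)) = (\<integral>z. H z \<partial>lborel)"
    unfolding stft_fun_eq_fourier fourier_def H_def ..
  also have "\<dots> = (\<integral>u. (\<integral>v. H (u, v) \<partial>lborel) \<partial>lborel)" by (rule schwartz_integral_pair[OF sH])
  also have "\<dots> = cis (- 2 * pi * (\<xi> \<bullet> y)) * (\<integral>u. (\<integral>t. wigner_kernel \<tau> \<psi>1 (\<lambda>s. cnj (\<psi>2 s)) (u, t) \<partial>lborel) \<partial>lborel)"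
    by (simp only: inner integral_mult_right_zero)
  also have "\<dots> = cis (- 2 * pi * (\<xi> \<bullet> y)) * ((\<integral>s. \<psi>1 s \<partial>lborel) * cnj (\<integral>s. \<psi>2 s \<partial>lborel))"
    by (simp only: wigner_kernel_integral[OF \<tau> s\<psi>(1) schwartz_cnj[OF s\<psi>(2)]] Bochner_Integration.integral_cnj)
  finally show ?thesis unfolding i1 i2 W_def \<Phi>_def by (simp add: norm_mult)
qed

text \<open>At frequency 0 there is no oscillation and the integrand is a product of two positive
  Gaussians. The value at 0 is the squared norm of the window.\<close>

lemma stft_fun_gauss_time:
  obtains A :: "'a::euclidean_space \<Rightarrow> real" where "\<And>x. 0 \<le> A x" "0 < A 0" "\<And>x. stft_fun gauss gauss (x, 0 :: 'a) = of_real (A x)"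
proof -
  obtain r where r: "0 < r" "(\<integral>t. gauss t * cnj (gauss t) \<partial>(lborel :: 'a measure)) = of_real r"
    using window_norm_pos[OF schwartz_gauss, of "0::'a"] by (auto simp: gauss_def)
  define A where "A x = (\<integral>t. exp (- pi * (t \<bullet> t)) * exp (- pi * ((t - x) \<bullet> (t - x))) \<partial>lborel)" for x :: 'a
  have A: "stft_fun gauss gauss (x, 0 :: 'a) = of_real (A x)" for x
    unfolding A_def by (simp add: stft_fun_eq_fourier fourier_def gauss_def flip: of_real_mult)
  have "stft_fun gauss gauss (0, 0 :: 'a) = of_real r" using r(2) by (simp add: stft_fun_eq_fourier fourier_def)
  with A[of 0] have "A 0 = r" by simp
  then show thesis using A r by (intro that[of A]) (auto simp: A_def intro!: Bochner_Integration.integral_nonneg)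
qed

text \<open>At time 0 the integrand is the square of the Gaussian, again a Gaussian dilated by
  \<open>sqrt 2\<close>, and the transform of that is a positive Gaussian.\<close>

lemma stft_fun_gauss_frequency:
  obtains B :: "'a::euclidean_space \<Rightarrow> real" where "\<And>\<xi>. 0 \<le> B \<xi>" "0 < B 0" "\<And>\<xi>. stft_fun gauss gauss (0 :: 'a, \<xi>) = of_real (B \<xi>)"
proof -
  define B where "B \<xi> = exp (- pi * ((\<xi> /\<^sub>R sqrt 2) \<bullet> (\<xi> /\<^sub>R sqrt 2))) / sqrt 2 ^ DIM('a)" for \<xi> :: 'a
  have g: "gauss t * cnj (gauss (t - 0)) = gauss (sqrt 2 *\<^sub>R t)" for t :: 'a
  proof -
    have "- pi * ((sqrt 2 *\<^sub>R t) \<bullet> (sqrt 2 *\<^sub>R t)) = - pi * (t \<bullet> t) + - pi * (t \<bullet> t)" by simp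
    then have "exp (- pi * ((sqrt 2 *\<^sub>R t) \<bullet> (sqrt 2 *\<^sub>R t))) = exp (- pi * (t \<bullet> t)) * exp (- pi * (t \<bullet> t))"
      by (simp only: exp_add)
    then show ?thesis unfolding gauss_def by (simp only: complex_cnj_complex_of_real of_real_mult diff_zero)
  qed
  have "stft_fun gauss gauss (0 :: 'a, \<xi>) = of_real (B \<xi>)" for \<xi>
    unfolding stft_fun_eq_fourier g fourier_def by (subst fourier_gauss_scaled) (simp_all add: B_def gauss_def)
  then show thesis by (intro that[of B]) (auto simp: B_def)
qed

text \<open>The comparison goes through lattice norms of maximal functions, where windows can be
  exchanged pointwise. The bounding window has to be nonzero, since the other transform is
  reproduced from it.\<close>

lemma modulation_norm_window:
  fixes \<phi> \<psi> :: "'a::euclidean_space \<Rightarrow> complex"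
  assumes \<phi>: "schwartz \<phi>" and nz: "\<phi> t0 \<noteq> 0" and \<psi>: "schwartz \<psi>"
    and p: "0 < p" and q: "0 < q" and w: "poly_weight w" and u: "poly_weight u"
  obtains C where "0 < C" "\<And>f. schwartz f \<Longrightarrow> modulation_norm \<psi> p q (w \<otimes>\<^sub>w u) (regular_distr f)
    \<le> ennreal C * modulation_norm \<phi> p q (w \<otimes>\<^sub>w u) (regular_distr f)"
proof -
  obtain N where "\<forall>N'\<ge>N. \<exists>C>0. \<forall>f. schwartz f \<longrightarrow>
    lattice_norm p q w u (peetre N' (\<lambda>z. cmod (stft_fun \<phi> f z))) \<le> ennreal C * modulation_norm \<phi> p q (w \<otimes>\<^sub>w u) (regular_distr f)"
    by (rule exE[OF lattice_norm_le_modulation_norm[OF \<phi> nz p q w u]])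
  from this[rule_format, OF order_refl]
  obtain C1 where C1: "0 < C1" "\<And>f. schwartz f \<Longrightarrow>
    lattice_norm p q w u (peetre N (\<lambda>z. cmod (stft_fun \<phi> f z))) \<le> ennreal C1 * modulation_norm \<phi> p q (w \<otimes>\<^sub>w u) (regular_distr f)"
    by blast
  obtain C2 where C2: "0 < C2" "\<And>f. schwartz f \<Longrightarrow> modulation_norm \<psi> p q (w \<otimes>\<^sub>w u) (regular_distr f)
    \<le> ennreal C2 * lattice_norm p q w u (peetre N (\<lambda>z. cmod (stft_fun \<psi> f z)))"
    using modulation_norm_le_lattice_norm[OF \<psi> p q w u] by blast
  obtain C3 where C3: "0 < C3" "\<And>f z. schwartz f \<Longrightarrow> peetre N (\<lambda>z. cmod (stft_fun \<psi> f z)) z \<le> ennreal C3 * peetre N (\<lambda>z. cmod (stft_fun \<phi> f z)) z"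
    using peetre_window_change[OF \<phi> nz \<psi>] by blast
  have "modulation_norm \<psi> p q (w \<otimes>\<^sub>w u) (regular_distr f)
    \<le> ennreal (C2 * C3 * C1) * modulation_norm \<phi> p q (w \<otimes>\<^sub>w u) (regular_distr f)" if f: "schwartz f" for f
  proof -
    have "lattice_norm p q w u (peetre N (\<lambda>z. cmod (stft_fun \<psi> f z))) \<le> lattice_norm p q w u (\<lambda>z. ennreal C3 * peetre N (\<lambda>z. cmod (stft_fun \<phi> f z)) z)"
      by (rule lattice_norm_mono[OF p q]) (rule C3(2)[OF f])
    also have "\<dots> \<le> ennreal C3 * lattice_norm p q w u (peetre N (\<lambda>z. cmod (stft_fun \<phi> f z)))"
      by (rule lattice_norm_cmult) (use p q in auto)
    also have "\<dots> \<le> ennreal C3 * (ennreal C1 * modulation_norm \<phi> p q (w \<otimes>\<^sub>w u) (regular_distr f))"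
      by (intro mult_left_mono C1(2)[OF f]) simp
    finally have "ennreal C2 * lattice_norm p q w u (peetre N (\<lambda>z. cmod (stft_fun \<psi> f z)))
      \<le> ennreal C2 * (ennreal C3 * (ennreal C1 * modulation_norm \<phi> p q (w \<otimes>\<^sub>w u) (regular_distr f)))"
      by (rule mult_left_mono) simp
    with C2(2)[OF f] show ?thesis
      using C1(1) C2(1) C3(1) by (auto simp: ennreal_mult mult.assoc intro: order_trans)
  qed
  with C1(1) C2(1) C3(1) show thesis by (intro that[of "C2 * C3 * C1"]) auto
qed

section \<open>Correlation estimates on the lattice\<close>

lemma lnorm_prod:
  fixes f :: "'a::euclidean_space \<times> 'b::euclidean_space \<Rightarrow> ennreal"
  assumes "0 < p"
  shows "lnorm p f = lnorm p (\<lambda>n. lnorm p (\<lambda>k. f (k, n)))"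
proof (cases "p = \<infinity>")
  case True
  have "(SUP z\<in>lattice. f z) = (SUP n\<in>lattice. SUP k\<in>lattice. f (k, n))"
  proof (rule antisym; intro SUP_least)
    fix z :: "'a \<times> 'b" assume "z \<in> lattice"
    then have z: "fst z \<in> lattice" "snd z \<in> lattice" by (cases z; simp)+
    have "f z \<le> (SUP k\<in>lattice. f (k, snd z))" by (rule SUP_upper2[OF z(1)]) simp
    also have "\<dots> \<le> (SUP n\<in>lattice. SUP k\<in>lattice. f (k, n))" by (rule SUP_upper[OF z(2)])
    finally show "f z \<le> (SUP n\<in>lattice. SUP k\<in>lattice. f (k, n))" .
  next
    fix n :: 'b and k :: 'a assume "n \<in> lattice" "k \<in> lattice"
    then show "f (k, n) \<le> (SUP z\<in>lattice. f z)" by (intro SUP_upper) simp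
  qed
  then show ?thesis using True by (simp add: esssup_count_space)
next
  case False
  interpret A: sigma_finite_measure "count_space (lattice :: 'a set)"
    by (rule sigma_finite_measure_count_space_countable[OF countable_lattice])
  interpret B: sigma_finite_measure "count_space (lattice :: 'b set)"
    by (rule sigma_finite_measure_count_space_countable[OF countable_lattice])
  interpret P: pair_sigma_finite "count_space (lattice :: 'a set)" "count_space (lattice :: 'b set)" ..
  have pm: "count_space (lattice :: 'a set) \<Otimes>\<^sub>M count_space (lattice :: 'b set) = count_space lattice"
    unfolding lattice_times by (rule pair_measure_countable[OF countable_lattice countable_lattice])
  have "(\<integral>\<^sup>+n. (\<integral>\<^sup>+k. ennreal_powr (f (k, n)) (enn2real p) \<partial>count_space lattice) \<partial>count_space lattice)
    = (\<integral>\<^sup>+z. ennreal_powr (f z) (enn2real p) \<partial>count_space lattice)"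
    using P.nn_integral_snd[of "\<lambda>z. ennreal_powr (f z) (enn2real p)"] unfolding pm by simp
  then show ?thesis using False enn2real_pos[OF assms] by (simp add: Lp_norm_finite)
qed

lemma lnorm_swap_eq:
  assumes "0 < p" shows "lnorm p (\<lambda>a. lnorm p (\<lambda>b. f a b)) = lnorm p (\<lambda>b. lnorm p (\<lambda>a. f a b))"
proof (cases "p = \<infinity>")
  case True
  then show ?thesis by (simp add: esssup_count_space) (rule SUP_commute)
next
  case False
  show ?thesis
    by (intro antisym Lp_norm_swap[OF assms order_refl False countable_lattice]) auto
qed

lemma Lp_norm_count_inj:
  assumes "inj_on g A" "g ` A \<subseteq> B" "0 < p"
  shows "Lp_norm (count_space A) p (\<lambda>k. f (g k)) \<le> Lp_norm (count_space B) p f"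
proof -
  have "Lp_norm (count_space A) p (\<lambda>k. f (g k)) = Lp_norm (count_space (g ` A)) p f"
    by (rule Lp_norm_count_bij[OF inj_on_imp_bij_betw[OF assms(1)] assms(3)])
  also have "\<dots> \<le> Lp_norm (count_space B) p f"
  proof (cases "p = \<infinity>")
    case True then show ?thesis using assms(2) by (simp add: esssup_count_space SUP_subset_mono)
  next
    case False
    have "(\<integral>\<^sup>+x. h x \<partial>count_space (g ` A)) \<le> (\<integral>\<^sup>+x. h x \<partial>count_space B)" for h
      using assms(2) by (subst (1 2) nn_integral_count_space_indicator)
        (auto simp: image_subset_iff intro!: nn_integral_mono split: split_indicator)
    then show ?thesis using False enn2real_pos[OF assms(3)]
      by (simp add: Lp_norm_finite ennreal_powr_mono)
  qed
  finally show ?thesis .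
qed

section \<open>Correlation inequalities and reduction to finitely supported sequences\<close>

lemma Lp_norm_count_SUP:
  assumes "0 < p" "incseq f"
  shows "Lp_norm (count_space A) p (\<lambda>k. SUP i. f i k) = (SUP i::nat. Lp_norm (count_space A) p (f i))"
proof (cases "p = \<infinity>")
  case True
  then show ?thesis by (simp add: esssup_count_space) (rule SUP_commute)
next
  case False
  let ?p = "enn2real p"
  have p: "0 < ?p" using assms False by (intro enn2real_pos)
  have inc: "incseq (\<lambda>i k. ennreal_powr (f i k) ?p)"
    using assms(2) p by (auto simp: incseq_def le_fun_def intro!: ennreal_powr_mono)
  have "Lp_norm (count_space A) p (\<lambda>k. SUP i. f i k)
    = ennreal_powr (\<integral>\<^sup>+k. (SUP i. ennreal_powr (f i k) ?p) \<partial>count_space A) (1 / ?p)"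
    using False p by (simp add: Lp_norm_finite ennreal_powr_SUP)
  also have "(\<integral>\<^sup>+k. (SUP i. ennreal_powr (f i k) ?p) \<partial>count_space A) = (SUP i. \<integral>\<^sup>+k. ennreal_powr (f i k) ?p \<partial>count_space A)"
    by (rule nn_integral_monotone_convergence_SUP[OF inc]) simp
  finally show ?thesis using False p by (simp add: Lp_norm_finite ennreal_powr_SUP)
qed

text \<open>Both the support (the first i points of an enumeration) and the height are cut, so that
  even a sequence with the value \<infinity> is an increasing limit of finitely supported real
  ones.\<close>

definition truncation :: "nat \<Rightarrow> ('a::euclidean_space \<Rightarrow> ennreal) \<Rightarrow> 'a \<Rightarrow> ennreal" where
  "truncation i a k = (if k \<in> from_nat_into lattice ` {..<i} then min (a k) (of_nat i) else 0)"

lemma truncation_incseq: "incseq (\<lambda>i. truncation i a)"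
proof (rule incseq_SucI, rule le_funI)
  fix i k
  have "min (a k) (of_nat i) \<le> min (a k) (of_nat (Suc i))" by (intro min.mono) auto
  then show "truncation i a k \<le> truncation (Suc i) a k"
    unfolding truncation_def by (auto simp: lessThan_Suc simp del: of_nat_Suc)
qed

lemma truncation_SUP: assumes "k \<in> lattice" shows "(SUP i. truncation i a k) = a k"
proof (rule antisym)
  show "(SUP i. truncation i a k) \<le> a k" by (intro SUP_least) (simp add: truncation_def)
  obtain i0 where i0: "k = from_nat_into lattice i0"
    using assms countable_lattice by (metis from_nat_into_surj)
  show "a k \<le> (SUP i. truncation i a k)"
  proof (rule dense_le)
    fix y assume y: "y < a k"
    then obtain r where r: "y = ennreal r" "0 \<le> r" by (cases y) auto
    obtain j where "r < real j" using reals_Archimedean2 by blast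
    then have j: "y < of_nat j" using r by (simp add: ennreal_of_nat_eq_real_of_nat ennreal_lessI)
    define i where "i = max j (Suc i0)"
    have "of_nat j \<le> (of_nat i :: ennreal)" by (simp add: i_def)
    with j have "y < of_nat i" by (rule less_le_trans)
    then have "y \<le> min (a k) (of_nat i)" using y by (intro min.boundedI less_imp_le)
    also have "\<dots> = truncation i a k" using i0 by (auto simp: truncation_def i_def)
    also have "\<dots> \<le> (SUP i. truncation i a k)" by (rule SUP_upper) simp
    finally show "y \<le> (SUP i. truncation i a k)" .
  qed
qed

lemma truncation_le: "truncation i a k \<le> a k"
  by (simp add: truncation_def)

lemma truncation_real:
  fixes a :: "'a::euclidean_space \<Rightarrow> ennreal"
  shows "\<exists>c. (\<forall>k. truncation i a k = ennreal (c k)) \<and> (\<forall>k. 0 \<le> c k) \<and> finite {k. c k \<noteq> 0} \<and> {k. c k \<noteq> 0} \<subseteq> lattice"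
proof -
  define c where "c k = enn2real (truncation i a k)" for k
  have "truncation i a k \<le> of_nat i" for k by (simp add: truncation_def)
  then have fin: "truncation i a k \<noteq> top" for k by (metis ennreal_of_nat_neq_top top_unique)
  have "{k. c k \<noteq> 0} \<subseteq> from_nat_into lattice ` {..<i}" by (auto simp: c_def truncation_def split: if_splits)
  moreover have "from_nat_into lattice ` {..<i} \<subseteq> (lattice :: 'a set)"
    by (auto intro!: from_nat_into) (use lattice_0 in blast)
  ultimately show ?thesis using fin
    by (intro exI[of _ c]) (auto simp: c_def less_top intro: finite_subset)
qed

text \<open>The one-variable condition on which both parts of the theorem turn. It is stated for all
  sequences with values in [0, \<infinity>], so membership in sequence spaces and convergence need
  not be tracked, and p = \<infinity> is included.\<close>

definition corr_bounded ::
  "ennreal \<Rightarrow> ennreal \<Rightarrow> ('a::euclidean_space \<Rightarrow> real) \<Rightarrow> ennreal \<Rightarrow> ('a \<Rightarrow> real) \<Rightarrow> ennreal \<Rightarrow> ('a \<Rightarrow> real) \<Rightarrow> bool" where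
  "corr_bounded p p1 w1 p2 w2 q u \<longleftrightarrow> (\<exists>C>0. \<forall>a b.
     lnorm q (\<lambda>y. ennreal (u y) * lnorm p (\<lambda>k. a k * b (k + y)))
       \<le> ennreal C * lnorm p1 (\<lambda>k. ennreal (w1 k) * a k) * lnorm p2 (\<lambda>k. ennreal (w2 k) * b k))"

text \<open>Monotone convergence, first in b for a truncated a and then in a. Finitely supported
  real sequences are those for which a sum of shifted Gaussians is a Schwartz function.\<close>

lemma corr_boundedI:
  fixes w1 w2 u :: "'a::euclidean_space \<Rightarrow> real"
  assumes pos: "0 < p" "0 < p1" "0 < p2" "0 < q" and C: "0 < C"
    and fin: "\<And>a b. (\<And>k. 0 \<le> a k) \<Longrightarrow> finite {k. a k \<noteq> 0} \<Longrightarrow> {k. a k \<noteq> 0} \<subseteq> lattice \<Longrightarrow>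
      (\<And>k. 0 \<le> b k) \<Longrightarrow> finite {k. b k \<noteq> 0} \<Longrightarrow> {k. b k \<noteq> 0} \<subseteq> lattice \<Longrightarrow>
      lnorm q (\<lambda>y. ennreal (u y) * lnorm p (\<lambda>k. ennreal (a k) * ennreal (b (k + y))))
       \<le> ennreal C * lnorm p1 (\<lambda>k. ennreal (w1 k) * ennreal (a k)) * lnorm p2 (\<lambda>k. ennreal (w2 k) * ennreal (b k))"
  shows "corr_bounded p p1 w1 p2 w2 q u"
  unfolding corr_bounded_def
proof (intro exI[of _ C] conjI C allI)
  fix a b :: "'a \<Rightarrow> ennreal"
  let ?R = "ennreal C * lnorm p1 (\<lambda>k. ennreal (w1 k) * a k) * lnorm p2 (\<lambda>k. ennreal (w2 k) * b k)"
  define \<Psi> where "\<Psi> a b = lnorm q (\<lambda>y. ennreal (u y) * lnorm p (\<lambda>k. a k * b (k + y)))" for a b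
  have ij: "\<Psi> (truncation i a) (truncation j b) \<le> ?R" for i j
  proof -
    obtain c where c: "\<And>k. truncation i a k = ennreal (c k)" "\<And>k. 0 \<le> c k" "finite {k. c k \<noteq> 0}" "{k. c k \<noteq> 0} \<subseteq> lattice"
      using truncation_real[of i a] by blast
    obtain d where d: "\<And>k. truncation j b k = ennreal (d k)" "\<And>k. 0 \<le> d k" "finite {k. d k \<noteq> 0}" "{k. d k \<noteq> 0} \<subseteq> lattice"
      using truncation_real[of j b] by blast
    have "\<Psi> (truncation i a) (truncation j b) \<le> ennreal C * lnorm p1 (\<lambda>k. ennreal (w1 k) * truncation i a k) * lnorm p2 (\<lambda>k. ennreal (w2 k) * truncation j b k)"
      unfolding \<Psi>_def c(1) d(1) by (rule fin[OF c(2-4) d(2-4)])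
    also have "\<dots> \<le> ?R"
      by (intro mult_mono Lp_norm_count_mono mult_left_mono truncation_le pos) auto
    finally show ?thesis .
  qed
  have inc: "truncation i a k \<le> truncation j a k" if "i \<le> j" for i j k and a :: "'a \<Rightarrow> ennreal"
    using truncation_incseq[of a] that by (auto simp: incseq_def le_fun_def)
  have j: "\<Psi> (truncation i a) b = (SUP j. \<Psi> (truncation i a) (truncation j b))" for i
  proof -
    have "\<Psi> (truncation i a) b = lnorm q (\<lambda>y. ennreal (u y) * lnorm p (\<lambda>k. SUP j. truncation i a k * truncation j b (k + y)))"
      unfolding \<Psi>_def by (intro Lp_norm_cong pos arg_cong2[where f = "(*)"] refl)
        (simp add: truncation_SUP flip: SUP_mult_left_ennreal)
    also have "\<dots> = lnorm q (\<lambda>y. SUP j. ennreal (u y) * lnorm p (\<lambda>k. truncation i a k * truncation j b (k + y)))"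
      by (subst Lp_norm_count_SUP[OF pos(1)]) (auto simp: incseq_def le_fun_def SUP_mult_left_ennreal intro!: mult_left_mono inc)
    also have "\<dots> = (SUP j. \<Psi> (truncation i a) (truncation j b))"
      unfolding \<Psi>_def by (rule Lp_norm_count_SUP[OF pos(4)])
        (auto simp: incseq_def le_fun_def intro!: mult_left_mono inc Lp_norm_count_mono pos)
    finally show ?thesis .
  qed
  have i: "\<Psi> a b = (SUP i. \<Psi> (truncation i a) b)"
  proof -
    have "\<Psi> a b = lnorm q (\<lambda>y. ennreal (u y) * lnorm p (\<lambda>k. SUP i. truncation i a k * b (k + y)))"
      unfolding \<Psi>_def by (intro Lp_norm_cong pos arg_cong2[where f = "(*)"] refl)
        (simp add: truncation_SUP flip: SUP_mult_right_ennreal)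
    also have "\<dots> = lnorm q (\<lambda>y. SUP i. ennreal (u y) * lnorm p (\<lambda>k. truncation i a k * b (k + y)))"
      by (subst Lp_norm_count_SUP[OF pos(1)]) (auto simp: incseq_def le_fun_def SUP_mult_left_ennreal intro!: mult_right_mono inc)
    also have "\<dots> = (SUP i. \<Psi> (truncation i a) b)"
      unfolding \<Psi>_def by (rule Lp_norm_count_SUP[OF pos(4)])
        (auto simp: incseq_def le_fun_def intro!: mult_left_mono mult_right_mono inc Lp_norm_count_mono pos)
    finally show ?thesis .
  qed
  show "lnorm q (\<lambda>y. ennreal (u y) * lnorm p (\<lambda>k. a k * b (k + y))) \<le> ?R"
    unfolding \<Psi>_def[symmetric] i j by (intro SUP_least ij)
qed

section \<open>Passage to sequences indexed by \<open>int ^ 'd\<close>\<close>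

lemma lattice_point_props:
  "lattice_point (j + k) = lattice_point j + lattice_point k"
  "lattice_point (j - k) = lattice_point j - lattice_point k"
  "lattice_point (- k) = - lattice_point k"
  by (simp_all add: lattice_point_def vec_eq_iff)

lemma bij_lattice_point: "bij_betw lattice_point (UNIV :: (int ^ 'd::finite) set) lattice"
proof (rule bij_betwI[where g = "\<lambda>x. \<chi> i. \<lfloor>x $ i\<rfloor>"])
  show "lattice_point \<in> (UNIV :: (int ^ 'd) set) \<rightarrow> lattice"
    by (auto simp: lattice_def lattice_point_def Basis_vec_def inner_axis)
  fix x :: "real ^ 'd" assume "x \<in> lattice"
  then have "x $ i \<in> \<int>" for i
    unfolding lattice_def by (auto simp: Basis_vec_def inner_axis dest: bspec[of _ _ "axis i 1"])
  then show "lattice_point (\<chi> i. \<lfloor>x $ i\<rfloor>) = x" by (simp add: lattice_point_def vec_eq_iff)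
qed (auto simp: lattice_point_def vec_eq_iff)

lemma lnorm_lattice_point:
  "0 < p \<Longrightarrow> lnorm p f = Lp_norm (count_space UNIV) p (\<lambda>k. f (lattice_point k))"
  by (rule Lp_norm_count_bij[OF bij_lattice_point, symmetric])

lemma nn_integral_lattice_point:
  "(\<integral>\<^sup>+x. f x \<partial>count_space lattice) = (\<integral>\<^sup>+k. f (lattice_point k) \<partial>count_space UNIV)"
  by (rule nn_integral_bij_count_space[OF bij_lattice_point, symmetric])

definition lattice_index :: "real ^ 'd \<Rightarrow> int ^ 'd::finite" where
  "lattice_index x = (\<chi> i. \<lfloor>x $ i\<rfloor>)"

lemma lattice_index_point [simp]: "lattice_index (lattice_point k) = k"
  by (simp add: lattice_index_def lattice_point_def vec_eq_iff)

text \<open>When the norm on the right is infinite there is nothing to show. Otherwise the positive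
  weight forces the sequence to be finite on the lattice, so it is the modulus of a complex
  sequence.\<close>

lemma lp_embeds_iff:
  fixes w u :: "real ^ 'd::finite \<Rightarrow> real"
  assumes p: "0 < p" and q: "0 < q" and w: "\<And>x. 0 < w x" and u: "\<And>x. 0 < u x"
  shows "lp_embeds p w q u \<longleftrightarrow> (\<exists>C>0. \<forall>a. lnorm q (\<lambda>k. ennreal (u k) * a k) \<le> ennreal C * lnorm p (\<lambda>k. ennreal (w k) * a k))"
    (is "_ \<longleftrightarrow> ?R")
proof -
  have lp: "lp_norm r v b = lnorm r (\<lambda>k. ennreal (v k) * ennreal (cmod (b (lattice_index k))))"
    if "0 < r" "\<And>x. 0 < v x" for r v and b :: "int ^ 'd \<Rightarrow> complex"
    using that by (simp add: lp_norm_def lnorm_lattice_point less_imp_le ennreal_mult mult.commute)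
  show ?thesis
  proof
    assume "lp_embeds p w q u"
    then obtain C where C: "0 < C" "\<And>a. a \<in> lp_space p w \<Longrightarrow> lp_norm q u a \<le> ennreal C * lp_norm p w a"
      unfolding lp_embeds_def by blast
    have "lnorm q (\<lambda>k. ennreal (u k) * a k) \<le> ennreal C * lnorm p (\<lambda>k. ennreal (w k) * a k)" for a
    proof (cases "lnorm p (\<lambda>k. ennreal (w k) * a k) = \<infinity>")
      case True then show ?thesis using C(1) by (simp add: ennreal_mult_top)
    next
      case False
      have fin: "a k \<noteq> \<infinity>" if k: "k \<in> lattice" for k
      proof
        assume "a k = \<infinity>"
        then have "ennreal (w k) * a k = \<infinity>" using w[of k] by (simp add: ennreal_mult_top)
        then show False using le_Lp_norm_count[OF p k, of "\<lambda>k. ennreal (w k) * a k"] False by (simp add: top_unique)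
      qed
      define b where "b k = complex_of_real (enn2real (a (lattice_point k)))" for k
      have ab: "a k = ennreal (cmod (b (lattice_index k)))" if k: "k \<in> lattice" for k
      proof -
        obtain j where "k = lattice_point j" using k bij_betw_imp_surj_on[OF bij_lattice_point] by blast
        then show ?thesis using fin[OF k] by (simp add: b_def less_top)
      qed
      have "lnorm p (\<lambda>k. ennreal (w k) * a k) = lp_norm p w b" "lnorm q (\<lambda>k. ennreal (u k) * a k) = lp_norm q u b"
        unfolding lp[OF p w] lp[OF q u] by (intro Lp_norm_cong p q; simp add: ab)+
      moreover from this False have "b \<in> lp_space p w" by (simp add: lp_space_def less_top)
      ultimately show ?thesis using C(2) by simp
    qed
    with C(1) show ?R by blast
  next
    assume ?R
    then show "lp_embeds p w q u" unfolding lp_embeds_def using lp[OF p w] lp[OF q u] by auto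
  qed
qed

lemma lnorm_delta:
  assumes "0 < p" "j \<in> lattice" shows "lnorm p (\<lambda>k. c k * (if k = j then 1 else 0)) = c j"
proof (rule antisym)
  show "c j \<le> lnorm p (\<lambda>k. c k * (if k = j then 1 else 0))"
    using le_Lp_norm_count[OF assms, of "\<lambda>k. c k * (if k = j then 1 else 0)"] by simp
  show "lnorm p (\<lambda>k. c k * (if k = j then 1 else 0)) \<le> c j"
  proof (cases "p = \<infinity>")
    case True then show ?thesis by (auto simp: esssup_count_space intro: SUP_least)
  next
    case False
    have "(\<integral>\<^sup>+k. ennreal_powr (c k * (if k = j then 1 else 0)) (enn2real p) \<partial>count_space lattice)
      = (\<Sum>k\<in>{j}. ennreal_powr (c k * (if k = j then 1 else 0)) (enn2real p))"
      by (rule nn_integral_count_space') (use assms in \<open>auto split: if_splits\<close>)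
    then show ?thesis using False enn2real_pos[OF assms(1)] by (simp add: Lp_norm_finite)
  qed
qed

text \<open>If b is the Dirac sequence at 0, the inner norm is a(-y), which explains the reflected
  u; the norm of b is w2(0), and this enters the constant. If a is the Dirac sequence, the inner
  norm is b(y), and reflecting b puts the reflection on both weights.\<close>

lemma corr_bounded_embeds:
  fixes w1 w2 u :: "real ^ 'd::finite \<Rightarrow> real"
  assumes pos: "0 < p" "0 < p1" "0 < p2" "0 < q"
    and w: "\<And>x. 0 < w1 x" "\<And>x. 0 < w2 x" "\<And>x. 0 < u x"
    and cb: "corr_bounded p p1 w1 p2 w2 q u"
  shows "lp_embeds p1 w1 q (reflect u)" "lp_embeds p2 (reflect w2) q (reflect u)"
proof -
  obtain C where C: "0 < C" "\<And>a b. lnorm q (\<lambda>y. ennreal (u y) * lnorm p (\<lambda>k. a k * b (k + y)))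
       \<le> ennreal C * lnorm p1 (\<lambda>k. ennreal (w1 k) * a k) * lnorm p2 (\<lambda>k. ennreal (w2 k) * b k)"
    using cb unfolding corr_bounded_def by blast
  let ?\<delta> = "\<lambda>k. if k = 0 then 1 else 0 :: ennreal"
  have refl: "lnorm r f = lnorm r (\<lambda>k. f (- k))" if "0 < r" for r and f :: "real ^ 'd \<Rightarrow> ennreal"
    by (rule Lp_norm_count_bij[OF bij_lattice_uminus that, symmetric])
  have "lnorm q (\<lambda>k. ennreal (reflect u k) * a k) \<le> ennreal (C * w2 0) * lnorm p1 (\<lambda>k. ennreal (w1 k) * a k)" for a
  proof -
    have "lnorm q (\<lambda>k. ennreal (reflect u k) * a k) = lnorm q (\<lambda>y. ennreal (u y) * lnorm p (\<lambda>k. a k * ?\<delta> (k + y)))"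
    proof (subst refl[OF pos(4)], intro Lp_norm_cong pos)
      fix y :: "real ^ 'd" assume "y \<in> space (count_space lattice)"
      then show "ennreal (reflect u (- y)) * a (- y) = ennreal (u y) * lnorm p (\<lambda>k. a k * ?\<delta> (k + y))"
        using lnorm_delta[OF pos(1), of "- y" a] by (simp add: reflect_def add_eq_0_iff2)
    qed
    also have "\<dots> \<le> ennreal C * lnorm p1 (\<lambda>k. ennreal (w1 k) * a k) * ennreal (w2 0)"
      using C(2)[of a ?\<delta>] lnorm_delta[OF pos(3) lattice_0, of "\<lambda>k. ennreal (w2 k)"] by simp
    finally show ?thesis using C(1) w(2)[of 0] by (simp add: ennreal_mult mult_ac)
  qed
  then show "lp_embeds p1 w1 q (reflect u)"
    using C(1) w(2)[of 0] by (subst lp_embeds_iff) (auto simp: pos w reflect_def intro!: exI[of _ "C * w2 0"])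
  have "lnorm q (\<lambda>k. ennreal (reflect u k) * b k) \<le> ennreal (C * w1 0) * lnorm p2 (\<lambda>k. ennreal (reflect w2 k) * b k)" for b
  proof -
    have "lnorm q (\<lambda>k. ennreal (reflect u k) * b k) = lnorm q (\<lambda>y. ennreal (u y) * lnorm p (\<lambda>k. ?\<delta> k * b (- (k + y))))"
    proof (subst refl[OF pos(4)], intro Lp_norm_cong pos)
      fix y :: "real ^ 'd"
      show "ennreal (reflect u (- y)) * b (- y) = ennreal (u y) * lnorm p (\<lambda>k. ?\<delta> k * b (- (k + y)))"
        using lnorm_delta[OF pos(1) lattice_0, of "\<lambda>k. b (- (k + y))"] by (simp add: reflect_def mult.commute)
    qed
    also have "\<dots> \<le> ennreal C * ennreal (w1 0) * lnorm p2 (\<lambda>k. ennreal (w2 k) * b (- k))"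
      using C(2)[of ?\<delta> "\<lambda>k. b (- k)"] lnorm_delta[OF pos(2) lattice_0, of "\<lambda>k. ennreal (w1 k)"] by simp
    also have "lnorm p2 (\<lambda>k. ennreal (w2 k) * b (- k)) = lnorm p2 (\<lambda>k. ennreal (reflect w2 k) * b k)"
      by (subst refl[OF pos(3)]) (simp add: reflect_def)
    finally show ?thesis using C(1) w(1)[of 0] by (simp add: ennreal_mult mult_ac)
  qed
  then show "lp_embeds p2 (reflect w2) q (reflect u)"
    using C(1) w(1)[of 0] by (subst lp_embeds_iff) (auto simp: pos w reflect_def intro!: exI[of _ "C * w1 0"])
qed

lemma Lp_norm_count_cmult:
  assumes "0 < p" shows "Lp_norm (count_space A) p (\<lambda>x. c * f x) = c * Lp_norm (count_space A) p f"
proof (cases "p = \<infinity>")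
  case True then show ?thesis by (simp add: esssup_count_space SUP_mult_left_ennreal)
next
  case False
  then show ?thesis using enn2real_pos[OF assms False]
    by (simp add: Lp_norm_finite ennreal_powr_mult nn_integral_cmult)
qed

lemma lnorm_reflect: "0 < r \<Longrightarrow> lnorm r f = lnorm r (\<lambda>k. f (- k))"
  by (rule Lp_norm_count_bij[OF bij_lattice_uminus, symmetric])

lemma lnorm_finite_support:
  assumes "0 < p" "finite F" "\<And>k. k \<in> lattice \<Longrightarrow> k \<notin> F \<Longrightarrow> f k = 0" "\<And>k. f k < \<infinity>"
  shows "lnorm p f < \<infinity>"
proof (cases "p = \<infinity>")
  case True
  have "f k \<le> (\<Sum>j\<in>F. f j)" if "k \<in> lattice" for k
    using assms(3)[OF that] assms(2) by (cases "k \<in> F") (auto intro: member_le_sum)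
  then have "(SUP k\<in>lattice. f k) \<le> (\<Sum>j\<in>F. f j)" by (rule SUP_least)
  also have "\<dots> < \<infinity>" using assms(2,4) by simp
  finally show ?thesis using True by (simp add: esssup_count_space)
next
  case False
  have "(\<integral>\<^sup>+k. ennreal_powr (f k) (enn2real p) \<partial>count_space lattice) = (\<Sum>k\<in>F \<inter> lattice. ennreal_powr (f k) (enn2real p))"
    by (rule nn_integral_count_space') (use assms in auto)
  also have "\<dots> \<noteq> top" using assms(2,4) by (simp add: less_top)
  finally show ?thesis using False by (simp add: Lp_norm_finite less_top[symmetric])
qed

text \<open>The convolution of the moduli with values in [0, \<infinity>], defined before absolute
  convergence is known; its finiteness is what gives convergence.\<close>

definition abs_conv :: "(int ^ 'd::finite \<Rightarrow> complex) \<Rightarrow> (int ^ 'd \<Rightarrow> complex) \<Rightarrow> int ^ 'd \<Rightarrow> ennreal" where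
  "abs_conv A B n = (\<integral>\<^sup>+k. ennreal (cmod (A k * B (n - k))) \<partial>count_space UNIV)"

lemma lattice_point_lattice_index: "k \<in> lattice \<Longrightarrow> lattice_point (lattice_index k) = k"
  using bij_betw_imp_surj_on[OF bij_lattice_point] by force

lemma lp_norm_weight_power:
  fixes w :: "real ^ 'd::finite \<Rightarrow> real"
  assumes p1: "0 < p1" and s: "0 < s" and w: "\<And>x. 0 < w x"
  shows "lp_norm (p1 / ennreal s) (weight_power w (ennreal s)) A
    = ennreal_powr (lnorm p1 (\<lambda>x. ennreal (w x) * ennreal_powr (ennreal (cmod (A (lattice_index x)))) (1 / s))) s"
proof -
  have pos: "0 < p1 / ennreal s" using p1 by (simp add: ennreal_zero_less_divide)
  have "lp_norm (p1 / ennreal s) (weight_power w (ennreal s)) A = lnorm (p1 / ennreal s) (\<lambda>x. ennreal (cmod (A (lattice_index x)) * w x powr s))"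
    unfolding lp_norm_def lnorm_lattice_point[OF pos] weight_power_def using s by simp
  also have "\<dots> = lnorm (p1 / ennreal s) (\<lambda>x. ennreal_powr (ennreal (w x) * ennreal_powr (ennreal (cmod (A (lattice_index x)))) (1 / s)) s)"
  proof -
    have "ennreal (cmod a * w x powr s) = ennreal_powr (ennreal (w x) * ennreal_powr (ennreal (cmod a)) (1 / s)) s" for a x
      using s unfolding ennreal_powr_mult[OF s] ennreal_powr_inverse(2)[OF s] ennreal_powr_ennreal[OF less_imp_le[OF w]]
      by (simp add: ennreal_mult mult.commute)
    then show ?thesis by simp
  qed
  finally show ?thesis by (subst Lp_norm_powr[OF p1 s]) (use s in simp)
qed

text \<open>Put a = |A| ^ (1 / s) and b(x) = |B(-x)| ^ (1 / s). The s-th power of the inner l^s norm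
  is then the sum of |A(x) B(-(x + y))|, which is the convolution at -y. The sign turns u into its
  reflection.\<close>

lemma corr_norm_eq_conv:
  fixes u :: "real ^ 'd::finite \<Rightarrow> real"
  assumes q: "0 < q" and s: "0 < s" and u: "\<And>x. 0 < u x"
  shows "ennreal_powr (lnorm q (\<lambda>y. ennreal (u y) * lnorm (ennreal s) (\<lambda>x. ennreal_powr (ennreal (cmod (A (lattice_index x)))) (1 / s)
        * ennreal_powr (ennreal (cmod (B (lattice_index (- (x + y)))))) (1 / s)))) s
    = lnorm (q / ennreal s) (\<lambda>x. ennreal (weight_power (reflect u) (ennreal s) x) * abs_conv A B (lattice_index x))"
proof -
  have inner: "lnorm (ennreal s) (\<lambda>x. ennreal_powr (ennreal (cmod (A (lattice_index x)))) (1 / s)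
      * ennreal_powr (ennreal (cmod (B (lattice_index (- (x + - y)))))) (1 / s)) = ennreal_powr (abs_conv A B (lattice_index y)) (1 / s)"
    if y: "y \<in> lattice" for y
  proof -
    have "(\<integral>\<^sup>+x. ennreal_powr (ennreal_powr (ennreal (cmod (A (lattice_index x)))) (1 / s) * ennreal_powr (ennreal (cmod (B (lattice_index (- (x + - y)))))) (1 / s)) s \<partial>count_space lattice)
      = (\<integral>\<^sup>+x. ennreal (cmod (A (lattice_index x)) * cmod (B (lattice_index (y - x)))) \<partial>count_space lattice)"
      using s by (simp add: ennreal_powr_mult ennreal_mult)
    also have "\<dots> = abs_conv A B (lattice_index y)"
    proof -
      have "lattice_index (y - lattice_point k) = lattice_index y - k" for k
        using lattice_point_lattice_index[OF y] by (metis lattice_index_point lattice_point_props(2))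
      then show ?thesis unfolding abs_conv_def nn_integral_lattice_point by (simp add: norm_mult)
    qed
    finally show ?thesis using s by (simp add: Lp_norm_finite)
  qed
  have "lnorm q (\<lambda>y. ennreal (u y) * lnorm (ennreal s) (\<lambda>x. ennreal_powr (ennreal (cmod (A (lattice_index x)))) (1 / s)
        * ennreal_powr (ennreal (cmod (B (lattice_index (- (x + y)))))) (1 / s)))
    = lnorm q (\<lambda>y. ennreal (reflect u y) * ennreal_powr (abs_conv A B (lattice_index y)) (1 / s))"
    by (subst lnorm_reflect[OF q], intro Lp_norm_cong q) (simp only: inner space_count_space reflect_def)
  then show ?thesis
    using s u Lp_norm_powr[OF q s, of "count_space lattice" "\<lambda>y. ennreal (reflect u y) * ennreal_powr (abs_conv A B (lattice_index y)) (1 / s)"]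
    by (simp add: ennreal_powr_mult ennreal_powr_ennreal reflect_def less_imp_le weight_power_def)
qed

lemma cmod_conv_le: "abs_conv A B n < \<infinity> \<Longrightarrow> (\<lambda>k. cmod (A k * B (n - k))) summable_on UNIV \<and> ennreal (cmod (conv A B n)) \<le> abs_conv A B n"
proof -
  assume "abs_conv A B n < \<infinity>"
  then obtain r where r: "abs_conv A B n = ennreal r" "0 \<le> r" by (cases "abs_conv A B n") auto
  have bd: "(\<Sum>k\<in>F. cmod (A k * B (n - k))) \<le> r" if "finite F" for F
  proof -
    have "ennreal (\<Sum>k\<in>F. cmod (A k * B (n - k))) = (\<Sum>k\<in>F. ennreal (cmod (A k * B (n - k))))" by (simp add: sum_ennreal)
    also have "\<dots> = (\<integral>\<^sup>+k. ennreal (cmod (A k * B (n - k))) * indicator F k \<partial>count_space UNIV)"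
      using that by (simp flip: nn_integral_count_space_indicator add: nn_integral_count_space_finite)
    also have "\<dots> \<le> abs_conv A B n" unfolding abs_conv_def by (intro nn_integral_mono) (simp split: split_indicator)
    finally show ?thesis using r by simp
  qed
  have s: "(\<lambda>k. cmod (A k * B (n - k))) summable_on UNIV"
    by (rule nonneg_bdd_above_summable_on) (auto intro!: bdd_aboveI2[where M = r] bd)
  have "cmod (conv A B n) \<le> (\<Sum>\<^sub>\<infinity>k. cmod (A k * B (n - k)))"
    unfolding conv_def by (rule norm_infsum_bound[OF s])
  also have "\<dots> \<le> r" by (rule infsum_le_finite_sums[OF s]) (use bd in auto)
  finally show ?thesis using s r by (simp add: ennreal_leI)
qed

text \<open>In one direction the correlation inequality is applied to s-th roots of the moduli and
  raised to the power s. In the other it suffices to test finitely supported non-negative sequences,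
  whose s-th powers convolve without cancellation.\<close>

lemma corr_bounded_iff_conv:
  fixes w1 w2 u :: "real ^ 'd::finite \<Rightarrow> real"
  assumes pos: "0 < p" "0 < p1" "0 < p2" "0 < q" and pf: "p < \<infinity>"
    and w: "\<And>x. 0 < w1 x" "\<And>x. 0 < w2 x" "\<And>x. 0 < u x"
  shows "corr_bounded p p1 w1 p2 w2 q u \<longleftrightarrow>
    lp_conv_embeds (p1 / p) (weight_power w1 p) (p2 / p) (weight_power (reflect w2) p) (q / p) (weight_power (reflect u) p)"
proof -
  obtain s where ps: "p = ennreal s" "0 < s" using pos(1) pf by (cases p) auto
  define root where "root (A :: int ^ 'd \<Rightarrow> complex) x = ennreal_powr (ennreal (cmod (A (lattice_index x)))) (1 / s)" for A x
  let ?X = "\<lambda>A B. lnorm q (\<lambda>y. ennreal (u y) * lnorm p (\<lambda>x. root A x * root B (- (x + y))))"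
  let ?S = "\<lambda>A B. lnorm (q / p) (\<lambda>x. ennreal (weight_power (reflect u) p x) * abs_conv A B (lattice_index x))"
  have qp: "0 < q / p" using pos(4) pf by (simp add: ennreal_zero_less_divide)
  have rw2: "0 < reflect w2 x" for x using w by (simp add: reflect_def)
  have X: "ennreal_powr (?X A B) s = ?S A B" for A B
    unfolding root_def ps(1) by (rule corr_norm_eq_conv[OF pos(4) ps(2) w(3)])
  have nA: "lp_norm (p1 / p) (weight_power w1 p) A = ennreal_powr (lnorm p1 (\<lambda>x. ennreal (w1 x) * root A x)) s" for A
    unfolding root_def ps(1) by (rule lp_norm_weight_power[OF pos(2) ps(2) w(1)])
  have nB: "lp_norm (p2 / p) (weight_power (reflect w2) p) B = ennreal_powr (lnorm p2 (\<lambda>x. ennreal (w2 x) * root B (- x))) s" for B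
  proof -
    have "lp_norm (p2 / p) (weight_power (reflect w2) p) B = ennreal_powr (lnorm p2 (\<lambda>x. ennreal (reflect w2 x) * root B x)) s"
      unfolding root_def ps(1) by (rule lp_norm_weight_power[OF pos(3) ps(2) rw2])
    also have "lnorm p2 (\<lambda>x. ennreal (reflect w2 x) * root B x) = lnorm p2 (\<lambda>x. ennreal (w2 x) * root B (- x))"
      by (subst lnorm_reflect[OF pos(3)]) (simp add: reflect_def)
    finally show ?thesis .
  qed
  have lpn: "lp_norm (q / p) (weight_power (reflect u) p) c = lnorm (q / p) (\<lambda>x. ennreal (weight_power (reflect u) p x) * ennreal (cmod (c (lattice_index x))))" for c :: "int ^ 'd \<Rightarrow> complex"
    unfolding lp_norm_def lnorm_lattice_point[OF qp] by (simp add: weight_power_def ennreal_mult mult.commute)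
  show ?thesis
  proof
    assume "corr_bounded p p1 w1 p2 w2 q u"
    then obtain C where C: "0 < C" "\<And>a b. lnorm q (\<lambda>y. ennreal (u y) * lnorm p (\<lambda>k. a k * b (k + y)))
       \<le> ennreal C * lnorm p1 (\<lambda>k. ennreal (w1 k) * a k) * lnorm p2 (\<lambda>k. ennreal (w2 k) * b k)"
      unfolding corr_bounded_def by blast
    show "lp_conv_embeds (p1 / p) (weight_power w1 p) (p2 / p) (weight_power (reflect w2) p) (q / p) (weight_power (reflect u) p)"
      unfolding lp_conv_embeds_def
    proof (intro exI[of _ "C powr s"] conjI ballI)
      show "0 < C powr s" using C(1) by simp
      fix A B assume A: "A \<in> lp_space (p1 / p) (weight_power w1 p)" and B: "B \<in> lp_space (p2 / p) (weight_power (reflect w2) p)"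
      have "ennreal_powr (?X A B) s \<le> ennreal_powr (ennreal C * lnorm p1 (\<lambda>x. ennreal (w1 x) * root A x) * lnorm p2 (\<lambda>x. ennreal (w2 x) * root B (- x))) s"
        using C(2)[of "root A" "\<lambda>x. root B (- x)"] ps(2) by (intro ennreal_powr_mono)
      then have main: "?S A B \<le> ennreal (C powr s) * lp_norm (p1 / p) (weight_power w1 p) A * lp_norm (p2 / p) (weight_power (reflect w2) p) B"
        using C(1) ps(2) unfolding X nA nB by (simp add: ennreal_powr_mult ennreal_powr_ennreal)
      also have "\<dots> < \<infinity>" using A B by (simp add: lp_space_def ennreal_mult_less_top)
      finally have fin: "?S A B < \<infinity>" .
      \<comment> \<open>An infinite value at one point would, the weight being positive, make the
        whole bounded norm infinite. This is where absolute convergence comes from.\<close>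
      have cf: "abs_conv A B n < \<infinity>" for n
      proof (rule ccontr)
        assume "\<not> abs_conv A B n < \<infinity>"
        then have "abs_conv A B n = top" by (simp add: less_top[symmetric])
        moreover have "lattice_point n \<in> lattice" using bij_betw_imp_surj_on[OF bij_lattice_point] by blast
        moreover have "0 < weight_power (reflect u) p (lattice_point n)" using w(3) by (simp add: weight_power_def reflect_def less_imp_neq[symmetric])
        ultimately have "top \<le> ?S A B"
          using le_Lp_norm_count[OF qp, of "lattice_point n" lattice "\<lambda>x. ennreal (weight_power (reflect u) p x) * abs_conv A B (lattice_index x)"]
          by (simp add: ennreal_mult_top)
        then show False using fin by (simp add: top_unique)
      qed
      show "\<forall>n. (\<lambda>k. cmod (A k * B (n - k))) summable_on UNIV" using cmod_conv_le[OF cf] by blast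
      have "lp_norm (q / p) (weight_power (reflect u) p) (conv A B) \<le> ?S A B"
        unfolding lpn using cmod_conv_le[OF cf] by (intro Lp_norm_count_mono qp mult_left_mono) auto
      with main show "lp_norm (q / p) (weight_power (reflect u) p) (conv A B)
        \<le> ennreal (C powr s) * lp_norm (p1 / p) (weight_power w1 p) A * lp_norm (p2 / p) (weight_power (reflect w2) p) B"
        by (rule order_trans[rotated])
    qed
  next
    assume "lp_conv_embeds (p1 / p) (weight_power w1 p) (p2 / p) (weight_power (reflect w2) p) (q / p) (weight_power (reflect u) p)"
    then obtain C where C: "0 < C" "\<And>A B. A \<in> lp_space (p1 / p) (weight_power w1 p) \<Longrightarrow> B \<in> lp_space (p2 / p) (weight_power (reflect w2) p) \<Longrightarrow>
        lp_norm (q / p) (weight_power (reflect u) p) (conv A B)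
        \<le> ennreal C * lp_norm (p1 / p) (weight_power w1 p) A * lp_norm (p2 / p) (weight_power (reflect w2) p) B"
      unfolding lp_conv_embeds_def by blast
    show "corr_bounded p p1 w1 p2 w2 q u"
    proof (rule corr_boundedI[OF pos, of "C powr (1 / s)"])
      show "0 < C powr (1 / s)" using C(1) by simp
      fix a b :: "real ^ 'd \<Rightarrow> real"
      assume a: "\<And>k. 0 \<le> a k" "finite {k. a k \<noteq> 0}" and b: "\<And>k. 0 \<le> b k" "finite {k. b k \<noteq> 0}"
      define A where "A k = complex_of_real (a (lattice_point k) powr s)" for k
      define B where "B k = complex_of_real (b (- lattice_point k) powr s)" for k
      have rA: "root A x = ennreal (a x)" and rB: "root B (- x) = ennreal (b x)" if "x \<in> lattice" for x
        using a(1) b(1) ps(2) lattice_point_lattice_index[OF that] lattice_point_lattice_index[of "- x"] that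
        by (simp_all add: root_def A_def B_def ennreal_powr_ennreal powr_powr)
      have nA': "lnorm p1 (\<lambda>x. ennreal (w1 x) * root A x) = lnorm p1 (\<lambda>x. ennreal (w1 x) * ennreal (a x))"
        and nB': "lnorm p2 (\<lambda>x. ennreal (w2 x) * root B (- x)) = lnorm p2 (\<lambda>x. ennreal (w2 x) * ennreal (b x))"
        by (intro Lp_norm_cong pos; simp add: rA rB)+
      have "lnorm p1 (\<lambda>x. ennreal (w1 x) * ennreal (a x)) < \<infinity>" "lnorm p2 (\<lambda>x. ennreal (w2 x) * ennreal (b x)) < \<infinity>"
        by (rule lnorm_finite_support[OF pos(2) a(2)] lnorm_finite_support[OF pos(3) b(2)];
            auto simp: ennreal_mult_less_top)+
      then have AB: "A \<in> lp_space (p1 / p) (weight_power w1 p)" "B \<in> lp_space (p2 / p) (weight_power (reflect w2) p)"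
        by (simp_all add: lp_space_def nA nB nA' nB' less_top[symmetric])
      \<comment> \<open>\<open>A\<close> and \<open>B\<close> are non-negative, so the modulus of
        the convolution is the convolution of the moduli.\<close>
      have conv: "ennreal (cmod (conv A B n)) = abs_conv A B n" for n
      proof -
        define F where "F = lattice_index ` {k. a k \<noteq> 0}"
        have F: "finite F" "\<And>k. k \<notin> F \<Longrightarrow> A k = 0"
          using a(2) lattice_index_point by (auto simp: F_def A_def image_iff)
        have "conv A B n = (\<Sum>k\<in>F. A k * B (n - k))"
          unfolding conv_def using F infsum_cong_neutral[of UNIV F "\<lambda>k. A k * B (n - k)" "\<lambda>k. A k * B (n - k)"] by simp
        also have "\<dots> = complex_of_real (\<Sum>k\<in>F. cmod (A k * B (n - k)))"
          by (simp add: A_def B_def norm_mult)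
        finally have "cmod (conv A B n) = (\<Sum>k\<in>F. cmod (A k * B (n - k)))"
          by (simp only: norm_of_real abs_of_nonneg[OF sum_nonneg] norm_ge_zero)
        moreover have "abs_conv A B n = (\<Sum>k\<in>F. ennreal (cmod (A k * B (n - k))))"
          unfolding abs_conv_def by (rule nn_integral_count_space') (use F in auto)
        ultimately show ?thesis by (simp add: sum_ennreal)
      qed
      have "lnorm q (\<lambda>y. ennreal (u y) * lnorm p (\<lambda>k. ennreal (a k) * ennreal (b (k + y)))) = ?X A B"
        by (intro Lp_norm_cong pos arg_cong2[where f = "(*)"] refl)
          (auto simp: rA[symmetric] rB[symmetric] lattice_add simp del: minus_add_distrib)
      also have "\<dots> = ennreal_powr (?S A B) (1 / s)" unfolding X[symmetric] using ps(2) by simp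
      also have "?S A B = lp_norm (q / p) (weight_power (reflect u) p) (conv A B)" unfolding lpn conv ..
      also have "ennreal_powr \<dots> (1 / s) \<le> ennreal_powr (ennreal C * lp_norm (p1 / p) (weight_power w1 p) A * lp_norm (p2 / p) (weight_power (reflect w2) p) B) (1 / s)"
        using ps(2) by (intro ennreal_powr_mono C(2) AB) auto
      also have "\<dots> = ennreal (C powr (1 / s)) * lnorm p1 (\<lambda>x. ennreal (w1 x) * ennreal (a x)) * lnorm p2 (\<lambda>x. ennreal (w2 x) * ennreal (b x))"
        unfolding nA nB nA' nB' using ps(2) C(1) by (simp add: ennreal_powr_mult ennreal_powr_ennreal)
      finally show "lnorm q (\<lambda>y. ennreal (u y) * lnorm p (\<lambda>k. ennreal (a k) * ennreal (b (k + y)))) \<le> \<dots>" .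
    qed
  qed
qed

text \<open>The lattice form of the target norm, with P and Q standing for the two maximal
  functions. The shift of z is the one that appears in the transform of a Wigner
  distribution.\<close>

definition corr_form :: "ennreal \<Rightarrow> ennreal \<Rightarrow> ('a::euclidean_space \<times> 'a \<Rightarrow> real) \<Rightarrow> ('a \<times> 'a \<Rightarrow> ennreal) \<Rightarrow> ('a \<times> 'a \<Rightarrow> ennreal) \<Rightarrow> ennreal" where
  "corr_form p q m P Q = lnorm q (\<lambda>\<zeta>. ennreal (m \<zeta>) * lnorm p (\<lambda>z. P z * Q (z + (snd \<zeta>, - fst \<zeta>))))"

section \<open>The two sufficient conditions on the lattice\<close>

lemma lattice_norm_eq:
  assumes "0 < p" "0 < q" "\<And>x. 0 < w x" "\<And>x. 0 < u x"
  shows "lattice_norm p q w u P = lnorm q (\<lambda>n. ennreal (u n) * lnorm p (\<lambda>k. ennreal (w k) * P (k, n)))"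
  unfolding lattice_norm_def using assms
  by (simp add: Lp_norm_count_cmult[symmetric] less_imp_le ennreal_mult mult_ac)

text \<open>With \<zeta> = (j, l) and z = (k, n), for fixed j the l^q norm over l is moved inside
  the l^p norm over n, so that the time inequality applies to each pair of rows n and n - j. The
  norms A and B of the rows are then correlated over j by the frequency inequality.\<close>

lemma corr_form_le_conv:
  fixes m :: "'a::euclidean_space \<times> 'a \<Rightarrow> real"
  assumes pos: "0 < p" "0 < p1" "0 < p2" "0 < q1" "0 < q2" and pq: "p \<le> q" "p < \<infinity>"
    and w: "\<And>x. 0 < \<omega>1 x" "\<And>x. 0 < \<omega>2 x" "\<And>x. 0 < \<mu>1 x" "\<And>x. 0 < \<mu>2 x" and m: "\<And>z. 0 < m z"
    and K: "0 < K" "\<And>j l. m (j, l) \<le> K * m (j, 0) * m (0, l)"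
    and N1: "corr_bounded p p1 \<omega>1 p2 \<omega>2 q (\<lambda>l. m (0, l))"
    and N2: "corr_bounded p q1 \<mu>1 q2 \<mu>2 q (reflect (\<lambda>j. m (j, 0)))"
  shows "\<exists>C>0. \<forall>P Q. corr_form p q m P Q \<le> ennreal C * lattice_norm p1 q1 \<omega>1 \<mu>1 P * lattice_norm p2 q2 \<omega>2 \<mu>2 Q"
proof -
  have q: "0 < q" using pos(1) pq(1) by simp
  obtain C1 where C1: "0 < C1" "\<And>a b. lnorm q (\<lambda>y. ennreal (m (0, y)) * lnorm p (\<lambda>k. a k * b (k + y)))
       \<le> ennreal C1 * lnorm p1 (\<lambda>k. ennreal (\<omega>1 k) * a k) * lnorm p2 (\<lambda>k. ennreal (\<omega>2 k) * b k)"
    using N1 unfolding corr_bounded_def by blast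
  obtain C2 where C2: "0 < C2" "\<And>a b. lnorm q (\<lambda>y. ennreal (reflect (\<lambda>j. m (j, 0)) y) * lnorm p (\<lambda>k. a k * b (k + y)))
       \<le> ennreal C2 * lnorm q1 (\<lambda>k. ennreal (\<mu>1 k) * a k) * lnorm q2 (\<lambda>k. ennreal (\<mu>2 k) * b k)"
    using N2 unfolding corr_bounded_def by blast
  have "corr_form p q m P Q \<le> ennreal (K * C1 * C2) * lattice_norm p1 q1 \<omega>1 \<mu>1 P * lattice_norm p2 q2 \<omega>2 \<mu>2 Q" for P Q
  proof -
    define A where "A n = lnorm p1 (\<lambda>k. ennreal (\<omega>1 k) * P (k, n))" for n
    define B where "B n = lnorm p2 (\<lambda>k. ennreal (\<omega>2 k) * Q (k, n))" for n
    let ?I = "\<lambda>j l n. lnorm p (\<lambda>k. P (k, n) * Q (k + l, n - j))"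
    have "corr_form p q m P Q = lnorm q (\<lambda>l. lnorm q (\<lambda>j. ennreal (m (j, l)) * lnorm p (\<lambda>n. ?I j l n)))"
      unfolding corr_form_def by (subst lnorm_prod[OF q], subst lnorm_prod[OF pos(1)]) simp
    also have "\<dots> = lnorm q (\<lambda>j. lnorm q (\<lambda>l. ennreal (m (j, l)) * lnorm p (\<lambda>n. ?I j l n)))"
      by (rule lnorm_swap_eq[OF q])
    also have "\<dots> \<le> lnorm q (\<lambda>j. ennreal (K * C1) * (ennreal (m (j, 0)) * lnorm p (\<lambda>n. A n * B (n - j))))"
    proof (rule Lp_norm_count_mono[OF q])
      fix j
      have "lnorm q (\<lambda>l. ennreal (m (j, l)) * lnorm p (\<lambda>n. ?I j l n))
        \<le> lnorm q (\<lambda>l. ennreal (K * m (j, 0)) * lnorm p (\<lambda>n. ennreal (m (0, l)) * ?I j l n))"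
      proof (rule Lp_norm_count_mono[OF q])
        fix l
        have "ennreal (m (j, l)) \<le> ennreal (K * m (j, 0)) * ennreal (m (0, l))"
          using K(2)[of j l] K(1) m[of "(j, 0)"] m[of "(0, l)"] by (simp add: ennreal_leI flip: ennreal_mult)
        from mult_right_mono[OF this zero_le]
        show "ennreal (m (j, l)) * lnorm p (\<lambda>n. ?I j l n) \<le> ennreal (K * m (j, 0)) * lnorm p (\<lambda>n. ennreal (m (0, l)) * ?I j l n)"
          by (simp add: Lp_norm_count_cmult[OF pos(1)] mult.assoc)
      qed
      also have "\<dots> = ennreal (K * m (j, 0)) * lnorm q (\<lambda>l. lnorm p (\<lambda>n. ennreal (m (0, l)) * ?I j l n))"
        by (rule Lp_norm_count_cmult[OF q])
      \<comment> \<open>This exchange is where p \<le> q is used.\<close>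
      also have "\<dots> \<le> ennreal (K * m (j, 0)) * lnorm p (\<lambda>n. lnorm q (\<lambda>l. ennreal (m (0, l)) * ?I j l n))"
        using pq pos countable_lattice by (intro mult_left_mono Lp_norm_swap) auto
      also have "\<dots> \<le> ennreal (K * m (j, 0)) * lnorm p (\<lambda>n. ennreal C1 * (A n * B (n - j)))"
      proof (intro mult_left_mono Lp_norm_count_mono pos)
        fix n
        show "lnorm q (\<lambda>l. ennreal (m (0, l)) * ?I j l n) \<le> ennreal C1 * (A n * B (n - j))"
          using C1(2)[of "\<lambda>k. P (k, n)" "\<lambda>k. Q (k, n - j)"] by (simp add: A_def B_def mult.assoc)
      qed simp
      also have "\<dots> = ennreal (K * C1) * (ennreal (m (j, 0)) * lnorm p (\<lambda>n. A n * B (n - j)))"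
        unfolding Lp_norm_count_cmult[OF pos(1)] using K(1) C1(1) less_imp_le[OF m[of "(j, 0)"]]
        by (simp add: ennreal_mult mult_ac)
      finally show "lnorm q (\<lambda>l. ennreal (m (j, l)) * lnorm p (\<lambda>n. ?I j l n))
        \<le> ennreal (K * C1) * (ennreal (m (j, 0)) * lnorm p (\<lambda>n. A n * B (n - j)))" .
    qed
    also have "\<dots> = ennreal (K * C1) * lnorm q (\<lambda>j. ennreal (m (j, 0)) * lnorm p (\<lambda>n. A n * B (n - j)))"
      by (rule Lp_norm_count_cmult[OF q])
    \<comment> \<open>Rows are paired as n and n - j, whereas the correlation inequality pairs k
      with k + y; hence the frequency condition is stated with the reflected weight.\<close>
    also have "lnorm q (\<lambda>j. ennreal (m (j, 0)) * lnorm p (\<lambda>n. A n * B (n - j)))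
      = lnorm q (\<lambda>j. ennreal (reflect (\<lambda>j. m (j, 0)) j) * lnorm p (\<lambda>n. A n * B (n + j)))"
      by (subst lnorm_reflect[OF q]) (simp add: reflect_def)
    also have "ennreal (K * C1) * \<dots> \<le> ennreal (K * C1) * (ennreal C2 * lnorm q1 (\<lambda>k. ennreal (\<mu>1 k) * A k) * lnorm q2 (\<lambda>k. ennreal (\<mu>2 k) * B k))"
      by (intro mult_left_mono C2(2)) simp
    also have "\<dots> = ennreal (K * C1 * C2) * lattice_norm p1 q1 \<omega>1 \<mu>1 P * lattice_norm p2 q2 \<omega>2 \<mu>2 Q"
      using K(1) C1(1) C2(1) by (simp add: lattice_norm_eq pos w A_def B_def ennreal_mult mult_ac)
    finally show ?thesis .
  qed
  with K(1) C1(1) C2(1) show ?thesis by (intro exI[of _ "K * C1 * C2"]) auto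
qed

text \<open>Once the inner norm is an l^q norm, the expression is a double sum over z and \<zeta>,
  and the substitution of z + \<open>(snd \<zeta>, - fst \<zeta>)\<close> for \<zeta> makes it a
  product, provided the weight splits into a function of z and one of the shifted point.\<close>

lemma corr_form_le_embeds:
  fixes m :: "'a::euclidean_space \<times> 'a \<Rightarrow> real"
  assumes pos: "0 < q" "0 < p1" "0 < p2" "0 < q1" "0 < q2" and qp: "q \<le> p"
    and w: "\<And>x. 0 < \<omega>1 x" "\<And>x. 0 < \<omega>2 x" "\<And>x. 0 < \<mu>1 x" "\<And>x. 0 < \<mu>2 x" and m: "\<And>z. 0 < m z"
    and K: "0 < K" "\<And>z z'. m (z + z') \<le> K * m z * m z'"
    and E1: "0 < C1" "\<And>a. lnorm q (\<lambda>k. ennreal (m (0, - k)) * a k) \<le> ennreal C1 * lnorm p1 (\<lambda>k. ennreal (\<omega>1 k) * a k)"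
    and E2: "0 < C2" "\<And>a. lnorm q (\<lambda>k. ennreal (m (0, k)) * a k) \<le> ennreal C2 * lnorm p2 (\<lambda>k. ennreal (\<omega>2 k) * a k)"
    and E3: "0 < C3" "\<And>a. lnorm q (\<lambda>k. ennreal (m (k, 0)) * a k) \<le> ennreal C3 * lnorm q1 (\<lambda>k. ennreal (\<mu>1 k) * a k)"
    and E4: "0 < C4" "\<And>a. lnorm q (\<lambda>k. ennreal (m (- k, 0)) * a k) \<le> ennreal C4 * lnorm q2 (\<lambda>k. ennreal (\<mu>2 k) * a k)"
  shows "\<exists>C>0. \<forall>P Q. corr_form p q m P Q \<le> ennreal C * lattice_norm p1 q1 \<omega>1 \<mu>1 P * lattice_norm p2 q2 \<omega>2 \<mu>2 Q"
proof -
  have p: "0 < p" using pos(1) qp by simp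
  \<comment> \<open>The two one-variable embeddings are applied in turn, in k for each fixed n and
    then in n to the resulting row norms.\<close>
  have weighted: "lnorm q (\<lambda>z. ennreal (\<alpha> (fst z)) * ennreal (\<beta> (snd z)) * P z) \<le> ennreal (D * D') * lattice_norm r r' v v' P"
    if r: "0 < r" "0 < r'" and v: "\<And>x. 0 < v x" "\<And>x. 0 < v' x" and D: "0 < D" "0 < D'"
      and E: "\<And>a. lnorm q (\<lambda>k. ennreal (\<alpha> k) * a k) \<le> ennreal D * lnorm r (\<lambda>k. ennreal (v k) * a k)"
      and E': "\<And>a. lnorm q (\<lambda>k. ennreal (\<beta> k) * a k) \<le> ennreal D' * lnorm r' (\<lambda>k. ennreal (v' k) * a k)"
    for \<alpha> \<beta> v v' :: "'a \<Rightarrow> real" and r r' D D' and P :: "'a \<times> 'a \<Rightarrow> ennreal"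
  proof -
    have "lnorm q (\<lambda>z. ennreal (\<alpha> (fst z)) * ennreal (\<beta> (snd z)) * P z) = lnorm q (\<lambda>n. ennreal (\<beta> n) * lnorm q (\<lambda>k. ennreal (\<alpha> k) * P (k, n)))"
      by (subst lnorm_prod[OF pos(1)]) (simp add: Lp_norm_count_cmult[OF pos(1), symmetric] mult_ac)
    also have "\<dots> \<le> lnorm q (\<lambda>n. ennreal (\<beta> n) * (ennreal D * lnorm r (\<lambda>k. ennreal (v k) * P (k, n))))"
      by (intro Lp_norm_count_mono pos mult_left_mono E) auto
    also have "\<dots> = ennreal D * lnorm q (\<lambda>n. ennreal (\<beta> n) * lnorm r (\<lambda>k. ennreal (v k) * P (k, n)))"
      by (simp add: Lp_norm_count_cmult[OF pos(1), symmetric] mult_ac)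
    also have "\<dots> \<le> ennreal D * (ennreal D' * lnorm r' (\<lambda>n. ennreal (v' n) * lnorm r (\<lambda>k. ennreal (v k) * P (k, n))))"
      by (intro mult_left_mono E') auto
    finally show ?thesis using D by (simp add: lattice_norm_eq r v ennreal_mult mult.assoc)
  qed
  have "corr_form p q m P Q \<le> ennreal (K * K * K * (C1 * C3) * (C2 * C4)) * lattice_norm p1 q1 \<omega>1 \<mu>1 P * lattice_norm p2 q2 \<omega>2 \<mu>2 Q" for P Q
  proof -
    define R where "R z = ennreal (m (0, - fst z)) * ennreal (m (snd z, 0)) * P z" for z
    define S where "S z = ennreal (m (0, fst z)) * ennreal (m (- snd z, 0)) * Q z" for z
    have "corr_form p q m P Q \<le> lnorm q (\<lambda>\<zeta>. lnorm q (\<lambda>z. ennreal (K * K * K) * (R z * S (z + (snd \<zeta>, - fst \<zeta>)))))"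
      unfolding corr_form_def
    proof (rule Lp_norm_count_mono[OF pos(1)])
      fix \<zeta> :: "'a \<times> 'a"
      have "ennreal (m \<zeta>) * lnorm p (\<lambda>z. P z * Q (z + (snd \<zeta>, - fst \<zeta>))) \<le> ennreal (m \<zeta>) * lnorm q (\<lambda>z. P z * Q (z + (snd \<zeta>, - fst \<zeta>)))"
        by (intro mult_left_mono Lp_norm_count_antimono pos qp) simp
      also have "\<dots> = lnorm q (\<lambda>z. ennreal (m \<zeta>) * (P z * Q (z + (snd \<zeta>, - fst \<zeta>))))"
        by (rule Lp_norm_count_cmult[OF pos(1), symmetric])
      also have "\<dots> \<le> lnorm q (\<lambda>z. ennreal (K * K * K) * (R z * S (z + (snd \<zeta>, - fst \<zeta>))))"
      proof (rule Lp_norm_count_mono[OF pos(1)])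
        fix z :: "'a \<times> 'a"
        obtain j l k n where e: "\<zeta> = (j, l)" "z = (k, n)" by (cases \<zeta>, cases z)
        \<comment> \<open>The weight is split three times, which gives K ^ 3: (j, l) into its
          components, then j = n - (n - j) and l = -k + (k + l). The parts with k and n belong to P
          at (k, n), the others to Q at (k + l, n - j).\<close>
        have "m (j, l) \<le> K * m (j, 0) * m (0, l)" using K(2)[of "(j, 0)" "(0, l)"] by simp
        also have "\<dots> \<le> K * (K * m (n, 0) * m (- (n - j), 0)) * (K * m (0, - k) * m (0, k + l))"
          using K(2)[of "(n, 0)" "(- (n - j), 0)"] K(2)[of "(0, - k)" "(0, k + l)"] K(1) less_imp_le[OF m]
          by (intro mult_mono mult_nonneg_nonneg) (auto intro: less_imp_le)
        also have "\<dots> = K * K * K * (m (0, - k) * m (n, 0) * (m (0, k + l) * m (- (n - j), 0)))" by simp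
        finally have "ennreal (m \<zeta>) \<le> ennreal (K * K * K) * (ennreal (m (0, - k)) * ennreal (m (n, 0)) * (ennreal (m (0, k + l)) * ennreal (m (- (n - j), 0))))"
          using K(1) less_imp_le[OF m] unfolding e(1) by (simp add: ennreal_leI flip: ennreal_mult)
        from mult_right_mono[OF this zero_le, of "P z * Q (z + (snd \<zeta>, - fst \<zeta>))"]
        show "ennreal (m \<zeta>) * (P z * Q (z + (snd \<zeta>, - fst \<zeta>))) \<le> ennreal (K * K * K) * (R z * S (z + (snd \<zeta>, - fst \<zeta>)))"
          unfolding R_def S_def e by (simp add: mult_ac)
      qed
      finally show "ennreal (m \<zeta>) * lnorm p (\<lambda>z. P z * Q (z + (snd \<zeta>, - fst \<zeta>))) \<le> \<dots>" .
    qed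
    also have "\<dots> = ennreal (K * K * K) * lnorm q (\<lambda>z. R z * lnorm q (\<lambda>\<zeta>. S (z + (snd \<zeta>, - fst \<zeta>))))"
      by (simp add: Lp_norm_count_cmult[OF pos(1)], subst lnorm_swap_eq[OF pos(1)]) (simp add: Lp_norm_count_cmult[OF pos(1)])
    also have "lnorm q (\<lambda>z. R z * lnorm q (\<lambda>\<zeta>. S (z + (snd \<zeta>, - fst \<zeta>)))) = lnorm q (\<lambda>z. lnorm q S * R z)"
    proof (intro Lp_norm_cong pos)
      fix z :: "'a \<times> 'a" assume "z \<in> space (count_space lattice)"
      then have z: "fst z \<in> lattice" "snd z \<in> lattice" by (cases z; simp)+
      \<comment> \<open>For a fixed lattice point z the shifted point runs through the whole lattice
        once, so the inner norm does not depend on z.\<close>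
      have "bij_betw (\<lambda>\<zeta>. z + (snd \<zeta>, - fst \<zeta>)) (lattice :: ('a \<times> 'a) set) lattice"
        by (rule bij_betwI[where g = "\<lambda>\<zeta>. (snd z - snd \<zeta>, fst \<zeta> - fst z)"])
          (use z in \<open>auto simp: lattice_times[where 'a = 'a and 'b = 'a] prod_eq_iff plus_prod_def\<close>)
      from Lp_norm_count_bij[OF this pos(1), of S]
      show "R z * lnorm q (\<lambda>\<zeta>. S (z + (snd \<zeta>, - fst \<zeta>))) = lnorm q S * R z" by (simp add: mult.commute)
    qed
    also have "\<dots> = lnorm q S * lnorm q R" by (rule Lp_norm_count_cmult[OF pos(1)])
    also have "ennreal (K * K * K) * \<dots> \<le> ennreal (K * K * K) * ((ennreal (C2 * C4) * lattice_norm p2 q2 \<omega>2 \<mu>2 Q) * (ennreal (C1 * C3) * lattice_norm p1 q1 \<omega>1 \<mu>1 P))"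
    proof (intro mult_left_mono mult_mono)
      show "lnorm q R \<le> ennreal (C1 * C3) * lattice_norm p1 q1 \<omega>1 \<mu>1 P"
        unfolding R_def by (rule weighted[OF pos(2,4) w(1,3) E1(1) E3(1) E1(2) E3(2)])
      show "lnorm q S \<le> ennreal (C2 * C4) * lattice_norm p2 q2 \<omega>2 \<mu>2 Q"
        unfolding S_def by (rule weighted[OF pos(3,5) w(2,4) E2(1) E4(1) E2(2) E4(2)])
    qed auto
    also have "\<dots> = ennreal (K * K * K * (C1 * C3) * (C2 * C4)) * lattice_norm p1 q1 \<omega>1 \<mu>1 P * lattice_norm p2 q2 \<omega>2 \<mu>2 Q"
      using K(1) E1(1) E2(1) E3(1) E4(1) by (simp add: ennreal_mult mult_ac)
    finally show ?thesis .
  qed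
  moreover have "0 < K * K * K * (C1 * C3) * (C2 * C4)" using K(1) E1(1) E2(1) E3(1) E4(1) by simp
  ultimately show ?thesis by blast
qed

section \<open>Boundedness of the Wigner distribution\<close>

lemma lfloor_Pair: "lfloor (x, y) = (lfloor x, lfloor y)"
  by (rule euclidean_eqI) (auto simp: Basis_prod_def)

lemma Lp_norm_lebesgue_translate:
  fixes h :: "'a::euclidean_space \<Rightarrow> ennreal"
  assumes [measurable]: "h \<in> borel_measurable borel"
  shows "Lp_norm lebesgue p (\<lambda>z. h (z + c)) = Lp_norm lebesgue p h"
proof (cases "p = \<infinity>")
  case True
  have "(AE x in lborel. h x \<le> z) \<longleftrightarrow> (AE x in lborel. h (x + c) \<le> z)" for z
  proof -
    have "(AE x in lborel. h x \<le> z) \<longleftrightarrow> (AE x in distr lborel borel ((+) c). h x \<le> z)" by (subst lborel_distr_plus) (rule refl)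
    also have "\<dots> \<longleftrightarrow> (AE x in lborel. h (c + x) \<le> z)" by (subst AE_distr_iff) auto
    finally show ?thesis by (simp add: add.commute)
  qed
  then show ?thesis using True by (subst (1 2) Lp_norm_lebesgue_eq) (auto simp: esssup_eq_AE)
next
  case False
  then show ?thesis
    using lborel_nn_integral_translate[of "\<lambda>z. ennreal_powr (h z) (enn2real p)" c]
    by (simp add: Lp_norm_finite nn_integral_completion)
qed

lemma poly_weight_one: "poly_weight (\<lambda>_::'a::euclidean_space. 1)"
  unfolding poly_weight_def polynomial_growth_def moderate_def
  by (auto intro!: exI[of _ "\<lambda>_. 1"] exI[of _ "1::real"] exI[of _ "0::nat"])

text \<open>Both factors are shifted by the same vector, the only place where \<tau> enters. For
  fixed \<zeta> translation invariance in z removes it.\<close>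

lemma stft_fun_wigner_shift:
  fixes f1 f2 \<phi>1 \<phi>2 :: "'a::euclidean_space \<Rightarrow> complex"
  assumes "\<tau> \<in> {0..1}" "schwartz f1" "schwartz f2" "schwartz \<phi>1" "schwartz \<phi>2"
  shows "cmod (stft_fun (wigner \<tau> \<phi>1 \<phi>2) (wigner \<tau> f1 f2) (z, \<zeta>))
    = cmod (stft_fun \<phi>1 f1 (z + (- (\<tau> *\<^sub>R snd \<zeta>), (1 - \<tau>) *\<^sub>R fst \<zeta>)))
      * cmod (stft_fun \<phi>2 f2 (z + (- (\<tau> *\<^sub>R snd \<zeta>), (1 - \<tau>) *\<^sub>R fst \<zeta>) + (snd \<zeta>, - fst \<zeta>)))"
  using stft_fun_wigner[OF assms, of "fst z" "snd z" "fst \<zeta>" "snd \<zeta>"]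
  by (cases z, cases \<zeta>) (simp add: algebra_simps)

text \<open>After the translation is removed, z and \<zeta> are both moved to the corners of their
  cubes; slow variation of the maximal functions and moderateness of m bound the cost.\<close>

lemma wigner_norm_le_corr_form:
  fixes m :: "'a::euclidean_space \<times> 'a \<Rightarrow> real"
  assumes \<tau>: "\<tau> \<in> {0..1}" and p: "0 < p" and q: "0 < q" and m: "poly_weight m" and \<phi>: "schwartz \<phi>"
  shows "\<exists>C>0. \<forall>f1 f2. schwartz f1 \<longrightarrow> schwartz f2 \<longrightarrow>
    modulation_norm (wigner \<tau> \<phi> \<phi>) p q ((\<lambda>_. 1) \<otimes>\<^sub>w m) (regular_distr (wigner \<tau> f1 f2))
    \<le> ennreal C * corr_form p q m (peetre N (\<lambda>z. cmod (stft_fun \<phi> f1 z))) (peetre N (\<lambda>z. cmod (stft_fun \<phi> f2 z)))"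
proof -
  obtain Cm a where m: "1 \<le> Cm" "\<And>x y. m x \<le> Cm * jbracket (x - y) ^ a * m y" "\<And>x. 0 < m x" "m \<in> borel_measurable lebesgue"
    using poly_weightE[OF m] by blast
  define J where "J = 1 + real DIM('a)"
  have J: "jbracket (x - lfloor x) \<le> J" "0 < J" for x :: 'a using jbracket_lfloor[of x] by (auto simp: J_def)
  define J2 where "J2 = 1 + real DIM('a \<times> 'a)"
  have J2: "jbracket (x - lfloor x) \<le> J2" "0 < J2" for x :: "'a \<times> 'a" using jbracket_lfloor[of x] by (auto simp: J2_def)
  \<comment> \<open>J ^ N per variable for the first factor. The argument of the second factor is
    displaced by the rounding of z and of \<zeta> together, which gives J * J instead of J.\<close>
  define D where "D = (J ^ N * J ^ N) * ((J * J) ^ N * (J * J) ^ N)"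
  have D: "0 < D" using J by (simp add: D_def)
  define C where "C = (Cm * J2 ^ a) * D"
  have C: "0 < C" using m(1) J2 D by (simp add: C_def)
  have "modulation_norm (wigner \<tau> \<phi> \<phi>) p q ((\<lambda>_. 1) \<otimes>\<^sub>w m) (regular_distr (wigner \<tau> f1 f2))
    \<le> ennreal C * corr_form p q m (peetre N (\<lambda>z. cmod (stft_fun \<phi> f1 z))) (peetre N (\<lambda>z. cmod (stft_fun \<phi> f2 z)))"
    if f: "schwartz f1" "schwartz f2" for f1 f2
  proof -
    define F1 where "F1 z = cmod (stft_fun \<phi> f1 z)" for z
    define F2 where "F2 z = cmod (stft_fun \<phi> f2 z)" for z
    define P where "P = peetre N F1"
    define Q where "Q = peetre N F2"
    have F0: "0 \<le> F1 z" "0 \<le> F2 z" for z by (auto simp: F1_def F2_def)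
    have Fc: "continuous_on S F1" "continuous_on S F2" for S unfolding F1_def F2_def
      by (intro continuous_intros schwartz_continuous schwartz_stft_fun \<phi> f)+
    have sW: "schwartz (wigner \<tau> f1 f2)" and s\<Phi>: "schwartz (wigner \<tau> \<phi> \<phi>)" by (intro schwartz_wigner \<tau> f \<phi>)+
    define H where "H z = cmod (stft_fun (wigner \<tau> \<phi> \<phi>) (wigner \<tau> f1 f2) z)" for z
    have Hc: "continuous_on UNIV H" unfolding H_def
      by (intro continuous_intros schwartz_continuous schwartz_stft_fun s\<Phi> sW)
    define \<sigma> where "\<sigma> \<zeta> = (snd \<zeta>, - fst \<zeta>)" for \<zeta> :: "'a \<times> 'a"
    have le: "ennreal (F1 z * F2 (z + \<sigma> \<zeta>)) \<le> ennreal D * (P (lfloor z) * Q (lfloor z + \<sigma> (lfloor \<zeta>)))" for z \<zeta>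
    proof -
      obtain x \<xi> \<eta> y where e: "z = (x, \<xi>)" "\<zeta> = (\<eta>, y)" by (cases z, cases \<zeta>)
      have "ennreal (F1 z) \<le> P z" using le_peetre[of F1 x \<xi> x N \<xi>] by (simp add: jbracket_def P_def e)
      also have "\<dots> \<le> ennreal (jbracket (x - lfloor x) ^ N * jbracket (\<xi> - lfloor \<xi>) ^ N) * P (lfloor z)"
        unfolding P_def e lfloor_Pair by (rule peetre_shift) (rule F0)
      also have "\<dots> \<le> ennreal (J ^ N * J ^ N) * P (lfloor z)"
        using J by (intro mult_right_mono ennreal_leI mult_mono power_mono) (auto intro: less_imp_le)
      finally have 1: "ennreal (F1 z) \<le> ennreal (J ^ N * J ^ N) * P (lfloor z)" .
      have b: "jbracket (s + t - (lfloor s + lfloor t)) \<le> J * J" "jbracket (s - t - (lfloor s - lfloor t)) \<le> J * J" for s t :: 'a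
      proof -
        have "jbracket ((s - lfloor s) + (t - lfloor t)) \<le> jbracket (s - lfloor s) * jbracket (t - lfloor t)" by (rule jbracket_add)
        also have "\<dots> \<le> J * J" using J by (intro mult_mono) (auto intro: less_imp_le)
        finally show "jbracket (s + t - (lfloor s + lfloor t)) \<le> J * J" by (simp add: algebra_simps)
        have "jbracket ((s - lfloor s) + - (t - lfloor t)) \<le> jbracket (s - lfloor s) * jbracket (- (t - lfloor t))" by (rule jbracket_add)
        also have "\<dots> \<le> J * J" unfolding jbracket_minus using J by (intro mult_mono) (auto intro: less_imp_le)
        finally show "jbracket (s - t - (lfloor s - lfloor t)) \<le> J * J" by (simp add: algebra_simps)
      qed
      have "ennreal (F2 (z + \<sigma> \<zeta>)) \<le> Q (z + \<sigma> \<zeta>)"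
        using le_peetre[of F2 "x + y" "\<xi> - \<eta>" "x + y" N "\<xi> - \<eta>"] by (simp add: jbracket_def Q_def e \<sigma>_def)
      also have "\<dots> \<le> ennreal (jbracket (x + y - (lfloor x + lfloor y)) ^ N * jbracket (\<xi> - \<eta> - (lfloor \<xi> - lfloor \<eta>)) ^ N) * Q (lfloor z + \<sigma> (lfloor \<zeta>))"
        using peetre_shift[of F2 N "x + y" "\<xi> - \<eta>" "lfloor x + lfloor y" "lfloor \<xi> - lfloor \<eta>"] F0(2)
        by (simp add: Q_def e lfloor_Pair \<sigma>_def)
      also have "\<dots> \<le> ennreal ((J * J) ^ N * (J * J) ^ N) * Q (lfloor z + \<sigma> (lfloor \<zeta>))"
        using J by (intro mult_right_mono ennreal_leI mult_mono power_mono b) auto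
      finally have 2: "ennreal (F2 (z + \<sigma> \<zeta>)) \<le> ennreal ((J * J) ^ N * (J * J) ^ N) * Q (lfloor z + \<sigma> (lfloor \<zeta>))" .
      have "ennreal (F1 z * F2 (z + \<sigma> \<zeta>)) = ennreal (F1 z) * ennreal (F2 (z + \<sigma> \<zeta>))" by (rule ennreal_mult[OF F0])
      also have "\<dots> \<le> (ennreal (J ^ N * J ^ N) * P (lfloor z)) * (ennreal ((J * J) ^ N * (J * J) ^ N) * Q (lfloor z + \<sigma> (lfloor \<zeta>)))"
        by (rule mult_mono[OF 1 2]) auto
      also have "\<dots> = (ennreal (J ^ N * J ^ N) * ennreal ((J * J) ^ N * (J * J) ^ N)) * (P (lfloor z) * Q (lfloor z + \<sigma> (lfloor \<zeta>)))"
        by (simp only: mult_ac)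
      also have "ennreal (J ^ N * J ^ N) * ennreal ((J * J) ^ N * (J * J) ^ N) = ennreal D"
        unfolding D_def using J(2) by (intro ennreal_mult[symmetric]) auto
      finally show ?thesis .
    qed
    define g where "g \<zeta> = Lp_norm lebesgue p (\<lambda>z. ennreal 1 * ennreal (H (z, \<zeta>)))" for \<zeta>
    have gm: "g \<in> borel_measurable lebesgue" unfolding g_def
      by (rule measurable_completion, subst measurable_lborel2, rule Lp_norm_param_measurable[OF p Hc]) (auto simp: H_def)
    have gle: "g \<zeta> \<le> ennreal D * lnorm p (\<lambda>z. P z * Q (z + \<sigma> (lfloor \<zeta>)))" for \<zeta>
    proof -
      have Gm: "(\<lambda>z. ennreal (F1 z * F2 (z + \<sigma> \<zeta>))) \<in> borel_measurable borel"
        by (intro measurable_compose[OF _ measurable_ennreal] borel_measurable_continuous_onI continuous_intros continuous_on_compose2[OF Fc(2)] Fc(1)) auto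
      have "g \<zeta> = Lp_norm lebesgue p (\<lambda>z. (\<lambda>z. ennreal (F1 z * F2 (z + \<sigma> \<zeta>))) (z + (- (\<tau> *\<^sub>R snd \<zeta>), (1 - \<tau>) *\<^sub>R fst \<zeta>)))"
        unfolding g_def H_def F1_def F2_def \<sigma>_def stft_fun_wigner_shift[OF \<tau> f \<phi> \<phi>] by (simp only: ennreal_1 mult_1_left)
      also have "\<dots> = Lp_norm lebesgue p (\<lambda>z. ennreal (F1 z * F2 (z + \<sigma> \<zeta>)))"
        by (rule Lp_norm_lebesgue_translate[OF Gm])
      also have "\<dots> \<le> lnorm p (\<lambda>z. ennreal D * (P z * Q (z + \<sigma> (lfloor \<zeta>))))"
      proof (rule Lp_norm_le_step[OF p])
        show "ennreal (F1 z * F2 (z + \<sigma> \<zeta>)) \<le> ennreal D * (P (lfloor z) * Q (lfloor z + \<sigma> (lfloor \<zeta>)))" for z by (rule le)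
      qed (use Gm in \<open>auto intro: measurable_completion\<close>)
      finally show ?thesis by (simp only: Lp_norm_count_cmult[OF p])
    qed
    have "modulation_norm (wigner \<tau> \<phi> \<phi>) p q ((\<lambda>_. 1) \<otimes>\<^sub>w m) (regular_distr (wigner \<tau> f1 f2)) = Lp_norm lebesgue q (\<lambda>\<zeta>. ennreal (m \<zeta>) * g \<zeta>)"
      unfolding g_def H_def by (rule modulation_norm_regular[OF s\<Phi> sW p _ m(3)]) simp
    also have "\<dots> \<le> lnorm q (\<lambda>\<zeta>. ennreal C * (ennreal (m \<zeta>) * lnorm p (\<lambda>z. P z * Q (z + \<sigma> \<zeta>))))"
    proof (rule Lp_norm_le_step[OF q])
      fix \<zeta> :: "'a \<times> 'a"
      have "m \<zeta> \<le> (Cm * J2 ^ a) * m (lfloor \<zeta>)"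
        using m(1) less_imp_le[OF m(3)[of "lfloor \<zeta>"]] J2(1)[of \<zeta>]
        by (intro order_trans[OF m(2)[of \<zeta> "lfloor \<zeta>"]] mult_right_mono mult_left_mono power_mono) auto
      then have "ennreal (m \<zeta>) \<le> ennreal (Cm * J2 ^ a) * ennreal (m (lfloor \<zeta>))"
        using m(1) J2(2) less_imp_le[OF m(3)[of "lfloor \<zeta>"]] by (simp add: ennreal_leI flip: ennreal_mult)
      from mult_mono[OF this gle[of \<zeta>]]
      have "ennreal (m \<zeta>) * g \<zeta> \<le> (ennreal (Cm * J2 ^ a) * ennreal (m (lfloor \<zeta>))) * (ennreal D * lnorm p (\<lambda>z. P z * Q (z + \<sigma> (lfloor \<zeta>))))" by simp
      also have "\<dots> = (ennreal (Cm * J2 ^ a) * ennreal D) * (ennreal (m (lfloor \<zeta>)) * lnorm p (\<lambda>z. P z * Q (z + \<sigma> (lfloor \<zeta>))))"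
        by (simp only: mult_ac)
      also have "ennreal (Cm * J2 ^ a) * ennreal D = ennreal C"
        unfolding C_def using m(1) J2(2) D by (intro ennreal_mult[symmetric]) auto
      finally show "ennreal (m \<zeta>) * g \<zeta> \<le> ennreal C * (ennreal (m (lfloor \<zeta>)) * lnorm p (\<lambda>z. P z * Q (z + \<sigma> (lfloor \<zeta>))))" .
    qed (use gm m(4) in auto)
    also have "\<dots> = ennreal C * corr_form p q m P Q"
      unfolding corr_form_def \<sigma>_def by (rule Lp_norm_count_cmult[OF q])
    finally show ?thesis unfolding P_def Q_def F1_def F2_def .
  qed
  with C show ?thesis by blast
qed

section \<open>Test functions built from shifted Gaussians\<close>

definition synth :: "'a set \<Rightarrow> ('a \<Rightarrow> real) \<Rightarrow> ('a \<Rightarrow> 'a) \<Rightarrow> ('a \<Rightarrow> 'a) \<Rightarrow> 'a::euclidean_space \<Rightarrow> complex" where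
  "synth S a \<kappa> \<nu> = (\<lambda>t. \<Sum>j\<in>S. of_real (a j) * modulate (\<nu> j) (translate (\<kappa> j) gauss) t)"

lemma schwartz_synth: "schwartz (synth S a \<kappa> \<nu>)"
  unfolding synth_def by (intro schwartz_sum schwartz_cmult schwartz_modulate schwartz_translate schwartz_gauss)

lemma stft_fun_synth:
  "stft_fun gauss (synth S a \<kappa> \<nu>) (x, \<xi>) = (\<Sum>j\<in>S. of_real (a j) * (cis (2 * pi * ((\<nu> j - \<xi>) \<bullet> \<kappa> j)) * stft_fun gauss gauss (x - \<kappa> j, \<xi> - \<nu> j)))"
proof -
  let ?g = "\<lambda>j. modulate (\<nu> j) (translate (\<kappa> j) gauss)"
  have sg: "schwartz (?g j)" for j by (intro schwartz_modulate schwartz_translate schwartz_gauss)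
  have int: "integrable lborel (\<lambda>t. ?g j t * cnj (modulate \<xi> (translate x gauss) t))" for j
    by (intro schwartz_integrable schwartz_mult sg schwartz_cnj schwartz_modulate schwartz_translate schwartz_gauss)
  have "stft_fun gauss (synth S a \<kappa> \<nu>) (x, \<xi>) = (\<integral>t. (\<Sum>j\<in>S. of_real (a j) * (?g j t * cnj (modulate \<xi> (translate x gauss) t))) \<partial>lborel)"
    by (simp add: stft_fun_inner synth_def sum_distrib_right mult.assoc)
  also have "\<dots> = (\<Sum>j\<in>S. of_real (a j) * stft_fun gauss (?g j) (x, \<xi>))"
    using int by (subst Bochner_Integration.integral_sum) (auto simp: stft_fun_inner)
  finally show ?thesis by (simp only: stft_fun_covariance[OF schwartz_gauss schwartz_gauss])
qed

lemma jbracket_product_ge: "jbracket (y - k) ^ N \<le> jbracket (x - k) ^ N * jbracket (x - y) ^ N"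
  using power_mono[OF jbracket_triangle[of y k x], of N] by (simp add: power_mult_distrib jbracket_minus_commute[of y x] mult.commute)

text \<open>The transform of each summand decays to order N around its centre, and the triangle
  inequality for brackets exchanges the centre distance of x for that of y at the cost of the
  denominator of the maximal function. The constant does not depend on the coefficients or
  shifts.\<close>

lemma peetre_synth:
  "\<exists>C>0. \<forall>S a \<kappa> \<nu> y \<eta>. (\<forall>j. 0 \<le> a j) \<longrightarrow> peetre N (\<lambda>z. cmod (stft_fun gauss (synth S a \<kappa> \<nu>) z)) (y, \<eta> :: 'a::euclidean_space)
    \<le> ennreal C * ennreal (\<Sum>j\<in>S. a j * (1 / jbracket (y - \<kappa> j) ^ N * (1 / jbracket (\<eta> - \<nu> j) ^ N)))"
proof -
  obtain C where C: "0 < C" "\<And>x \<xi> :: 'a. cmod (stft_fun gauss gauss (x, \<xi>)) \<le> C / (jbracket x ^ N * jbracket \<xi> ^ N)"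
    using stft_fun_bound[OF schwartz_gauss schwartz_gauss] by blast
  have "peetre N (\<lambda>z. cmod (stft_fun gauss (synth S a \<kappa> \<nu>) z)) (y, \<eta>)
    \<le> ennreal C * ennreal (\<Sum>j\<in>S. a j * (1 / jbracket (y - \<kappa> j) ^ N * (1 / jbracket (\<eta> - \<nu> j) ^ N)))"
    if a: "\<forall>j. 0 \<le> a j" for S a \<kappa> \<nu> and y \<eta> :: 'a
  proof (rule peetre_least)
    fix x \<xi>
    let ?J = "jbracket (x - y) ^ N * jbracket (\<xi> - \<eta>) ^ N"
    have "cmod (stft_fun gauss (synth S a \<kappa> \<nu>) (x, \<xi>)) / ?J \<le> (\<Sum>j\<in>S. a j * (C / (jbracket (x - \<kappa> j) ^ N * jbracket (\<xi> - \<nu> j) ^ N))) / ?J"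
      unfolding stft_fun_synth using a C(2)
      by (intro divide_right_mono sum_norm_le) (auto simp: norm_mult simp del: times_divide_eq_right intro!: mult_left_mono)
    also have "\<dots> = (\<Sum>j\<in>S. a j * (C / (jbracket (x - \<kappa> j) ^ N * jbracket (\<xi> - \<nu> j) ^ N) / ?J))"
      by (simp add: sum_divide_distrib)
    also have "\<dots> \<le> (\<Sum>j\<in>S. a j * (C * (1 / jbracket (y - \<kappa> j) ^ N * (1 / jbracket (\<eta> - \<nu> j) ^ N))))"
    proof (intro sum_mono mult_left_mono)
      fix j
      have "jbracket (y - \<kappa> j) ^ N * jbracket (\<eta> - \<nu> j) ^ N \<le> (jbracket (x - \<kappa> j) ^ N * jbracket (x - y) ^ N) * (jbracket (\<xi> - \<nu> j) ^ N * jbracket (\<xi> - \<eta>) ^ N)"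
        by (intro mult_mono jbracket_product_ge) auto
      then have "C / ((jbracket (x - \<kappa> j) ^ N * jbracket (x - y) ^ N) * (jbracket (\<xi> - \<nu> j) ^ N * jbracket (\<xi> - \<eta>) ^ N)) \<le> C / (jbracket (y - \<kappa> j) ^ N * jbracket (\<eta> - \<nu> j) ^ N)"
        using C(1) by (intro divide_left_mono) auto
      then show "C / (jbracket (x - \<kappa> j) ^ N * jbracket (\<xi> - \<nu> j) ^ N) / ?J \<le> C * (1 / jbracket (y - \<kappa> j) ^ N * (1 / jbracket (\<eta> - \<nu> j) ^ N))"
        by (simp add: mult_ac)
    qed (use a in auto)
    also have "\<dots> = C * (\<Sum>j\<in>S. a j * (1 / jbracket (y - \<kappa> j) ^ N * (1 / jbracket (\<eta> - \<nu> j) ^ N)))"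
      by (simp add: sum_distrib_left mult_ac)
    finally show "ennreal (cmod (stft_fun gauss (synth S a \<kappa> \<nu>) (x, \<xi>)) / ?J) \<le> ennreal C * ennreal (\<Sum>j\<in>S. a j * (1 / jbracket (y - \<kappa> j) ^ N * (1 / jbracket (\<eta> - \<nu> j) ^ N)))"
      using C(1) a by (subst ennreal_mult[symmetric]) (auto intro!: ennreal_leI sum_nonneg)
  qed
  with C(1) show ?thesis by blast
qed

lemma exponent_below:
  assumes "0 < p"
  obtains \<rho> where "0 < \<rho>" "ennreal \<rho> \<le> p" "ennreal \<rho> \<le> 1"
proof (cases p)
  case (real x)
  then show thesis using assms by (intro that[of "min 1 x"]) (auto intro!: ennreal_leI simp flip: ennreal_1)
next
  case top
  then show thesis by (intro that[of 1]) auto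
qed

lemma decay_exponent:
  assumes "0 < \<rho>"
  obtains M where "\<And>M'. M \<le> M' \<Longrightarrow> Lp_norm (count_space (lattice :: 'a::euclidean_space set)) (ennreal \<rho>) (\<lambda>k. ennreal (1 / jbracket k ^ M')) < \<infinity>"
proof -
  define M where "M = nat \<lceil>real (DIM('a) + 2) / \<rho>\<rceil>"
  have "real (DIM('a) + 2) \<le> \<rho> * real M'" if "M \<le> M'" for M'
  proof -
    have "real (DIM('a) + 2) / \<rho> \<le> real M" unfolding M_def by (rule real_nat_ceiling_ge)
    also have "\<dots> \<le> real M'" using that by simp
    finally show ?thesis using assms by (simp add: divide_le_eq mult.commute)
  qed
  then show thesis using assms by (intro that[of M] lattice_Lp_finite)
qed

lemma jbracket_power_diff: "b \<le> N \<Longrightarrow> jbracket x ^ b * (1 / jbracket x ^ N) = 1 / jbracket x ^ (N - b)"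
  by (simp add: power_diff field_simps)

text \<open>The weight grows at most like a fixed power b of the bracket, and what remains of the
  decay lies in a smaller l^\<rho>, hence in l^q.\<close>

lemma lnorm_weight_decay_finite:
  fixes u :: "'a::euclidean_space \<Rightarrow> real"
  assumes u: "poly_weight u" and q: "0 < q"
  obtains N0 where "\<And>N. N0 \<le> N \<Longrightarrow> lnorm q (\<lambda>n. ennreal (u n) * ennreal (1 / jbracket n ^ N)) < \<infinity>"
proof -
  obtain C b where u: "1 \<le> C" "\<And>x y. u x \<le> C * jbracket (x - y) ^ b * u y" "\<And>x. 0 < u x"
    "u \<in> borel_measurable lebesgue"
    using poly_weightE[OF u] by blast
  obtain \<rho> where \<rho>: "0 < \<rho>" "ennreal \<rho> \<le> q" using exponent_below[OF q] by blast
  obtain M where M: "\<And>M'. M \<le> M' \<Longrightarrow> Lp_norm (count_space (lattice :: 'a set)) (ennreal \<rho>) (\<lambda>k. ennreal (1 / jbracket k ^ M')) < \<infinity>"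
    using decay_exponent[OF \<rho>(1)] by blast
  have "lnorm q (\<lambda>n. ennreal (u n) * ennreal (1 / jbracket n ^ N)) < \<infinity>" if N: "M + b \<le> N" for N
  proof -
    have "lnorm q (\<lambda>n. ennreal (u n) * ennreal (1 / jbracket n ^ N)) \<le> lnorm q (\<lambda>n::'a. ennreal (C * u 0) * ennreal (1 / jbracket n ^ (N - b)))"
    proof (rule Lp_norm_count_mono[OF q])
      fix n
      have "u n * (1 / jbracket n ^ N) \<le> (C * jbracket n ^ b * u 0) * (1 / jbracket n ^ N)"
        using u(2)[of n 0] by (intro mult_right_mono) auto
      also have "\<dots> = (C * u 0) * (jbracket n ^ b * (1 / jbracket n ^ N))" by simp
      also have "\<dots> = (C * u 0) * (1 / jbracket n ^ (N - b))" using N by (subst jbracket_power_diff) auto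
      finally show "ennreal (u n) * ennreal (1 / jbracket n ^ N) \<le> ennreal (C * u 0) * ennreal (1 / jbracket n ^ (N - b))"
        using u(1) less_imp_le[OF u(3)] by (simp add: ennreal_leI flip: ennreal_mult)
    qed
    also have "\<dots> = ennreal (C * u 0) * lnorm q (\<lambda>n::'a. ennreal (1 / jbracket n ^ (N - b)))" by (rule Lp_norm_count_cmult[OF q])
    also have "\<dots> \<le> ennreal (C * u 0) * lnorm (ennreal \<rho>) (\<lambda>n::'a. ennreal (1 / jbracket n ^ (N - b)))"
      using \<rho> by (intro mult_left_mono Lp_norm_count_antimono) auto
    also have "\<dots> < \<infinity>" using M[of "N - b"] N by (simp add: ennreal_mult_less_top)
    finally show ?thesis .
  qed
  then show thesis by (rule that)
qed

text \<open>Convolution with a rapidly decaying kernel is bounded on weighted l^p also for p < 1.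
  The sum is first enlarged to an l^\<rho> quasi-norm with \<rho> at most 1 and p, to which Young's
  inequality applies; moving the weight from k to j costs a power b of the kernel.\<close>

lemma lnorm_smoothing:
  fixes w :: "'a::euclidean_space \<Rightarrow> real"
  assumes w: "poly_weight w" and p: "0 < p"
  obtains N0 where "\<And>N. N0 \<le> N \<Longrightarrow> \<exists>C>0. \<forall>a. (\<forall>k. 0 \<le> a k) \<longrightarrow> finite {k. a k \<noteq> 0} \<longrightarrow> {k. a k \<noteq> 0} \<subseteq> lattice \<longrightarrow>
    lnorm p (\<lambda>k. ennreal (w k) * ennreal (\<Sum>j | a j \<noteq> 0. a j * (1 / jbracket (k - j) ^ N))) \<le> ennreal C * lnorm p (\<lambda>k. ennreal (w k) * ennreal (a k))"
proof -
  obtain Cw b where w: "1 \<le> Cw" "\<And>x y. w x \<le> Cw * jbracket (x - y) ^ b * w y" "\<And>x. 0 < w x"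
    "w \<in> borel_measurable lebesgue"
    using poly_weightE[OF w] by blast
  obtain \<rho> where \<rho>: "0 < \<rho>" "ennreal \<rho> \<le> p" "ennreal \<rho> \<le> 1" using exponent_below[OF p] by blast
  have \<rho>0: "0 < ennreal \<rho>" using \<rho>(1) by simp
  obtain M where M: "\<And>M'. M \<le> M' \<Longrightarrow> Lp_norm (count_space (lattice :: 'a set)) (ennreal \<rho>) (\<lambda>k. ennreal (1 / jbracket k ^ M')) < \<infinity>"
    using decay_exponent[OF \<rho>(1)] by blast
  have "\<exists>C>0. \<forall>a. (\<forall>k. 0 \<le> a k) \<longrightarrow> finite {k. a k \<noteq> 0} \<longrightarrow> {k. a k \<noteq> 0} \<subseteq> lattice \<longrightarrow>
    lnorm p (\<lambda>k. ennreal (w k) * ennreal (\<Sum>j | a j \<noteq> 0. a j * (1 / jbracket (k - j) ^ N))) \<le> ennreal C * lnorm p (\<lambda>k. ennreal (w k) * ennreal (a k))"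
    if N: "M + b \<le> N" for N
  proof -
    define g where "g i = ennreal (1 / jbracket i ^ (N - b))" for i :: 'a
    let ?G = "lnorm (ennreal \<rho>) g"
    have Gf: "?G < \<infinity>" unfolding g_def using N by (intro M) simp
    have "1 \<le> ?G" using le_Lp_norm_count[OF \<rho>0 lattice_0, of g] by (simp add: g_def jbracket_def)
    then have G0: "?G \<noteq> 0" by auto
    then obtain G where G: "?G = ennreal G" "0 < G" using Gf by (cases ?G) auto
    have "lnorm p (\<lambda>k. ennreal (w k) * ennreal (\<Sum>j | a j \<noteq> 0. a j * (1 / jbracket (k - j) ^ N))) \<le> ennreal (Cw * G) * lnorm p (\<lambda>k. ennreal (w k) * ennreal (a k))"
      if a: "\<forall>k. 0 \<le> a k" "finite {k. a k \<noteq> 0}" "{k. a k \<noteq> 0} \<subseteq> lattice" for a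
    proof -
      define V where "V k = ennreal (w k) * ennreal (a k)" for k
      have "lnorm p (\<lambda>k. ennreal (w k) * ennreal (\<Sum>j | a j \<noteq> 0. a j * (1 / jbracket (k - j) ^ N)))
        \<le> lnorm p (\<lambda>k. ennreal Cw * lnorm (ennreal \<rho>) (\<lambda>i. g i * V (k + i)))"
      proof (rule Lp_norm_count_mono[OF p])
        fix k :: 'a assume k: "k \<in> lattice"
        have "ennreal (w k) * ennreal (\<Sum>j | a j \<noteq> 0. a j * (1 / jbracket (k - j) ^ N)) = ennreal (\<Sum>j | a j \<noteq> 0. w k * (a j * (1 / jbracket (k - j) ^ N)))"
          using a(1) less_imp_le[OF w(3)] by (simp add: sum_distrib_left sum_nonneg flip: ennreal_mult)
        also have "\<dots> \<le> ennreal (\<Sum>j | a j \<noteq> 0. Cw * (1 / jbracket (k - j) ^ (N - b) * (w j * a j)))"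
        proof (intro ennreal_leI sum_mono)
          fix j
          have "w k * (a j * (1 / jbracket (k - j) ^ N)) \<le> (Cw * jbracket (k - j) ^ b * w j) * (a j * (1 / jbracket (k - j) ^ N))"
            using a(1) by (intro mult_right_mono w(2)) auto
          also have "\<dots> = Cw * ((jbracket (k - j) ^ b * (1 / jbracket (k - j) ^ N)) * (w j * a j))" by (simp only: mult_ac)
          also have "\<dots> = Cw * (1 / jbracket (k - j) ^ (N - b) * (w j * a j))" using N by (subst jbracket_power_diff) auto
          finally show "w k * (a j * (1 / jbracket (k - j) ^ N)) \<le> \<dots>" .
        qed
        also have "\<dots> = ennreal Cw * (\<Sum>j | a j \<noteq> 0. g (j - k) * V j)"
          using a(1) w(1) less_imp_le[OF w(3)]
          unfolding sum_distrib_left g_def V_def jbracket_minus_commute[of k]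
          by (subst sum_ennreal[symmetric]) (auto simp flip: ennreal_mult)
        also have "(\<Sum>j | a j \<noteq> 0. g (j - k) * V j) = (\<integral>\<^sup>+j. g (j - k) * V j \<partial>count_space lattice)"
          by (rule nn_integral_count_space'[symmetric]) (use a in \<open>auto simp: V_def\<close>)
        also have "\<dots> = lnorm 1 (\<lambda>j. g (j - k) * V j)" by (simp add: Lp_norm_finite)
        also have "\<dots> = lnorm 1 (\<lambda>i. g i * V (k + i))"
          by (subst Lp_norm_count_bij[OF bij_lattice_shift[OF k], symmetric]) (simp_all add: add.commute)
        finally have "ennreal (w k) * ennreal (\<Sum>j | a j \<noteq> 0. a j * (1 / jbracket (k - j) ^ N)) \<le> ennreal Cw * lnorm 1 (\<lambda>i. g i * V (k + i))" .
        also have "\<dots> \<le> ennreal Cw * lnorm (ennreal \<rho>) (\<lambda>i. g i * V (k + i))"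
          by (intro mult_left_mono Lp_norm_count_antimono \<rho>0 \<rho>(3)) simp
        finally show "ennreal (w k) * ennreal (\<Sum>j | a j \<noteq> 0. a j * (1 / jbracket (k - j) ^ N)) \<le> \<dots>" .
      qed
      also have "\<dots> = ennreal Cw * lnorm p (\<lambda>k. lnorm (ennreal \<rho>) (\<lambda>i. g i * V (k + i)))" by (rule Lp_norm_count_cmult[OF p])
      also have "\<dots> \<le> ennreal Cw * (?G * lnorm p V)"
        by (intro mult_left_mono lattice_young \<rho>0 \<rho>(2) G0) (auto simp: g_def)
      finally show ?thesis using w(1) G by (simp add: ennreal_mult mult.assoc V_def[abs_def])
    qed
    moreover have "0 < Cw * G" using w(1) G(2) by simp
    ultimately show ?thesis by blast
  qed
  then show thesis by (rule that)
qed

text \<open>The maximal function is bounded by a product: along the axis of the shifts a smoothing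
  of the coefficients, along the other axis pure decay with finite norm. So time shifts see only p
  and w, frequency shifts only q and u.\<close>

lemma synth_norms:
  fixes w u :: "'a::euclidean_space \<Rightarrow> real"
  assumes w: "poly_weight w" and u: "poly_weight u" and p: "0 < p" and q: "0 < q"
  shows "\<exists>C>0. \<forall>a. (\<forall>k. 0 \<le> a k) \<longrightarrow> finite {k. a k \<noteq> 0} \<longrightarrow> {k. a k \<noteq> 0} \<subseteq> lattice \<longrightarrow>
      modulation_norm gauss p q (w \<otimes>\<^sub>w u) (regular_distr (synth {k. a k \<noteq> 0} a (\<lambda>k. k) (\<lambda>_. 0))) \<le> ennreal C * lnorm p (\<lambda>k. ennreal (w k) * ennreal (a k)) \<and>
      modulation_norm gauss p q (w \<otimes>\<^sub>w u) (regular_distr (synth {k. a k \<noteq> 0} a (\<lambda>_. 0) (\<lambda>k. k))) \<le> ennreal C * lnorm q (\<lambda>k. ennreal (u k) * ennreal (a k))"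
proof -
  have wp: "0 < w x" for x by (rule poly_weightE[OF w])
  have up: "0 < u x" for x by (rule poly_weightE[OF u])
  obtain N1 where N1: "\<And>N. N1 \<le> N \<Longrightarrow> lnorm q (\<lambda>n. ennreal (u n) * ennreal (1 / jbracket n ^ N)) < \<infinity>"
    using lnorm_weight_decay_finite[OF u q] by blast
  obtain N2 where N2: "\<And>N. N2 \<le> N \<Longrightarrow> lnorm p (\<lambda>n. ennreal (w n) * ennreal (1 / jbracket n ^ N)) < \<infinity>"
    using lnorm_weight_decay_finite[OF w p] by blast
  let ?adm = "\<lambda>a. (\<forall>k. 0 \<le> a k) \<and> finite {k. a k \<noteq> 0} \<and> {k. a k \<noteq> 0} \<subseteq> (lattice :: 'a set)"
  let ?s = "\<lambda>N a k. ennreal (\<Sum>j | a j \<noteq> 0. a j * (1 / jbracket (k - j) ^ N))"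
  obtain N3 where N3: "\<And>N. N3 \<le> N \<Longrightarrow> \<exists>C>0. \<forall>a. ?adm a \<longrightarrow> lnorm p (\<lambda>k. ennreal (w k) * ?s N a k) \<le> ennreal C * lnorm p (\<lambda>k. ennreal (w k) * ennreal (a k))"
    using lnorm_smoothing[OF w p] unfolding conj_imp_eq_imp_imp imp_conjL by blast
  obtain N4 where N4: "\<And>N. N4 \<le> N \<Longrightarrow> \<exists>C>0. \<forall>a. ?adm a \<longrightarrow> lnorm q (\<lambda>k. ennreal (u k) * ?s N a k) \<le> ennreal C * lnorm q (\<lambda>k. ennreal (u k) * ennreal (a k))"
    using lnorm_smoothing[OF u q] unfolding conj_imp_eq_imp_imp imp_conjL by blast
  define N where "N = N1 + N2 + N3 + N4"
  obtain C3 where C3: "0 < C3" "\<And>a. ?adm a \<Longrightarrow> lnorm p (\<lambda>k. ennreal (w k) * ?s N a k) \<le> ennreal C3 * lnorm p (\<lambda>k. ennreal (w k) * ennreal (a k))"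
    using N3[of N] unfolding N_def by auto
  obtain C4 where C4: "0 < C4" "\<And>a. ?adm a \<Longrightarrow> lnorm q (\<lambda>k. ennreal (u k) * ?s N a k) \<le> ennreal C4 * lnorm q (\<lambda>k. ennreal (u k) * ennreal (a k))"
    using N4[of N] unfolding N_def by auto
  obtain D1 where D1: "lnorm q (\<lambda>n. ennreal (u n) * ennreal (1 / jbracket n ^ N)) = ennreal D1" "0 \<le> D1"
    using N1[of N] by (cases "lnorm q (\<lambda>n. ennreal (u n) * ennreal (1 / jbracket n ^ N))") (auto simp: N_def)
  obtain D2 where D2: "lnorm p (\<lambda>n. ennreal (w n) * ennreal (1 / jbracket n ^ N)) = ennreal D2" "0 \<le> D2"
    using N2[of N] by (cases "lnorm p (\<lambda>n. ennreal (w n) * ennreal (1 / jbracket n ^ N))") (auto simp: N_def)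
  obtain C where C: "0 < C" "\<And>f. schwartz f \<Longrightarrow> modulation_norm gauss p q (w \<otimes>\<^sub>w u) (regular_distr f)
    \<le> ennreal C * lattice_norm p q w u (peetre N (\<lambda>z. cmod (stft_fun gauss f z)))"
    using modulation_norm_le_lattice_norm[OF schwartz_gauss p q w u] by blast
  obtain K where K: "0 < K" "\<And>S a \<kappa> \<nu> y \<eta>. (\<forall>j. 0 \<le> a j) \<Longrightarrow> peetre N (\<lambda>z. cmod (stft_fun gauss (synth S a \<kappa> \<nu>) z)) (y, \<eta> :: 'a)
    \<le> ennreal K * ennreal (\<Sum>j\<in>S. a j * (1 / jbracket (y - \<kappa> j) ^ N * (1 / jbracket (\<eta> - \<nu> j) ^ N)))"
    using peetre_synth[of N, where 'a = 'a] by blast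
  \<comment> \<open>One summand for each of the two families, and 1 to keep the constant positive
    when D1 and D2 are known only to be non-negative.\<close>
  define E where "E = C * K * (C3 * D1 + C4 * D2 + 1)"
  have E: "0 < E" using C(1) K(1) C3(1) C4(1) D1(2) D2(2) by (auto simp: E_def intro!: mult_pos_pos add_nonneg_pos)
  have prod_norm: "lattice_norm p q w u (\<lambda>(k, n). ennreal K * (s k * t n)) = ennreal K * (lnorm p (\<lambda>k. ennreal (w k) * s k) * lnorm q (\<lambda>n. ennreal (u n) * t n))" for s t
  proof -
    have "lattice_norm p q w u (\<lambda>(k, n). ennreal K * (s k * t n)) = lnorm q (\<lambda>n. ennreal (u n) * lnorm p (\<lambda>k. (ennreal K * t n) * (ennreal (w k) * s k)))"
      by (simp add: lattice_norm_eq p q wp up mult_ac)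
    also have "\<dots> = lnorm q (\<lambda>n. (ennreal K * lnorm p (\<lambda>k. ennreal (w k) * s k)) * (ennreal (u n) * t n))"
      unfolding Lp_norm_count_cmult[OF p] by (simp only: mult_ac)
    finally show ?thesis unfolding Lp_norm_count_cmult[OF q] by (simp only: mult_ac)
  qed
  have "modulation_norm gauss p q (w \<otimes>\<^sub>w u) (regular_distr (synth {k. a k \<noteq> 0} a (\<lambda>k. k) (\<lambda>_. 0))) \<le> ennreal E * lnorm p (\<lambda>k. ennreal (w k) * ennreal (a k)) \<and>
      modulation_norm gauss p q (w \<otimes>\<^sub>w u) (regular_distr (synth {k. a k \<noteq> 0} a (\<lambda>_. 0) (\<lambda>k. k))) \<le> ennreal E * lnorm q (\<lambda>k. ennreal (u k) * ennreal (a k))"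
    if a: "?adm a" for a
  proof
    have a0: "\<forall>j. 0 \<le> a j" using a by blast
    let ?f = "synth {k. a k \<noteq> 0} a (\<lambda>k. k) (\<lambda>_. 0)"
    have "modulation_norm gauss p q (w \<otimes>\<^sub>w u) (regular_distr ?f) \<le> ennreal C * lattice_norm p q w u (\<lambda>(k, n). ennreal K * (?s N a k * ennreal (1 / jbracket n ^ N)))"
    proof (rule order_trans[OF C(2)[OF schwartz_synth]], intro mult_left_mono lattice_norm_mono p q)
      fix k n :: 'a
      have "(\<Sum>j | a j \<noteq> 0. a j * (1 / jbracket (k - j) ^ N * (1 / jbracket (n - 0) ^ N))) = (\<Sum>j | a j \<noteq> 0. a j * (1 / jbracket (k - j) ^ N)) * (1 / jbracket n ^ N)"
        by (simp only: sum_distrib_right mult.assoc diff_zero)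
      moreover have "ennreal ((\<Sum>j | a j \<noteq> 0. a j * (1 / jbracket (k - j) ^ N)) * (1 / jbracket n ^ N)) = ?s N a k * ennreal (1 / jbracket n ^ N)"
        using a0 by (intro ennreal_mult sum_nonneg) auto
      ultimately show "peetre N (\<lambda>z. cmod (stft_fun gauss ?f z)) (k, n) \<le> (case (k, n) of (k, n) \<Rightarrow> ennreal K * (?s N a k * ennreal (1 / jbracket n ^ N)))"
        using K(2)[OF a0, of "{k. a k \<noteq> 0}" "\<lambda>k. k" "\<lambda>_. 0" k n] by (simp only: prod.case)
    qed simp
    also have "\<dots> = ennreal C * (ennreal K * (lnorm p (\<lambda>k. ennreal (w k) * ?s N a k) * ennreal D1))"
      unfolding prod_norm D1 ..
    also have "\<dots> \<le> ennreal C * (ennreal K * ((ennreal C3 * lnorm p (\<lambda>k. ennreal (w k) * ennreal (a k))) * ennreal D1))"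
      by (intro mult_left_mono mult_right_mono C3(2)[OF a]) auto
    also have "\<dots> = ennreal (C * K * (C3 * D1)) * lnorm p (\<lambda>k. ennreal (w k) * ennreal (a k))"
      using C(1) K(1) C3(1) D1(2) by (simp add: ennreal_mult mult_ac)
    also have "\<dots> \<le> ennreal E * lnorm p (\<lambda>k. ennreal (w k) * ennreal (a k))"
      using C(1) K(1) C4(1) D2(2) by (intro mult_right_mono ennreal_leI) (auto simp: E_def)
    finally show "modulation_norm gauss p q (w \<otimes>\<^sub>w u) (regular_distr ?f) \<le> \<dots>" .
  next
    have a0: "\<forall>j. 0 \<le> a j" using a by blast
    let ?f = "synth {k. a k \<noteq> 0} a (\<lambda>_. 0) (\<lambda>k. k)"
    have "modulation_norm gauss p q (w \<otimes>\<^sub>w u) (regular_distr ?f) \<le> ennreal C * lattice_norm p q w u (\<lambda>(k, n). ennreal K * (ennreal (1 / jbracket k ^ N) * ?s N a n))"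
    proof (rule order_trans[OF C(2)[OF schwartz_synth]], intro mult_left_mono lattice_norm_mono p q)
      fix k n :: 'a
      have "(\<Sum>j | a j \<noteq> 0. a j * (1 / jbracket (k - 0) ^ N * (1 / jbracket (n - j) ^ N))) = (1 / jbracket k ^ N) * (\<Sum>j | a j \<noteq> 0. a j * (1 / jbracket (n - j) ^ N))"
        by (simp only: sum_distrib_left mult_ac diff_zero)
      moreover have "ennreal ((1 / jbracket k ^ N) * (\<Sum>j | a j \<noteq> 0. a j * (1 / jbracket (n - j) ^ N))) = ennreal (1 / jbracket k ^ N) * ?s N a n"
        using a0 by (intro ennreal_mult sum_nonneg) auto
      ultimately show "peetre N (\<lambda>z. cmod (stft_fun gauss ?f z)) (k, n) \<le> (case (k, n) of (k, n) \<Rightarrow> ennreal K * (ennreal (1 / jbracket k ^ N) * ?s N a n))"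
        using K(2)[OF a0, of "{k. a k \<noteq> 0}" "\<lambda>_. 0" "\<lambda>k. k" k n] by (simp only: prod.case)
    qed simp
    also have "\<dots> = ennreal C * (ennreal K * (ennreal D2 * lnorm q (\<lambda>k. ennreal (u k) * ?s N a k)))"
      unfolding prod_norm D2 ..
    also have "\<dots> \<le> ennreal C * (ennreal K * (ennreal D2 * (ennreal C4 * lnorm q (\<lambda>k. ennreal (u k) * ennreal (a k)))))"
      by (intro mult_left_mono C4(2)[OF a]) auto
    also have "\<dots> = ennreal (C * K * (C4 * D2)) * lnorm q (\<lambda>k. ennreal (u k) * ennreal (a k))"
      using C(1) K(1) C4(1) D2(2) by (simp add: ennreal_mult mult_ac)
    also have "\<dots> \<le> ennreal E * lnorm q (\<lambda>k. ennreal (u k) * ennreal (a k))"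
      using C(1) K(1) C3(1) D1(2) by (intro mult_right_mono ennreal_leI) (auto simp: E_def)
    finally show "modulation_norm gauss p q (w \<otimes>\<^sub>w u) (regular_distr ?f) \<le> \<dots>" .
  qed
  with E show ?thesis by blast
qed

section \<open>Necessity and sufficiency of the correlation inequalities\<close>

lemma gauss_0: "gauss 0 \<noteq> 0"
  by (simp add: gauss_def)

text \<open>Were it zero, its transform at the origin would vanish, but the modulus of that is the
  square of the transform of the Gaussian at the origin, which is positive.\<close>

lemma wigner_gauss_nonzero:
  assumes "\<tau> \<in> {0..1}"
  shows "\<exists>z. wigner \<tau> gauss gauss z \<noteq> 0"
proof (rule ccontr)
  let ?\<Phi> = "wigner \<tau> gauss gauss :: 'a::euclidean_space \<times> 'a \<Rightarrow> complex"
  assume "\<not> ?thesis"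
  then have "?\<Phi> z = 0" for z by blast
  then have "stft_fun ?\<Phi> ?\<Phi> ((0, 0), (0, 0)) = 0" by (simp add: stft_fun_inner)
  moreover have "cmod (stft_fun ?\<Phi> ?\<Phi> ((0, 0), (0, 0))) = cmod (stft_fun gauss gauss (0 :: 'a, 0)) * cmod (stft_fun gauss gauss (0 :: 'a, 0))"
    using stft_fun_wigner[OF assms schwartz_gauss schwartz_gauss schwartz_gauss schwartz_gauss, of "0 :: 'a" 0 0 0] by simp
  moreover obtain A :: "'a \<Rightarrow> real" where "\<And>x. 0 \<le> A x" "0 < A 0" "\<And>x. stft_fun gauss gauss (x, 0 :: 'a) = of_real (A x)"
    using stft_fun_gauss_time[where ?'a = 'a] by blast
  ultimately show False by simp
qed

text \<open>The target norm is restricted to \<zeta> = (0, y) and z = (k + \<tau> y, 0), where the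
  two factors sit at k and k + y on the time axis; similarly for frequencies with \<zeta> = (y, 0)
  and z = (0, k - (1 - \<tau>) y). The maximal function makes sense of these restrictions, which
  concern sets of measure zero.\<close>

lemma wigner_lattice_lower_bounds:
  fixes m :: "'a::euclidean_space \<times> 'a \<Rightarrow> real"
  assumes \<tau>: "\<tau> \<in> {0..1}" and p: "0 < p" and q: "0 < q" and m: "poly_weight m"
  shows "\<exists>C>0. \<forall>f1 f2. schwartz f1 \<longrightarrow> schwartz f2 \<longrightarrow>
      lnorm q (\<lambda>y. ennreal (m (0, y)) * lnorm p (\<lambda>k. ennreal (cmod (stft_fun gauss f1 (k, 0)) * cmod (stft_fun gauss f2 (k + y, 0)))))
        \<le> ennreal C * modulation_norm (wigner \<tau> gauss gauss) p q ((\<lambda>_. 1) \<otimes>\<^sub>w m) (regular_distr (wigner \<tau> f1 f2)) \<and>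
      lnorm q (\<lambda>y. ennreal (m (y, 0)) * lnorm p (\<lambda>k. ennreal (cmod (stft_fun gauss f1 (0, k)) * cmod (stft_fun gauss f2 (0, k - y)))))
        \<le> ennreal C * modulation_norm (wigner \<tau> gauss gauss) p q ((\<lambda>_. 1) \<otimes>\<^sub>w m) (regular_distr (wigner \<tau> f1 f2))"
proof -
  define \<Phi> where "\<Phi> = (wigner \<tau> gauss gauss :: 'a \<times> 'a \<Rightarrow> complex)"
  have s\<Phi>: "schwartz \<Phi>" unfolding \<Phi>_def by (intro schwartz_wigner \<tau> schwartz_gauss)
  obtain z0 where z0: "\<Phi> z0 \<noteq> 0" using wigner_gauss_nonzero[OF \<tau>] unfolding \<Phi>_def by blast
  have m0: "0 < m z" for z by (rule poly_weightE[OF m])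
  obtain N where "\<forall>N'\<ge>N. \<exists>C>0. \<forall>f. schwartz f \<longrightarrow>
    lattice_norm p q (\<lambda>_. 1) m (peetre N' (\<lambda>z. cmod (stft_fun \<Phi> f z))) \<le> ennreal C * modulation_norm \<Phi> p q ((\<lambda>_. 1) \<otimes>\<^sub>w m) (regular_distr f)"
    by (rule exE[OF lattice_norm_le_modulation_norm[OF s\<Phi> z0 p q poly_weight_one m]])
  then obtain C where C: "0 < C" "\<And>f. schwartz f \<Longrightarrow>
    lattice_norm p q (\<lambda>_. 1) m (peetre N (\<lambda>z. cmod (stft_fun \<Phi> f z))) \<le> ennreal C * modulation_norm \<Phi> p q ((\<lambda>_. 1) \<otimes>\<^sub>w m) (regular_distr f)"
    by blast
  \<comment> \<open>The cost of rounding the displacement by a multiple of y, which is off the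
    lattice, to a lattice point.\<close>
  define J where "J = (1 + real DIM('a \<times> 'a)) ^ N"
  have J: "0 < J" by (simp add: J_def add_pos_nonneg)
  have lat: "(0, y) \<in> lattice" "(y, 0) \<in> lattice" if "y \<in> lattice" for y :: 'a
    using that by (auto simp: lattice_def Basis_prod_def)
  have inj: "inj (\<lambda>y::'a. (0 :: 'a, y))" "inj (\<lambda>y::'a. (y, 0 :: 'a))" by (auto simp: inj_on_def)
  \<comment> \<open>\<open>e\<close> embeds the axis of z, \<open>e'\<close> the axis of \<zeta>,
    and \<open>s\<close> is the displacement that may leave the lattice. After rounding
    \<open>s\<close>, both sums are sums over part of a lattice, and injectivity bounds them by the
    full norm.\<close>
  have bound: "lnorm q (\<lambda>y. ennreal (m (e' y)) * lnorm p (\<lambda>k. ennreal (cmod (stft_fun \<Phi> f (e k + s y, e' y)))))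
    \<le> ennreal (J * C) * modulation_norm \<Phi> p q ((\<lambda>_. 1) \<otimes>\<^sub>w m) (regular_distr f)"
    if f: "schwartz f" and e: "inj e" "\<And>k. k \<in> lattice \<Longrightarrow> e k \<in> lattice"
      and e': "inj e'" "\<And>k. k \<in> lattice \<Longrightarrow> e' k \<in> lattice" for f e s and e' :: "'a \<Rightarrow> 'a \<times> 'a"
  proof -
    define P where "P = peetre N (\<lambda>z. cmod (stft_fun \<Phi> f z))"
    have pt: "ennreal (cmod (stft_fun \<Phi> f (z + c, \<zeta>))) \<le> ennreal J * P (z + lfloor c, \<zeta>)" for z c \<zeta>
    proof -
      have "jbracket (z + c - (z + lfloor c)) ^ N \<le> J" unfolding J_def using jbracket_lfloor[of c] by (intro power_mono) auto
      then have "cmod (stft_fun \<Phi> f (z + c, \<zeta>)) \<le> J * (cmod (stft_fun \<Phi> f (z + c, \<zeta>)) / (jbracket (z + c - (z + lfloor c)) ^ N * jbracket (\<zeta> - \<zeta>) ^ N))"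
        by (simp add: jbracket_def[of 0] pos_le_divide_eq mult.commute mult_right_mono)
      then have "ennreal (cmod (stft_fun \<Phi> f (z + c, \<zeta>))) \<le> ennreal J * ennreal (cmod (stft_fun \<Phi> f (z + c, \<zeta>)) / (jbracket (z + c - (z + lfloor c)) ^ N * jbracket (\<zeta> - \<zeta>) ^ N))"
        using J by (subst ennreal_mult[symmetric]) (auto intro: ennreal_leI)
      also have "\<dots> \<le> ennreal J * P (z + lfloor c, \<zeta>)" unfolding P_def by (intro mult_left_mono le_peetre) simp
      finally show ?thesis .
    qed
    have inner: "lnorm p (\<lambda>k. ennreal (cmod (stft_fun \<Phi> f (e k + c, \<zeta>)))) \<le> ennreal J * lnorm p (\<lambda>z. P (z, \<zeta>))" for c \<zeta>
    proof -
      have "lnorm p (\<lambda>k. ennreal (cmod (stft_fun \<Phi> f (e k + c, \<zeta>)))) \<le> lnorm p (\<lambda>k. ennreal J * P (e k + lfloor c, \<zeta>))"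
        by (intro Lp_norm_count_mono p pt)
      also have "\<dots> \<le> lnorm p (\<lambda>z. ennreal J * P (z, \<zeta>))"
        by (rule Lp_norm_count_inj[where g = "\<lambda>k. e k + lfloor c" and f = "\<lambda>z. ennreal J * P (z, \<zeta>)"])
          (use e p in \<open>auto simp: inj_on_def\<close>)
      finally show ?thesis unfolding Lp_norm_count_cmult[OF p] .
    qed
    have "lnorm q (\<lambda>y. ennreal (m (e' y)) * lnorm p (\<lambda>k. ennreal (cmod (stft_fun \<Phi> f (e k + s y, e' y)))))
      \<le> lnorm q (\<lambda>y. ennreal J * (ennreal (m (e' y)) * lnorm p (\<lambda>z. P (z, e' y))))"
      by (subst mult.left_commute, intro Lp_norm_count_mono q mult_left_mono inner) simp
    also have "\<dots> = ennreal J * lnorm q (\<lambda>y. ennreal (m (e' y)) * lnorm p (\<lambda>z. P (z, e' y)))"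
      by (rule Lp_norm_count_cmult[OF q])
    also have "\<dots> \<le> ennreal J * lnorm q (\<lambda>\<zeta>. ennreal (m \<zeta>) * lnorm p (\<lambda>z. P (z, \<zeta>)))"
      by (rule mult_left_mono[OF Lp_norm_count_inj[where g = e' and f = "\<lambda>\<zeta>. ennreal (m \<zeta>) * lnorm p (\<lambda>z. P (z, \<zeta>))"]])
        (use e' q in \<open>auto intro: inj_on_subset\<close>)
    also have "lnorm q (\<lambda>\<zeta>. ennreal (m \<zeta>) * lnorm p (\<lambda>z. P (z, \<zeta>))) = lattice_norm p q (\<lambda>_. 1) m P"
      by (simp add: lattice_norm_eq p q m0)
    also have "ennreal J * \<dots> \<le> ennreal J * (ennreal C * modulation_norm \<Phi> p q ((\<lambda>_. 1) \<otimes>\<^sub>w m) (regular_distr f))"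
      unfolding P_def by (intro mult_left_mono C(2) f) simp
    finally show ?thesis using J C(1) by (simp add: ennreal_mult mult.assoc)
  qed
  have "lnorm q (\<lambda>y. ennreal (m (0, y)) * lnorm p (\<lambda>k. ennreal (cmod (stft_fun gauss f1 (k, 0)) * cmod (stft_fun gauss f2 (k + y, 0)))))
        \<le> ennreal (J * C) * modulation_norm \<Phi> p q ((\<lambda>_. 1) \<otimes>\<^sub>w m) (regular_distr (wigner \<tau> f1 f2)) \<and>
      lnorm q (\<lambda>y. ennreal (m (y, 0)) * lnorm p (\<lambda>k. ennreal (cmod (stft_fun gauss f1 (0, k)) * cmod (stft_fun gauss f2 (0, k - y)))))
        \<le> ennreal (J * C) * modulation_norm \<Phi> p q ((\<lambda>_. 1) \<otimes>\<^sub>w m) (regular_distr (wigner \<tau> f1 f2))"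
    if f: "schwartz f1" "schwartz f2" for f1 f2
  proof
    have sW: "schwartz (wigner \<tau> f1 f2)" by (intro schwartz_wigner \<tau> f)
    note W = stft_fun_wigner[OF \<tau> f schwartz_gauss schwartz_gauss, folded \<Phi>_def]
    have "cmod (stft_fun gauss f1 (k, 0)) * cmod (stft_fun gauss f2 (k + y, 0)) = cmod (stft_fun \<Phi> (wigner \<tau> f1 f2) ((k, 0) + (\<tau> *\<^sub>R y, 0), (0, y)))" for k y
      by (simp add: W algebra_simps)
    with bound[OF sW inj(2) lat(2) inj(1) lat(1), of "\<lambda>y. (\<tau> *\<^sub>R y, 0)"]
    show "lnorm q (\<lambda>y. ennreal (m (0, y)) * lnorm p (\<lambda>k. ennreal (cmod (stft_fun gauss f1 (k, 0)) * cmod (stft_fun gauss f2 (k + y, 0)))))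
        \<le> ennreal (J * C) * modulation_norm \<Phi> p q ((\<lambda>_. 1) \<otimes>\<^sub>w m) (regular_distr (wigner \<tau> f1 f2))" by simp
    have "cmod (stft_fun gauss f1 (0, k)) * cmod (stft_fun gauss f2 (0, k - y)) = cmod (stft_fun \<Phi> (wigner \<tau> f1 f2) ((0, k) + (0, - ((1 - \<tau>) *\<^sub>R y)), (y, 0)))" for k y
      by (simp add: W algebra_simps)
    with bound[OF sW inj(1) lat(1) inj(2) lat(2), of "\<lambda>y. (0, - ((1 - \<tau>) *\<^sub>R y))"]
    show "lnorm q (\<lambda>y. ennreal (m (y, 0)) * lnorm p (\<lambda>k. ennreal (cmod (stft_fun gauss f1 (0, k)) * cmod (stft_fun gauss f2 (0, k - y)))))
        \<le> ennreal (J * C) * modulation_norm \<Phi> p q ((\<lambda>_. 1) \<otimes>\<^sub>w m) (regular_distr (wigner \<tau> f1 f2))" by simp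
  qed
  moreover have "0 < J * C" using J C(1) by simp
  ultimately show ?thesis unfolding \<Phi>_def by blast
qed

text \<open>On its own axis the transform of a sum of shifts has no phase and non-negative summands,
  so nothing cancels and the summand with j = k alone bounds it from below.\<close>

lemma synth_lower_bounds:
  obtains c where "0 < c"
    "\<And>a (k :: 'a::euclidean_space). (\<And>j. 0 \<le> a j) \<Longrightarrow> finite {j. a j \<noteq> 0} \<Longrightarrow> c * a k \<le> cmod (stft_fun gauss (synth {j. a j \<noteq> 0} a (\<lambda>j. j) (\<lambda>_. 0)) (k, 0))"
    "\<And>a (k :: 'a). (\<And>j. 0 \<le> a j) \<Longrightarrow> finite {j. a j \<noteq> 0} \<Longrightarrow> c * a k \<le> cmod (stft_fun gauss (synth {j. a j \<noteq> 0} a (\<lambda>_. 0) (\<lambda>j. j)) (0, k))"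
proof -
  obtain A :: "'a \<Rightarrow> real" where A: "\<And>x. 0 \<le> A x" "0 < A 0" "\<And>x. stft_fun gauss gauss (x, 0 :: 'a) = of_real (A x)"
    using stft_fun_gauss_time by blast
  obtain B :: "'a \<Rightarrow> real" where B: "\<And>x. 0 \<le> B x" "0 < B 0" "\<And>x. stft_fun gauss gauss (0 :: 'a, x) = of_real (B x)"
    using stft_fun_gauss_frequency by blast
  have ge: "min (A 0) (B 0) * a k \<le> (\<Sum>j | a j \<noteq> 0. a j * D (k - j))"
    if a: "\<And>j. 0 \<le> a j" "finite {j. a j \<noteq> 0}" and D: "\<And>x. 0 \<le> D x" "min (A 0) (B 0) \<le> D 0" for a D and k :: 'a
  proof (cases "a k = 0")
    case True then show ?thesis using a D by (simp add: sum_nonneg)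
  next
    case False
    have "min (A 0) (B 0) * a k \<le> a k * D (k - k)" using mult_right_mono[OF D(2) a(1)[of k]] by (simp add: mult.commute)
    also have "\<dots> \<le> (\<Sum>j | a j \<noteq> 0. a j * D (k - j))"
      by (rule member_le_sum) (use False a D in auto)
    finally show ?thesis .
  qed
  show thesis
  proof (rule that[of "min (A 0) (B 0)"])
    fix a :: "'a \<Rightarrow> real" and k :: 'a
    assume a: "\<And>j. 0 \<le> a j" "finite {j. a j \<noteq> 0}"
    have "stft_fun gauss (synth {j. a j \<noteq> 0} a (\<lambda>j. j) (\<lambda>_. 0)) (k, 0) = of_real (\<Sum>j | a j \<noteq> 0. a j * A (k - j))"
      by (simp add: stft_fun_synth A)
    with ge[of a A k, OF a A(1)] show "min (A 0) (B 0) * a k \<le> cmod (stft_fun gauss (synth {j. a j \<noteq> 0} a (\<lambda>j. j) (\<lambda>_. 0)) (k, 0))"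
      by (simp only: norm_of_real) (meson abs_ge_self min.cobounded1 order_trans)
    have "stft_fun gauss (synth {j. a j \<noteq> 0} a (\<lambda>_. 0) (\<lambda>j. j)) (0, k) = of_real (\<Sum>j | a j \<noteq> 0. a j * B (k - j))"
      by (simp add: stft_fun_synth B)
    with ge[of a B k, OF a B(1)] show "min (A 0) (B 0) * a k \<le> cmod (stft_fun gauss (synth {j. a j \<noteq> 0} a (\<lambda>_. 0) (\<lambda>j. j)) (0, k))"
      by (simp only: norm_of_real) (meson abs_ge_self min.cobounded2 order_trans)
  qed (use A B in auto)
qed

text \<open>Boundedness is squeezed between the two estimates for test functions: the coefficients
  bound the transforms from below on the axis, and their weighted sequence norms bound the
  modulation norms from above.\<close>

lemma wigner_bounded_imp_corr_bounded:
  fixes m :: "'a::euclidean_space \<times> 'a \<Rightarrow> real"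
  assumes \<tau>: "\<tau> \<in> {0..1}" and pos: "0 < p" "0 < q" "0 < p1" "0 < q1" "0 < p2" "0 < q2"
    and m: "poly_weight m" and w: "poly_weight \<omega>1" "poly_weight \<omega>2" "poly_weight \<mu>1" "poly_weight \<mu>2"
    and bd: "wigner_bounded gauss (wigner \<tau> gauss gauss) \<tau> p1 q1 (\<omega>1 \<otimes>\<^sub>w \<mu>1) p2 q2 (\<omega>2 \<otimes>\<^sub>w \<mu>2) p q ((\<lambda>_. 1) \<otimes>\<^sub>w m)"
  shows "corr_bounded p p1 \<omega>1 p2 \<omega>2 q (\<lambda>l. m (0, l))" "corr_bounded p q1 \<mu>1 q2 \<mu>2 q (reflect (\<lambda>j. m (j, 0)))"
proof -
  let ?W = "\<lambda>f1 f2. modulation_norm (wigner \<tau> gauss gauss) p q ((\<lambda>_. 1) \<otimes>\<^sub>w m) (regular_distr (wigner \<tau> f1 f2))"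
  let ?M1 = "\<lambda>f. modulation_norm gauss p1 q1 (\<omega>1 \<otimes>\<^sub>w \<mu>1) (regular_distr f)"
  let ?M2 = "\<lambda>f. modulation_norm gauss p2 q2 (\<omega>2 \<otimes>\<^sub>w \<mu>2) (regular_distr f)"
  let ?adm = "\<lambda>a. (\<forall>k. 0 \<le> a k) \<and> finite {k. a k \<noteq> 0} \<and> {k. a k \<noteq> 0} \<subseteq> (lattice :: 'a set)"
  let ?t = "\<lambda>a. synth {k. a k \<noteq> 0} a (\<lambda>k. k) (\<lambda>_. 0) :: 'a \<Rightarrow> complex"
  let ?f = "\<lambda>a. synth {k. a k \<noteq> 0} a (\<lambda>_. 0) (\<lambda>k. k) :: 'a \<Rightarrow> complex"
  obtain C where C: "0 < C" "\<And>f1 f2. schwartz f1 \<Longrightarrow> schwartz f2 \<Longrightarrow> ?W f1 f2 \<le> ennreal C * ?M1 f1 * ?M2 f2"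
    using bd unfolding wigner_bounded_def by blast
  obtain D where D: "0 < D" "\<And>f1 f2. schwartz f1 \<Longrightarrow> schwartz f2 \<Longrightarrow>
      lnorm q (\<lambda>y. ennreal (m (0, y)) * lnorm p (\<lambda>k. ennreal (cmod (stft_fun gauss f1 (k, 0)) * cmod (stft_fun gauss f2 (k + y, 0))))) \<le> ennreal D * ?W f1 f2"
      "\<And>f1 f2. schwartz f1 \<Longrightarrow> schwartz f2 \<Longrightarrow>
      lnorm q (\<lambda>y. ennreal (m (y, 0)) * lnorm p (\<lambda>k. ennreal (cmod (stft_fun gauss f1 (0, k)) * cmod (stft_fun gauss f2 (0, k - y))))) \<le> ennreal D * ?W f1 f2"
    using wigner_lattice_lower_bounds[OF \<tau> pos(1,2) m] by blast
  obtain S1 where S1: "0 < S1" "\<And>a. ?adm a \<Longrightarrow> ?M1 (?t a) \<le> ennreal S1 * lnorm p1 (\<lambda>k. ennreal (\<omega>1 k) * ennreal (a k))"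
      "\<And>a. ?adm a \<Longrightarrow> ?M1 (?f a) \<le> ennreal S1 * lnorm q1 (\<lambda>k. ennreal (\<mu>1 k) * ennreal (a k))"
    using synth_norms[OF w(1,3) pos(3,4)] by blast
  obtain S2 where S2: "0 < S2" "\<And>a. ?adm a \<Longrightarrow> ?M2 (?t a) \<le> ennreal S2 * lnorm p2 (\<lambda>k. ennreal (\<omega>2 k) * ennreal (a k))"
      "\<And>a. ?adm a \<Longrightarrow> ?M2 (?f a) \<le> ennreal S2 * lnorm q2 (\<lambda>k. ennreal (\<mu>2 k) * ennreal (a k))"
    using synth_norms[OF w(2,4) pos(5,6)] by blast
  obtain c where c: "0 < c"
    "\<And>a (k :: 'a). ?adm a \<Longrightarrow> c * a k \<le> cmod (stft_fun gauss (?t a) (k, 0))" "\<And>a (k :: 'a). ?adm a \<Longrightarrow> c * a k \<le> cmod (stft_fun gauss (?f a) (0, k))"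
    using synth_lower_bounds[where ?'a = 'a] by metis
  define E where "E = D * C * S1 * S2"
  have E: "0 < E" using D(1) C(1) S1(1) S2(1) by (simp add: E_def)
  \<comment> \<open>Stated with \<sigma> for k + y or k - y, so that it serves the time and the
    frequency axis alike. The two lower bounds contribute the factor c * c.\<close>
  have step: "lnorm q (\<lambda>y. ennreal (u y) * lnorm p (\<lambda>k. ennreal (a k) * ennreal (b (\<sigma> k y)))) \<le> ennreal (E / (c * c)) * Y1 * Y2"
    if f: "schwartz f1" "schwartz f2" and ab: "?adm a" "?adm b"
      and L: "lnorm q (\<lambda>y. ennreal (u y) * lnorm p (\<lambda>k. ennreal (G1 k * G2 (\<sigma> k y)))) \<le> ennreal D * ?W f1 f2"
      and G: "\<And>k. c * a k \<le> G1 k" "\<And>k. c * b k \<le> G2 k"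
      and Y: "?M1 f1 \<le> ennreal S1 * Y1" "?M2 f2 \<le> ennreal S2 * Y2"
    for f1 f2 :: "'a \<Rightarrow> complex" and u :: "'a \<Rightarrow> real" and a b :: "'a \<Rightarrow> real" and \<sigma> and G1 G2 :: "'a \<Rightarrow> real" and Y1 Y2
  proof -
    let ?X = "lnorm q (\<lambda>y. ennreal (u y) * lnorm p (\<lambda>k. ennreal (a k) * ennreal (b (\<sigma> k y))))"
    have pt: "ennreal (c * c) * (ennreal (a k) * ennreal (b l)) \<le> ennreal (G1 k * G2 l)" for k l
    proof -
      have "ennreal (c * c) * (ennreal (a k) * ennreal (b l)) = ennreal ((c * a k) * (c * b l))"
        using c(1) ab by (simp add: mult_ac flip: ennreal_mult)
      also have "\<dots> \<le> ennreal (G1 k * G2 l)"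
        using c(1) ab G order_trans[OF _ G(1)] by (intro ennreal_leI mult_mono) auto
      finally show ?thesis .
    qed
    have "ennreal (c * c) * ?X = lnorm q (\<lambda>y. ennreal (u y) * lnorm p (\<lambda>k. ennreal (c * c) * (ennreal (a k) * ennreal (b (\<sigma> k y)))))"
      unfolding Lp_norm_count_cmult[OF pos(1)] by (subst mult.left_commute) (simp only: Lp_norm_count_cmult[OF pos(2)])
    also have "\<dots> \<le> lnorm q (\<lambda>y. ennreal (u y) * lnorm p (\<lambda>k. ennreal (G1 k * G2 (\<sigma> k y))))"
      by (intro Lp_norm_count_mono pos mult_left_mono pt) auto
    also note L
    also have "ennreal D * ?W f1 f2 \<le> ennreal D * (ennreal C * ?M1 f1 * ?M2 f2)"
      by (intro mult_left_mono C(2) f) simp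
    also have "\<dots> \<le> ennreal D * (ennreal C * (ennreal S1 * Y1) * (ennreal S2 * Y2))"
      by (intro mult_left_mono mult_mono Y) auto
    also have "\<dots> = ennreal E * Y1 * Y2"
      using D(1) C(1) S1(1) S2(1) by (simp add: E_def ennreal_mult mult_ac)
    finally have le: "ennreal (c * c) * ?X \<le> ennreal E * Y1 * Y2" .
    have "?X = ennreal (1 / (c * c)) * (ennreal (c * c) * ?X)"
      using c(1) by (simp add: mult.assoc[symmetric] ennreal_mult[symmetric])
    also have "\<dots> \<le> ennreal (1 / (c * c)) * (ennreal E * Y1 * Y2)" by (intro mult_left_mono le) simp
    also have "\<dots> = ennreal (1 / (c * c) * E) * Y1 * Y2" using c(1) E by (subst ennreal_mult) (auto simp: mult.assoc)
    finally show ?thesis by (simp only: times_divide_eq_left mult_1_left)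
  qed
  have Ec: "0 < E / (c * c)" using E c(1) by simp
  show "corr_bounded p p1 \<omega>1 p2 \<omega>2 q (\<lambda>l. m (0, l))"
  proof (rule corr_boundedI[OF pos(1,3,5,2) Ec])
    fix a b :: "'a \<Rightarrow> real"
    assume "\<And>k. 0 \<le> a k" "finite {k. a k \<noteq> 0}" "{k. a k \<noteq> 0} \<subseteq> lattice" "\<And>k. 0 \<le> b k" "finite {k. b k \<noteq> 0}" "{k. b k \<noteq> 0} \<subseteq> lattice"
    then have ab: "?adm a" "?adm b" by auto
    show "lnorm q (\<lambda>y. ennreal (m (0, y)) * lnorm p (\<lambda>k. ennreal (a k) * ennreal (b (k + y))))
      \<le> ennreal (E / (c * c)) * lnorm p1 (\<lambda>k. ennreal (\<omega>1 k) * ennreal (a k)) * lnorm p2 (\<lambda>k. ennreal (\<omega>2 k) * ennreal (b k))"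
      by (rule step[OF schwartz_synth schwartz_synth ab D(2)[OF schwartz_synth schwartz_synth] c(2)[OF ab(1)] c(2)[OF ab(2)] S1(2)[OF ab(1)] S2(2)[OF ab(2)]])
  qed
  show "corr_bounded p q1 \<mu>1 q2 \<mu>2 q (reflect (\<lambda>j. m (j, 0)))"
  proof (rule corr_boundedI[OF pos(1,4,6,2) Ec])
    fix a b :: "'a \<Rightarrow> real"
    assume "\<And>k. 0 \<le> a k" "finite {k. a k \<noteq> 0}" "{k. a k \<noteq> 0} \<subseteq> lattice" "\<And>k. 0 \<le> b k" "finite {k. b k \<noteq> 0}" "{k. b k \<noteq> 0} \<subseteq> lattice"
    then have ab: "?adm a" "?adm b" by auto
    have "lnorm q (\<lambda>y. ennreal (reflect (\<lambda>j. m (j, 0)) y) * lnorm p (\<lambda>k. ennreal (a k) * ennreal (b (k + y))))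
      = lnorm q (\<lambda>y. ennreal (m (y, 0)) * lnorm p (\<lambda>k. ennreal (a k) * ennreal (b (k - y))))"
      by (subst lnorm_reflect[OF pos(2)]) (simp add: reflect_def)
    also have "\<dots> \<le> ennreal (E / (c * c)) * lnorm q1 (\<lambda>k. ennreal (\<mu>1 k) * ennreal (a k)) * lnorm q2 (\<lambda>k. ennreal (\<mu>2 k) * ennreal (b k))"
      by (rule step[OF schwartz_synth schwartz_synth ab D(3)[OF schwartz_synth schwartz_synth] c(3)[OF ab(1)] c(3)[OF ab(2)] S1(3)[OF ab(1)] S2(3)[OF ab(2)]])
    finally show "lnorm q (\<lambda>y. ennreal (reflect (\<lambda>j. m (j, 0)) y) * lnorm p (\<lambda>k. ennreal (a k) * ennreal (b (k + y)))) \<le> \<dots>" .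
  qed
qed

lemma corr_form_imp_wigner_bounded:
  fixes m :: "'a::euclidean_space \<times> 'a \<Rightarrow> real"
  assumes \<tau>: "\<tau> \<in> {0..1}" and pos: "0 < p" "0 < q" "0 < p1" "0 < q1" "0 < p2" "0 < q2"
    and m: "poly_weight m" and w: "poly_weight \<omega>1" "poly_weight \<omega>2" "poly_weight \<mu>1" "poly_weight \<mu>2"
    and bd: "\<exists>C>0. \<forall>P Q. corr_form p q m P Q \<le> ennreal C * lattice_norm p1 q1 \<omega>1 \<mu>1 P * lattice_norm p2 q2 \<omega>2 \<mu>2 Q"
  shows "wigner_bounded gauss (wigner \<tau> gauss gauss) \<tau> p1 q1 (\<omega>1 \<otimes>\<^sub>w \<mu>1) p2 q2 (\<omega>2 \<otimes>\<^sub>w \<mu>2) p q ((\<lambda>_. 1) \<otimes>\<^sub>w m)"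
proof -
  let ?W = "\<lambda>f1 f2. modulation_norm (wigner \<tau> gauss gauss) p q ((\<lambda>_. 1) \<otimes>\<^sub>w m) (regular_distr (wigner \<tau> f1 f2))"
  let ?M1 = "\<lambda>f. modulation_norm gauss p1 q1 (\<omega>1 \<otimes>\<^sub>w \<mu>1) (regular_distr f)"
  let ?M2 = "\<lambda>f. modulation_norm gauss p2 q2 (\<omega>2 \<otimes>\<^sub>w \<mu>2) (regular_distr f)"
  let ?P = "\<lambda>N f. peetre N (\<lambda>z. cmod (stft_fun gauss f z)) :: 'a \<times> 'a \<Rightarrow> ennreal"
  obtain N1 where N1: "\<forall>N\<ge>N1. \<exists>C>0. \<forall>f. schwartz f \<longrightarrow> lattice_norm p1 q1 \<omega>1 \<mu>1 (?P N f) \<le> ennreal C * ?M1 f"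
    by (rule exE[OF lattice_norm_le_modulation_norm[OF schwartz_gauss gauss_0 pos(3,4) w(1,3)]])
  obtain N2 where N2: "\<forall>N\<ge>N2. \<exists>C>0. \<forall>f. schwartz f \<longrightarrow> lattice_norm p2 q2 \<omega>2 \<mu>2 (?P N f) \<le> ennreal C * ?M2 f"
    by (rule exE[OF lattice_norm_le_modulation_norm[OF schwartz_gauss gauss_0 pos(5,6) w(2,4)]])
  \<comment> \<open>One order has to serve both norms on the domain side, since the two maximal
    functions occur in the same form.\<close>
  define N where "N = N1 + N2"
  obtain C1 where C1: "0 < C1" "\<And>f. schwartz f \<Longrightarrow> lattice_norm p1 q1 \<omega>1 \<mu>1 (?P N f) \<le> ennreal C1 * ?M1 f"
    using N1[rule_format, of N] unfolding N_def by auto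
  obtain C2 where C2: "0 < C2" "\<And>f. schwartz f \<Longrightarrow> lattice_norm p2 q2 \<omega>2 \<mu>2 (?P N f) \<le> ennreal C2 * ?M2 f"
    using N2[rule_format, of N] unfolding N_def by auto
  obtain C where C: "0 < C" "\<And>P Q. corr_form p q m P Q \<le> ennreal C * lattice_norm p1 q1 \<omega>1 \<mu>1 P * lattice_norm p2 q2 \<omega>2 \<mu>2 Q"
    using bd by blast
  obtain D where D: "0 < D" "\<And>f1 f2. schwartz f1 \<Longrightarrow> schwartz f2 \<Longrightarrow> ?W f1 f2 \<le> ennreal D * corr_form p q m (?P N f1) (?P N f2)"
    using wigner_norm_le_corr_form[OF \<tau> pos(1,2) m schwartz_gauss, of N] by blast
  have "?W f1 f2 \<le> ennreal (D * C * C1 * C2) * ?M1 f1 * ?M2 f2" if f: "schwartz f1" "schwartz f2" for f1 f2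
  proof -
    have "?W f1 f2 \<le> ennreal D * corr_form p q m (?P N f1) (?P N f2)" by (rule D(2)[OF f])
    also have "\<dots> \<le> ennreal D * (ennreal C * lattice_norm p1 q1 \<omega>1 \<mu>1 (?P N f1) * lattice_norm p2 q2 \<omega>2 \<mu>2 (?P N f2))"
      by (intro mult_left_mono C(2)) simp
    also have "\<dots> \<le> ennreal D * (ennreal C * (ennreal C1 * ?M1 f1) * (ennreal C2 * ?M2 f2))"
      by (intro mult_left_mono mult_mono C1(2) C2(2) f) auto
    also have "\<dots> = ennreal (D * C * C1 * C2) * ?M1 f1 * ?M2 f2"
      using D(1) C(1) C1(1) C2(1) by (simp add: ennreal_mult mult_ac)
    finally show ?thesis .
  qed
  moreover have "0 < D * C * C1 * C2" using D(1) C(1) C1(1) C2(1) by simp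
  ultimately show ?thesis unfolding wigner_bounded_def by blast
qed

text \<open>Domain norms are passed from \<phi> to \<phi>' and the target norm from \<Phi>' to
  \<Phi>. In each comparison the window of the upper bound, \<phi>' or \<Phi>, is the one required
  to be nonzero.\<close>

lemma wigner_bounded_window:
  fixes m :: "'a::euclidean_space \<times> 'a \<Rightarrow> real"
  assumes \<tau>: "\<tau> \<in> {0..1}" and pos: "0 < p" "0 < q" "0 < p1" "0 < q1" "0 < p2" "0 < q2"
    and m: "poly_weight m" and w: "poly_weight \<omega>1" "poly_weight \<omega>2" "poly_weight \<mu>1" "poly_weight \<mu>2"
    and \<phi>: "schwartz \<phi>" "schwartz \<phi>'" "\<exists>t. \<phi>' t \<noteq> 0" and \<Phi>: "schwartz \<Phi>" "\<exists>z. \<Phi> z \<noteq> 0" "schwartz \<Phi>'"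
    and bd: "wigner_bounded \<phi> \<Phi> \<tau> p1 q1 (\<omega>1 \<otimes>\<^sub>w \<mu>1) p2 q2 (\<omega>2 \<otimes>\<^sub>w \<mu>2) p q ((\<lambda>_. 1) \<otimes>\<^sub>w m)"
  shows "wigner_bounded \<phi>' \<Phi>' \<tau> p1 q1 (\<omega>1 \<otimes>\<^sub>w \<mu>1) p2 q2 (\<omega>2 \<otimes>\<^sub>w \<mu>2) p q ((\<lambda>_. 1) \<otimes>\<^sub>w m)"
proof -
  let ?W = "\<lambda>\<Phi> f1 f2. modulation_norm \<Phi> p q ((\<lambda>_. 1) \<otimes>\<^sub>w m) (regular_distr (wigner \<tau> f1 f2))"
  let ?M1 = "\<lambda>\<phi> f. modulation_norm \<phi> p1 q1 (\<omega>1 \<otimes>\<^sub>w \<mu>1) (regular_distr f)"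
  let ?M2 = "\<lambda>\<phi> f. modulation_norm \<phi> p2 q2 (\<omega>2 \<otimes>\<^sub>w \<mu>2) (regular_distr f)"
  obtain t0 z0 where nz: "\<phi>' t0 \<noteq> 0" "\<Phi> z0 \<noteq> 0" using \<phi> \<Phi> by blast
  obtain C where C: "0 < C" "\<And>f1 f2. schwartz f1 \<Longrightarrow> schwartz f2 \<Longrightarrow> ?W \<Phi> f1 f2 \<le> ennreal C * ?M1 \<phi> f1 * ?M2 \<phi> f2"
    using bd unfolding wigner_bounded_def by blast
  obtain C1 where C1: "0 < C1" "\<And>f. schwartz f \<Longrightarrow> ?M1 \<phi> f \<le> ennreal C1 * ?M1 \<phi>' f"
    using modulation_norm_window[OF \<phi>(2) nz(1) \<phi>(1) pos(3,4) w(1,3)] by blast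
  obtain C2 where C2: "0 < C2" "\<And>f. schwartz f \<Longrightarrow> ?M2 \<phi> f \<le> ennreal C2 * ?M2 \<phi>' f"
    using modulation_norm_window[OF \<phi>(2) nz(1) \<phi>(1) pos(5,6) w(2,4)] by blast
  obtain D where D: "0 < D" "\<And>f. schwartz f \<Longrightarrow>
      modulation_norm \<Phi>' p q ((\<lambda>_. 1) \<otimes>\<^sub>w m) (regular_distr f) \<le> ennreal D * modulation_norm \<Phi> p q ((\<lambda>_. 1) \<otimes>\<^sub>w m) (regular_distr f)"
    using modulation_norm_window[OF \<Phi>(1) nz(2) \<Phi>(3) pos(1,2) poly_weight_one m] by blast
  have "?W \<Phi>' f1 f2 \<le> ennreal (D * C * C1 * C2) * ?M1 \<phi>' f1 * ?M2 \<phi>' f2" if f: "schwartz f1" "schwartz f2" for f1 f2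
  proof -
    have "?W \<Phi>' f1 f2 \<le> ennreal D * ?W \<Phi> f1 f2" by (intro D(2) schwartz_wigner \<tau> f)
    also have "\<dots> \<le> ennreal D * (ennreal C * ?M1 \<phi> f1 * ?M2 \<phi> f2)"
      by (intro mult_left_mono C(2) f) simp
    also have "\<dots> \<le> ennreal D * (ennreal C * (ennreal C1 * ?M1 \<phi>' f1) * (ennreal C2 * ?M2 \<phi>' f2))"
      by (intro mult_left_mono mult_mono C1(2) C2(2) f) auto
    also have "\<dots> = ennreal (D * C * C1 * C2) * ?M1 \<phi>' f1 * ?M2 \<phi>' f2"
      using D(1) C(1) C1(1) C2(1) by (simp add: ennreal_mult mult_ac)
    finally show ?thesis .
  qed
  moreover have "0 < D * C * C1 * C2" using D(1) C(1) C1(1) C2(1) by simp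
  ultimately show ?thesis unfolding wigner_bounded_def by blast
qed

lemma wigner_bounded_gauss_iff:
  fixes m :: "'a::euclidean_space \<times> 'a \<Rightarrow> real"
  assumes \<tau>: "\<tau> \<in> {0..1}" and pos: "0 < p" "0 < q" "0 < p1" "0 < q1" "0 < p2" "0 < q2"
    and m: "poly_weight m" and w: "poly_weight \<omega>1" "poly_weight \<omega>2" "poly_weight \<mu>1" "poly_weight \<mu>2"
    and \<phi>: "schwartz \<phi>" "\<exists>t. \<phi> t \<noteq> 0" and \<Phi>: "schwartz \<Phi>" "\<exists>z. \<Phi> z \<noteq> 0"
  shows "wigner_bounded \<phi> \<Phi> \<tau> p1 q1 (\<omega>1 \<otimes>\<^sub>w \<mu>1) p2 q2 (\<omega>2 \<otimes>\<^sub>w \<mu>2) p q ((\<lambda>_. 1) \<otimes>\<^sub>w m) \<longleftrightarrow>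
    wigner_bounded gauss (wigner \<tau> gauss gauss) \<tau> p1 q1 (\<omega>1 \<otimes>\<^sub>w \<mu>1) p2 q2 (\<omega>2 \<otimes>\<^sub>w \<mu>2) p q ((\<lambda>_. 1) \<otimes>\<^sub>w m)"
proof -
  have g: "\<exists>t. gauss t \<noteq> 0" using gauss_0 by blast
  have s: "schwartz (wigner \<tau> gauss gauss)" by (intro schwartz_wigner \<tau> schwartz_gauss)
  show ?thesis
    using wigner_bounded_window[OF \<tau> pos m w \<phi>(1) schwartz_gauss g \<Phi> s]
      wigner_bounded_window[OF \<tau> pos m w schwartz_gauss \<phi> s wigner_gauss_nonzero[OF \<tau>] \<Phi>(1)] by blast
qed

theorem theorem1p2:
  fixes p\<^sub>1 p\<^sub>2 q\<^sub>1 q\<^sub>2 p q :: ennreal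
    and \<tau> :: real
    and m :: "(real ^ 'd::finite) \<times> (real ^ 'd) \<Rightarrow> real"
    and \<omega>\<^sub>1 \<omega>\<^sub>2 \<mu>\<^sub>1 \<mu>\<^sub>2 m\<^sub>\<alpha> m\<^sub>\<beta> :: "real ^ 'd \<Rightarrow> real"
    and \<phi> :: "real ^ 'd \<Rightarrow> complex"
    and \<Phi> :: "(real ^ 'd) \<times> (real ^ 'd) \<Rightarrow> complex"
  assumes "0 < p\<^sub>1" "0 < p\<^sub>2" "0 < q\<^sub>1" "0 < q\<^sub>2" "0 < p" "0 < q"
    and "\<tau> \<in> {0..1}"
    and "poly_weight m" "submultiplicative m"
    and "poly_weight \<omega>\<^sub>1" "poly_weight \<omega>\<^sub>2" "poly_weight \<mu>\<^sub>1" "poly_weight \<mu>\<^sub>2"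
    and "m\<^sub>\<alpha> = (\<lambda>z\<^sub>1. m (z\<^sub>1, 0))" "m\<^sub>\<beta> = (\<lambda>z\<^sub>2. m (0, z\<^sub>2))"
    and "schwartz \<phi>" "\<exists>t. \<phi> t \<noteq> 0"
    and "schwartz \<Phi>" "\<exists>z. \<Phi> z \<noteq> 0"
  shows "(p < \<infinity> \<longrightarrow>
      (wigner_bounded \<phi> \<Phi> \<tau> p\<^sub>1 q\<^sub>1 (\<omega>\<^sub>1 \<otimes>\<^sub>w \<mu>\<^sub>1) p\<^sub>2 q\<^sub>2 (\<omega>\<^sub>2 \<otimes>\<^sub>w \<mu>\<^sub>2) p q ((\<lambda>_. 1) \<otimes>\<^sub>w m) \<longleftrightarrow>
        lp_conv_embeds (p\<^sub>1 / p) (weight_power \<omega>\<^sub>1 p) (p\<^sub>2 / p) (weight_power (reflect \<omega>\<^sub>2) p)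
                       (q / p) (weight_power (reflect m\<^sub>\<beta>) p) \<and>
        lp_conv_embeds (q\<^sub>1 / p) (weight_power \<mu>\<^sub>1 p) (q\<^sub>2 / p) (weight_power (reflect \<mu>\<^sub>2) p)
                       (q / p) (weight_power m\<^sub>\<alpha> p))) \<and>
    (p \<ge> q \<longrightarrow>
      (wigner_bounded \<phi> \<Phi> \<tau> p\<^sub>1 q\<^sub>1 (\<omega>\<^sub>1 \<otimes>\<^sub>w \<mu>\<^sub>1) p\<^sub>2 q\<^sub>2 (\<omega>\<^sub>2 \<otimes>\<^sub>w \<mu>\<^sub>2) p q ((\<lambda>_. 1) \<otimes>\<^sub>w m) \<longleftrightarrow>
        lp_embeds p\<^sub>1 \<omega>\<^sub>1 q (reflect m\<^sub>\<beta>) \<and> lp_embeds p\<^sub>2 (reflect \<omega>\<^sub>2) q (reflect m\<^sub>\<beta>) \<and>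
        lp_embeds q\<^sub>1 \<mu>\<^sub>1 q m\<^sub>\<alpha> \<and> lp_embeds q\<^sub>2 (reflect \<mu>\<^sub>2) q m\<^sub>\<alpha>))"
proof -
  note pos = assms(5,6,1,3,2,4) and \<tau> = assms(7) and m = assms(8) and w = assms(10-13)
  define B where "B \<longleftrightarrow> wigner_bounded gauss (wigner \<tau> gauss gauss) \<tau> p\<^sub>1 q\<^sub>1 (\<omega>\<^sub>1 \<otimes>\<^sub>w \<mu>\<^sub>1) p\<^sub>2 q\<^sub>2 (\<omega>\<^sub>2 \<otimes>\<^sub>w \<mu>\<^sub>2) p q ((\<lambda>_. 1) \<otimes>\<^sub>w m)"
  have B: "wigner_bounded \<phi> \<Phi> \<tau> p\<^sub>1 q\<^sub>1 (\<omega>\<^sub>1 \<otimes>\<^sub>w \<mu>\<^sub>1) p\<^sub>2 q\<^sub>2 (\<omega>\<^sub>2 \<otimes>\<^sub>w \<mu>\<^sub>2) p q ((\<lambda>_. 1) \<otimes>\<^sub>w m) \<longleftrightarrow> B"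
    unfolding B_def by (rule wigner_bounded_gauss_iff[OF \<tau> pos m w assms(16-19)])
  have pw: "0 < v x" if "poly_weight v" for v :: "real ^ 'd \<Rightarrow> real" and x by (rule poly_weightE[OF that])
  note w0 = w[THEN pw]
  have m0: "0 < m z" for z by (rule poly_weightE[OF m])
  have u0: "0 < m\<^sub>\<alpha> x" "0 < m\<^sub>\<beta> x" and r0: "0 < reflect \<omega>\<^sub>2 x" "0 < reflect \<mu>\<^sub>2 x" "0 < reflect m\<^sub>\<alpha> x" "0 < reflect m\<^sub>\<beta> x" for x
    using m0 w0 by (simp_all add: assms(14,15) reflect_def)
  obtain K where K: "0 < K" "\<And>z z'. m (z + z') \<le> K * m z * m z'"
  proof -
    obtain C where C: "\<And>z z'. m (z + z') \<le> C * m z * m z'" using assms(9) unfolding submultiplicative_def by blast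
    have "C * m z * m z' \<le> (\<bar>C\<bar> + 1) * m z * m z'" for z z'
      using less_imp_le[OF m0] by (intro mult_right_mono) auto
    \<comment> \<open>Taking the absolute value and adding 1 makes the constant positive; this only
      enlarges the bound, as m is positive.\<close>
    from order_trans[OF C this] show thesis by (intro that[of "\<bar>C\<bar> + 1"]) auto
  qed
  have K': "m (j, l) \<le> K * m (j, 0) * m (0, l)" for j l using K(2)[of "(j, 0)" "(0, l)"] by simp
  have rr: "reflect (reflect v) = v" for v :: "real ^ 'd \<Rightarrow> real" by (simp add: reflect_def)
  \<comment> \<open>The proof is a cycle of implications: B gives N, N gives E, E gives B when q
    \<le> p, and N gives B when p is finite. The frequency inequality carries the reflected weight,
    and reflecting once more yields the unreflected \<open>m\<^sub>\<alpha>\<close> of the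
    statement.\<close>
  define N where "N \<longleftrightarrow> corr_bounded p p\<^sub>1 \<omega>\<^sub>1 p\<^sub>2 \<omega>\<^sub>2 q m\<^sub>\<beta> \<and> corr_bounded p q\<^sub>1 \<mu>\<^sub>1 q\<^sub>2 \<mu>\<^sub>2 q (reflect m\<^sub>\<alpha>)"
  define E where "E \<longleftrightarrow> lp_embeds p\<^sub>1 \<omega>\<^sub>1 q (reflect m\<^sub>\<beta>) \<and> lp_embeds p\<^sub>2 (reflect \<omega>\<^sub>2) q (reflect m\<^sub>\<beta>) \<and>
    lp_embeds q\<^sub>1 \<mu>\<^sub>1 q m\<^sub>\<alpha> \<and> lp_embeds q\<^sub>2 (reflect \<mu>\<^sub>2) q m\<^sub>\<alpha>"
  have BN: "N" if "B"
    using wigner_bounded_imp_corr_bounded[OF \<tau> pos m w] that unfolding N_def B_def assms(14,15) by blast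
  have NE: "E" if "N"
    using that corr_bounded_embeds[of p p\<^sub>1 p\<^sub>2 q \<omega>\<^sub>1 \<omega>\<^sub>2 m\<^sub>\<beta>, OF assms(5,1,2,6) w0(1,2) u0(2)] corr_bounded_embeds[of p q\<^sub>1 q\<^sub>2 q \<mu>\<^sub>1 \<mu>\<^sub>2 "reflect m\<^sub>\<alpha>", OF assms(5,3,4,6) w0(3,4) r0(3)]
    unfolding N_def E_def rr by blast
  have EB: "B" if E and "q \<le> p"
  proof -
    have refl: "lnorm r (\<lambda>k. ennreal (reflect v k) * a k) = lnorm r (\<lambda>k. ennreal (v k) * a (- k))"
      if "0 < r" for r v and a :: "real ^ 'd \<Rightarrow> ennreal"
      by (subst lnorm_reflect[OF that]) (simp add: reflect_def)
    obtain C1 where C1: "0 < C1" "\<And>a. lnorm q (\<lambda>k. ennreal (reflect m\<^sub>\<beta> k) * a k) \<le> ennreal C1 * lnorm p\<^sub>1 (\<lambda>k. ennreal (\<omega>\<^sub>1 k) * a k)"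
      using \<open>E\<close> unfolding E_def lp_embeds_iff[of p\<^sub>1 q \<omega>\<^sub>1 "reflect m\<^sub>\<beta>", OF assms(1,6) w0(1) r0(4)] by blast
    obtain C2 where C2: "0 < C2" "\<And>a. lnorm q (\<lambda>k. ennreal (reflect m\<^sub>\<beta> k) * a k) \<le> ennreal C2 * lnorm p\<^sub>2 (\<lambda>k. ennreal (reflect \<omega>\<^sub>2 k) * a k)"
      using \<open>E\<close> unfolding E_def lp_embeds_iff[of p\<^sub>2 q "reflect \<omega>\<^sub>2" "reflect m\<^sub>\<beta>", OF assms(2,6) r0(1) r0(4)] by blast
    obtain C3 where C3: "0 < C3" "\<And>a. lnorm q (\<lambda>k. ennreal (m\<^sub>\<alpha> k) * a k) \<le> ennreal C3 * lnorm q\<^sub>1 (\<lambda>k. ennreal (\<mu>\<^sub>1 k) * a k)"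
      using \<open>E\<close> unfolding E_def lp_embeds_iff[of q\<^sub>1 q \<mu>\<^sub>1 m\<^sub>\<alpha>, OF assms(3,6) w0(3) u0(1)] by blast
    obtain C4 where C4: "0 < C4" "\<And>a. lnorm q (\<lambda>k. ennreal (m\<^sub>\<alpha> k) * a k) \<le> ennreal C4 * lnorm q\<^sub>2 (\<lambda>k. ennreal (reflect \<mu>\<^sub>2 k) * a k)"
      using \<open>E\<close> unfolding E_def lp_embeds_iff[of q\<^sub>2 q "reflect \<mu>\<^sub>2" m\<^sub>\<alpha>, OF assms(4,6) r0(2) u0(1)] by blast
    have E1: "lnorm q (\<lambda>k. ennreal (m (0, - k)) * a k) \<le> ennreal C1 * lnorm p\<^sub>1 (\<lambda>k. ennreal (\<omega>\<^sub>1 k) * a k)" for a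
      using C1(2)[of a] by (simp add: reflect_def assms(15))
    have E2: "lnorm q (\<lambda>k. ennreal (m (0, k)) * a k) \<le> ennreal C2 * lnorm p\<^sub>2 (\<lambda>k. ennreal (\<omega>\<^sub>2 k) * a k)" for a
      using C2(2)[of "\<lambda>k. a (- k)"] by (simp add: refl assms(2,6,15))
    have E3: "lnorm q (\<lambda>k. ennreal (m (k, 0)) * a k) \<le> ennreal C3 * lnorm q\<^sub>1 (\<lambda>k. ennreal (\<mu>\<^sub>1 k) * a k)" for a
      using C3(2)[of a] by (simp add: assms(14))
    have E4: "lnorm q (\<lambda>k. ennreal (m (- k, 0)) * a k) \<le> ennreal C4 * lnorm q\<^sub>2 (\<lambda>k. ennreal (\<mu>\<^sub>2 k) * a k)" for a
      using C4(2)[of "\<lambda>k. a (- k)"] lnorm_reflect[OF assms(6), of "\<lambda>k. ennreal (m (- k, 0)) * a k"]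
      by (simp add: refl assms(4,14))
    show ?thesis unfolding B_def
      by (rule corr_form_imp_wigner_bounded[OF \<tau> pos m w
            corr_form_le_embeds[where ?\<omega>1.0 = \<omega>\<^sub>1 and ?\<omega>2.0 = \<omega>\<^sub>2 and ?\<mu>1.0 = \<mu>\<^sub>1 and ?\<mu>2.0 = \<mu>\<^sub>2 and m = m, OF assms(6,1,2,3,4) \<open>q \<le> p\<close> w0 m0 K C1(1) E1 C2(1) E2 C3(1) E3 C4(1) E4]])
  qed
  \<comment> \<open>For p \<le> q the two inequalities combine by Minkowski. For q < p that exchange
    goes the wrong way, and the detour over the embeddings E takes its place.\<close>
  have NB: "B" if N "p < \<infinity>"
  proof (cases "p \<le> q")
    case True
    have "corr_bounded p p\<^sub>1 \<omega>\<^sub>1 p\<^sub>2 \<omega>\<^sub>2 q (\<lambda>l. m (0, l))" "corr_bounded p q\<^sub>1 \<mu>\<^sub>1 q\<^sub>2 \<mu>\<^sub>2 q (reflect (\<lambda>j. m (j, 0)))"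
      using \<open>N\<close> unfolding N_def assms(14,15) by blast+
    from corr_form_le_conv[where ?\<omega>1.0 = \<omega>\<^sub>1 and ?\<omega>2.0 = \<omega>\<^sub>2 and ?\<mu>1.0 = \<mu>\<^sub>1 and ?\<mu>2.0 = \<mu>\<^sub>2 and m = m, OF assms(5,1,2,3,4) True \<open>p < \<infinity>\<close> w0 m0 K(1) K' this] show ?thesis
      unfolding B_def by (rule corr_form_imp_wigner_bounded[OF \<tau> pos m w])
  next
    case False
    then show ?thesis using EB NE[OF \<open>N\<close>] by simp
  qed
  have "p < \<infinity> \<Longrightarrow> N \<longleftrightarrow>
        lp_conv_embeds (p\<^sub>1 / p) (weight_power \<omega>\<^sub>1 p) (p\<^sub>2 / p) (weight_power (reflect \<omega>\<^sub>2) p)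
                       (q / p) (weight_power (reflect m\<^sub>\<beta>) p) \<and>
        lp_conv_embeds (q\<^sub>1 / p) (weight_power \<mu>\<^sub>1 p) (q\<^sub>2 / p) (weight_power (reflect \<mu>\<^sub>2) p)
                       (q / p) (weight_power m\<^sub>\<alpha> p)"
    unfolding N_def
    using corr_bounded_iff_conv[of p p\<^sub>1 p\<^sub>2 q \<omega>\<^sub>1 \<omega>\<^sub>2 m\<^sub>\<beta>, OF assms(5,1,2,6) _ w0(1,2) u0(2)] corr_bounded_iff_conv[of p q\<^sub>1 q\<^sub>2 q \<mu>\<^sub>1 \<mu>\<^sub>2 "reflect m\<^sub>\<alpha>", OF assms(5,3,4,6) _ w0(3,4) r0(3)]
    unfolding rr by blast
  then show ?thesis unfolding B E_def[symmetric] using BN NE EB NB by blast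
qed

end
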